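(* Let $G$ be a locally compact second countable group having Kazhdan's Property (T) and let $(\Omega,\nu)$ be an ergodic $G$-space. Let $X$ be a CAT(0) cube complex and $H\le\mathrm{Isom}(X)$ a subgroup. Then any measurable cocycle $\alpha:G\times\Omega\to H$ is cohomologous to a cocycle taking values in the isotropy group in $H$ of a bounded sub-cube complex of $X$.
   Context: An ergodic $G$-space is a standard probability space with a measurable measure-preserving ergodic $G$-action. A CAT(0) cube complex is regarded as a median space through its $0$-skeleton with the combinatorial (graph) metric of the $1$-skeleton; $\mathrm{Isom}(X)$ is the corresponding isometry group, with the topology of pointwise convergence and its Borel structure. A measurable (strict) cocycle is a measurable map $\alpha:G\times\Omega\to H$ with $\alpha(g_1g_2,\omega)=\alpha(g_1,g_2.\omega)\circ\alpha(g_2,\omega)$ for all $g_1,g_2\in G$, $\omega\in\Omega$. Two cocycles $\alpha,\beta:G\times\Omega\to H$ are cohomologous if there is a measurable map $\phi:\Omega\to H$ such that for all $g\in G$, $\alpha(g,\omega)=\phi(g.\omega)^{-1}\circ\beta(g,\omega)\circ\phi(\omega)$ for almost all $\omega\in\Omega$. The isotropy group in $H$ of a (nonempty) subcomplex $Z$ is $\{h\in H: h(Z)=Z\}$. *)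

theory Defs
  imports "HOL-Probability.Probability" "HOL-Algebra.Group_Action" "HOL-Algebra.Module"
begin

section \<open>Borel structures\<close>

definition borel_of :: "'a topology \<Rightarrow> 'a measure" where
  "borel_of T = sigma (topspace T) {U. openin T U}"

lemma space_borel_of: "space (borel_of T) = topspace T"
  unfolding borel_of_def by (rule space_measure_of) (auto dest: openin_subset)

lemma sets_borel_of: "sets (borel_of T) = sigma_sets (topspace T) {U. openin T U}"
  unfolding borel_of_def by (rule sets_measure_of) (auto dest: openin_subset)

definition standard_borel :: "'a measure \<Rightarrow> bool" where
  "standard_borel M \<longleftrightarrow>
     (\<exists>T. completely_metrizable_space T \<and> second_countable T \<and>
          topspace T = space M \<and> sets M = sets (borel_of T))"


section \<open>Locally compact second countable groups\<close>

definition topological_group :: "'g monoid \<Rightarrow> 'g topology \<Rightarrow> bool" where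
  "topological_group G T \<longleftrightarrow>
     group G \<and> topspace T = carrier G \<and>
     continuous_map (prod_topology T T) T (\<lambda>(x, y). x \<otimes>\<^bsub>G\<^esub> y) \<and>
     continuous_map T T (\<lambda>x. inv\<^bsub>G\<^esub> x)"

definition lcsc_group :: "'g monoid \<Rightarrow> 'g topology \<Rightarrow> bool" where
  "lcsc_group G T \<longleftrightarrow>
     topological_group G T \<and> Hausdorff_space T \<and> locally_compact_space T \<and> second_countable T"


section \<open>Unitary representations and Property (T)\<close>

definition complex_ring :: "complex ring" where
  "complex_ring = \<lparr>carrier = UNIV, mult = (*), one = 1, zero = 0, add = (+)\<rparr>"

definition ip_norm :: "('v \<Rightarrow> 'v \<Rightarrow> complex) \<Rightarrow> 'v \<Rightarrow> real" where
  "ip_norm ip x = sqrt (Re (ip x x))"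

definition ip_dist :: "(complex, 'v) module \<Rightarrow> ('v \<Rightarrow> 'v \<Rightarrow> complex) \<Rightarrow> 'v \<Rightarrow> 'v \<Rightarrow> real" where
  "ip_dist V ip x y = ip_norm ip (x \<ominus>\<^bsub>V\<^esub> y)"

definition complex_hilbert_space :: "(complex, 'v) module \<Rightarrow> ('v \<Rightarrow> 'v \<Rightarrow> complex) \<Rightarrow> bool" where
  "complex_hilbert_space V ip \<longleftrightarrow>
     Module.module complex_ring V \<and>
     (\<forall>x\<in>carrier V. \<forall>y\<in>carrier V. ip y x = cnj (ip x y)) \<and>
     (\<forall>x\<in>carrier V. \<forall>y\<in>carrier V. \<forall>z\<in>carrier V. ip (x \<oplus>\<^bsub>V\<^esub> y) z = ip x z + ip y z) \<and>
     (\<forall>a. \<forall>x\<in>carrier V. \<forall>y\<in>carrier V. ip (a \<odot>\<^bsub>V\<^esub> x) y = a * ip x y) \<and>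
     (\<forall>x\<in>carrier V. x \<noteq> \<zero>\<^bsub>V\<^esub> \<longrightarrow> Re (ip x x) > 0) \<and>
     Metric_space.mcomplete (carrier V) (ip_dist V ip)"

definition unitary_rep ::
  "'g monoid \<Rightarrow> 'g topology \<Rightarrow> (complex, 'v) module \<Rightarrow> ('v \<Rightarrow> 'v \<Rightarrow> complex) \<Rightarrow> ('g \<Rightarrow> 'v \<Rightarrow> 'v) \<Rightarrow> bool"
where
  "unitary_rep G T V ip \<pi> \<longleftrightarrow>
     group_action G (carrier V) \<pi> \<and>
     (\<forall>g\<in>carrier G.
        (\<forall>x\<in>carrier V. \<forall>y\<in>carrier V. \<pi> g (x \<oplus>\<^bsub>V\<^esub> y) = \<pi> g x \<oplus>\<^bsub>V\<^esub> \<pi> g y) \<and>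
        (\<forall>a. \<forall>x\<in>carrier V. \<pi> g (a \<odot>\<^bsub>V\<^esub> x) = a \<odot>\<^bsub>V\<^esub> \<pi> g x) \<and>
        (\<forall>x\<in>carrier V. \<forall>y\<in>carrier V. ip (\<pi> g x) (\<pi> g y) = ip x y)) \<and>
     (\<forall>x\<in>carrier V.
        continuous_map T (Metric_space.mtopology (carrier V) (ip_dist V ip)) (\<lambda>g. \<pi> g x))"

text \<open>
  There are a compact set \<open>Q\<close> and \<open>\<epsilon> > 0\<close> such that every unitary representation having a
  \<open>(Q, \<epsilon>)\<close>-invariant vector has a nonzero invariant vector.

  A definition in HOL cannot quantify over the types of the representation spaces, so these are
  carried by subsets of the type \<^typ>\<open>'g \<Rightarrow> complex\<close>, with arbitrary operations. This is no
  restriction: if \<open>\<xi>\<close> is \<open>(Q, \<epsilon>)\<close>-invariant in any unitary representation \<open>\<pi>\<close>, then it is so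
  in the closed invariant subspace \<open>W\<close> generated by \<open>\<xi>\<close>, and
  \<open>v \<mapsto> (\<lambda>g. \<langle>v, \<pi> g \<xi>\<rangle>)\<close> is injective on \<open>W\<close>.
\<close>

definition property_T :: "'g monoid \<Rightarrow> 'g topology \<Rightarrow> bool" where
  "property_T G T \<longleftrightarrow>
     (\<exists>Q \<epsilon>. compactin T Q \<and> \<epsilon> > 0 \<and>
        (\<forall>(V :: (complex, 'g \<Rightarrow> complex) module) ip \<pi>.
           complex_hilbert_space V ip \<longrightarrow> unitary_rep G T V ip \<pi> \<longrightarrow>
           (\<exists>\<xi>\<in>carrier V. \<xi> \<noteq> \<zero>\<^bsub>V\<^esub> \<and> (\<forall>g\<in>Q. ip_dist V ip (\<pi> g \<xi>) \<xi> < \<epsilon> * ip_norm ip \<xi>)) \<longrightarrow>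
           (\<exists>\<eta>\<in>carrier V. \<eta> \<noteq> \<zero>\<^bsub>V\<^esub> \<and> (\<forall>g\<in>carrier G. \<pi> g \<eta> = \<eta>))))"


section \<open>Ergodic spaces and cocycles\<close>

definition ergodic_gspace ::
  "'g monoid \<Rightarrow> 'g topology \<Rightarrow> 'w measure \<Rightarrow> ('g \<Rightarrow> 'w \<Rightarrow> 'w) \<Rightarrow> bool"
where
  "ergodic_gspace G T M act \<longleftrightarrow>
     prob_space M \<and> standard_borel M \<and>
     group_action G (space M) act \<and>
     (\<lambda>(g, \<omega>). act g \<omega>) \<in> borel_of T \<Otimes>\<^sub>M M \<rightarrow>\<^sub>M M \<and>
     (\<forall>g\<in>carrier G. distr M M (act g) = M) \<and>
     (\<forall>A\<in>sets M. (\<forall>g\<in>carrier G. act g ` A = A) \<longrightarrow> measure M A = 0 \<or> measure M A = 1)"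

definition measurable_cocycle ::
  "'g monoid \<Rightarrow> 'g topology \<Rightarrow> 'w measure \<Rightarrow> ('g \<Rightarrow> 'w \<Rightarrow> 'w) \<Rightarrow>
   'h monoid \<Rightarrow> 'h topology \<Rightarrow> ('g \<Rightarrow> 'w \<Rightarrow> 'h) \<Rightarrow> bool"
where
  "measurable_cocycle G T M act H TH \<alpha> \<longleftrightarrow>
     (\<lambda>(g, \<omega>). \<alpha> g \<omega>) \<in> borel_of T \<Otimes>\<^sub>M M \<rightarrow>\<^sub>M borel_of TH \<and>
     (\<forall>g\<^sub>1\<in>carrier G. \<forall>g\<^sub>2\<in>carrier G. \<forall>\<omega>\<in>space M.
        \<alpha> (g\<^sub>1 \<otimes>\<^bsub>G\<^esub> g\<^sub>2) \<omega> = \<alpha> g\<^sub>1 (act g\<^sub>2 \<omega>) \<otimes>\<^bsub>H\<^esub> \<alpha> g\<^sub>2 \<omega>)"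

definition cohomologous ::
  "'g monoid \<Rightarrow> 'w measure \<Rightarrow> ('g \<Rightarrow> 'w \<Rightarrow> 'w) \<Rightarrow>
   'h monoid \<Rightarrow> 'h topology \<Rightarrow> ('g \<Rightarrow> 'w \<Rightarrow> 'h) \<Rightarrow> ('g \<Rightarrow> 'w \<Rightarrow> 'h) \<Rightarrow> bool"
where
  "cohomologous G M act H TH \<alpha> \<beta> \<longleftrightarrow>
     (\<exists>\<phi> \<in> M \<rightarrow>\<^sub>M borel_of TH. \<forall>g\<in>carrier G. AE \<omega> in M.
        \<alpha> g \<omega> = inv\<^bsub>H\<^esub> (\<phi> (act g \<omega>)) \<otimes>\<^bsub>H\<^esub> \<beta> g \<omega> \<otimes>\<^bsub>H\<^esub> \<phi> \<omega>)"


section \<open>CAT(0) cube complexes\<close>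

text \<open>
  A cube complex is given by the family \<open>X\<close> of the vertex sets of its cubes. The vertices of the
  standard \<open>n\<close>-cube are the subsets of \<open>{..<n}\<close>, and its faces are the intervals \<open>{A..B}\<close> of
  sets. Thus cubes are embedded and two cubes meet in a common face or not at all; both hold in
  every CAT(0) cube complex. Dimension and local cardinality are unrestricted.
\<close>

definition cube_complex :: "'v set set \<Rightarrow> bool" where
  "cube_complex X \<longleftrightarrow>
     (\<forall>c\<in>X. \<exists>n f. bij_betw f (Pow {..<n::nat}) c \<and>
        {d \<in> X. d \<subseteq> c} = {f ` {A..B} |A B. A \<subseteq> B \<and> B \<subseteq> {..<n}}) \<and>
     (\<forall>c\<in>X. \<forall>d\<in>X. c \<inter> d \<noteq> {} \<longrightarrow> c \<inter> d \<in> X)"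

abbreviation vertices :: "'v set set \<Rightarrow> 'v set" where
  "vertices X \<equiv> \<Union>X"

definition adj :: "'v set set \<Rightarrow> 'v \<Rightarrow> 'v \<Rightarrow> bool" where
  "adj X u v \<longleftrightarrow> u \<noteq> v \<and> {u, v} \<in> X"

text \<open>The combinatorial metric of the 1-skeleton, meaningful when the latter is connected.\<close>

definition gdist :: "'v set set \<Rightarrow> 'v \<Rightarrow> 'v \<Rightarrow> nat" where
  "gdist X u v = (LEAST n. (adj X ^^ n) u v)"

definition edge_path :: "'v set set \<Rightarrow> 'v list \<Rightarrow> bool" where
  "edge_path X p \<longleftrightarrow> p \<noteq> [] \<and> set p \<subseteq> vertices X \<and> successively (adj X) p"

inductive elem_homotopy :: "'v set set \<Rightarrow> 'v list \<Rightarrow> 'v list \<Rightarrow> bool" for X where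
  backtrack: "adj X u v \<Longrightarrow> elem_homotopy X (p @ [u, v, u] @ q) (p @ [u] @ q)"
| square: "\<lbrakk>{a, b, c, d} \<in> X; distinct [a, b, c, d];
            adj X a b; adj X b c; adj X a d; adj X d c\<rbrakk>
          \<Longrightarrow> elem_homotopy X (p @ [a, b, c] @ q) (p @ [a, d, c] @ q)"

text \<open>Connected and with trivial edge-path group, that is, trivial fundamental group.\<close>

definition simply_connected_complex :: "'v set set \<Rightarrow> bool" where
  "simply_connected_complex X \<longleftrightarrow>
     (\<forall>u\<in>vertices X. \<forall>v\<in>vertices X. \<exists>p. edge_path X p \<and> hd p = u \<and> last p = v) \<and>
     (\<forall>p. edge_path X p \<longrightarrow> hd p = last p \<longrightarrow> equivclp (elem_homotopy X) p [hd p])"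

text \<open>
  The link of a vertex \<open>v\<close>, as an abstract simplicial complex whose vertices are the neighbours
  of \<open>v\<close>; the empty simplex is included.
\<close>

definition link :: "'v set set \<Rightarrow> 'v \<Rightarrow> 'v set set" where
  "link X v = {{u \<in> c. adj X v u} |c. c \<in> X \<and> v \<in> c}"

definition flag_complex :: "'v set set \<Rightarrow> bool" where
  "flag_complex K \<longleftrightarrow>
     (\<forall>N. finite N \<longrightarrow> N \<subseteq> \<Union>K \<longrightarrow> (\<forall>u\<in>N. \<forall>w\<in>N. {u, w} \<in> K) \<longrightarrow> N \<in> K)"

definition cat0_cube_complex :: "'v set set \<Rightarrow> bool" where
  "cat0_cube_complex X \<longleftrightarrow>
     cube_complex X \<and> X \<noteq> {} \<and> simply_connected_complex X \<and>
     (\<forall>v\<in>vertices X. flag_complex (link X v))"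

definition bounded_subcomplex :: "'v set set \<Rightarrow> 'v set set \<Rightarrow> bool" where
  "bounded_subcomplex X Z \<longleftrightarrow>
     Z \<noteq> {} \<and> Z \<subseteq> X \<and> (\<forall>c\<in>Z. \<forall>d\<in>X. d \<subseteq> c \<longrightarrow> d \<in> Z) \<and>
     (\<exists>n. \<forall>u\<in>vertices Z. \<forall>v\<in>vertices Z. gdist X u v \<le> n)"


section \<open>Isometry groups\<close>

definition isom_group :: "'v set set \<Rightarrow> ('v \<Rightarrow> 'v) monoid" where
  "isom_group X = (BijGroup (vertices X))
     \<lparr>carrier := {f \<in> Bij (vertices X).
        \<forall>u\<in>vertices X. \<forall>v\<in>vertices X. gdist X (f u) (f v) = gdist X u v}\<rparr>"

text \<open>The metric topology of the 0-skeleton is discrete, since \<^const>\<open>gdist\<close> is integer-valued.\<close>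

definition pointwise_topology :: "'v set set \<Rightarrow> ('v \<Rightarrow> 'v) set \<Rightarrow> ('v \<Rightarrow> 'v) topology" where
  "pointwise_topology X H =
     subtopology (product_topology (\<lambda>_. discrete_topology (vertices X)) (vertices X)) H"

definition isotropy_group :: "('v \<Rightarrow> 'v) set \<Rightarrow> 'v set set \<Rightarrow> ('v \<Rightarrow> 'v) set" where
  "isotropy_group H Z = {h \<in> H. (\<lambda>c. h ` c) ` Z = Z}"

end

theory Submission
  imports Defs "HOL-Library.Sublist"
begin

text \<open>
  In a CAT(0) cube complex the distance of two vertices is the number of halfspaces that contain
  the first and not the second (\<open>dst_eq_card_separators\<close>). Hence \<open>exp (- t * d x y)\<close> is a
  product of elementary positive definite kernels, one for each halfspace, and is itself
  positive definite (\<open>exp_dist_pos\<close>).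

  A map defined on an analytic space has countable range if all its preimages are Borel sets
  (\<open>countable_range_of_discrete_borel_map\<close>). So, although the complex may have uncountably many
  vertices, a cocycle \<open>\<alpha>\<close> moves any vertex only to countably many others, and there is a
  countable convex set \<open>D\<close> of vertices that \<open>\<alpha>\<close> preserves. Let \<open>base\<close> be a vertex of \<open>D\<close>.
  Write \<open>orb g w\<close> for \<open>\<alpha>(g, inv g . w) base\<close>. The integral \<open>Psi t g h\<close> of
  \<open>exp (- t * d (orb g w) (orb h w))\<close> over \<open>w\<close> is a left-invariant positive definite kernel on
  \<open>G\<close>, continuous because a measurable action on a countable set is continuous in measure
  (\<open>disp_small\<close>), and tending to \<open>1\<close> uniformly on compact sets as \<open>t\<close> tends to \<open>0\<close>. By Property
  (T) the unitary representation of \<open>G\<close> on its reproducing kernel Hilbert space has a nonzero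
  invariant vector for some \<open>t > 0\<close>.

  This vector is a limit of finite combinations of the generators indexed by \<open>G\<close>. For almost
  every \<open>w\<close>, replacing \<open>g\<close> by the vertex \<open>orb g w\<close> in these combinations and evaluating against
  the kernel on \<open>D\<close> gives functions on \<open>D\<close> that converge uniformly to some \<open>F w\<close>. Invariance of
  the vector means that \<open>F\<close> is equivariant; since each approximating function decays at
  infinity, the level sets \<open>{x. r \<le> cmod (F w x)}\<close> are bounded. For small \<open>r\<close> they form an
  equivariant family of bounded sets, nonempty with positive probability
  (\<open>bounded_equivariant_sets\<close>).

  In a convex set of vertices the centre of a nonempty bounded set is finite, even in infinite
  dimension (\<open>finite_centre\<close>). Passing to centres gives an equivariant family of finite sets
  \<open>C w\<close>. There are only countably many finite subsets of \<open>D\<close>. Fubini's theorem for Haar measure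
  makes the family strictly equivariant on a conull set, and ergodicity puts its values into the
  \<open>H\<close>-orbit of one finite nonempty set \<open>F0\<close>. An element \<open>\<phi> w\<close> of \<open>H\<close> with
  \<open>\<phi> w (C w) = F0\<close> then conjugates \<open>\<alpha>\<close> into the stabiliser of \<open>F0\<close>, the isotropy
  group of the bounded subcomplex formed by the vertices in \<open>F0\<close>.
\<close>

section \<open>Hermitian forms of kernels on finite combinations\<close>

text \<open>
  A list of pairs stands for a formal linear combination of points. Points may repeat, so that
  sums are concatenations, pullbacks along a map are images of lists, and no coefficients have
  to be collected.
\<close>

definition kernel_form :: "('a \<Rightarrow> 'a \<Rightarrow> real) \<Rightarrow> (complex \<times> 'a) list \<Rightarrow> (complex \<times> 'a) list \<Rightarrow> complex" where
  "kernel_form k c d = (\<Sum>p\<leftarrow>c. \<Sum>q\<leftarrow>d. fst p * cnj (fst q) * of_real (k (snd p) (snd q)))"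

definition cscale :: "complex \<Rightarrow> (complex \<times> 'a) list \<Rightarrow> (complex \<times> 'a) list" where
  "cscale z = map (\<lambda>p. (z * fst p, snd p))"

definition csub :: "(complex \<times> 'a) list \<Rightarrow> (complex \<times> 'a) list \<Rightarrow> (complex \<times> 'a) list" where
  "csub c d = c @ cscale (-1) d"

lemma kernel_form_Nil [simp]: "kernel_form k [] d = 0" "kernel_form k c [] = 0"
  unfolding kernel_form_def by auto

lemma kernel_form_append [simp]:
  "kernel_form k (c @ c') d = kernel_form k c d + kernel_form k c' d"
  "kernel_form k c (d @ d') = kernel_form k c d + kernel_form k c d'"
  unfolding kernel_form_def by (auto simp: sum_list_addf)

lemma kernel_form_Cons:
  "kernel_form k (p # c) d = kernel_form k [p] d + kernel_form k c d"
  "kernel_form k c (p # d) = kernel_form k c [p] + kernel_form k c d"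
  using kernel_form_append(1)[of k "[p]" c d] kernel_form_append(2)[of k c "[p]" d] by auto

lemma kernel_form_single: "kernel_form k [(a, x)] [(b, y)] = a * cnj b * of_real (k x y)"
  unfolding kernel_form_def by simp

lemma cscale_Cons [simp]: "cscale z [] = []" "cscale z (p # c) = (z * fst p, snd p) # cscale z c"
  unfolding cscale_def by auto

lemma kernel_form_scale_single:
  "kernel_form k [(z * a, x)] d = z * kernel_form k [(a, x)] d"
  "kernel_form k c [(z * b, y)] = cnj z * kernel_form k c [(b, y)]"
  unfolding kernel_form_def
  by (auto simp: sum_list_const_mult[symmetric] mult_ac simp del: sum_list_const_mult)

lemma kernel_form_cscale [simp]:
  "kernel_form k (cscale z c) d = z * kernel_form k c d"
  "kernel_form k c (cscale z d) = cnj z * kernel_form k c d"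
proof -
  show "kernel_form k (cscale z c) d = z * kernel_form k c d"
  proof (induction c)
    case (Cons p c)
    then show ?case using kernel_form_Cons(1)[of k p c d] kernel_form_Cons(1)[of k "(z * fst p, snd p)" "cscale z c" d]
        kernel_form_scale_single(1)[of k z "fst p" "snd p" d]
      by (simp add: algebra_simps)
  qed simp
  show "kernel_form k c (cscale z d) = cnj z * kernel_form k c d"
  proof (induction d)
    case (Cons p d)
    then show ?case using kernel_form_Cons(2)[of k c p d] kernel_form_Cons(2)[of k c "(z * fst p, snd p)" "cscale z d"]
        kernel_form_scale_single(2)[of k c z "fst p" "snd p"]
      by (simp add: algebra_simps)
  qed simp
qed

lemma kernel_form_csub [simp]:
  "kernel_form k (csub c c') d = kernel_form k c d - kernel_form k c' d"
  "kernel_form k c (csub d d') = kernel_form k c d - kernel_form k c d'"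
  unfolding csub_def by auto

lemma set_cscale [simp]: "snd ` set (cscale z c) = snd ` set c"
  unfolding cscale_def by (force simp: image_image)

lemma set_csub [simp]: "snd ` set (csub c d) = snd ` set c \<union> snd ` set d"
  unfolding csub_def by (simp add: image_Un)

lemma kernel_form_pullback:
  "kernel_form k (map (apsnd g) c) (map (apsnd g) d) = kernel_form (\<lambda>x y. k (g x) (g y)) c d"
  unfolding kernel_form_def by (simp add: comp_def)

lemma kernel_form_sum:
  "kernel_form (\<lambda>x y. k x y + l x y) c d = kernel_form k c d + kernel_form l c d"
  unfolding kernel_form_def by (simp add: sum_list_addf algebra_simps)

lemma kernel_form_mult:
  "kernel_form (\<lambda>x y. r * k x y) c d = of_real r * kernel_form k c d"
  unfolding kernel_form_def by (simp add: sum_list_const_mult[symmetric] mult_ac del: sum_list_const_mult)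

lemma kernel_form_cong:
  assumes "\<And>x y. x \<in> snd ` set c \<Longrightarrow> y \<in> snd ` set d \<Longrightarrow> k x y = l x y"
  shows "kernel_form k c d = kernel_form l c d"
  unfolding kernel_form_def using assms
  by (intro arg_cong[of _ _ sum_list] map_cong refl) (force simp: intro!: arg_cong[of _ _ sum_list] map_cong)+

definition cut_kernel :: "real \<Rightarrow> 'a set set \<Rightarrow> 'a \<Rightarrow> 'a \<Rightarrow> real" where
  "cut_kernel q F x y = (\<Prod>h\<in>F. if (x \<in> h) = (y \<in> h) then 1 else q)"

text \<open>
  A set \<open>h\<close> contributes the factor
  \<open>q + (1 - q) * (1\<^sub>h x * 1\<^sub>h y + 1\<^sub>c x * 1\<^sub>c y)\<close>, with \<open>c\<close> the
  complement of \<open>h\<close>. Multiplying a kernel by \<open>f x * f y\<close> only rescales the weights of a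
  combination, so positivity survives each factor.
\<close>

lemma cut_kernel_pos:
  assumes "finite F" "0 \<le> q" "q \<le> 1"
  shows "0 \<le> Re (kernel_form (cut_kernel q F) c c)"
  using assms(1)
proof (induction F arbitrary: c rule: finite_induct)
  case empty
  have "kernel_form (\<lambda>_ _. 1) c d = (\<Sum>p\<leftarrow>c. fst p) * cnj (\<Sum>p\<leftarrow>d. fst p)" for c d :: "(complex \<times> 'a) list"
  proof (induction c)
    case (Cons p c)
    have "kernel_form (\<lambda>_ _. 1) [p] d = fst p * cnj (\<Sum>p\<leftarrow>d. fst p)"
    proof (induction d)
      case (Cons r d)
      then show ?case unfolding kernel_form_Cons(2)[of _ _ r d]
        by (cases p, cases r) (simp add: kernel_form_single algebra_simps)
    qed simp
    then show ?case using Cons unfolding kernel_form_Cons(1)[of _ p c] by (simp add: algebra_simps)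
  qed simp
  moreover have "cut_kernel q ({} :: 'a set set) = (\<lambda>_ _. 1)" by (intro ext) (simp add: cut_kernel_def)
  ultimately show ?case by (simp add: complex_mult_cnj)
next
  case (insert h F)
  define r where "r = (\<lambda>(s :: 'a set) (c :: (complex \<times> 'a) list). map (\<lambda>p. (of_real (indicator s (snd p)) * fst p, snd p)) c)"
  have k: "cut_kernel q (insert h F) x y =
      q * cut_kernel q F x y + (1 - q) * (indicator h x * indicator h y * cut_kernel q F x y
        + indicator (-h) x * indicator (-h) y * cut_kernel q F x y)" for x y
    using insert(1,2) by (auto simp: cut_kernel_def indicator_def algebra_simps)
  have r: "kernel_form (cut_kernel q F) (r s c) (r s c) = kernel_form (\<lambda>x y. indicator s x * indicator s y * cut_kernel q F x y) c c" for s
    unfolding r_def kernel_form_def by (simp add: comp_def mult_ac)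
  have "kernel_form (cut_kernel q (insert h F)) c c = of_real q * kernel_form (cut_kernel q F) c c
    + of_real (1 - q) * (kernel_form (cut_kernel q F) (r h c) (r h c) + kernel_form (cut_kernel q F) (r (-h) c) (r (-h) c))"
    unfolding r unfolding kernel_form_mult[symmetric] kernel_form_sum[symmetric]
    by (rule arg_cong[of _ _ "\<lambda>k. kernel_form k c c"]) (intro ext k)
  then show ?case using insert.IH assms(2,3) by (simp add: mult_nonneg_nonneg)
qed

section \<open>Graphs with squares and reduced paths\<close>

text \<open>
  The local structure of the one-skeleton of a cube complex that the combinatorics of geodesics
  needs. The squares carry an orientation and a starting corner, \<open>a\<close> and \<open>c\<close> being opposite in
  \<open>sq a b c d\<close>. The condition \<open>cube\<close> is what remains of the link condition: three squares at \<open>b\<close>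
  that pairwise share an edge span a cube, whose vertex opposite to \<open>b\<close> is \<open>t\<close>.
\<close>

locale square_graph =
  fixes adj :: "'v \<Rightarrow> 'v \<Rightarrow> bool" and sq :: "'v \<Rightarrow> 'v \<Rightarrow> 'v \<Rightarrow> 'v \<Rightarrow> bool"
  assumes adj_sym: "adj u v \<Longrightarrow> adj v u"
    and adj_irrefl: "\<not> adj v v"
    and sq_adj: "sq a b c d \<Longrightarrow> adj a b"
    and sq_rotate: "sq a b c d \<Longrightarrow> sq b c d a"
    and sq_reflect: "sq a b c d \<Longrightarrow> sq a d c b"
    and sq_diagonal: "sq a b c d \<Longrightarrow> a \<noteq> c"
    and sq_unique: "sq a b c d \<Longrightarrow> sq a b c' d \<Longrightarrow> c = c'"
    and cube: "sq b v a x \<Longrightarrow> sq b v c y \<Longrightarrow> sq b y w x \<Longrightarrow>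
                 \<exists>t. sq v a t c \<and> sq a x w t \<and> sq c y w t"
begin

text \<open>
  A flip pushes two consecutive edges of a path across a square. Flips keep the length and both
  ends.
\<close>

inductive flip :: "'v list \<Rightarrow> 'v list \<Rightarrow> bool" where
  flip_here: "sq v a x b \<Longrightarrow> flip (v # a # x # p) (v # b # x # p)"
| flip_Cons: "flip p q \<Longrightarrow> flip (v # p) (v # q)"

abbreviation flips :: "'v list \<Rightarrow> 'v list \<Rightarrow> bool"  (infix \<open>\<simeq>\<close> 50) where
  "p \<simeq> q \<equiv> flip\<^sup>*\<^sup>* p q"

lemma flip_sym: "flip p q \<Longrightarrow> flip q p"
  by (induction rule: flip.induct) (auto intro: flip.intros sq_reflect)

lemma flips_sym: "p \<simeq> q \<Longrightarrow> q \<simeq> p"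
  by (metis flip_sym sympI symp_rtranclp sympD)

lemma flips_trans: "p \<simeq> q \<Longrightarrow> q \<simeq> r \<Longrightarrow> p \<simeq> r"
  by (rule rtranclp_trans)

lemma flips_Cons: "p \<simeq> q \<Longrightarrow> v # p \<simeq> v # q"
  by (induction rule: rtranclp_induct) (auto intro: flip_Cons rtranclp.rtrancl_into_rtrancl)

lemma flips_here: "sq v a x b \<Longrightarrow> v # a # x # p \<simeq> v # b # x # p"
  by (blast intro: flip_here)

lemma flip_length: "flip p q \<Longrightarrow> length p = length q"
  by (induction rule: flip.induct) auto

lemma flips_length: "p \<simeq> q \<Longrightarrow> length p = length q"
  by (induction rule: rtranclp_induct) (auto dest: flip_length)

lemma flip_hd: "flip p q \<Longrightarrow> hd p = hd q"
  by (induction rule: flip.induct) auto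

lemma flips_hd: "p \<simeq> q \<Longrightarrow> hd p = hd q"
  by (induction rule: rtranclp_induct) (auto dest: flip_hd)

lemma flip_last: "flip p q \<Longrightarrow> last p = last q"
proof (induction rule: flip.induct)
  case (flip_Cons p q v)
  then show ?case using flip_length[OF flip_Cons(1)] by (cases p; cases q) auto
qed auto

lemma flips_last: "p \<simeq> q \<Longrightarrow> last p = last q"
  by (induction rule: rtranclp_induct) (auto dest: flip_last)

lemma flip_path: "flip p q \<Longrightarrow> successively adj p \<Longrightarrow> successively adj q"
proof (induction rule: flip.induct)
  case (flip_here v a x b p)
  then have "adj v b" "adj b x" "adj a x" by (metis sq_adj sq_rotate sq_reflect)+
  then show ?case using flip_here by (auto simp: successively_Cons)
next
  case (flip_Cons p q v)
  then show ?case using flip_length[OF flip_Cons(1)] flip_hd[OF flip_Cons(1)]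
    by (auto simp: successively_Cons)
qed

lemma flips_path: "p \<simeq> q \<Longrightarrow> successively adj p \<Longrightarrow> successively adj q"
  by (induction rule: rtranclp_induct) (auto dest: flip_path)

text \<open>
  The exchange property: if paths with distinct first edges \<open>v a\<close> and \<open>v c\<close> are related by
  flips, then these edges span a square, and flips bring both paths through its fourth corner.
  The proof is by induction on the length and, for a fixed length, on the number of flips.
\<close>

lemma two_descents:
  assumes "v # a # p \<simeq> v # c # q"
  shows "(a = c \<and> a # p \<simeq> c # q) \<or>
         (a \<noteq> c \<and> (\<exists>x r. sq v a x c \<and> a # p \<simeq> a # x # r \<and> c # q \<simeq> c # x # r))"
  using assms
proof (induction "length p" arbitrary: v a p c q rule: less_induct)
  case less
  let ?R = "\<lambda>c q. (a = c \<and> a # p \<simeq> c # q) \<or>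
         (a \<noteq> c \<and> (\<exists>x r. sq v a x c \<and> a # p \<simeq> a # x # r \<and> c # q \<simeq> c # x # r))"
  have "\<forall>c q. l = v # c # q \<longrightarrow> ?R c q" if "v # a # p \<simeq> l" for l
    using that
  proof (induction rule: rtranclp_induct)
    case base then show ?case by auto
  next
    case (step l l')
    have hdl: "length l = length (v # a # p)" "hd l = v"
      using flips_length[OF step(1)] flips_hd[OF step(1)] by auto
    then obtain b s where l: "l = v # b # s"
      by (cases l; cases "tl l") auto
    have len_s: "length s = length p" using hdl l by auto
    have IH: "?R b s" using step(3) l by blast
    show ?case
    proof (intro allI impI)
      fix c q assume l': "l' = v # c # q"
      have "flip (v # b # s) (v # c # q)" using step(2) l l' by simp
      then show "?R c q"
      proof (cases rule: flip.cases)
        case (flip_Cons)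
        then have fl: "flip (b # s) (c # q)" by simp
        then have bc: "b = c" using flip_hd by fastforce
        have "c # q \<simeq> b # s" using fl flip_sym by blast
        then show ?thesis using IH bc fl by (metis flips_trans r_into_rtranclp)
      next
        case (flip_here x t)
        then have s: "s = x # t" and q: "q = x # t" and sqc: "sq v b x c" by auto
        from IH show ?thesis
        proof (elim disjE conjE exE)
          assume "a = b" "a # p \<simeq> b # s"
          moreover have "a \<noteq> c" using sq_diagonal[OF sq_rotate[OF sqc]] \<open>a = b\<close> by simp
          ultimately show ?thesis using s q sqc by blast
        next
          fix y r assume ab: "a \<noteq> b" and sqa: "sq v a y b"
            and pa: "a # p \<simeq> a # y # r" and sb: "b # s \<simeq> b # y # r"
          have "length t < length p" using len_s s by simp
          from less.hyps[OF this sb[unfolded s]] show ?thesis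
          proof (elim disjE conjE exE)
            assume "x = y" "x # t \<simeq> y # r"
            have "a = c" using sqa sqc \<open>x = y\<close>
              by (metis sq_reflect sq_rotate sq_unique)
            moreover have "a # p \<simeq> c # q"
              using pa \<open>x = y\<close> \<open>x # t \<simeq> y # r\<close> \<open>a = c\<close> q
              by (metis flips_Cons flips_sym flips_trans)
            ultimately show ?thesis by blast
          next
            fix w u assume xy: "x \<noteq> y" and sqw: "sq b x w y"
              and xt: "x # t \<simeq> x # w # u" and yr: "y # r \<simeq> y # w # u"
            have "a \<noteq> c"
            proof
              assume "a = c"
              then have "sq v a x b" "sq v a y b" using sqc sqa sq_reflect by auto
              then show False using sq_unique xy by blast
            qed
            \<comment> \<open>The squares at \<open>b\<close> through the vertices \<open>v\<close>, \<open>x\<close> and \<open>y\<close> pairwise share an edge.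
              The vertex \<open>z\<close> opposite to \<open>b\<close> in their cube replaces \<open>b\<close>.\<close>
            have "sq b v a y" using sqa sq_rotate by blast
            moreover have "sq b v c x"
              using sqc by (metis sq_rotate sq_reflect)
            moreover have "sq b x w y" using sqw .
            ultimately obtain z where z: "sq v a z c" "sq a y w z" "sq c x w z"
              using cube by blast
            have "a # p \<simeq> a # y # w # u" using pa yr flips_Cons flips_trans by blast
            also have "a # y # w # u \<simeq> a # z # w # u" by (rule flips_here[OF z(2)])
            finally have 1: "a # p \<simeq> a # z # w # u" .
            have "c # q \<simeq> c # x # w # u" using q xt flips_Cons by blast
            also have "c # x # w # u \<simeq> c # z # w # u" by (rule flips_here[OF z(3)])
            finally have 2: "c # q \<simeq> c # z # w # u" .
            show ?thesis using \<open>a \<noteq> c\<close> z(1) 1 2 by blast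
          qed
        qed
      qed
    qed
  qed
  from this[OF less.prems] show ?case by blast
qed

lemma flips_ConsD: "v # a # p \<simeq> v # a # q \<Longrightarrow> a # p \<simeq> a # q"
  using two_descents by blast

fun backtracks :: "'v list \<Rightarrow> bool" where
  "backtracks (u # v # w # p) \<longleftrightarrow> u = w \<or> backtracks (v # w # p)"
| "backtracks _ \<longleftrightarrow> False"

text \<open>
  Reduced paths will turn out to be the geodesics, see \<open>shortest_reduced\<close> and \<open>reduced_length\<close>.
\<close>

definition reduced :: "'v list \<Rightarrow> bool" where
  "reduced p \<longleftrightarrow> (\<forall>q. p \<simeq> q \<longrightarrow> \<not> backtracks q)"

text \<open>
  Paths are listed from their current end backwards. For a reduced path, the neighbour \<open>u\<close> of
  the end is a descent if the path can be flipped to pass through \<open>u\<close> just before its end, that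
  is, if \<open>u\<close> is closer to the start.
\<close>

definition descent :: "'v list \<Rightarrow> 'v \<Rightarrow> bool" where
  "descent p u \<longleftrightarrow> (\<exists>q. p \<simeq> hd p # u # q)"

lemma reduced_cong: "p \<simeq> q \<Longrightarrow> reduced p \<longleftrightarrow> reduced q"
  unfolding reduced_def using flips_sym flips_trans by meson

lemma descent_cong: "p \<simeq> q \<Longrightarrow> descent p u \<longleftrightarrow> descent q u"
  unfolding descent_def using flips_sym flips_trans flips_hd by metis

lemma backtracks_Cons: "backtracks p \<Longrightarrow> backtracks (v # p)"
  by (cases p rule: backtracks.cases) auto

lemma reduced_ConsD: "reduced (v # p) \<Longrightarrow> reduced p"
  unfolding reduced_def using flips_Cons backtracks_Cons by blast

lemma reduced_not_descent: "reduced (v # u # p) \<Longrightarrow> \<not> descent (u # p) v"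
  unfolding reduced_def descent_def
  by (metis backtracks.simps(1) flips_Cons list.sel(1))

lemma flips_expand: assumes "v # p \<simeq> l" "p \<noteq> []" obtains a q where "l = v # a # q"
proof -
  have "length l = Suc (length p)" "hd l = v" using flips_length[OF assms(1)] flips_hd[OF assms(1)] by auto
  then show thesis using that assms(2) by (cases l; cases "tl l") auto
qed

text \<open>
  By \<open>two_descents\<close>, flips of the longer path either leave its new first edge in place or slide
  it across a square. If the result backtracks, then a shorter path does, or \<open>u\<close> is a descent.
\<close>

lemma reduced_Cons:
  assumes "reduced (v # p)" "\<not> descent (v # p) u"
  shows "reduced (u # v # p)"
  using assms
proof (induction "length p" arbitrary: u v p rule: less_induct)
  case less
  show ?case unfolding reduced_def
  proof (intro allI impI notI)
    fix l assume l0: "u # v # p \<simeq> l" and bt: "backtracks l"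
    obtain a q where l: "l = u # a # q" using flips_expand[OF l0] by blast
    have td: "u # v # p \<simeq> u # a # q" using l0 l by simp
    show False
    proof (cases "v = a")
      case True
      then have vp: "v # p \<simeq> a # q" using flips_ConsD td by blast
      then have nb: "\<not> backtracks (a # q)" using less.prems(1) reduced_def by blast
      then obtain r where "q = u # r" using bt l by (cases q) auto
      then show False using vp less.prems(2) True unfolding descent_def by auto
    next
      case False
      then obtain x r where sqx: "sq u v x a" and vp: "v # p \<simeq> v # x # r" and aq: "a # q \<simeq> a # x # r"
        using two_descents[OF td] by blast
      have red_vxr: "reduced (v # x # r)" using vp less.prems(1) reduced_cong by blast
      have red_xr: "reduced (x # r)" using red_vxr reduced_ConsD by blast
      have lenr: "length r < length p" using flips_length[OF vp] by simp
      have "backtracks (a # q) \<or> (\<exists>s. q = u # s)" using bt l by (cases q) auto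
      then show False
      proof (elim disjE exE)
        assume "backtracks (a # q)"
        then have "\<not> reduced (a # x # r)" using aq reduced_def flips_sym by blast
        then have "descent (x # r) a" using less.hyps[OF lenr red_xr] by blast
        then obtain s where s: "x # r \<simeq> x # a # s" unfolding descent_def by auto
        have "v # p \<simeq> v # x # a # s" using vp s flips_Cons flips_trans by blast
        also have "sq v x a u" using sqx sq_rotate by blast
        then have "v # x # a # s \<simeq> v # u # a # s" using flips_here by blast
        finally show False using less.prems(2) unfolding descent_def by auto
      next
        fix s assume q: "q = u # s"
        have "a # u # s \<simeq> a # x # r" using aq q by simp
        moreover have "u \<noteq> x" using sq_diagonal[OF sqx] .
        ultimately obtain y t where y: "sq a u y x" "x # r \<simeq> x # y # t"
          using two_descents by blast
        have "y = v" using y(1) sqx by (metis sq_rotate sq_reflect sq_unique)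
        then have "v # x # r \<simeq> v # x # v # t" using y(2) flips_Cons by blast
        then show False using red_vxr unfolding reduced_def by (metis backtracks.simps(1))
      qed
    qed
  qed
qed

text \<open>
  Moves the end of a path along the edge to \<open>u\<close>. This makes edge paths act on reduced paths up
  to flips: \<open>step_back\<close> and \<open>step_square\<close> say that backtracks and squares act trivially, so that
  the action only depends on the homotopy class.
\<close>

definition step :: "'v list \<Rightarrow> 'v \<Rightarrow> 'v list" where
  "step p u = (if descent p u then u # (SOME q. p \<simeq> hd p # u # q) else u # p)"

lemma step_descent: "p \<simeq> v # u # q \<Longrightarrow> step p u \<simeq> u # q"
proof -
  assume p: "p \<simeq> v # u # q"
  then have v: "hd p = v" using flips_hd by fastforce
  have d: "descent p u" using p v unfolding descent_def by blast
  then have "p \<simeq> hd p # u # (SOME q. p \<simeq> hd p # u # q)"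
    unfolding descent_def by (rule someI_ex)
  then have "v # u # (SOME q. p \<simeq> hd p # u # q) \<simeq> v # u # q"
    using p v flips_sym flips_trans by metis
  then show ?thesis unfolding step_def using d flips_ConsD by auto
qed

lemma step_not_descent: "\<not> descent p u \<Longrightarrow> step p u = u # p"
  unfolding step_def by simp

lemma step_cases:
  obtains q where "p \<simeq> hd p # u # q" "step p u \<simeq> u # q" | "\<not> descent p u" "step p u = u # p"
proof (cases "descent p u")
  case True
  then obtain q where "p \<simeq> hd p # u # q" unfolding descent_def by blast
  then show ?thesis using that(1) step_descent by blast
qed (use that(2) step_not_descent in blast)

lemma step_cong: assumes "p \<simeq> q" shows "step p u \<simeq> step q u"
proof (cases rule: step_cases[of p u])
  case (1 r)
  then have "q \<simeq> hd p # u # r" using assms flips_sym flips_trans by blast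
  then show ?thesis using step_descent 1 flips_sym flips_trans by meson
next
  case 2
  then show ?thesis using assms descent_cong step_not_descent flips_Cons by metis
qed

lemma step_hd: "hd (step p u) = u"
  unfolding step_def by simp

lemma step_Nil: "step p u \<noteq> []"
  unfolding step_def by simp

lemma step_reduced: assumes "reduced p" "p \<noteq> []" shows "reduced (step p u)"
proof (cases rule: step_cases[of p u])
  case (1 r)
  then show ?thesis using assms reduced_cong reduced_ConsD by blast
next
  case 2
  then show ?thesis using assms reduced_Cons by (cases p) auto
qed

lemma step_back: assumes "reduced p" "p \<noteq> []" shows "step (step p u) (hd p) \<simeq> p"
proof (cases rule: step_cases[of p u])
  case (1 q)
  have "reduced (hd p # u # q)" using 1(1) assms(1) reduced_cong by blast
  then have "\<not> descent (u # q) (hd p)" by (rule reduced_not_descent)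
  then have "step (u # q) (hd p) \<simeq> p" using step_not_descent 1(1) flips_sym by simp
  then show ?thesis using step_cong[OF 1(2)] flips_trans by blast
next
  case 2
  have "u # p = u # hd p # tl p" using assms by simp
  then have "step (u # p) (hd p) \<simeq> hd p # tl p" using step_descent by (metis rtranclp.rtrancl_refl)
  then show ?thesis using 2 assms by simp
qed

lemma descents_square:
  assumes "a # p \<simeq> a # b # q" "sq a b c d" "descent (a # p) d"
  obtains r where "a # p \<simeq> a # b # c # r" "a # p \<simeq> a # d # c # r"
proof -
  obtain s where s: "a # p \<simeq> a # d # s" using assms(3) unfolding descent_def by auto
  have "b \<noteq> d" using sq_diagonal sq_rotate assms(2) by blast
  moreover have "a # b # q \<simeq> a # d # s" using assms(1) s flips_sym flips_trans by blast
  ultimately obtain x r where x: "sq a b x d" "b # q \<simeq> b # x # r" "d # s \<simeq> d # x # r"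
    using two_descents by blast
  have "x = c" using x(1) assms(2) sq_unique by blast
  then show thesis using that x s assms(1) flips_Cons flips_trans by metis
qed

lemma step_square_aux:
  assumes red: "reduced p" and ne: "p \<noteq> []" and sq: "sq (hd p) b c d" and db: "descent p b" and dd: "\<not> descent p d"
  shows "step (step p b) c \<simeq> step (step p d) c"
proof -
  let ?a = "hd p"
  obtain q where q: "p \<simeq> ?a # b # q" using db unfolding descent_def by blast
  have sb: "step p b \<simeq> b # q" using step_descent q by blast
  have sd: "step p d = d # p" using dd step_not_descent by blast
  have "d # p \<simeq> d # ?a # b # q" using q flips_Cons by blast
  also have "sq d ?a b c" using sq sq_rotate by blast
  then have "d # ?a # b # q \<simeq> d # c # b # q" using flips_here by blast
  finally have dp: "d # p \<simeq> d # c # b # q" .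
  have "reduced (d # p)" using red dd ne reduced_Cons by (cases p) auto
  then have "reduced (d # c # b # q)" using dp reduced_cong by blast
  then have "\<not> descent (b # q) c" using reduced_ConsD reduced_not_descent by blast
  then have "step (b # q) c = c # b # q" by (rule step_not_descent)
  moreover have "step (d # p) c \<simeq> c # b # q" using dp step_descent by blast
  ultimately show ?thesis using step_cong[OF sb, of c] sd flips_sym flips_trans by metis
qed

text \<open>
  If \<open>b\<close> and \<open>d\<close> are both descents, then by the exchange property so is \<open>c\<close> after either. If
  neither is, then \<open>c\<close> is not a descent after either, and the two longer paths differ by a flip.
\<close>

lemma step_square:
  assumes red: "reduced p" and ne: "p \<noteq> []" and sq: "sq (hd p) b c d"
  shows "step (step p b) c \<simeq> step (step p d) c"
proof -
  let ?a = "hd p"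
  have p: "p = ?a # tl p" using ne by simp
  consider "descent p b" "descent p d" | "descent p b" "\<not> descent p d" | "\<not> descent p b" "descent p d"
    | "\<not> descent p b" "\<not> descent p d" by blast
  then show ?thesis
  proof cases
    case 1
    then obtain q where "p \<simeq> ?a # b # q" unfolding descent_def by blast
    then obtain r where r: "p \<simeq> ?a # b # c # r" "p \<simeq> ?a # d # c # r"
      using descents_square[of ?a "tl p" b q c d] p sq 1 by metis
    have "step p b \<simeq> b # c # r" "step p d \<simeq> d # c # r" using r step_descent by blast+
    then have "step (step p b) c \<simeq> c # r" "step (step p d) c \<simeq> c # r"
      using step_descent by blast+
    then show ?thesis using flips_sym flips_trans by blast
  next
    case 2
    then show ?thesis using step_square_aux assms by blast
  next
    case 3
    then show ?thesis using step_square_aux[OF red ne sq_reflect[OF sq]] flips_sym by blast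
  next
    case 4
    have *: "step (b # p) c = c # b # p" if sq: "sq ?a b c d" and db: "\<not> descent p b" and dd: "\<not> descent p d" for b d
    proof (rule step_not_descent, rule notI)
      assume "descent (b # p) c"
      moreover have "b # ?a # tl p \<simeq> b # ?a # tl p" by simp
      moreover have "sq b ?a d c" using sq by (metis sq_rotate sq_reflect)
      ultimately obtain r where "b # ?a # tl p \<simeq> b # ?a # d # r"
        using descents_square[of b "?a # tl p" ?a "tl p" d c] p by metis
      then have "p \<simeq> ?a # d # r" using flips_ConsD p by metis
      then show False using dd unfolding descent_def by blast
    qed
    have "step (step p b) c = c # b # p" using * 4 sq step_not_descent by metis
    moreover have "step (step p d) c = c # d # p" using * 4 sq_reflect[OF sq] step_not_descent by metis
    moreover have "c # b # ?a # tl p \<simeq> c # d # ?a # tl p"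
      by (rule flips_here) (metis sq sq_rotate sq_reflect)
    ultimately show ?thesis using p by metis
  qed
qed

definition walk :: "'v list \<Rightarrow> 'v list \<Rightarrow> 'v list" where
  "walk p l = fold (\<lambda>u p. step p u) l p"

lemma walk_simps [simp]: "walk p [] = p" "walk p (u # l) = walk (step p u) l"
  "walk p (l @ l') = walk (walk p l) l'"
  unfolding walk_def by auto

lemma walk_cong: "p \<simeq> q \<Longrightarrow> walk p l \<simeq> walk q l"
  by (induction l arbitrary: p q) (auto simp: step_cong)

lemma walk_reduced: "reduced p \<Longrightarrow> p \<noteq> [] \<Longrightarrow> reduced (walk p l) \<and> walk p l \<noteq> []"
  by (induction l arbitrary: p) (auto simp: step_reduced step_Nil)

lemma walk_hd: "l \<noteq> [] \<Longrightarrow> hd (walk p l) = last l"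
  by (induction l arbitrary: p) (auto simp: step_hd)

lemma walk_back:
  "reduced p \<Longrightarrow> p \<noteq> [] \<Longrightarrow> walk (walk p l) (tl (rev (hd p # l))) \<simeq> p"
proof (induction l arbitrary: p)
  case (Cons u l)
  have 1: "reduced (step p u)" "step p u \<noteq> []" "hd (step p u) = u"
    using Cons step_reduced step_Nil step_hd by auto
  have "tl (rev (hd p # u # l)) = tl (rev (u # l)) @ [hd p]" by (cases "rev l") auto
  then have "walk (walk p (u # l)) (tl (rev (hd p # u # l))) =
    step (walk (walk (step p u) l) (tl (rev (u # l)))) (hd p)" by simp
  also have "\<dots> \<simeq> step (step p u) (hd p)"
    using Cons.IH[OF 1(1,2)] 1(3) step_cong by metis
  also have "\<dots> \<simeq> p" using step_back Cons.prems by blast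
  finally show ?case .
qed simp

text \<open>
  Elementary homotopies of edge paths, the moves that do not change the effect of \<open>step\<close>.
\<close>

inductive elem_hom :: "'v list \<Rightarrow> 'v list \<Rightarrow> bool" where
  eh_back: "adj u v \<Longrightarrow> elem_hom (p @ [u, v, u] @ q) (p @ [u] @ q)"
| eh_square: "sq a b c d \<Longrightarrow> elem_hom (p @ [a, b, c] @ q) (p @ [a, d, c] @ q)"

lemma reduced_single: "reduced [v]"
proof -
  have "q = [v]" if "[v] \<simeq> q" for q
    using flips_length[OF that] flips_hd[OF that] by (cases q) auto
  then show ?thesis unfolding reduced_def using backtracks.simps(3) by blast
qed

lemma walk_elem_hom:
  assumes "elem_hom l l'"
  shows "l \<noteq> [] \<and> l' \<noteq> [] \<and> hd l = hd l' \<and> walk [hd l] (tl l) \<simeq> walk [hd l'] (tl l')"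
proof -
  have main: "walk [hd (p @ a # r @ q)] (tl (p @ a # r @ q)) \<simeq> walk [hd (p @ a # r' @ q)] (tl (p @ a # r' @ q))"
    if *: "\<And>s. reduced s \<Longrightarrow> s \<noteq> [] \<Longrightarrow> hd s = a \<Longrightarrow> walk s r \<simeq> walk s r'" for p a r r' q
  proof (cases p)
    case Nil
    then show ?thesis using *[of "[a]"] reduced_single walk_cong by simp
  next
    case (Cons b p')
    have "reduced (walk [b] (p' @ [a])) \<and> walk [b] (p' @ [a]) \<noteq> []" by (intro walk_reduced reduced_single) simp
    moreover have "hd (walk [b] (p' @ [a])) = a" by (subst walk_hd) auto
    ultimately have "walk (walk [b] (p' @ [a])) r \<simeq> walk (walk [b] (p' @ [a])) r'" using * by blast
    then show ?thesis using Cons walk_cong by simp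
  qed
  show ?thesis using assms
  proof (cases rule: elem_hom.cases)
    case (eh_back u v p q)
    have "walk s [v, u] \<simeq> walk s []" if "reduced s" "s \<noteq> []" "hd s = u" for s
      using step_back[of s v] that by simp
    then have "walk [hd (p @ u # [v, u] @ q)] (tl (p @ u # [v, u] @ q)) \<simeq> walk [hd (p @ u # [] @ q)] (tl (p @ u # [] @ q))"
      by (rule main)
    moreover have "hd (p @ u # [v, u] @ q) = hd (p @ u # [] @ q)" by (cases p) auto
    ultimately show ?thesis using eh_back by simp
  next
    case (eh_square a b c d p q)
    have "walk s [b, c] \<simeq> walk s [d, c]" if "reduced s" "s \<noteq> []" "hd s = a" for s
      using step_square[of s b c d] that eh_square by simp
    then have "walk [hd (p @ a # [b, c] @ q)] (tl (p @ a # [b, c] @ q)) \<simeq> walk [hd (p @ a # [d, c] @ q)] (tl (p @ a # [d, c] @ q))"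
      by (rule main)
    moreover have "hd (p @ a # [b, c] @ q) = hd (p @ a # [d, c] @ q)" by (cases p) auto
    ultimately show ?thesis using eh_square by simp
  qed
qed

lemma walk_homotopic:
  assumes "equivclp elem_hom l l'" "l \<noteq> []"
  shows "l' \<noteq> [] \<and> hd l = hd l' \<and> walk [hd l] (tl l) \<simeq> walk [hd l'] (tl l')"
  using assms
proof (induction rule: equivclp_induct)
  case base then show ?case by simp
next
  case (step y z)
  then have *: "elem_hom y z \<or> elem_hom z y" by blast
  show ?case using walk_elem_hom[of y z] walk_elem_hom[of z y] * step flips_sym flips_trans by metis
qed

lemma walk_reduced_path: "reduced p \<Longrightarrow> p \<noteq> [] \<Longrightarrow> walk [last p] (tl (rev p)) \<simeq> p"
proof (induction p)
  case (Cons v p)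
  show ?case
  proof (cases p)
    case (Cons u q)
    have "reduced p" using Cons.prems reduced_ConsD by blast
    then have IH: "walk [last p] (tl (rev p)) \<simeq> p" using Cons.IH Cons by simp
    have "\<not> descent p v" using Cons.prems Cons reduced_not_descent by simp
    then have "step p v = v # p" by (rule step_not_descent)
    moreover have "tl (rev (v # p)) = tl (rev p) @ [v]"
      using Cons by (cases "rev p") auto
    moreover have "last (v # p) = last p" using Cons by simp
    ultimately show ?thesis using step_cong[OF IH, of v] by (simp del: rev.simps)
  qed simp
qed simp

definition dst :: "'v \<Rightarrow> 'v \<Rightarrow> nat" where
  "dst u v = (LEAST n. (adj ^^ n) u v)"

end

section \<open>Halfspaces, intervals and centres\<close>

locale simply_connected_square_graph = square_graph adj sq
  for adj :: "'v \<Rightarrow> 'v \<Rightarrow> bool" and sq +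
  fixes V :: "'v set"
  assumes adj_V: "adj u v \<Longrightarrow> u \<in> V"
    and connected: "u \<in> V \<Longrightarrow> v \<in> V \<Longrightarrow> \<exists>p. successively adj p \<and> p \<noteq> [] \<and> hd p = u \<and> last p = v"
    and simply_connected: "successively adj p \<Longrightarrow> p \<noteq> [] \<Longrightarrow> set p \<subseteq> V \<Longrightarrow> hd p = last p \<Longrightarrow> equivclp elem_hom p [hd p]"
begin

definition is_path :: "'v list \<Rightarrow> bool" where
  "is_path p \<longleftrightarrow> p \<noteq> [] \<and> successively adj p \<and> set p \<subseteq> V"

lemma successively_adj_swap [simp]: "successively (\<lambda>x y. adj y x) p \<longleftrightarrow> successively adj p"
proof -
  have "(\<lambda>x y. adj y x) = adj" using adj_sym by blast
  then show ?thesis by argo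
qed

lemma is_path_rev: "is_path (rev p) \<longleftrightarrow> is_path p"
  unfolding is_path_def by simp

text \<open>Walking along one path and back along the other is null-homotopic.\<close>

lemma walk_unique:
  assumes "is_path p" "is_path q" "hd p = hd q" "last p = last q"
  shows "walk [hd p] (tl p) \<simeq> walk [hd q] (tl q)"
proof -
  let ?z = "hd p" and ?A = "walk [hd p] (tl p)"
  have p: "p = ?z # tl p" using assms(1) unfolding is_path_def by simp
  have q: "q = ?z # tl q" using assms(2,3) unfolding is_path_def by simp
  have "is_path (p @ tl (rev q))"
  proof -
    have "rev q = last p # tl (rev q)" using assms(2,4) hd_Cons_tl[of "rev q"] unfolding is_path_def by (simp add: hd_rev)
    then have *: "successively adj (last p # tl (rev q))" using assms is_path_rev unfolding is_path_def by metis
    moreover have "set (tl (rev q)) \<subseteq> V" using assms(2) unfolding is_path_def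
      using list.set_sel(2)[of "rev q"] by (cases "rev q") auto
    ultimately show ?thesis using assms(1) unfolding is_path_def
      by (cases "tl (rev q)") (auto simp: successively_append_iff successively_Cons)
  qed
  moreover have "last (p @ tl (rev q)) = hd (p @ tl (rev q))"
  proof (cases "tl (rev q) = []")
    case True
    then have "length q = 1" using assms(2) unfolding is_path_def by (cases "rev q") (auto)
    then have "hd q = last q" by (cases q) auto
    then show ?thesis using True assms unfolding is_path_def by simp
  next
    case False
    then have "last (tl (rev q)) = hd q" by (metis last_rev last_tl)
    then show ?thesis using False assms unfolding is_path_def by simp
  qed
  moreover have "hd (p @ tl (rev q)) = ?z" using assms(1) unfolding is_path_def by simp
  ultimately have "equivclp elem_hom (p @ tl (rev q)) [?z]"
    using simply_connected[of "p @ tl (rev q)"] unfolding is_path_def by simp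
  then have "walk [?z] (tl p @ tl (rev q)) \<simeq> [?z]"
    using walk_homotopic[of "p @ tl (rev q)" "[?z]"] p by (cases p) auto
  then have Az: "walk ?A (tl (rev q)) \<simeq> [?z]" by simp
  have A: "reduced ?A" "?A \<noteq> []" using walk_reduced[OF reduced_single] by auto
  have hdA: "hd ?A = last q"
    using p assms walk_hd[of "tl p" "[?z]"] by (cases "tl p") (auto simp: last_tl)
  have "tl (rev (hd ?A # tl (rev q))) = tl q"
  proof -
    have "rev q = hd ?A # tl (rev q)" using hdA assms(2) hd_Cons_tl[of "rev q"] unfolding is_path_def by (simp add: hd_rev)
    then show ?thesis by (metis rev_rev_ident)
  qed
  then have "walk (walk ?A (tl (rev q))) (tl q) \<simeq> ?A" using walk_back[OF A, of "tl (rev q)"] by metis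
  then show ?thesis using walk_cong[OF Az, of "tl q"] assms(3) flips_sym flips_trans by metis
qed

text \<open>
  Walking along a reduced path from its start reproduces it, and the result only depends on the
  ends.
\<close>

lemma reduced_paths_flips:
  assumes "is_path p" "is_path q" "reduced p" "reduced q" "hd p = hd q" "last p = last q"
  shows "p \<simeq> q"
proof -
  have ne: "p \<noteq> []" "q \<noteq> []" using assms unfolding is_path_def by auto
  have "walk [hd (rev p)] (tl (rev p)) \<simeq> walk [hd (rev q)] (tl (rev q))"
    using assms is_path_rev by (intro walk_unique) (auto simp: hd_rev last_rev is_path_def)
  then have "walk [last p] (tl (rev p)) \<simeq> walk [last q] (tl (rev q))" by (simp add: hd_rev)
  then show ?thesis using walk_reduced_path assms(3,4) ne flips_sym flips_trans by meson
qed

lemma relpowp_iff_path: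
  "(adj ^^ n) u v \<longleftrightarrow> (\<exists>p. successively adj p \<and> length p = Suc n \<and> last p = u \<and> hd p = v)"
proof (induction n arbitrary: v)
  case 0
  show ?case by (auto simp: length_Suc_conv intro!: exI[of _ "[v]"])
next
  case (Suc n)
  show ?case
  proof
    assume "(adj ^^ Suc n) u v"
    then obtain w where "(adj ^^ n) u w" "adj w v" by (auto simp: relcompp_apply)
    then obtain p where "successively adj p" "length p = Suc n" "last p = u" "hd p = w"
      using Suc by blast
    then show "\<exists>p. successively adj p \<and> length p = Suc (Suc n) \<and> last p = u \<and> hd p = v"
      using adj_sym[OF \<open>adj w v\<close>] by (intro exI[of _ "v # p"]) (auto simp: successively_Cons)
  next
    assume "\<exists>p. successively adj p \<and> length p = Suc (Suc n) \<and> last p = u \<and> hd p = v"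
    then obtain p w q where p: "successively adj p" "length p = Suc (Suc n)" "last p = u" "p = v # w # q"
      by (metis length_Suc_conv list.sel(1))
    then have "successively adj (w # q) \<and> length (w # q) = Suc n \<and> last (w # q) = u \<and> hd (w # q) = w"
      by (auto simp: successively_Cons)
    then have "(adj ^^ n) u w" using Suc by blast
    moreover have "adj w v" using p adj_sym by (auto simp: successively_Cons)
    ultimately show "(adj ^^ Suc n) u v" by (auto simp: relcompp_apply)
  qed
qed

lemma is_path_Cons: "is_path (v # u # p) \<longleftrightarrow> adj v u \<and> is_path (u # p)"
  unfolding is_path_def using adj_V by auto

lemma is_path_extend: "is_path p \<Longrightarrow> adj v (hd p) \<Longrightarrow> is_path (v # p)"
  by (cases p) (auto simp: is_path_Cons, auto simp: is_path_def)

lemma path_V: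
  assumes "successively adj p" "p \<noteq> []" "last p \<in> V \<or> hd p \<in> V" shows "is_path p"
proof -
  have "set p \<subseteq> V" using assms
  proof (induction p)
    case (Cons a p)
    then show ?case
    proof (cases p)
      case (Cons b q)
      then have "adj a b" using Cons.prems by simp
      then have "a \<in> V" "b \<in> V" using adj_V adj_sym by blast+
      then show ?thesis using Cons.IH Cons.prems Cons by (auto simp: successively_Cons)
    qed auto
  qed simp
  then show ?thesis using assms unfolding is_path_def by simp
qed

lemma flips_is_path: "p \<simeq> q \<Longrightarrow> is_path p \<Longrightarrow> is_path q"
  using path_V flips_path flips_last flips_length unfolding is_path_def
  by (metis last_in_set length_0_conv subset_code(1))

lemma dst_le: assumes "is_path p" shows "Suc (dst (last p) (hd p)) \<le> length p"
proof -
  obtain n where n: "length p = Suc n" using assms unfolding is_path_def by (cases p) auto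
  then have "(adj ^^ n) (last p) (hd p)" unfolding relpowp_iff_path using assms unfolding is_path_def by blast
  then have "dst (last p) (hd p) \<le> n" unfolding dst_def by (rule Least_le)
  then show ?thesis using n by simp
qed

lemma shortest_path:
  assumes "u \<in> V" "v \<in> V"
  obtains p where "is_path p" "last p = u" "hd p = v" "length p = Suc (dst u v)"
proof -
  obtain q where q: "successively adj q" "q \<noteq> []" "hd q = v" "last q = u"
    using connected assms by blast
  then obtain n where "length q = Suc n" by (cases q) auto
  then have "(adj ^^ n) u v" unfolding relpowp_iff_path using q by blast
  then have "(adj ^^ dst u v) u v" unfolding dst_def by (rule LeastI)
  then obtain p where p: "successively adj p" "length p = Suc (dst u v)" "last p = u" "hd p = v"
    unfolding relpowp_iff_path by blast
  moreover have "is_path p" using p assms by (intro path_V) auto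
  ultimately show thesis using that by blast
qed

lemma backtracks_shorten:
  "backtracks p \<Longrightarrow> is_path p \<Longrightarrow> \<exists>q. is_path q \<and> hd q = hd p \<and> last q = last p \<and> length q < length p"
proof (induction p rule: backtracks.induct)
  case (1 u v w p)
  show ?case
  proof (cases "u = w")
    case True
    then show ?thesis using 1 by (intro exI[of _ "w # p"]) (auto simp: is_path_Cons)
  next
    case False
    then obtain q where q: "is_path q" "hd q = v" "last q = last (w # p)" "length q < length (v # w # p)"
      using 1 by (auto simp: is_path_Cons)
    then obtain q' where "q = v # q'" unfolding is_path_def by (cases q) auto
    then show ?thesis using q 1 by (intro exI[of _ "u # q"]) (auto simp: is_path_Cons)
  qed
qed auto

lemma shortest_reduced:
  assumes "is_path p" "length p = Suc (dst (last p) (hd p))"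
  shows "reduced p"
  unfolding reduced_def
proof (intro allI impI notI)
  fix q assume q: "p \<simeq> q" "backtracks q"
  then obtain r where "is_path r" "hd r = hd q" "last r = last q" "length r < length q"
    using backtracks_shorten flips_is_path assms by blast
  moreover have "hd p = hd q" "last p = last q" "length p = length q"
    using q(1) flips_hd flips_last flips_length by auto
  ultimately show False using dst_le[of r] assms by simp
qed

text \<open>A shortest path is reduced, and flips keep the length.\<close>

lemma reduced_length:
  assumes "is_path p" "reduced p"
  shows "length p = Suc (dst (last p) (hd p))"
proof -
  have "last p \<in> V" "hd p \<in> V" using assms unfolding is_path_def by auto
  then obtain q where q: "is_path q" "last q = last p" "hd q = hd p" "length q = Suc (dst (last p) (hd p))"
    using shortest_path by metis
  then have "p \<simeq> q" using reduced_paths_flips assms shortest_reduced by metis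
  then show ?thesis using flips_length q by metis
qed

lemma dst_refl [simp]: "dst v v = 0"
  unfolding dst_def by (rule Least_eq_0) simp

lemma dst_eq_0: "u \<in> V \<Longrightarrow> v \<in> V \<Longrightarrow> dst u v = 0 \<longleftrightarrow> u = v"
  using shortest_path[of u v] by (metis One_nat_def dst_refl hd_conv_nth last_conv_nth length_greater_0_conv less_one diff_Suc_1)

lemma dst_commute: assumes "u \<in> V" "v \<in> V" shows "dst u v = dst v u"
proof -
  have "dst u v \<le> dst v u" if "u \<in> V" "v \<in> V" for u v
  proof -
    obtain p where "is_path p" "last p = v" "hd p = u" "length p = Suc (dst v u)"
      using shortest_path \<open>u \<in> V\<close> \<open>v \<in> V\<close> by metis
    then show ?thesis using dst_le[of "rev p"] is_path_rev by (simp add: hd_rev last_rev)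
  qed
  then show ?thesis using assms by (simp add: le_antisym)
qed

lemma dst_triangle: assumes "u \<in> V" "v \<in> V" "w \<in> V" shows "dst u w \<le> dst u v + dst v w"
proof -
  obtain p where p: "is_path p" "last p = u" "hd p = v" "length p = Suc (dst u v)"
    using shortest_path assms by metis
  obtain q where q: "is_path q" "last q = v" "hd q = w" "length q = Suc (dst v w)"
    using shortest_path assms by metis
  have pp: "p = v # tl p" using p unfolding is_path_def by auto
  have "is_path (q @ tl p)"
  proof (cases "tl p")
    case (Cons a r)
    then have "adj v a" "is_path (tl p)" using p(1) pp is_path_Cons by metis+
    then show ?thesis using q(1,2) Cons unfolding is_path_def by (auto simp: successively_append_iff)
  qed (use q in simp)
  then have "Suc (dst (last (q @ tl p)) (hd (q @ tl p))) \<le> length (q @ tl p)" by (rule dst_le)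
  moreover have "last (q @ tl p) = u"
  proof (cases "tl p = []")
    case True
    then have "u = v" using p pp by (metis last.simps)
    then show ?thesis using True q by simp
  next
    case False
    then show ?thesis using p(2) pp by (metis last_ConsR last_appendR)
  qed
  moreover have "hd (q @ tl p) = w" using q unfolding is_path_def by simp
  ultimately show ?thesis using p q by simp
qed

lemma dst_adj: "adj u v \<Longrightarrow> z \<in> V \<Longrightarrow> dst z v \<le> Suc (dst z u)"
proof -
  assume "adj u v" "z \<in> V"
  then have "u \<in> V" "v \<in> V" using adj_V adj_sym by blast+
  then obtain p where p: "is_path p" "last p = z" "hd p = u" "length p = Suc (dst z u)"
    using shortest_path \<open>z \<in> V\<close> by metis
  then have "is_path (v # p)" using \<open>adj u v\<close> adj_sym is_path_extend by blast
  then show ?thesis using dst_le[of "v # p"] p unfolding is_path_def by (auto split: if_splits)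
qed

text \<open>
  A step changes the length of a reduced path by exactly one. In particular the graph is
  bipartite.
\<close>

lemma dst_adj_cases:
  assumes "adj u v" "z \<in> V"
  shows "dst z v = Suc (dst z u) \<or> dst z u = Suc (dst z v)"
proof -
  have V: "u \<in> V" "v \<in> V" using assms adj_V adj_sym by blast+
  then obtain p where p: "is_path p" "last p = z" "hd p = u" "length p = Suc (dst z u)"
    using shortest_path \<open>z \<in> V\<close> by metis
  have red: "reduced p" using shortest_reduced p by metis
  have ne: "p \<noteq> []" using p unfolding is_path_def by simp
  show ?thesis
  proof (cases rule: step_cases[of p v])
    case (1 q)
    then have "is_path (u # v # q)" "reduced (u # v # q)" "last (u # v # q) = z" "length (u # v # q) = length p"
      using p flips_is_path[OF 1(1)] reduced_cong[OF 1(1)] red flips_last[OF 1(1)] flips_length[OF 1(1)] by auto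
    then have "is_path (v # q)" "reduced (v # q)" "last (v # q) = z" "Suc (length (v # q)) = length p"
      using is_path_Cons reduced_ConsD by auto
    then show ?thesis using reduced_length[of "v # q"] p by simp
  next
    case 2
    then have "reduced (v # p)" using step_reduced[OF red ne, of v] by simp
    moreover have "is_path (v # p)" using p assms adj_sym is_path_extend by blast
    ultimately show ?thesis using reduced_length[of "v # p"] p ne by simp
  qed
qed

lemma geodesic_Cons:
  assumes "adj v u" "z \<in> V" "dst z v = Suc (dst z u)" "is_path p" "last p = z" "hd p = u" "length p = Suc (dst z u)"
  shows "is_path (v # p)" "reduced (v # p)"
proof -
  show 1: "is_path (v # p)" using assms is_path_extend by blast
  have "last (v # p) = z" using assms unfolding is_path_def by simp
  then show "reduced (v # p)" using 1 assms by (intro shortest_reduced) auto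
qed

text \<open>
  The quadrangle condition of median graphs, with \<open>z\<close> as the base point of the distance.
\<close>

lemma quadrangle:
  assumes "adj v a" "adj v c" "a \<noteq> c" "z \<in> V" "dst z v = Suc (dst z a)" "dst z v = Suc (dst z c)"
  shows "\<exists>x. sq v a x c \<and> dst z a = Suc (dst z x)"
proof -
  have V: "a \<in> V" "c \<in> V" using assms adj_V adj_sym by blast+
  obtain p where p: "is_path p" "last p = z" "hd p = a" "length p = Suc (dst z a)"
    using shortest_path \<open>z \<in> V\<close> V by metis
  obtain q where q: "is_path q" "last q = z" "hd q = c" "length q = Suc (dst z c)"
    using shortest_path \<open>z \<in> V\<close> V by metis
  have pq: "p = a # tl p" "q = c # tl q" using p q unfolding is_path_def by auto
  have vp: "is_path (v # p)" "reduced (v # p)" using geodesic_Cons[OF assms(1,4,5) p] by auto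
  have vq: "is_path (v # q)" "reduced (v # q)" using geodesic_Cons[OF assms(2,4,6) q] by auto
  have "v # p \<simeq> v # q"
    using vp vq p q by (intro reduced_paths_flips) (auto simp: is_path_def)
  then have "v # a # tl p \<simeq> v # c # tl q" using pq by simp
  then obtain x r where x: "sq v a x c" "a # tl p \<simeq> a # x # r"
    using two_descents assms(3) by blast
  have ap: "p \<simeq> a # x # r" using x pq by simp
  have "is_path (a # x # r)" "reduced (a # x # r)" "last (a # x # r) = z" "length (a # x # r) = length p"
      using p flips_is_path[OF ap] reduced_cong[OF ap] vp reduced_ConsD flips_last[OF ap] flips_length[OF ap] by auto
  then have "is_path (x # r)" "reduced (x # r)" "last (x # r) = z" "Suc (length (x # r)) = length p"
      using is_path_Cons reduced_ConsD by auto
  then have "dst z a = Suc (dst z x)" using reduced_length[of "x # r"] p by simp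
  then show ?thesis using x by blast
qed

definition halfspace :: "'v \<Rightarrow> 'v \<Rightarrow> 'v set" where
  "halfspace a b = {z \<in> V. dst z a < dst z b}"

lemma adj_in_V: "adj u v \<Longrightarrow> u \<in> V" "adj u v \<Longrightarrow> v \<in> V"
  using adj_V adj_sym by blast+

lemma halfspace_iff:
  assumes "adj a b"
  shows "z \<in> halfspace a b \<longleftrightarrow> z \<in> V \<and> dst z b = Suc (dst z a)"
  unfolding halfspace_def using dst_adj_cases[OF assms, of z] by auto

lemma not_halfspace_iff:
  assumes "adj a b" "z \<in> V"
  shows "z \<notin> halfspace a b \<longleftrightarrow> dst z a = Suc (dst z b)"
  unfolding halfspace_def using dst_adj_cases[OF assms] assms by auto

lemma halfspace_compl: "adj a b \<Longrightarrow> halfspace b a = V - halfspace a b"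
  using not_halfspace_iff halfspace_iff[of b a] adj_sym by blast

lemma sq_edges: assumes "sq a b c d" shows "adj a b" "adj b c" "adj c d" "adj d a"
  using assms by (metis sq_adj sq_rotate)+

lemma square_halfspace_subset:
  assumes "sq a b c d" shows "halfspace a b \<subseteq> halfspace d c"
proof
  fix z assume "z \<in> halfspace a b"
  note e = sq_edges[OF assms]
  have z: "z \<in> V" "dst z b = Suc (dst z a)"
    using \<open>z \<in> halfspace a b\<close> halfspace_iff[OF e(1)] by auto
  show "z \<in> halfspace d c"
  proof (rule ccontr)
    assume "z \<notin> halfspace d c"
    then have dc: "dst z d = Suc (dst z c)" using not_halfspace_iff[of d c z] e adj_sym z by blast
    have "dst z c = dst z a" "dst z d = Suc (dst z a)"
      using dst_adj_cases[OF e(2) z(1)] dst_adj_cases[OF e(4) z(1)] z(2) dc by arith+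
    moreover have "a \<noteq> c" using assms sq_diagonal by blast
    ultimately obtain x where x: "sq b a x c" "dst z a = Suc (dst z x)"
      using quadrangle[OF adj_sym[OF e(1)] e(2) _ z(1)] z(2) by auto
    have "x = d" using x(1) assms by (metis sq_rotate sq_reflect sq_unique)
    then show False using x(2) \<open>dst z d = Suc (dst z a)\<close> by simp
  qed
qed

lemma square_halfspace: assumes "sq a b c d" shows "halfspace a b = halfspace d c"
  using square_halfspace_subset[OF assms] square_halfspace_subset[of d c b a] assms
  by (metis sq_rotate sq_reflect subset_antisym)

lemma closer_neighbour:
  assumes "u \<in> V" "z \<in> V" "dst z u = Suc k"
  obtains w where "adj u w" "dst z w = k"
proof -
  obtain p where p: "is_path p" "last p = z" "hd p = u" "length p = Suc (Suc k)"
    using shortest_path assms by metis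
  then obtain w q where pq: "p = u # w # q" by (cases p; cases "tl p") auto
  have "reduced p" using p assms by (intro shortest_reduced) auto
  then have "reduced (w # q)" "is_path (w # q)" using pq reduced_ConsD p is_path_Cons by auto
  then have "dst z w = k" using reduced_length[of "w # q"] p pq by simp
  moreover have "adj u w" using p pq is_path_Cons by simp
  ultimately show thesis using that by blast
qed

text \<open>
  Pushing the edge \<open>u v\<close> towards \<open>a\<close> across squares keeps its halfspace, by \<open>square_halfspace\<close>.
\<close>

lemma crossing_halfspace:
  assumes "adj a b" "adj u v" "u \<in> halfspace a b" "v \<notin> halfspace a b"
  shows "halfspace u v = halfspace a b"
  using assms(2-)
proof (induction "dst u a" arbitrary: u v)
  case 0
  have V: "u \<in> V" "v \<in> V" "a \<in> V" "b \<in> V" using 0 assms(1) adj_in_V by blast+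
  have "u = a" using 0 V dst_eq_0 by auto
  moreover have "dst v a = Suc (dst v b)" using 0 V not_halfspace_iff[OF assms(1)] by blast
  moreover have "dst v a \<le> 1" using dst_adj[of u v a] \<open>u = a\<close> 0 V dst_commute by simp
  ultimately show ?case using dst_eq_0 V by simp
next
  case (Suc k)
  have V: "u \<in> V" "v \<in> V" "a \<in> V" "b \<in> V" using Suc.prems assms(1) adj_in_V by blast+
  have u: "dst b u = Suc (Suc k)" "dst a u = Suc k"
    using Suc.prems Suc.hyps(2) halfspace_iff[OF assms(1)] V dst_commute by auto
  have "dst a v = Suc (dst b v)" using Suc.prems V not_halfspace_iff[OF assms(1)] dst_commute by auto
  then have v: "dst b v = Suc k" "dst a v = Suc (Suc k)"
    using dst_adj_cases[OF Suc.prems(1) V(3)] dst_adj_cases[OF Suc.prems(1) V(4)] u by arith+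
  obtain w where w: "adj u w" "dst a w = k" using closer_neighbour V u(2) by blast
  have wV: "w \<in> V" using w adj_in_V by blast
  have "dst b w \<le> Suc k"
    using dst_adj[OF assms(1) wV] w(2) dst_commute[OF wV] V by simp
  then have bw: "dst b w = Suc k" using dst_adj_cases[OF w(1) V(4)] u by arith
  have "v \<noteq> w" using w v by auto
  then obtain x where x: "sq u v x w" "dst b v = Suc (dst b x)"
    using quadrangle[OF Suc.prems(1) w(1) _ V(4)] u v bw by auto
  note e = sq_edges[OF x(1)]
  have xV: "x \<in> V" using e adj_in_V by blast
  have bx: "dst b x = k" using x(2) v by simp
  have ax: "dst a x = Suc k"
    using dst_adj_cases[OF e(2) V(3)] dst_adj_cases[OF e(3) V(3)] v w by arith
  have "w \<in> halfspace a b" using halfspace_iff[OF assms(1)] w bw wV V dst_commute by auto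
  moreover have "x \<notin> halfspace a b" using not_halfspace_iff[OF assms(1) xV] ax bx xV V dst_commute by auto
  moreover have "k = dst w a" using w dst_commute wV V by simp
  moreover have "adj w x" using e adj_sym by blast
  ultimately have "halfspace w x = halfspace a b" using Suc.hyps(1) by blast
  moreover have "halfspace u v = halfspace w x" using square_halfspace x(1) by blast
  ultimately show ?case by simp
qed

definition halfspaces :: "'v set set" where
  "halfspaces = {halfspace a b |a b. adj a b}"

definition separators :: "'v \<Rightarrow> 'v \<Rightarrow> 'v set set" where
  "separators x y = {h \<in> halfspaces. x \<in> h \<and> y \<notin> h}"

lemma halfspaces_compl: "h \<in> halfspaces \<Longrightarrow> V - h \<in> halfspaces"
  unfolding halfspaces_def using halfspace_compl adj_sym by blast

lemma separators_refl: "separators x x = {}"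
  unfolding separators_def by auto

text \<open>
  By \<open>crossing_halfspace\<close> the edge from \<open>u\<close> to \<open>v\<close> crosses a single halfspace, and this one
  contains both \<open>x\<close> and \<open>u\<close>.
\<close>

lemma separators_step:
  assumes "x \<in> V" "adj v u" "dst x v = Suc (dst x u)"
  shows "separators x v = insert (halfspace u v) (separators x u) \<and> halfspace u v \<notin> separators x u"
proof -
  have V: "u \<in> V" "v \<in> V" using assms adj_in_V by blast+
  have uv: "adj u v" using assms adj_sym by blast
  have "x \<in> halfspace u v" using halfspace_iff[OF uv] assms by blast
  moreover have u_in: "u \<in> halfspace u v" using halfspace_iff[OF uv] V dst_adj[OF uv V(1)] dst_eq_0[of u v] adj_irrefl uv
    by (metis dst_refl le_Suc_eq le_zero_eq)
  moreover have "v \<notin> halfspace u v" using halfspace_iff[OF uv] by simp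
  moreover have "h = halfspace u v" if h: "h \<in> halfspaces" "(u \<in> h) \<noteq> (v \<in> h)" "x \<in> h" for h
  proof -
    obtain a b where ab: "h = halfspace a b" "adj a b" using h halfspaces_def by auto
    show ?thesis
    proof (cases "u \<in> h")
      case True
      then show ?thesis using crossing_halfspace[OF ab(2) uv] ab h by blast
    next
      case False
      then have "halfspace v u = h" using crossing_halfspace[OF ab(2) assms(2)] ab h by blast
      then have "x \<notin> halfspace u v" using h halfspace_compl[OF uv] by blast
      then show ?thesis using \<open>x \<in> halfspace u v\<close> by blast
    qed
  qed
  moreover have "halfspace u v \<in> halfspaces" unfolding halfspaces_def using uv by blast
  ultimately show ?thesis unfolding separators_def by blast
qed

theorem dst_eq_card_separators:
  assumes "x \<in> V" "y \<in> V"
  shows "finite (separators x y) \<and> card (separators x y) = dst x y"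
  using assms(2)
proof (induction "dst x y" arbitrary: y)
  case 0
  then show ?case using dst_eq_0 assms separators_refl by force
next
  case (Suc k)
  then obtain u where u: "adj y u" "dst x u = k" using closer_neighbour assms by metis
  then have "finite (separators x u) \<and> card (separators x u) = k" using Suc adj_in_V by metis
  moreover have "separators x y = insert (halfspace u y) (separators x u) \<and> halfspace u y \<notin> separators x u"
    using separators_step[OF assms(1) u(1)] u Suc by simp
  ultimately show ?case using Suc by simp
qed

definition interval :: "'v \<Rightarrow> 'v \<Rightarrow> 'v set" where
  "interval x y = {w \<in> V. dst x w + dst w y = dst x y}"

text \<open>
  A point of the interval is determined by the halfspaces that separate it from \<open>x\<close>, and these
  are among the finitely many that separate \<open>y\<close> from \<open>x\<close>. Vertices may have infinite degree.
\<close>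

lemma finite_interval:
  assumes "x \<in> V" "y \<in> V" shows "finite (interval x y)"
proof (rule inj_on_finite)
  show "finite (Pow (separators x y))" using dst_eq_card_separators assms by blast
  show "separators x ` interval x y \<subseteq> Pow (separators x y)"
  proof safe
    fix w h assume w: "w \<in> interval x y" and h: "h \<in> separators x w"
    have wV: "w \<in> V" using w interval_def by blast
    have sub: "separators x y \<subseteq> separators x w \<union> separators w y"
      unfolding separators_def by blast
    have c: "card (separators x w) + card (separators w y) = card (separators x y)"
        "finite (separators x w)" "finite (separators w y)"
      using w dst_eq_card_separators assms wV unfolding interval_def by auto
    have disj: "separators x w \<inter> separators w y = {}" unfolding separators_def by blast
    then have "card (separators x w \<union> separators w y) = card (separators x y)"
      using c by (simp add: card_Un_disjoint)
    then have "separators x y = separators x w \<union> separators w y"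
      using sub c by (intro card_subset_eq) auto
    then show "h \<in> separators x y" using h by blast
  qed
  show "inj_on (separators x) (interval x y)"
  proof
    fix v w assume vw: "v \<in> interval x y" "w \<in> interval x y" "separators x v = separators x w"
    then have V: "v \<in> V" "w \<in> V" unfolding interval_def by auto
    have "h \<notin> separators v w" for h
    proof
      assume h: "h \<in> separators v w"
      then have hc: "h \<in> halfspaces" "V - h \<in> halfspaces" "v \<in> h" "w \<notin> h"
        using halfspaces_compl unfolding separators_def by auto
      show False
      proof (cases "x \<in> h")
        case True
        then have "h \<in> separators x w" using hc unfolding separators_def by blast
        then have "h \<in> separators x v" using vw(3) by simp
        then show False using hc unfolding separators_def by blast
      next
        case False
        then have "V - h \<in> separators x v" using hc assms unfolding separators_def by blast
        then have "V - h \<in> separators x w" using vw(3) by simp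
        then show False using hc V unfolding separators_def by blast
      qed
    qed
    then have "dst v w = 0" using dst_eq_card_separators[OF V] by (metis card.empty ex_in_conv)
    then show "v = w" using dst_eq_0 V by blast
  qed
qed

text \<open>
  Walk from \<open>m\<close> along a geodesic to \<open>z\<close> and watch the distance to \<open>y\<close>. Where it first decreases,
  \<open>quadrangle\<close> yields a square that moves the decrease one step closer to \<open>m\<close>; at \<open>m\<close> itself a
  decrease of both distances is excluded.
\<close>

lemma geodesic_or_common_descent_aux:
  assumes "y \<in> V" "z \<in> V" "m \<in> V"
    and nc: "\<not> (\<exists>n. adj m n \<and> dst y n < dst y m \<and> dst z n < dst z m)"
  shows "is_path p \<Longrightarrow> reduced p \<Longrightarrow> last p = m \<Longrightarrow> dst z (hd p) + length p = Suc (dst z m) \<Longrightarrow>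
           Suc (dst y (hd p)) = dst y m + length p"
proof (induction "length p" arbitrary: p rule: less_induct)
  case less
  consider v where "p = [v]" | v u q where "p = v # u # q"
    using less.prems(1) unfolding is_path_def by (metis list.exhaust)
  then show ?case
  proof cases
    case 1
    then show ?thesis using less.prems by simp
  next
    case (2 v u q)
    have uq: "is_path (u # q)" "reduced (u # q)" "last (u # q) = m" "adj v u"
      using less.prems reduced_ConsD 2 by (auto simp: is_path_Cons)
    have V: "v \<in> V" "u \<in> V" using uq adj_in_V by blast+
    have dm: "dst m v = Suc (dst m u)" "dst m u = length q"
      using reduced_length[OF uq(1,2)] reduced_length[OF less.prems(1,2)] less.prems 2 uq by auto
    have dzv: "dst z v + dst m v = dst z m" using less.prems 2 dm by simp
    have "dst z m \<le> dst z u + dst m u" using dst_triangle[of z u m] dst_commute assms V by simp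
    then have dzu: "dst z u = Suc (dst z v)" using dst_adj[OF uq(4) assms(2)] dzv dm by simp
    have "Suc (dst y (hd (u # q))) = dst y m + length (u # q)"
      using uq 2 dzu less.prems by (intro less.hyps) auto
    then have dyu: "dst y u = dst y m + length q" by simp
    show ?thesis
    proof (rule ccontr)
      assume "\<not> ?thesis"
      then have dyv: "dst y u = Suc (dst y v)" using dst_adj_cases[OF uq(4) assms(1)] dyu 2 by simp
      show False
      proof (cases q)
        case Nil
        then show False using uq nc dyv dzu adj_sym by (metis last.simps lessI)
      next
        case (Cons w r)
        have wr: "is_path (w # r)" "reduced (w # r)" "last (w # r) = m" "adj u w"
          using uq reduced_ConsD Cons by (auto simp: is_path_Cons)
        have wV: "w \<in> V" using wr adj_in_V by blast
        have dmw: "dst m w = length r" using reduced_length[OF wr(1,2)] wr by simp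
        have "dst z m \<le> dst z w + dst m w" using dst_triangle[of z w m] dst_commute assms wV by simp
        then have dzw: "dst z w = Suc (dst z u)" using dst_adj[OF wr(4) assms(2)] dzv dzu dm dmw Cons by simp
        have "Suc (dst y (hd (w # r))) = dst y m + length (w # r)"
          using wr 2 dzu dzw less.prems Cons by (intro less.hyps) auto
        then have dyw: "dst y u = Suc (dst y w)" using dyu Cons by simp
        have "v \<noteq> w" using dzu dzw by auto
        then obtain x where x: "sq u v x w" "dst y v = Suc (dst y x)"
          using quadrangle[OF adj_sym[OF uq(4)] wr(4) _ assms(1)] dyv dyw by auto
        note e = sq_edges[OF x(1)]
        have xV: "x \<in> V" using e adj_in_V by blast
        have dzx: "dst z x = dst z u"
          using dst_adj_cases[OF e(2) assms(2)] dst_adj_cases[OF e(3) assms(2)] dzu dzw by arith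
        have pxw: "is_path (x # w # r)" using wr e is_path_Cons by blast
        have "dst z m \<le> dst z x + dst m x" using dst_triangle[of z x m] dst_commute assms xV by simp
        then have "dst m x = Suc (dst m w)" using dzx dzv dzu dm dmw Cons dst_adj[OF adj_sym[OF e(3)] assms(3)] by simp
        then have "reduced (x # w # r)"
          using pxw wr dmw by (intro shortest_reduced) auto
        then have "Suc (dst y (hd (x # w # r))) = dst y m + length (x # w # r)"
          using pxw wr 2 dzx dzu less.prems Cons by (intro less.hyps) auto
        then show False using x(2) dyv dyu Cons by simp
      qed
    qed
  qed
qed

text \<open>
  Either some neighbour of \<open>m\<close> is closer to both \<open>y\<close> and \<open>z\<close>, or \<open>m\<close> lies between them.
\<close>

lemma geodesic_or_common_descent:
  assumes "y \<in> V" "z \<in> V" "m \<in> V"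
    and "\<not> (\<exists>n. adj m n \<and> dst y n < dst y m \<and> dst z n < dst z m)"
  shows "dst y z = dst y m + dst m z"
proof -
  obtain p where p: "is_path p" "last p = m" "hd p = z" "length p = Suc (dst m z)"
    using shortest_path assms by metis
  moreover have "reduced p" using p by (intro shortest_reduced) auto
  ultimately show ?thesis using geodesic_or_common_descent_aux[OF assms, of p] dst_commute[OF assms(2,3)] by simp
qed

text \<open>The points of \<open>D\<close> that attain the circumradius of \<open>B\<close> relative to \<open>D\<close>.\<close>

definition centre :: "'v set \<Rightarrow> 'v set \<Rightarrow> 'v set" where
  "centre D B = {x \<in> D. \<exists>r. (\<forall>b\<in>B. dst x b \<le> r) \<and> (\<forall>y\<in>D. \<forall>s. (\<forall>b\<in>B. dst y b \<le> s) \<longrightarrow> r \<le> s)}"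

lemma centre_nonempty:
  assumes "o' \<in> D" "\<forall>b\<in>B. dst o' b \<le> n"
  shows "centre D B \<noteq> {}"
proof -
  define P where "P = (\<lambda>r. \<exists>x\<in>D. \<forall>b\<in>B. dst x b \<le> r)"
  have "P n" using assms P_def by blast
  then have "P (LEAST r. P r)" by (rule LeastI)
  then obtain x where "x \<in> D" "\<forall>b\<in>B. dst x b \<le> (LEAST r. P r)" unfolding P_def by blast
  moreover have "(LEAST r. P r) \<le> s" if "y \<in> D" "\<forall>b\<in>B. dst y b \<le> s" for y s
    using that by (intro Least_le) (auto simp: P_def)
  ultimately show ?thesis unfolding centre_def by blast
qed

text \<open>
  Choose \<open>m\<close> in \<open>D\<close> and \<open>k\<close> minimal such that infinitely many points of \<open>A\<close> have distance \<open>k\<close>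
  from \<open>m\<close>. For given \<open>b\<close>, one of them must be joined to \<open>b\<close> by a geodesic through \<open>m\<close>:
  otherwise each has, by \<open>geodesic_or_common_descent\<close>, a neighbour of \<open>m\<close> in the finite interval
  from \<open>m\<close> to \<open>b\<close> closer to it, and one such neighbour serves infinitely many points at distance
  \<open>k - 1\<close>.
\<close>

lemma infinite_bounded_dominated:
  assumes "A \<subseteq> D" "infinite A" "D \<subseteq> V" and conv: "\<And>x y. x \<in> D \<Longrightarrow> y \<in> D \<Longrightarrow> interval x y \<subseteq> D"
    and bdd: "o' \<in> D" "\<forall>a\<in>A. dst o' a \<le> n"
  obtains m where "m \<in> D" "\<And>b. b \<in> D \<Longrightarrow> \<exists>a\<in>A. dst b m < dst b a"
proof -
  define P where "P = (\<lambda>k. \<exists>m\<in>D. infinite {a \<in> A. dst m a = k})"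
  have "\<exists>k. P k"
  proof -
    have "\<exists>k\<in>{..n}. infinite {a \<in> A. dst o' a = k}"
    proof (rule ccontr)
      assume "\<not> ?thesis"
      then have "finite (\<Union>k\<in>{..n}. {a \<in> A. dst o' a = k})" by blast
      moreover have "A \<subseteq> (\<Union>k\<in>{..n}. {a \<in> A. dst o' a = k})" using bdd by auto
      ultimately show False using assms(2) finite_subset by blast
    qed
    then show ?thesis unfolding P_def using bdd by blast
  qed
  then have "P (LEAST k. P k)" by (metis LeastI)
  define k where "k = (LEAST k. P k)"
  obtain m where m: "m \<in> D" and inf: "infinite {a \<in> A. dst m a = k}"
    using \<open>P (LEAST k. P k)\<close> unfolding k_def P_def by blast
  have min: "\<not> P l" if "l < k" for l using that not_less_Least unfolding k_def by blast
  define A' where "A' = {a \<in> A. dst m a = k}"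
  have mV: "m \<in> V" using m assms by blast
  have k0: "0 < k"
  proof (rule ccontr)
    assume "\<not> 0 < k"
    then have "A' \<subseteq> {m}" using dst_eq_0[OF mV] assms(1,3) unfolding A'_def by auto
    then show False using inf unfolding A'_def by (metis finite.simps finite_subset)
  qed
  have "\<exists>a\<in>A. dst b m < dst b a" if b: "b \<in> D" for b
  proof -
    have bV: "b \<in> V" using b assms by blast
    have "\<exists>a\<in>A'. dst b a = dst b m + dst m a"
    proof (rule ccontr)
      assume no: "\<not> ?thesis"
      have "\<exists>n. adj m n \<and> n \<in> interval m b \<and> dst a m = Suc (dst a n)" if a: "a \<in> A'" for a
      proof -
        have aV: "a \<in> V" using a assms unfolding A'_def by blast
        obtain n where n: "adj m n" "dst b n < dst b m" "dst a n < dst a m"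
          using geodesic_or_common_descent[OF bV aV mV] no a by blast
        have nV: "n \<in> V" using n(1) adj_in_V by blast
        have "dst b m = Suc (dst b n)" "dst a m = Suc (dst a n)"
          using dst_adj_cases[OF n(1)] n aV bV by fastforce+
        moreover have "dst m n \<le> 1" using dst_adj[OF n(1) mV] by simp
        ultimately show ?thesis
          using dst_triangle[OF mV nV bV] dst_commute[OF bV mV] dst_commute[OF bV nV] n(1) nV
          unfolding interval_def by (intro exI[of _ n]) auto
      qed
      then obtain c where c: "\<And>a. a \<in> A' \<Longrightarrow> adj m (c a) \<and> c a \<in> interval m b \<and> dst a m = Suc (dst a (c a))"
        by metis
      have "finite (c ` A')" using finite_interval[OF mV bV] c by (meson finite_subset image_subsetI)
      moreover have "infinite A'" using inf unfolding A'_def .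
      ultimately obtain a0 where a0: "a0 \<in> A'" "infinite {a \<in> A'. c a = c a0}"
        using pigeonhole_infinite by blast
      let ?m = "c a0"
      have mm: "?m \<in> V" "?m \<in> D" using c[OF a0(1)] conv[OF m b] unfolding interval_def by auto
      have "{a \<in> A'. c a = ?m} \<subseteq> {a \<in> A. dst ?m a = k - 1}"
      proof safe
        fix a assume a: "a \<in> A'" "c a = ?m"
        then show "a \<in> A" unfolding A'_def by blast
        then have "a \<in> V" using assms by blast
        then show "dst ?m a = k - 1"
          using c[OF a(1)] a dst_commute[of a ?m] dst_commute[of a m] mm(1) mV unfolding A'_def by (simp, arith)
      qed
      then have "P (k - 1)" unfolding P_def using a0(2) mm finite_subset by blast
      then show False using min[of "k - 1"] k0 by simp
    qed
    then obtain a where "a \<in> A'" "dst b a = dst b m + dst m a" by blast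
    then show ?thesis using k0 unfolding A'_def by (intro bexI[of _ a]) auto
  qed
  then show thesis using that m by blast
qed

text \<open>
  If the centre were infinite, the point \<open>m\<close> of \<open>infinite_bounded_dominated\<close> would be closer to
  every point of \<open>B\<close> than the circumradius.
\<close>

theorem finite_centre:
  assumes D: "D \<subseteq> V" "\<And>x y. x \<in> D \<Longrightarrow> y \<in> D \<Longrightarrow> interval x y \<subseteq> D"
    and B: "B \<subseteq> D" "B \<noteq> {}"
  shows "finite (centre D B)"
proof (rule ccontr)
  assume inf: "infinite (centre D B)"
  obtain b0 where b0: "b0 \<in> B" using B by blast
  obtain x where x: "x \<in> centre D B" using inf by (metis ex_in_conv finite.emptyI)
  then obtain r where r: "\<forall>b\<in>B. dst x b \<le> r" "\<And>y s. y \<in> D \<Longrightarrow> \<forall>b\<in>B. dst y b \<le> s \<Longrightarrow> r \<le> s"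
    unfolding centre_def by blast
  have *: "\<forall>b\<in>B. dst y b \<le> r" if y: "y \<in> centre D B" for y
  proof -
    obtain s where s: "\<forall>b\<in>B. dst y b \<le> s" "\<And>z t. z \<in> D \<Longrightarrow> \<forall>b\<in>B. dst z b \<le> t \<Longrightarrow> s \<le> t"
      using y unfolding centre_def by blast
    have "s \<le> r" using s(2)[of x r] x r(1) unfolding centre_def by blast
    then show ?thesis using s(1) by (meson le_trans)
  qed
  have cD: "centre D B \<subseteq> D" unfolding centre_def by blast
  have "\<forall>a\<in>centre D B. dst b0 a \<le> r" using * b0 dst_commute cD B D by (metis subsetD)
  then obtain m where m: "m \<in> D" "\<And>b. b \<in> D \<Longrightarrow> \<exists>a\<in>centre D B. dst b m < dst b a"
    using infinite_bounded_dominated[OF cD inf D] b0 B by blast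
  have lt: "dst m b < r" if b: "b \<in> B" for b
  proof -
    obtain a where a: "a \<in> centre D B" "dst b m < dst b a" using m(2)[of b] b B by blast
    have "b \<in> V" "m \<in> V" "a \<in> V" using b a cD B D m by auto
    then have "dst m b = dst b m" "dst b a = dst a b" using dst_commute by auto
    moreover have "dst a b \<le> r" using * a b by blast
    ultimately show ?thesis using a by simp
  qed
  have "r > 0" using lt[OF b0] by simp
  have "\<forall>b\<in>B. dst m b \<le> r - 1"
  proof
    fix b assume "b \<in> B"
    from lt[OF this] show "dst m b \<le> r - 1" by simp
  qed
  then have "r \<le> r - 1" using r(2)[OF m(1)] by blast
  then show False using \<open>r > 0\<close> by simp
qed

text \<open>
  Halfspaces come in complementary pairs, so \<open>2 * dst x y\<close> of them separate \<open>x\<close> from \<open>y\<close> in one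
  of the two directions. Each contributes \<open>exp (- t / 2)\<close>.
\<close>

theorem exp_dist_pos:
  assumes c: "snd ` set c \<subseteq> V" and t: "0 \<le> t"
  shows "0 \<le> Re (kernel_form (\<lambda>x y. exp (- (t * real (dst x y)))) c c)"
proof -
  define P where "P = snd ` set c"
  define F where "F = (\<Union>x\<in>P. \<Union>y\<in>P. separators x y)"
  have PV: "P \<subseteq> V" using c P_def by simp
  have fin: "finite F" unfolding F_def using dst_eq_card_separators PV P_def by (intro finite_UN_I) auto
  have "exp (- (t * real (dst x y))) = cut_kernel (exp (- t / 2)) F x y" if xy: "x \<in> P" "y \<in> P" for x y
  proof -
    have V: "x \<in> V" "y \<in> V" using xy PV by auto
    have F: "{h \<in> F. (x \<in> h) \<noteq> (y \<in> h)} = separators x y \<union> separators y x"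
      using xy unfolding F_def separators_def by blast
    have "separators x y \<inter> separators y x = {}" unfolding separators_def by blast
    then have card: "card {h \<in> F. (x \<in> h) \<noteq> (y \<in> h)} = 2 * dst x y"
      unfolding F using dst_eq_card_separators[OF V] dst_eq_card_separators[OF V(2,1)] dst_commute[OF V]
      by (simp add: card_Un_disjoint)
    have "cut_kernel (exp (- t / 2)) F x y = (\<Prod>h\<in>{h \<in> F. (x \<in> h) \<noteq> (y \<in> h)}. exp (- t / 2))"
      unfolding cut_kernel_def by (subst prod.inter_filter[OF fin]) (intro prod.cong, auto)
    also have "\<dots> = exp (- t / 2) ^ (2 * dst x y)" using card by simp
    also have "\<dots> = exp (- (t * real (dst x y)))" by (simp flip: exp_of_nat_mult)
    finally show ?thesis by simp
  qed
  then have "kernel_form (\<lambda>x y. exp (- (t * real (dst x y)))) c c = kernel_form (cut_kernel (exp (- t / 2)) F) c c"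
    by (intro kernel_form_cong) (auto simp: P_def)
  then show ?thesis using cut_kernel_pos[OF fin, of "exp (- t / 2)" c] t by simp
qed

end

section \<open>The one-skeleton of a CAT(0) cube complex\<close>

definition square :: "'v set set \<Rightarrow> 'v \<Rightarrow> 'v \<Rightarrow> 'v \<Rightarrow> 'v \<Rightarrow> bool" where
  "square X a b c d \<longleftrightarrow> {a, b, c, d} \<in> X \<and> distinct [a, b, c, d] \<and>
     adj X a b \<and> adj X b c \<and> adj X c d \<and> adj X d a"

lemma adj_commute: "adj X u v \<longleftrightarrow> adj X v u"
  unfolding adj_def by (auto simp: insert_commute)

lemma cube_coordinates:
  assumes "cube_complex X" "c \<in> X"
  obtains n :: nat and f where "bij_betw f (Pow {..<n}) c"
    "{d \<in> X. d \<subseteq> c} = {f ` {A..B} |A B. A \<subseteq> B \<and> B \<subseteq> {..<n}}"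
  using bspec[OF conjunct1[OF assms(1)[unfolded cube_complex_def]] assms(2)] by (elim exE conjE)

lemma cube_card: assumes "cube_complex X" "c \<in> X" shows "\<exists>n. card c = 2 ^ n \<and> finite c"
proof -
  obtain n :: nat and f where f: "bij_betw f (Pow {..<n}) c" using cube_coordinates[OF assms] .
  have "card c = 2 ^ n" using bij_betw_same_card[OF f] by (simp add: card_Pow)
  moreover have "finite c" using bij_betw_finite[OF f] by simp
  ultimately show ?thesis by blast
qed

text \<open>
  Coordinates of a cube that put a prescribed vertex at the empty set, obtained from arbitrary
  ones by a symmetric difference.
\<close>

lemma chart:
  assumes X: "cube_complex X" and c: "c \<in> X" "b \<in> c"
  obtains n :: nat and F where "bij_betw F (Pow {..<n}) c" "F {} = b"
    "\<And>A J. A \<union> J \<subseteq> {..<n} \<Longrightarrow> A \<inter> J = {} \<Longrightarrow> F ` {A..A \<union> J} \<in> X"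
    "\<And>d. d \<in> X \<Longrightarrow> d \<subseteq> c \<Longrightarrow> b \<in> d \<Longrightarrow> \<exists>J\<subseteq>{..<n}. d = F ` Pow J"
proof -
  obtain n f where f: "bij_betw f (Pow {..<n::nat}) c"
    and faces: "{d \<in> X. d \<subseteq> c} = {f ` {A..B} |A B. A \<subseteq> B \<and> B \<subseteq> {..<n}}"
    using cube_coordinates[OF X c(1)] .
  obtain B where B: "B \<subseteq> {..<n}" "f B = b" using f c unfolding bij_betw_def by auto
  define s where "s = (\<lambda>S. (B - S) \<union> (S - B))"
  have ss: "s (s S) = S" for S unfolding s_def by blast
  have sn: "s S \<subseteq> {..<n}" if "S \<subseteq> {..<n}" for S using that B unfolding s_def by blast
  define F where "F = f \<circ> s"
  have "bij_betw s (Pow {..<n}) (Pow {..<n})"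
    by (rule bij_betw_byWitness[of _ s]) (auto simp: ss dest: sn)
  then have 1: "bij_betw F (Pow {..<n}) c" unfolding F_def using f by (rule bij_betw_trans)
  have 2: "F {} = b" unfolding F_def s_def using B by simp
  have 3: "F ` {A..A \<union> J} \<in> X" if "A \<union> J \<subseteq> {..<n}" "A \<inter> J = {}" for A J
  proof -
    have "s ` {A..A \<union> J} = {s A - J..s A \<union> J}"
    proof (intro equalityI subsetI)
      fix T assume "T \<in> {s A - J..s A \<union> J}"
      then have "s T \<in> {A..A \<union> J}" using that(2) unfolding s_def by auto
      then show "T \<in> s ` {A..A \<union> J}" using ss by (metis imageI)
    qed (use that(2) in \<open>auto simp: s_def\<close>)
    then have "F ` {A..A \<union> J} = f ` {s A - J..s A \<union> J}" unfolding F_def by (simp only: image_comp[symmetric])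
    moreover have "s A - J \<subseteq> s A \<union> J" "s A \<union> J \<subseteq> {..<n}" using that sn by auto
    ultimately have "F ` {A..A \<union> J} \<in> {d \<in> X. d \<subseteq> c}" unfolding faces by blast
    then show ?thesis by simp
  qed
  have 4: "\<exists>J\<subseteq>{..<n}. d = F ` Pow J" if d: "d \<in> X" "d \<subseteq> c" "b \<in> d" for d
  proof -
    have "d \<in> {d \<in> X. d \<subseteq> c}" using d by simp
    then have "d \<in> {f ` {A..B} |A B. A \<subseteq> B \<and> B \<subseteq> {..<n}}" unfolding faces .
    then obtain A C where AC: "d = f ` {A..C}" "A \<subseteq> C" "C \<subseteq> {..<n}" by blast
    obtain B' where "B' \<in> {A..C}" "f B' = f B" using d(3) AC(1) B by auto
    moreover have "B' \<in> Pow {..<n}" "B \<in> Pow {..<n}" using \<open>B' \<in> {A..C}\<close> AC B by auto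
    ultimately have "B' = B" using inj_onD[OF bij_betw_imp_inj_on[OF f]] by blast
    then have BAC: "A \<subseteq> B" "B \<subseteq> C" using \<open>B' \<in> {A..C}\<close> by auto
    have "s ` Pow (C - A) = {A..C}"
    proof (intro equalityI subsetI)
      fix T assume "T \<in> {A..C}"
      then have "s T \<in> Pow (C - A)" using BAC unfolding s_def by auto
      then show "T \<in> s ` Pow (C - A)" using ss by (metis imageI)
    qed (use BAC in \<open>auto simp: s_def\<close>)
    then have "d = F ` Pow (C - A)" unfolding F_def AC(1) by (simp only: image_comp[symmetric])
    moreover have "C - A \<subseteq> {..<n}" using AC(3) by blast
    ultimately show ?thesis by (intro exI[of _ "C - A"] conjI)
  qed
  show thesis by (rule that[OF 1 2 3 4])
qed

lemma edge_axis:
  assumes F: "bij_betw F (Pow {..<n::nat}) c" "F {} = b"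
    and faces: "\<And>d. d \<in> X \<Longrightarrow> d \<subseteq> c \<Longrightarrow> b \<in> d \<Longrightarrow> \<exists>J\<subseteq>{..<n}. d = F ` Pow J"
    and u: "u \<in> c" "b \<in> c" "adj X b u"
  shows "\<exists>i<n. u = F {i}"
proof -
  obtain J where J: "J \<subseteq> {..<n}" "{b, u} = F ` Pow J" using faces[of "{b, u}"] u unfolding adj_def by auto
  have "inj_on F (Pow J)" using F(1) J unfolding bij_betw_def by (auto intro: inj_on_subset)
  then have "card (F ` Pow J) = 2 ^ card J" using J(1) finite_subset by (simp add: card_image card_Pow finite_subset)
  moreover have "card {b, u} = 2" using u unfolding adj_def by auto
  ultimately have "card J = 1" using J(2) power_inject_exp[of "2::nat" "card J" 1] by simp
  then obtain i where "J = {i}" by (auto simp: card_1_singleton_iff)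
  then have "{b, u} = {F {}, F {i}}" "i < n" using J by (auto simp: Pow_insert)
  then show ?thesis using F(2) u unfolding adj_def by (auto simp: doubleton_eq_iff)
qed

lemma square_rotate: "square X a b c d \<Longrightarrow> square X b c d a"
  unfolding square_def by (auto simp: insert_commute)

lemma square_reflect: "square X a b c d \<Longrightarrow> square X a d c b"
  unfolding square_def by (auto simp: insert_commute adj_commute)

text \<open>Otherwise the two squares would meet in three vertices, not a power of two.\<close>

lemma square_unique:
  assumes X: "cube_complex X" and s: "square X a b c d" "square X a b c' d" shows "c = c'"
proof (rule ccontr)
  assume "c \<noteq> c'"
  then have "{a, b, c, d} \<inter> {a, b, c', d} = {a, b, d}" using s unfolding square_def by auto
  moreover have "{a, b, c, d} \<inter> {a, b, c', d} \<in> X"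
    using bspec[OF bspec[OF conjunct2[OF X[unfolded cube_complex_def]]], of "{a, b, c, d}" "{a, b, c', d}"] s
    unfolding square_def by auto
  ultimately obtain n where "card {a, b, d} = 2 ^ n" using cube_card[OF X] by metis
  moreover have "card {a, b, d} = 3" using s unfolding square_def by auto
  ultimately have "(2::nat) ^ n = 3" by simp
  then show False by (cases n) (auto, presburger)
qed

text \<open>A square has two axes, so only two of its vertices are adjacent to \<open>a\<close>.\<close>

lemma square_diagonal:
  assumes X: "cube_complex X" and s: "square X a b c d" shows "\<not> adj X a c"
proof
  assume ac: "adj X a c"
  let ?Q = "{a, b, c, d}"
  have Q: "?Q \<in> X" "a \<in> ?Q" "card ?Q = 4" using s unfolding square_def by auto
  obtain n :: nat and F where F: "bij_betw F (Pow {..<n}) ?Q" "F {} = a"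
    "\<And>d. d \<in> X \<Longrightarrow> d \<subseteq> ?Q \<Longrightarrow> a \<in> d \<Longrightarrow> \<exists>J\<subseteq>{..<n}. d = F ` Pow J"
    using chart[OF X Q(1,2)] by metis
  have "2 ^ n = (2::nat) ^ 2" using bij_betw_same_card[OF F(1)] Q by (simp add: card_Pow)
  then have n: "n = 2" by (rule power_inject_exp[THEN iffD1, rotated]) simp
  have edge: "\<exists>i<n. u = F {i}" if "u \<in> ?Q" "adj X a u" for u
    by (rule edge_axis[where X = X, OF F(1,2)]) (use F(3) Q that in blast)+
  have "adj X a b" "adj X a d" using s adj_commute[of X a d] unfolding square_def by auto
  then obtain i j k where "i < 2" "b = F {i}" "j < 2" "c = F {j}" "k < 2" "d = F {k}"
    using edge[of b] edge[of c] edge[of d] ac n by auto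
  moreover from this have "i \<noteq> j" "i \<noteq> k" "j \<noteq> k" using s unfolding square_def by auto
  ultimately show False by linarith
qed

lemma square_in_link:
  assumes "cube_complex X" "square X b v a x" shows "{v, x} \<in> link X b"
proof -
  have "{u \<in> {b, v, a, x}. adj X b u} = {v, x}"
    using square_diagonal[OF assms] assms(2) adj_commute[of X b x] unfolding square_def adj_def by auto
  then show ?thesis using assms(2) unfolding link_def square_def by blast
qed

lemma edge_in_link: assumes "adj X b v" shows "{v} \<in> link X b"
proof -
  have "{u \<in> {b, v}. adj X b u} = {v}" using assms unfolding adj_def by auto
  then show ?thesis using assms unfolding link_def adj_def by blast
qed

text \<open>
  The vertices \<open>v\<close>, \<open>x\<close>, \<open>y\<close> are pairwise joined in the link of \<open>b\<close>, which is a flag complex.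
  They therefore lie on a common cube, in whose coordinates everything is explicit.
\<close>

lemma three_cube:
  assumes X: "cube_complex X" and flag: "flag_complex (link X b)"
    and s: "square X b v a x" "square X b v c y" "square X b y w x"
  shows "\<exists>t. square X v a t c \<and> square X a x w t \<and> square X c y w t"
proof -
  have adj: "adj X b v" "adj X b x" "adj X b y" using s adj_commute[of X b x] unfolding square_def by auto
  have dist: "v \<noteq> x" "v \<noteq> y" "x \<noteq> y" "b \<noteq> v" "b \<noteq> x" "b \<noteq> y" using s unfolding square_def by auto
  have l: "{v, x} \<in> link X b" "{v, y} \<in> link X b" "{y, x} \<in> link X b" "{v} \<in> link X b" "{x} \<in> link X b" "{y} \<in> link X b"
    using square_in_link[OF X s(1)] square_in_link[OF X s(2)] square_in_link[OF X s(3)]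
      edge_in_link[OF adj(1)] edge_in_link[OF adj(2)] edge_in_link[OF adj(3)] by auto
  then have "{v, x, y} \<subseteq> \<Union>(link X b)" by blast
  moreover have "\<forall>p\<in>{v, x, y}. \<forall>q\<in>{v, x, y}. {p, q} \<in> link X b"
    using l by (auto simp: insert_commute)
  ultimately have "{v, x, y} \<in> link X b"
    using flag[unfolded flag_complex_def, THEN spec[of _ "{v, x, y}"]] by simp
  then obtain K where K: "K \<in> X" "b \<in> K" "{u \<in> K. adj X b u} = {v, x, y}" unfolding link_def by auto
  obtain n :: nat and F where F: "bij_betw F (Pow {..<n}) K" "F {} = b"
    "\<And>A J. A \<union> J \<subseteq> {..<n} \<Longrightarrow> A \<inter> J = {} \<Longrightarrow> F ` {A..A \<union> J} \<in> X"
    "\<And>d. d \<in> X \<Longrightarrow> d \<subseteq> K \<Longrightarrow> b \<in> d \<Longrightarrow> \<exists>J\<subseteq>{..<n}. d = F ` Pow J"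
    using chart[OF X K(1,2)] by metis
  have inj: "F S = F S' \<longleftrightarrow> S = S'" if "S \<subseteq> {..<n}" "S' \<subseteq> {..<n}" for S S'
    using that F(1) unfolding bij_betw_def inj_on_def by blast
  have edge: "\<exists>i<n. u = F {i}" if "u \<in> {v, x, y}" for u
    by (rule edge_axis[where X = X, OF F(1,2)]) (use F(4) that K in blast)+
  obtain i j k where ijk: "i < n" "v = F {i}" "j < n" "x = F {j}" "k < n" "y = F {k}"
    using edge[of v] edge[of x] edge[of y] by auto
  have ne: "i \<noteq> j" "i \<noteq> k" "j \<noteq> k" using dist ijk by auto
  have adjF: "adj X (F A) (F (insert p A))" if "insert p A \<subseteq> {..<n}" "p \<notin> A" for A p
  proof -
    have "{A..A \<union> {p}} = {A, insert p A}" by auto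
    then have "{F A, F (insert p A)} \<in> X" using F(3)[of A "{p}"] that by auto
    moreover have "F A \<noteq> F (insert p A)" using inj[of A "insert p A"] that by auto
    ultimately show ?thesis unfolding adj_def by simp
  qed
  have sqF: "square X (F A) (F (insert p A)) (F (insert p (insert q A))) (F (insert q A))"
    if A: "insert p (insert q A) \<subseteq> {..<n}" "p \<notin> A" "q \<notin> A" "p \<noteq> q" for A p q
  proof -
    have "{A..A \<union> {p, q}} = {A, insert p A, insert p (insert q A), insert q A}" by auto
    then have "{F A, F (insert p A), F (insert p (insert q A)), F (insert q A)} \<in> X" using F(3)[of A "{p, q}"] A by auto
    moreover have "distinct [F A, F (insert p A), F (insert p (insert q A)), F (insert q A)]"
    proof -
      have "distinct (map F [A, insert p A, insert p (insert q A), insert q A])"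
        unfolding distinct_map
      proof
        show "distinct [A, insert p A, insert p (insert q A), insert q A]" using A by auto
        show "inj_on F (set [A, insert p A, insert p (insert q A), insert q A])"
          by (rule inj_on_subset[OF bij_betw_imp_inj_on[OF F(1)]]) (use A in auto)
      qed
      then show ?thesis by simp
    qed
    moreover have "adj X (F (insert p A)) (F (insert p (insert q A)))"
      using adjF[of q "insert p A"] A by (auto simp: insert_commute)
    ultimately show ?thesis unfolding square_def using A adjF[of p A] adjF[of q A] adjF[of p "insert q A"]
      adj_commute[of X "F (insert p (insert q A))" "F (insert q A)"] adj_commute[of X "F (insert q A)" "F A"] by auto
  qed
  have a: "a = F {i, j}" using square_unique[OF X s(1)] sqF[of i j "{}"] ijk ne F(2) by auto
  have c: "c = F {i, k}" using square_unique[OF X s(2)] sqF[of i k "{}"] ijk ne F(2) by auto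
  have w: "w = F {k, j}" using square_unique[OF X s(3)] sqF[of k j "{}"] ijk ne F(2) by auto
  have "square X v a (F {i, j, k}) c" using sqF[of j k "{i}"] ijk ne a c by (auto simp: insert_commute)
  moreover have "square X x a (F {i, j, k}) w" using sqF[of i k "{j}"] ijk ne a w by (auto simp: insert_commute)
  moreover have "square X y c (F {i, j, k}) w" using sqF[of i j "{k}"] ijk ne c w by (auto simp: insert_commute)
  ultimately show ?thesis using square_rotate square_reflect by metis
qed

theorem cat0_square_graph:
  assumes "cat0_cube_complex X"
  shows "simply_connected_square_graph (adj X) (square X) (vertices X)"
proof -
  have X: "cube_complex X" "simply_connected_complex X" "\<And>v. v \<in> vertices X \<Longrightarrow> flag_complex (link X v)"
    using assms unfolding cat0_cube_complex_def by auto
  interpret square_graph "adj X" "square X"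
  proof
    show "adj X u v \<Longrightarrow> adj X v u" for u v by (simp add: adj_commute)
    show "\<not> adj X v v" for v by (simp add: adj_def)
    show "square X a b c d \<Longrightarrow> adj X a b" for a b c d by (simp add: square_def)
    show "square X a b c d \<Longrightarrow> a \<noteq> c" for a b c d by (simp add: square_def)
    fix b v a x c y w
    assume s: "square X b v a x" "square X b v c y" "square X b y w x"
    then have "b \<in> vertices X" unfolding square_def by blast
    then show "\<exists>t. square X v a t c \<and> square X a x w t \<and> square X c y w t"
      using three_cube[OF X(1) X(3) s] by blast
  qed (erule square_rotate, erule square_reflect, erule (1) square_unique[OF X(1)])
  show ?thesis
  proof
    show "adj X u v \<Longrightarrow> u \<in> vertices X" for u v unfolding adj_def by blast
    show "\<exists>p. successively (adj X) p \<and> p \<noteq> [] \<and> hd p = u \<and> last p = v"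
      if "u \<in> vertices X" "v \<in> vertices X" for u v
      using X(2) that unfolding simply_connected_complex_def edge_path_def by blast
    fix p assume p: "successively (adj X) p" "p \<noteq> []" "set p \<subseteq> vertices X" "hd p = last p"
    then have "equivclp (elem_homotopy X) p [hd p]"
      using X(2) unfolding simply_connected_complex_def edge_path_def by blast
    moreover have hom: "elem_homotopy X l l' \<Longrightarrow> elem_hom l l'" for l l'
    proof (induction rule: elem_homotopy.induct)
      case (square a b c d p q)
      then have "square X a b c d" using adj_commute[of X c d] adj_commute[of X d a] unfolding square_def by auto
      then show ?case by (rule eh_square)
    qed (rule eh_back)
    moreover have "symclp (elem_homotopy X) \<le> symclp elem_hom" using hom by (auto simp: symclp_def)
    ultimately show "equivclp elem_hom p [hd p]"
      unfolding equivclp_def by (meson predicate2D rtranclp_mono)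
  qed
qed

lemma gdist_eq_dst:
  assumes "cat0_cube_complex X" shows "square_graph.dst (adj X) = gdist X"
proof -
  interpret simply_connected_square_graph "adj X" "square X" "vertices X" using assms by (rule cat0_square_graph)
  show ?thesis by (intro ext) (simp add: dst_def gdist_def)
qed

section \<open>Borel maps into discrete spaces\<close>

abbreviation init :: "(nat \<Rightarrow> 'b) \<Rightarrow> nat \<Rightarrow> 'b list" where
  "init y j \<equiv> map y [0..<j]"

lemma init_Suc: "init y (Suc j) = init y j @ [y j]"
  by simp

lemma init_Suc': "init y (Suc j) = y 0 # init (\<lambda>i. y (Suc i)) j"
  by (induction j) auto

lemma prefix_init: "j \<le> k \<Longrightarrow> prefix (init y j) (init y k)"
proof -
  assume "j \<le> k"
  then have "init y k = init y j @ map y [j..<k]" by (metis le_add_diff_inverse map_append upt_add_eq_append zero_le)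
  then show ?thesis by simp
qed

lemma prefix_chain_branch:
  assumes "\<And>k. prefix (u k) (u (Suc k))" "\<And>n. \<exists>k. n \<le> length (u k)"
  obtains y where "\<And>k. u k = init y (length (u k))"
proof -
  have mono: "prefix (u k) (u m)" if "k \<le> m" for k m
    using that by (induction rule: dec_induct) (use assms(1) prefix_order.trans in blast)+
  define y where "y = (\<lambda>i. u (LEAST k. Suc i \<le> length (u k)) ! i)"
  have "u k = init y (length (u k))" for k
  proof (rule nth_equalityI)
    fix i assume i: "i < length (u k)"
    let ?m = "LEAST k. Suc i \<le> length (u k)"
    have m: "Suc i \<le> length (u ?m)" using assms(2) by (rule LeastI_ex)
    have "?m \<le> k" using i by (intro Least_le) simp
    then have "prefix (u ?m) (u k)" by (rule mono)
    then have "u k ! i = u ?m ! i" using m by (metis Suc_le_eq nth_append prefix_def)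
    then show "u k ! i = init y (length (u k)) ! i" using i by (simp add: y_def)
  qed simp
  then show thesis using that by blast
qed

text \<open>
  A sieve splits \<open>A\<close> into countably many pieces, each of these again, and so on. The pieces may
  overlap.
\<close>

definition sieve :: "'a set \<Rightarrow> (nat list \<Rightarrow> 'a set) \<Rightarrow> bool" where
  "sieve A S \<longleftrightarrow> S [] = A \<and> (\<forall>s. S s = (\<Union>n. S (s @ [n])))"

text \<open>The sequence \<open>p\<close> eventually enters all the pieces on the branch \<open>y\<close>.\<close>

definition along :: "(nat list \<Rightarrow> 'a set) \<Rightarrow> (nat \<Rightarrow> nat) \<Rightarrow> (nat \<Rightarrow> 'a) \<Rightarrow> bool" where
  "along S y p \<longleftrightarrow> (\<forall>j. \<forall>\<^sub>F n in sequentially. p n \<in> S (init y j))"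

text \<open>
  The analytic sets: the branches of the sieve have the convergence property of a continuous
  image of the Baire space. In this form countable unions and intersections are combinations of
  sieves.
\<close>

definition souslin :: "'a topology \<Rightarrow> 'a set \<Rightarrow> bool" where
  "souslin T A \<longleftrightarrow> A \<subseteq> topspace T \<and>
     (\<exists>S. sieve A S \<and> (\<forall>y p. along S y p \<longrightarrow> (\<exists>l\<in>A. limitin T p l sequentially)))"

lemma sieve_Nil: "sieve A S \<Longrightarrow> S [] = A"
  unfolding sieve_def by blast

lemma sieve_mono: assumes "sieve A S" "prefix s t" shows "S t \<subseteq> S s"
proof -
  have "S (s @ r) \<subseteq> S s" for r
  proof (induction r rule: rev_induct)
    case (snoc n r)
    have "S ((s @ r) @ [n]) \<subseteq> S (s @ r)" using assms(1) unfolding sieve_def by blast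
    then show ?case using snoc by simp
  qed simp
  then show ?thesis using assms(2) by (auto simp: prefix_def)
qed

lemma sieve_branch:
  assumes "sieve A S" "p \<in> S s"
  obtains y where "init y (length s) = s" "\<And>j. p \<in> S (init y j)"
proof -
  have "\<exists>n. p \<in> S (t @ [n])" if "p \<in> S t" for t using assms(1) that unfolding sieve_def by blast
  then obtain c where c: "\<And>t. p \<in> S t \<Longrightarrow> p \<in> S (t @ [c t])" by metis
  define u where "u = rec_nat s (\<lambda>_ t. t @ [c t])"
  have u: "u 0 = s" "\<And>k. u (Suc k) = u k @ [c (u k)]" by (auto simp: u_def)
  have pu: "p \<in> S (u k)" for k by (induction k) (use assms(2) u c in auto)
  have len: "length (u k) = length s + k" for k by (induction k) (auto simp: u)
  obtain y where y: "\<And>k. u k = init y (length (u k))"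
    using prefix_chain_branch[of u] u len by (metis le_add2 prefixI)
  have "p \<in> S (init y j)" for j
  proof -
    have "init y (length (u j)) = u j" using y[of j] by simp
    moreover have "S (init y (length (u j))) \<subseteq> S (init y j)"
      by (rule sieve_mono[OF assms(1) prefix_init]) (simp add: len)
    ultimately show ?thesis using pu[of j] by auto
  qed
  moreover have "init y (length s) = s" using y[of 0] u by simp
  ultimately show thesis using that by blast
qed

text \<open>
  The pairing function interleaves countably many sequences into one; this extracts the \<open>i\<close>-th.
\<close>

definition thread :: "nat \<Rightarrow> nat list \<Rightarrow> nat list" where
  "thread i s = map (\<lambda>m. s ! m) (filter (\<lambda>m. fst (prod_decode m) = i) [0..<length s])"

lemma thread_snoc: "thread i (s @ [n]) = thread i s @ (if fst (prod_decode (length s)) = i then [n] else [])"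
proof -
  have "map (\<lambda>m. (s @ [n]) ! m) (filter (\<lambda>m. fst (prod_decode m) = i) [0..<length s])
      = map (\<lambda>m. s ! m) (filter (\<lambda>m. fst (prod_decode m) = i) [0..<length s])"
    by (intro map_cong) (auto simp: nth_append)
  then show ?thesis unfolding thread_def by simp
qed

lemma thread_Nil [simp]: "thread i [] = []"
  by (simp add: thread_def)

text \<open>A sieve of the intersection, refining the sieves \<open>S i\<close> in turn.\<close>

definition merge :: "(nat \<Rightarrow> nat list \<Rightarrow> 'a set) \<Rightarrow> nat list \<Rightarrow> 'a set" where
  "merge S s = (\<Inter>i. S i (thread i s))"

lemma sieve_merge:
  assumes "\<And>i. sieve (A i) (S i)" shows "sieve (\<Inter>i. A i) (merge S)"
  unfolding sieve_def
proof (intro conjI allI)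
  have "S i [] = A i" for i using assms unfolding sieve_def by blast
  then show "merge S [] = (\<Inter>i. A i)" by (simp add: merge_def)
  fix s :: "nat list"
  let ?i = "fst (prod_decode (length s))"
  have *: "p \<in> merge S (s @ [n]) \<longleftrightarrow> (\<forall>i. i \<noteq> ?i \<longrightarrow> p \<in> S i (thread i s)) \<and> p \<in> S ?i (thread ?i s @ [n])" for p n
    unfolding merge_def INT_iff thread_snoc by (auto split: if_splits)
  have "S ?i (thread ?i s) = (\<Union>n. S ?i (thread ?i s @ [n]))" using assms unfolding sieve_def by blast
  then have **: "p \<in> S ?i (thread ?i s) \<longleftrightarrow> (\<exists>n. p \<in> S ?i (thread ?i s @ [n]))" for p by blast
  have "p \<in> merge S s \<longleftrightarrow> (\<forall>i. i \<noteq> ?i \<longrightarrow> p \<in> S i (thread i s)) \<and> p \<in> S ?i (thread ?i s)" for p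
    by (simp add: merge_def) metis
  then have "p \<in> merge S s \<longleftrightarrow> (\<exists>n. p \<in> merge S (s @ [n]))" for p
    unfolding * ** by simp
  then show "merge S s = (\<Union>n. merge S (s @ [n]))" by blast
qed

lemma thread_unbounded: "\<exists>k. n \<le> length (thread i (init y k))"
proof (induction n)
  case (Suc n)
  then obtain k where k: "n \<le> length (thread i (init y k))" by blast
  let ?m = "prod_encode (i, k)"
  have le: "k \<le> ?m" by (rule le_prod_encode_2)
  have "prefix (thread i (init y k)) (thread i (init y m))" if "k \<le> m" for m
    using that
  proof (induction rule: dec_induct)
    case (step m)
    then show ?case unfolding init_Suc thread_snoc by (auto intro: prefix_prefix)
  qed simp
  then have "n \<le> length (thread i (init y ?m))" using le k by (meson le_trans prefix_length_le)
  then have "Suc n \<le> length (thread i (init y (Suc ?m)))" unfolding init_Suc thread_snoc by simp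
  then show ?case by blast
qed simp

lemma thread_branch:
  obtains y' where "\<And>k. thread i (init y k) = init y' (length (thread i (init y k)))"
proof -
  have "prefix (thread i (init y k)) (thread i (init y (Suc k)))" for k
    unfolding init_Suc thread_snoc by simp
  then show thesis using prefix_chain_branch[of "\<lambda>k. thread i (init y k)"] thread_unbounded that by metis
qed

lemma along_merge:
  assumes "\<And>i. sieve (A i) (S i)" "along (merge S) y p"
  shows "\<exists>y'. along (S i) y' p"
proof -
  obtain y' where y': "\<And>k. thread i (init y k) = init y' (length (thread i (init y k)))"
    using thread_branch[of i y] by metis
  have "\<forall>\<^sub>F n in sequentially. p n \<in> S i (init y' j)" for j
  proof -
    obtain k where k: "j \<le> length (thread i (init y k))" using thread_unbounded by blast
    then have "S i (thread i (init y k)) \<subseteq> S i (init y' j)"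
      by (subst y') (rule sieve_mono[OF assms(1) prefix_init])
    then have "merge S (init y k) \<subseteq> S i (init y' j)" unfolding merge_def by blast
    moreover have "\<forall>\<^sub>F n in sequentially. p n \<in> merge S (init y k)"
      using assms(2) unfolding along_def by blast
    ultimately show ?thesis by (auto elim: eventually_mono)
  qed
  then show ?thesis unfolding along_def by blast
qed

definition branch_sieve :: "(nat \<Rightarrow> nat list \<Rightarrow> 'a set) \<Rightarrow> nat list \<Rightarrow> 'a set" where
  "branch_sieve S s = (case s of [] \<Rightarrow> \<Union>n. S n [] | n # t \<Rightarrow> S n t)"

lemma sieve_branch_sieve:
  assumes "\<And>i. sieve (A i) (S i)" shows "sieve (\<Union>i. A i) (branch_sieve S)"
  unfolding sieve_def
proof (intro conjI allI)
  have "S i [] = A i" for i using assms unfolding sieve_def by blast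
  then show "branch_sieve S [] = (\<Union>i. A i)" by (simp add: branch_sieve_def)
  show "branch_sieve S s = (\<Union>n. branch_sieve S (s @ [n]))" for s
  proof (cases s)
    case (Cons m t)
    have "S m t = (\<Union>n. S m (t @ [n]))" using assms unfolding sieve_def by blast
    then show ?thesis using Cons by (simp add: branch_sieve_def)
  qed (simp add: branch_sieve_def)
qed

lemma along_branch_sieve:
  assumes "along (branch_sieve S) y p" shows "along (S (y 0)) (\<lambda>i. y (Suc i)) p"
  unfolding along_def
proof
  fix j
  have "\<forall>\<^sub>F n in sequentially. p n \<in> branch_sieve S (init y (Suc j))" using assms unfolding along_def by blast
  then show "\<forall>\<^sub>F n in sequentially. p n \<in> S (y 0) (init (\<lambda>i. y (Suc i)) j)"
    unfolding init_Suc' branch_sieve_def by simp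
qed

lemma souslin_INT:
  assumes "Hausdorff_space T" "\<And>i::nat. souslin T (A i)" shows "souslin T (\<Inter>i. A i)"
proof -
  have "\<forall>i. \<exists>S. sieve (A i) S \<and> (\<forall>y p. along S y p \<longrightarrow> (\<exists>l\<in>A i. limitin T p l sequentially))"
    using assms(2) unfolding souslin_def by blast
  then obtain S where S: "\<And>i. sieve (A i) (S i)"
    "\<And>i y p. along (S i) y p \<Longrightarrow> \<exists>l\<in>A i. limitin T p l sequentially" by metis
  have "\<exists>l\<in>(\<Inter>i. A i). limitin T p l sequentially" if al: "along (merge S) y p" for y p
  proof -
    have "\<exists>l\<in>A i. limitin T p l sequentially" for i using along_merge[OF S(1) al] S(2) by blast
    then obtain l where l: "\<And>i. l i \<in> A i" "\<And>i. limitin T p (l i) sequentially" by metis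
    have "l i = l 0" for i using limitin_Hausdorff_unique[OF l(2) l(2) _ assms(1)] by simp
    then have "l 0 \<in> (\<Inter>i. A i)" using l(1) by (metis INT_I)
    then show ?thesis using l(2) by blast
  qed
  moreover have "(\<Inter>i. A i) \<subseteq> topspace T" using assms(2) unfolding souslin_def by blast
  moreover have "sieve (\<Inter>i. A i) (merge S)" using S(1) by (rule sieve_merge)
  ultimately show ?thesis unfolding souslin_def by blast
qed

lemma souslin_UN:
  assumes "\<And>i::nat. souslin T (A i)" shows "souslin T (\<Union>i. A i)"
proof -
  have "\<forall>i. \<exists>S. sieve (A i) S \<and> (\<forall>y p. along S y p \<longrightarrow> (\<exists>l\<in>A i. limitin T p l sequentially))"
    using assms unfolding souslin_def by blast
  then obtain S where S: "\<And>i. sieve (A i) (S i)"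
    "\<And>i y p. along (S i) y p \<Longrightarrow> \<exists>l\<in>A i. limitin T p l sequentially" by metis
  have "\<exists>l\<in>(\<Union>i. A i). limitin T p l sequentially" if al: "along (branch_sieve S) y p" for y p
    using S(2)[OF along_branch_sieve[OF al]] by blast
  moreover have "(\<Union>i. A i) \<subseteq> topspace T" using assms unfolding souslin_def by blast
  moreover have "sieve (\<Union>i. A i) (branch_sieve S)" using S(1) by (rule sieve_branch_sieve)
  ultimately show ?thesis unfolding souslin_def by blast
qed

lemma souslin_closedin:
  assumes "souslin T (topspace T)" "closedin T C" shows "souslin T C"
proof -
  obtain S where S: "sieve (topspace T) S"
    "\<And>y p. along S y p \<Longrightarrow> \<exists>l\<in>topspace T. limitin T p l sequentially"
    using assms(1) unfolding souslin_def by blast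
  have C: "C \<subseteq> topspace T" using assms(2) closedin_subset by blast
  then have "sieve C (\<lambda>s. S s \<inter> C)" using S(1) unfolding sieve_def by blast
  moreover have "\<exists>l\<in>C. limitin T p l sequentially" if al: "along (\<lambda>s. S s \<inter> C) y p" for y p
  proof -
    have "along S y p" using al unfolding along_def by (auto elim: eventually_mono)
    then obtain l where l: "limitin T p l sequentially" using S(2) by blast
    moreover have "\<forall>\<^sub>F n in sequentially. p n \<in> C" using al unfolding along_def by (auto elim: eventually_mono)
    ultimately have "l \<in> C" using assms(2) limitin_closedin trivial_limit_sequentially by metis
    then show ?thesis using l by blast
  qed
  ultimately show ?thesis using C unfolding souslin_def by blast
qed

lemma second_countable_base:
  assumes "second_countable T"
  obtains O' :: "nat \<Rightarrow> 'a set" where "\<And>n. openin T (O' n)"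
    "\<And>U x. openin T U \<Longrightarrow> x \<in> U \<Longrightarrow> \<exists>n. x \<in> O' n \<and> O' n \<subseteq> U"
proof -
  obtain \<B> where B: "countable \<B>" "\<forall>V\<in>\<B>. openin T V" "\<forall>U x. openin T U \<and> x \<in> U \<longrightarrow> (\<exists>V\<in>\<B>. x \<in> V \<and> V \<subseteq> U)"
    using assms unfolding second_countable_def by blast
  define O' where "O' = from_nat_into (insert {} \<B>)"
  have r: "range O' = insert {} \<B>" unfolding O'_def using B(1) by (simp add: range_from_nat_into)
  show thesis
  proof
    show "openin T (O' n)" for n using r B(2) by (metis insertE openin_empty rangeI)
    show "\<exists>n. x \<in> O' n \<and> O' n \<subseteq> U" if "openin T U" "x \<in> U" for U x
      using B(3) that r by (metis imageE insertCI)
  qed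
qed

lemma souslin_openin:
  assumes T: "souslin T (topspace T)" "regular_space T" "second_countable T" and U: "openin T U"
  shows "souslin T U"
proof -
  obtain O' :: "nat \<Rightarrow> 'a set" where O': "\<And>n. openin T (O' n)"
    "\<And>U x. openin T U \<Longrightarrow> x \<in> U \<Longrightarrow> \<exists>n. x \<in> O' n \<and> O' n \<subseteq> U"
    using second_countable_base T(3) by blast
  define C where "C = (\<lambda>n. if T closure_of O' n \<subseteq> U then T closure_of O' n else {})"
  have "souslin T (C n)" for n unfolding C_def by (intro souslin_closedin[OF T(1)]) auto
  then have "souslin T (\<Union>n. C n)" by (rule souslin_UN)
  moreover have "(\<Union>n. C n) = U"
  proof (intro equalityI subsetI)
    fix x assume x: "x \<in> U"
    then have "closedin T (topspace T - U)" "x \<in> topspace T - (topspace T - U)"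
      using U openin_subset by blast+
    then obtain V where V: "openin T V" "x \<in> V" "disjnt (topspace T - U) (T closure_of V)"
      using T(2) unfolding regular_space by blast
    obtain n where n: "x \<in> O' n" "O' n \<subseteq> V" using O'(2)[OF V(1,2)] by blast
    have "T closure_of O' n \<subseteq> T closure_of V" using n(2) by (rule closure_of_mono)
    moreover have "T closure_of V \<subseteq> topspace T" by (rule closure_of_subset_topspace)
    ultimately have "T closure_of O' n \<subseteq> U" using V(3) unfolding disjnt_iff by blast
    moreover have "x \<in> T closure_of O' n" using n(1) closure_of_subset[OF openin_subset[OF O'(1)]] by blast
    ultimately show "x \<in> (\<Union>n. C n)" unfolding C_def by auto
  qed (auto simp: C_def split: if_splits)
  ultimately show ?thesis by simp
qed

text \<open>The sets that are analytic together with their complements form a sigma algebra.\<close>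

lemma souslin_borel:
  assumes T: "souslin T (topspace T)" "Hausdorff_space T" "regular_space T" "second_countable T"
    and A: "A \<in> sigma_sets (topspace T) {U. openin T U}"
  shows "souslin T A \<and> souslin T (topspace T - A)"
  using A
proof (induction rule: sigma_sets.induct)
  case (Basic U)
  then show ?case using souslin_openin[OF T(1,3,4)] souslin_closedin[OF T(1)] by blast
next
  case Empty
  then show ?case using souslin_closedin[OF T(1), of "{}"] T(1) by simp
next
  case (Compl A)
  then show ?case by (metis double_diff souslin_def subset_refl)
next
  case (Union A)
  have "topspace T - (\<Union>i. A i) = (\<Inter>i. topspace T - A i)" by blast
  then show ?case using souslin_UN[of T A] souslin_INT[OF T(2), of "\<lambda>i. topspace T - A i"] Union by simp
qed

text \<open>
  Every analytic set is of this form for some code \<open>z\<close> (\<open>souslin_universal\<close>): \<open>z\<close> records which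
  basic open sets miss which pieces of a sieve.
\<close>

definition universal_souslin :: "'a topology \<Rightarrow> (nat \<Rightarrow> 'a set) \<Rightarrow> (nat \<Rightarrow> bool) \<Rightarrow> 'a set" where
  "universal_souslin T O' z =
     {l \<in> topspace T. \<exists>y. \<forall>j n. z (prod_encode (list_encode (init y j), n)) \<longrightarrow> l \<notin> O' n}"

lemma souslin_universal:
  assumes T: "Hausdorff_space T" and O': "\<And>n. openin T (O' n)"
    "\<And>U x. openin T U \<Longrightarrow> x \<in> U \<Longrightarrow> \<exists>n. x \<in> O' n \<and> O' n \<subseteq> U"
    and A: "souslin T A"
  obtains z where "A = universal_souslin T O' z"
proof -
  obtain S where S: "sieve A S"
    "\<And>y p. along S y p \<Longrightarrow> \<exists>l\<in>A. limitin T p l sequentially" and AT: "A \<subseteq> topspace T"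
    using A unfolding souslin_def by blast
  define z where "z = (\<lambda>k. case prod_decode k of (s, n) \<Rightarrow> O' n \<inter> S (list_decode s) = {})"
  have z: "z (prod_encode (list_encode s, n)) \<longleftrightarrow> O' n \<inter> S s = {}" for s n unfolding z_def by simp
  have "A = universal_souslin T O' z"
  proof (intro equalityI subsetI)
    fix l assume l: "l \<in> A"
    then obtain y where "\<And>j. l \<in> S (init y j)" using sieve_branch[OF S(1), of l "[]"] S(1) unfolding sieve_def by metis
    then show "l \<in> universal_souslin T O' z" using l AT unfolding universal_souslin_def z by blast
  next
    fix l assume "l \<in> universal_souslin T O' z"
    then obtain y where l: "l \<in> topspace T" "\<And>j n. l \<in> O' n \<Longrightarrow> O' n \<inter> S (init y j) \<noteq> {}"
      unfolding universal_souslin_def z by blast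
    define W where "W = (\<lambda>j. topspace T \<inter> (\<Inter>m\<in>{m. m \<le> j \<and> l \<in> O' m}. O' m))"
    have W: "openin T (W j)" "l \<in> W j" for j unfolding W_def using O'(1) l(1) by (auto intro!: openin_Int_Inter)
    have "\<exists>p. p \<in> W j \<and> p \<in> S (init y j)" for j using O'(2)[OF W] l(2) by blast
    then obtain p where p: "\<And>j. p j \<in> W j" "\<And>j. p j \<in> S (init y j)" by metis
    have "along S y p" unfolding along_def eventually_sequentially
      using p(2) sieve_mono[OF S(1) prefix_init] by blast
    then obtain l' where l': "l' \<in> A" "limitin T p l' sequentially" using S(2) by blast
    have "limitin T p l sequentially"
      unfolding limitin_def
    proof (intro conjI allI impI l(1))
      fix U assume "openin T U \<and> l \<in> U"
      then obtain m where m: "l \<in> O' m" "O' m \<subseteq> U" using O'(2) by blast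
      then have "p j \<in> U" if "j \<ge> m" for j using p(1)[of j] that unfolding W_def by blast
      then show "\<forall>\<^sub>F x in sequentially. p x \<in> U" unfolding eventually_sequentially by blast
    qed
    then have "l = l'" using limitin_Hausdorff_unique[OF _ l'(2) _ T] by simp
    then show "l \<in> A" using l' by simp
  qed
  then show thesis using that by blast
qed

text \<open>
  A sieve of the whole space along whose branches membership in each of countably many Borel
  sets is eventually decided, in agreement with the limit. It merges the sieves that first
  choose \<open>B i\<close> or its complement.
\<close>

lemma deciding_sieve:
  fixes B :: "nat \<Rightarrow> 'a set"
  assumes T: "souslin T (topspace T)" "Hausdorff_space T" "regular_space T" "second_countable T"
    and B: "\<And>i. B i \<in> sigma_sets (topspace T) {U. openin T U}"
  obtains D where "sieve (topspace T) D"
    "\<And>y p. along D y p \<Longrightarrow> \<exists>l\<in>topspace T. limitin T p l sequentially \<and>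
        (\<forall>i. if l \<in> B i then \<forall>\<^sub>F n in sequentially. p n \<in> B i else \<forall>\<^sub>F n in sequentially. p n \<notin> B i)"
    "\<And>y i. \<exists>j. D (init y j) \<subseteq> B i \<or> D (init y j) \<inter> B i = {}"
proof -
  define A where "A = (\<lambda>i n. if n = (0::nat) then B i else topspace T - B i)"
  have "souslin T (A i n)" for i n using souslin_borel[OF T B, of i] by (auto simp: A_def)
  then have "\<forall>i n. \<exists>S. sieve (A i n) S \<and> (\<forall>y p. along S y p \<longrightarrow> (\<exists>l\<in>A i n. limitin T p l sequentially))"
    unfolding souslin_def by blast
  then obtain R where R: "\<And>i n. sieve (A i n) (R i n)"
    "\<And>i n y p. along (R i n) y p \<Longrightarrow> \<exists>l\<in>A i n. limitin T p l sequentially" by metis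
  have BT: "B i \<subseteq> topspace T" for i using souslin_borel[OF T B, of i] unfolding souslin_def by blast
  have UA: "(\<Union>n. A i n) = topspace T" for i
  proof -
    have "A i 0 \<union> A i 1 = topspace T" using BT by (auto simp: A_def)
    moreover have "A i n \<subseteq> topspace T" for n using BT by (auto simp: A_def)
    ultimately show ?thesis by blast
  qed
  have sv: "sieve (topspace T) (branch_sieve (R i))" for i
    using sieve_branch_sieve[of "A i" "R i"] R(1) UA by metis
  define D where "D = merge (\<lambda>i. branch_sieve (R i))"
  have "sieve (topspace T) D" using sieve_merge[of "\<lambda>_. topspace T" "\<lambda>i. branch_sieve (R i)"] sv
    unfolding D_def by simp
  moreover have "\<exists>l\<in>topspace T. limitin T p l sequentially \<and>
        (\<forall>i. if l \<in> B i then \<forall>\<^sub>F n in sequentially. p n \<in> B i else \<forall>\<^sub>F n in sequentially. p n \<notin> B i)"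
    if al: "along D y p" for y p
  proof -
    have "\<exists>l\<in>topspace T. limitin T p l sequentially \<and>
        (if l \<in> B i then \<forall>\<^sub>F n in sequentially. p n \<in> B i else \<forall>\<^sub>F n in sequentially. p n \<notin> B i)" for i
    proof -
      obtain w where w: "along (branch_sieve (R i)) w p"
        using along_merge[of "\<lambda>_. topspace T" "\<lambda>i. branch_sieve (R i)" y p i] sv al unfolding D_def by blast
      obtain l where l: "l \<in> A i (w 0)" "limitin T p l sequentially"
        using R(2)[OF along_branch_sieve[OF w]] by blast
      have "R i (w 0) [] = A i (w 0)" using R(1) unfolding sieve_def by blast
      then have "\<forall>\<^sub>F n in sequentially. p n \<in> A i (w 0)"
        using w[unfolded along_def, THEN spec[of _ 1]] by (simp add: branch_sieve_def)
      then have "if l \<in> B i then \<forall>\<^sub>F n in sequentially. p n \<in> B i else \<forall>\<^sub>F n in sequentially. p n \<notin> B i"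
        using l(1) by (auto simp: A_def elim: eventually_mono split: if_splits)
      then show ?thesis using l limitin_topspace by metis
    qed
    then obtain l where l: "\<And>i. limitin T p (l i) sequentially"
      "\<And>i. if l i \<in> B i then \<forall>\<^sub>F n in sequentially. p n \<in> B i else \<forall>\<^sub>F n in sequentially. p n \<notin> B i"
      by metis
    have "l i = l 0" for i using limitin_Hausdorff_unique[OF l(1) l(1) _ T(2)] by simp
    then show ?thesis using l limitin_topspace by metis
  qed
  moreover have "\<exists>j. D (init y j) \<subseteq> B i \<or> D (init y j) \<inter> B i = {}" for y i
  proof -
    obtain k where "1 \<le> length (thread i (init y k))" using thread_unbounded by blast
    then obtain n t where nt: "thread i (init y k) = n # t" by (cases "thread i (init y k)") auto
    have "D (init y k) \<subseteq> branch_sieve (R i) (n # t)" unfolding D_def merge_def nt[symmetric] by blast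
    also have "\<dots> = R i n t" by (simp add: branch_sieve_def)
    also have "\<dots> \<subseteq> A i n" using sieve_mono[OF R(1) Nil_prefix, of i n t] sieve_Nil[OF R(1), of i n] by simp
    finally show ?thesis unfolding A_def by (intro exI[of _ k]) (auto split: if_splits)
  qed
  ultimately show thesis by (rule that)
qed

text \<open>
  If the range is uncountable, splitting pieces with uncountable image again and again gives a
  perfect tree and points \<open>c z\<close> with distinct images, one for each code \<open>z\<close>. Since every set of
  values has a Borel preimage, the diagonal set of those \<open>f (c z)\<close> for which \<open>c z\<close> is not in the
  analytic set coded by \<open>z\<close> has an analytic preimage. Its own code yields a contradiction.
\<close>

theorem countable_range_of_discrete_borel_map:
  fixes f :: "'a \<Rightarrow> 'b"
  assumes T: "souslin T (topspace T)" "Hausdorff_space T" "regular_space T" "second_countable T"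
    and f: "\<And>A. {p \<in> topspace T. f p \<in> A} \<in> sigma_sets (topspace T) {U. openin T U}"
  shows "countable (f ` topspace T)"
proof (rule ccontr)
  assume unc: "uncountable (f ` topspace T)"
  obtain O' :: "nat \<Rightarrow> 'a set" where O': "\<And>n. openin T (O' n)"
    "\<And>U x. openin T U \<Longrightarrow> x \<in> U \<Longrightarrow> \<exists>n. x \<in> O' n \<and> O' n \<subseteq> U"
    using second_countable_base T(4) by blast
  \<comment> \<open>Choosing preimages identifies the range with a set of points, so that countably many Borel
    sets \<open>B i\<close> separate the values of \<open>f\<close>.\<close>
  define q where "q = (\<lambda>y. SOME p. p \<in> topspace T \<and> f p = y)"
  have q: "q (f p) \<in> topspace T \<and> f (q (f p)) = f p" if "p \<in> topspace T" for p
    unfolding q_def by (rule someI[of _ p]) (use that in simp)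
  define B where "B = (\<lambda>i. {p \<in> topspace T. f p \<in> {y. q y \<in> O' i}})"
  have B: "B i \<in> sigma_sets (topspace T) {U. openin T U}" for i unfolding B_def by (rule f)
  have B_iff: "p \<in> B i \<longleftrightarrow> q (f p) \<in> O' i" if "p \<in> topspace T" for p i using that by (simp add: B_def)
  have sep: "\<exists>i. (p \<in> B i) \<noteq> (p' \<in> B i)" if p: "p \<in> topspace T" "p' \<in> topspace T" "f p \<noteq> f p'" for p p'
  proof -
    have ne: "q (f p) \<noteq> q (f p')" "q (f p) \<in> topspace T" "q (f p') \<in> topspace T" using q p by metis+
    then obtain U V where "openin T U" "openin T V" "q (f p) \<in> U" "q (f p') \<in> V" "disjnt U V"
      using T(2) unfolding Hausdorff_space_def by blast
    then obtain i where "q (f p) \<in> O' i" "q (f p') \<notin> O' i" using O'(2)[of U "q (f p)"] unfolding disjnt_iff by blast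
    then show ?thesis using B_iff p by blast
  qed
  obtain D where D: "sieve (topspace T) D"
    "\<And>y p. along D y p \<Longrightarrow> \<exists>l\<in>topspace T. limitin T p l sequentially \<and>
        (\<forall>i. if l \<in> B i then \<forall>\<^sub>F n in sequentially. p n \<in> B i else \<forall>\<^sub>F n in sequentially. p n \<notin> B i)"
    "\<And>y i. \<exists>j. D (init y j) \<subseteq> B i \<or> D (init y j) \<inter> B i = {}"
    using deciding_sieve[of T B, OF T B] by blast
  have DT: "D s \<subseteq> topspace T" for s using sieve_mono[OF D(1), of "[]" s] sieve_Nil[OF D(1)] by simp
  define big where "big = (\<lambda>s. uncountable (f ` D s))"
  have decide: "\<exists>t. prefix s t \<and> big t \<and> p \<in> D t \<and> (D t \<subseteq> B i \<or> D t \<inter> B i = {})"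
    if p: "p \<in> D s" "\<And>t. prefix s t \<Longrightarrow> p \<in> D t \<Longrightarrow> big t" for s p i
  proof -
    obtain y where y: "init y (length s) = s" "\<And>j. p \<in> D (init y j)" using sieve_branch[OF D(1) p(1)] by blast
    obtain j where j: "D (init y j) \<subseteq> B i \<or> D (init y j) \<inter> B i = {}" using D(3) by blast
    let ?t = "init y (max j (length s))"
    have "prefix s ?t" using prefix_init[of "length s" "max j (length s)" y] y(1) by simp
    moreover have "D ?t \<subseteq> D (init y j)" by (rule sieve_mono[OF D(1) prefix_init]) simp
    ultimately show ?thesis using y(2) p(2) j by blast
  qed
  have split: "\<exists>t. \<exists>i. (\<forall>b. prefix s (t b) \<and> big (t b)) \<and> D (t True) \<subseteq> B i \<and> D (t False) \<inter> B i = {}" if s: "big s" for s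
  proof -
    \<comment> \<open>Outside the countable set \<open>N\<close> of values of pieces that are not big, two different values
      are taken at points all of whose pieces below \<open>s\<close> are big.\<close>
    define N where "N = (\<Union>t\<in>{t. prefix s t \<and> \<not> big t}. f ` D t)"
    have "countable N" unfolding N_def by (rule countable_UN) (auto simp: big_def)
    then have unc: "uncountable (f ` D s - N)" using s unfolding big_def by (rule uncountable_minus_countable[rotated])
    then obtain v where v: "v \<in> f ` D s - N" by (metis countable_empty ex_in_conv)
    have "\<not> f ` D s - N \<subseteq> {v}" using unc countable_subset[of _ "{v}"] by auto
    then obtain v' where v': "v' \<in> f ` D s - N" "v \<noteq> v'" by blast
    obtain p p' where p: "p \<in> D s" "f p = v" "p' \<in> D s" "f p' = v'" using v v' by blast
    obtain i where i: "(p \<in> B i) \<noteq> (p' \<in> B i)" using sep[of p p'] p v' DT by blast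
    have b: "big t" if "prefix s t" "r \<in> D t" "f r \<notin> N" for r t
    proof (rule ccontr)
      assume "\<not> big t"
      then show False using that unfolding N_def by blast
    qed
    have fN: "f p \<notin> N" "f p' \<notin> N" using v v' p by auto
    obtain t where t: "prefix s t" "big t" "p \<in> D t" "D t \<subseteq> B i \<or> D t \<inter> B i = {}"
      using decide[OF p(1) b[OF _ _ fN(1)], of i] by blast
    obtain t' where t': "prefix s t'" "big t'" "p' \<in> D t'" "D t' \<subseteq> B i \<or> D t' \<inter> B i = {}"
      using decide[OF p(3) b[OF _ _ fN(2)], of i] by blast
    show ?thesis
    proof (cases "p \<in> B i")
      case True
      then have "D t \<subseteq> B i" "D t' \<inter> B i = {}" using t(3,4) t'(3,4) i by auto
      then show ?thesis using t t' by (intro exI[of _ "\<lambda>b. if b then t else t'"] exI[of _ i]) auto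
    next
      case False
      then have "D t' \<subseteq> B i" "D t \<inter> B i = {}" using t(3,4) t'(3,4) i by auto
      then show ?thesis using t t' by (intro exI[of _ "\<lambda>b. if b then t' else t"] exI[of _ i]) auto
    qed
  qed
  then have "\<forall>s. \<exists>t. big s \<longrightarrow> (\<exists>i. (\<forall>b. prefix s (t b) \<and> big (t b)) \<and> D (t True) \<subseteq> B i \<and> D (t False) \<inter> B i = {})"
    by blast
  then obtain t where t: "\<And>s. big s \<Longrightarrow> \<exists>i. (\<forall>b. prefix s (t s b) \<and> big (t s b)) \<and> D (t s True) \<subseteq> B i \<and> D (t s False) \<inter> B i = {}"
    by (metis (no_types))
  have ne: "D s \<noteq> {}" if "big s" for s using that unfolding big_def by auto
  have longer: "length s < length (t s b)" if s: "big s" for s b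
  proof -
    obtain i where i: "\<And>b. prefix s (t s b)" "\<And>b. big (t s b)" "D (t s True) \<subseteq> B i" "D (t s False) \<inter> B i = {}" using t[OF s] by blast
    have sub: "D (t s b) \<subseteq> D s" for b by (rule sieve_mono[OF D(1) i(1)])
    have "t s b \<noteq> s"
    proof
      assume "t s b = s"
      then show False using i(3,4) sub[of "\<not> b"] ne[OF i(2)[of "\<not> b"]] by (cases b) auto
    qed
    then show ?thesis using i(1)[of b] by (metis prefix_length_less prefix_order.less_le)
  qed
  define node where "node = (\<lambda>z :: nat \<Rightarrow> bool. rec_nat [] (\<lambda>k s. t s (z k)))"
  have node: "node z 0 = []" "node z (Suc k) = t (node z k) (z k)" for z k unfolding node_def by auto
  have "big []" using unc sieve_Nil[OF D(1)] unfolding big_def by simp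
  then have bign: "big (node z k)" for z k
  proof (induction k)
    case (Suc k)
    then show ?case using t[of "node z k"] unfolding node(2) by blast
  qed (simp add: node)
  have pre: "prefix (node z k) (node z (Suc k))" for z k using t[OF bign] node by metis
  have len: "k \<le> length (node z k)" for z k
  proof (induction k)
    case (Suc k)
    then show ?case using longer[OF bign, of z k "z k"] node(2) by simp
  qed simp
  have "\<exists>l. l \<in> topspace T \<and> (\<forall>i k. (D (node z k) \<subseteq> B i \<longrightarrow> l \<in> B i) \<and> (D (node z k) \<inter> B i = {} \<longrightarrow> l \<notin> B i))" for z
  proof -
    obtain y where y: "\<And>k. node z k = init y (length (node z k))"
      using prefix_chain_branch[of "node z"] pre len by metis
    have "\<forall>k. \<exists>p. p \<in> D (node z k)" using ne[OF bign] by blast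
    then obtain p where p: "\<And>k. p k \<in> D (node z k)" by metis
    have later: "p k \<in> D (init y j)" if "j \<le> k" for j k
    proof -
      have "D (init y (length (node z k))) \<subseteq> D (init y j)"
        by (rule sieve_mono[OF D(1) prefix_init]) (use that len[of k z] in simp)
      then show ?thesis using p[of k] y[of k] by auto
    qed
    then have "along D y p" unfolding along_def eventually_sequentially by blast
    then obtain l where l: "l \<in> topspace T"
        "\<And>i. if l \<in> B i then \<forall>\<^sub>F n in sequentially. p n \<in> B i else \<forall>\<^sub>F n in sequentially. p n \<notin> B i"
      using D(2) by blast
    have ev: "\<forall>\<^sub>F n in sequentially. p n \<in> D (node z k)" for k
      using later[of "length (node z k)"] y[of k] unfolding eventually_sequentially by metis
    have "(D (node z k) \<subseteq> B i \<longrightarrow> l \<in> B i) \<and> (D (node z k) \<inter> B i = {} \<longrightarrow> l \<notin> B i)" for i k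
    proof (intro conjI impI)
      assume "D (node z k) \<subseteq> B i"
      then have ev': "\<forall>\<^sub>F n in sequentially. p n \<in> B i" using ev[of k] by (auto elim: eventually_mono)
      show "l \<in> B i"
      proof (rule ccontr)
        assume "l \<notin> B i"
        then have "\<forall>\<^sub>F n in sequentially. p n \<notin> B i" using l(2)[of i] by simp
        then have "\<forall>\<^sub>F n in sequentially. False" using ev' by eventually_elim simp
        then show False by simp
      qed
    next
      assume "D (node z k) \<inter> B i = {}"
      then have ev': "\<forall>\<^sub>F n in sequentially. p n \<notin> B i" using ev[of k] by (auto elim: eventually_mono)
      show "l \<notin> B i"
      proof
        assume "l \<in> B i"
        then have "\<forall>\<^sub>F n in sequentially. p n \<in> B i" using l(2)[of i] by simp
        then have "\<forall>\<^sub>F n in sequentially. False" using ev' by eventually_elim simp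
        then show False by simp
      qed
    qed
    then show ?thesis using l by blast
  qed
  then obtain c where c: "\<And>z. c z \<in> topspace T" "\<And>z i k. D (node z k) \<subseteq> B i \<Longrightarrow> c z \<in> B i"
    "\<And>z i k. D (node z k) \<inter> B i = {} \<Longrightarrow> c z \<notin> B i" by metis
  have inj: "f (c z) \<noteq> f (c z')" if "z \<noteq> z'" for z z'
  proof -
    define k where "k = (LEAST k. z k \<noteq> z' k)"
    have "\<exists>k. z k \<noteq> z' k" using that by blast
    then have k: "z k \<noteq> z' k" unfolding k_def by (rule LeastI_ex)
    have "z j = z' j" if "j < k" for j using that not_less_Least unfolding k_def by blast
    then have "node z j = node z' j" if "j \<le> k" for j using that by (induction j) (auto simp: node)
    then have nk: "node z k = node z' k" by simp
    obtain i where i: "D (t (node z k) True) \<subseteq> B i" "D (t (node z k) False) \<inter> B i = {}" using t[OF bign] by blast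
    have "(c z \<in> B i) \<noteq> (c z' \<in> B i)"
      using c(2)[of z "Suc k" i] c(3)[of z "Suc k" i] c(2)[of z' "Suc k" i] c(3)[of z' "Suc k" i] i k nk
      by (cases "z k"; cases "z' k") (auto simp: node)
    then show ?thesis using B_iff c(1) by metis
  qed
  define A where "A = {f (c z) |z. c z \<notin> universal_souslin T O' z}"
  have "souslin T {p \<in> topspace T. f p \<in> A}" using souslin_borel[OF T f] by blast
  then obtain z0 where z0: "{p \<in> topspace T. f p \<in> A} = universal_souslin T O' z0"
    using souslin_universal[OF T(2) O'] by blast
  have "c z0 \<in> universal_souslin T O' z0 \<longleftrightarrow> f (c z0) \<in> A" using z0 c(1) by blast
  also have "\<dots> \<longleftrightarrow> c z0 \<notin> universal_souslin T O' z0"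
  proof
    assume "f (c z0) \<in> A"
    then obtain z where "f (c z0) = f (c z)" "c z \<notin> universal_souslin T O' z" unfolding A_def by auto
    then show "c z0 \<notin> universal_souslin T O' z0" using inj by metis
  qed (auto simp: A_def)
  finally show False by blast
qed

lemma souslin_completely_metrizable:
  assumes "completely_metrizable_space T" "second_countable T" shows "souslin T (topspace T)"
proof -
  obtain M d where M: "Metric_space M d" "Metric_space.mcomplete M d" "T = Metric_space.mtopology M d"
    using assms(1) unfolding completely_metrizable_space_def by blast
  interpret Metric_space M d by (rule M(1))
  obtain O' :: "nat \<Rightarrow> 'a set" where O': "\<And>n. openin T (O' n)"
    "\<And>U x. openin T U \<Longrightarrow> x \<in> U \<Longrightarrow> \<exists>n. x \<in> O' n \<and> O' n \<subseteq> U"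
    using second_countable_base assms(2) by blast
  define small where "small = (\<lambda>j n. \<exists>x. O' n \<subseteq> mball x (inverse (Suc j)))"
  define S where "S = (\<lambda>s. topspace T \<inter> (\<Inter>j\<in>{..<length s}. if small j (s ! j) then O' (s ! j) else {}))"
  have TM: "topspace T = M" using M(3) by simp
  have cov: "\<exists>n. small j n \<and> p \<in> O' n" if "p \<in> M" for p j
    using O'(2)[of "mball p (inverse (Suc j))" p] that M(3) unfolding small_def by auto
  have "sieve (topspace T) S"
    unfolding sieve_def
  proof (intro conjI allI)
    show "S [] = topspace T" unfolding S_def by simp
    fix s
    have "S (s @ [n]) = S s \<inter> (if small (length s) n then O' n else {})" for n
      unfolding S_def by (auto simp: nth_append lessThan_Suc split: if_splits)
    moreover have "S s \<subseteq> M" using TM unfolding S_def by blast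
    ultimately show "S s = (\<Union>n. S (s @ [n]))" using cov[of _ "length s"] by fastforce
  qed
  moreover have "\<exists>l\<in>topspace T. limitin T p l sequentially" if al: "along S y p" for y p
  proof -
    have "\<exists>N. p N \<in> M \<and> (\<forall>n\<ge>N. p n \<in> M \<and> small j (y j) \<and> p n \<in> O' (y j))" for j
    proof -
      have "S (init y (Suc j)) \<subseteq> (if small j (y j) then O' (y j) else {})" "S (init y (Suc j)) \<subseteq> M"
        unfolding S_def TM by (auto simp: nth_append simp del: upt_Suc split: if_splits)
      then have "x \<in> S (init y (Suc j)) \<longrightarrow> x \<in> M \<and> small j (y j) \<and> x \<in> O' (y j)" for x by (auto split: if_splits)
      moreover obtain N where "\<forall>n\<ge>N. p n \<in> S (init y (Suc j))"
        using al unfolding along_def eventually_sequentially by blast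
      ultimately show ?thesis by (intro exI[of _ N]) auto
    qed
    then obtain N where N: "\<And>j. p (N j) \<in> M" "\<And>j n. n \<ge> N j \<Longrightarrow> p n \<in> M \<and> small j (y j) \<and> p n \<in> O' (y j)" by metis
    define p' where "p' = (\<lambda>n. if n \<ge> N 0 then p n else p (N 0))"
    have p'M: "range p' \<subseteq> M" unfolding p'_def using N by auto
    have "MCauchy p'"
      unfolding MCauchy_def
    proof (intro conjI allI impI p'M)
      fix \<epsilon> :: real assume "\<epsilon> > 0"
      then obtain j where j: "inverse (Suc j) < \<epsilon> / 2" using reals_Archimedean[of "\<epsilon> / 2"] by auto
      have "d (p' m) (p' n) < \<epsilon>" if mn: "m \<ge> max (N 0) (N j)" "n \<ge> max (N 0) (N j)" for m n
      proof -
        obtain x where x: "O' (y j) \<subseteq> mball x (inverse (Suc j))" using N(2)[of j m] mn unfolding small_def by auto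
        have "p m \<in> O' (y j)" "p n \<in> O' (y j)" using N(2)[of j] mn by auto
        then have "p m \<in> mball x (inverse (Suc j))" "p n \<in> mball x (inverse (Suc j))" using x by blast+
        then have "d x (p m) < \<epsilon> / 2" "d x (p n) < \<epsilon> / 2" "x \<in> M" "p m \<in> M" "p n \<in> M" using j by auto
        moreover from this have "d (p m) (p n) \<le> d (p m) x + d x (p n)" by (intro triangle)
        ultimately have "d (p m) (p n) < \<epsilon>" using commute[of "p m" x] by simp
        then show ?thesis unfolding p'_def using mn by simp
      qed
      then show "\<exists>N. \<forall>n n'. N \<le> n \<longrightarrow> N \<le> n' \<longrightarrow> d (p' n) (p' n') < \<epsilon>" by blast
    qed
    then obtain l where "limitin mtopology p' l sequentially" using M(2) unfolding mcomplete_def by blast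
    then have l: "limitin T p' l sequentially" using M(3) by simp
    have "limitin T p l sequentially"
      by (rule limitin_transform_eventually[OF _ l]) (auto simp: p'_def eventually_sequentially intro!: exI[of _ "N 0"])
    then show ?thesis using limitin_topspace by metis
  qed
  ultimately show ?thesis unfolding souslin_def by blast
qed

text \<open>
  The first level of the sieve chooses a basic open set inside a compact set, and the later
  levels decide membership in each basic open set. Along a branch, compactness yields a limit.
\<close>

lemma souslin_locally_compact:
  assumes "locally_compact_space T" "Hausdorff_space T" "second_countable T" shows "souslin T (topspace T)"
proof -
  obtain O' :: "nat \<Rightarrow> 'a set" where O': "\<And>n. openin T (O' n)"
    "\<And>U x. openin T U \<Longrightarrow> x \<in> U \<Longrightarrow> \<exists>n. x \<in> O' n \<and> O' n \<subseteq> U"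
    using second_countable_base assms(3) by blast
  define piece where "piece = (\<lambda>j n. if j = 0 then (if \<exists>K. compactin T K \<and> O' n \<subseteq> K then O' n else {})
      else if n = 0 then topspace T \<inter> O' (j - 1) else topspace T - O' (j - 1))"
  define S where "S = (\<lambda>s. topspace T \<inter> (\<Inter>j\<in>{..<length s}. piece j (s ! j)))"
  have cov: "\<exists>n. p \<in> piece j n" if p: "p \<in> topspace T" for p j
  proof (cases "j = 0")
    case True
    obtain U K where "openin T U" "compactin T K" "p \<in> U" "U \<subseteq> K"
      using assms(1) p unfolding locally_compact_space_def by blast
    moreover then obtain n where "p \<in> O' n" "O' n \<subseteq> U" using O'(2) by blast
    ultimately have "p \<in> piece j n" using True unfolding piece_def by auto
    then show ?thesis by blast
  next
    case False
    then have "p \<in> piece j 0 \<or> p \<in> piece j 1" using p unfolding piece_def by auto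
    then show ?thesis by blast
  qed
  have "sieve (topspace T) S"
    unfolding sieve_def
  proof (intro conjI allI)
    show "S [] = topspace T" unfolding S_def by simp
    fix s
    have "S (s @ [n]) = S s \<inter> piece (length s) n" for n
      unfolding S_def by (auto simp: nth_append lessThan_Suc)
    moreover have "S s \<subseteq> topspace T" unfolding S_def by blast
    ultimately show "S s = (\<Union>n. S (s @ [n]))" using cov[of _ "length s"] by fastforce
  qed
  moreover have "\<exists>l\<in>topspace T. limitin T p l sequentially" if al: "along S y p" for y p
  proof -
    have ev: "\<forall>\<^sub>F n in sequentially. p n \<in> piece j (y j)" for j
    proof -
      have "S (init y (Suc j)) \<subseteq> piece j (y j)"
        unfolding S_def by (auto simp: nth_append simp del: upt_Suc)
      moreover have "\<forall>\<^sub>F n in sequentially. p n \<in> S (init y (Suc j))" using al unfolding along_def by blast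
      ultimately show ?thesis by (auto elim: eventually_mono)
    qed
    have dich: "(\<forall>\<^sub>F n in sequentially. p n \<in> O' i) \<or> (\<forall>\<^sub>F n in sequentially. p n \<notin> O' i)" for i
      using ev[of "Suc i"] unfolding piece_def by (auto simp: eventually_conj_iff split: if_splits)
    obtain K where K: "compactin T K" "\<forall>\<^sub>F n in sequentially. p n \<in> K"
    proof -
      have "\<exists>K. compactin T K \<and> O' (y 0) \<subseteq> K"
      proof (rule ccontr)
        assume "\<not> ?thesis"
        then have "piece 0 (y 0) = {}" unfolding piece_def by auto
        then show False using ev[of 0] by simp
      qed
      moreover from this have "piece 0 (y 0) = O' (y 0)" unfolding piece_def by auto
      then have "\<forall>\<^sub>F n in sequentially. p n \<in> O' (y 0)" using ev[of 0] by simp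
      ultimately obtain K where "compactin T K" "O' (y 0) \<subseteq> K" "\<forall>\<^sub>F n in sequentially. p n \<in> O' (y 0)" by blast
      moreover from this(2,3) have "\<forall>\<^sub>F n in sequentially. p n \<in> K" by (auto elim: eventually_mono)
      ultimately show ?thesis using that by blast
    qed
    have "\<exists>l\<in>K. \<forall>i. l \<in> O' i \<longrightarrow> (\<forall>\<^sub>F n in sequentially. p n \<in> O' i)"
    proof (rule ccontr)
      assume "\<not> ?thesis"
      then have "\<forall>l\<in>K. \<exists>i. l \<in> O' i \<and> (\<forall>\<^sub>F n in sequentially. p n \<notin> O' i)" using dich by metis
      then have "K \<subseteq> \<Union>{O' i |i. \<forall>\<^sub>F n in sequentially. p n \<notin> O' i}" by blast
      then obtain \<F> where F: "finite \<F>" "\<F> \<subseteq> {O' i |i. \<forall>\<^sub>F n in sequentially. p n \<notin> O' i}" "K \<subseteq> \<Union>\<F>"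
        using compactinD[OF K(1), of "{O' i |i. \<forall>\<^sub>F n in sequentially. p n \<notin> O' i}"] O'(1) by auto
      have "\<forall>\<^sub>F n in sequentially. \<forall>U\<in>\<F>. p n \<notin> U"
        using F(1,2) by (intro eventually_ball_finite) auto
      then have "\<forall>\<^sub>F n in sequentially. False" using K(2) by eventually_elim (use F(3) in blast)
      then show False by simp
    qed
    then obtain l where l: "l \<in> K" "\<And>i. l \<in> O' i \<Longrightarrow> \<forall>\<^sub>F n in sequentially. p n \<in> O' i" by blast
    have "l \<in> topspace T" using l(1) K(1) compactin_subset_topspace by blast
    moreover have "\<forall>\<^sub>F n in sequentially. p n \<in> U" if U: "openin T U" "l \<in> U" for U
    proof -
      obtain i where "l \<in> O' i" "O' i \<subseteq> U" using O'(2) U by blast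
      then show ?thesis using l(2)[of i] by (auto elim: eventually_mono)
    qed
    ultimately show ?thesis unfolding limitin_def by blast
  qed
  ultimately show ?thesis unfolding souslin_def by blast
qed

lemma souslin_prod_topology:
  assumes "souslin T1 (topspace T1)" "souslin T2 (topspace T2)"
  shows "souslin (prod_topology T1 T2) (topspace (prod_topology T1 T2))"
proof -
  obtain S1 where S1: "sieve (topspace T1) S1"
    "\<And>y p. along S1 y p \<Longrightarrow> \<exists>l\<in>topspace T1. limitin T1 p l sequentially" using assms(1) unfolding souslin_def by blast
  obtain S2 where S2: "sieve (topspace T2) S2"
    "\<And>y p. along S2 y p \<Longrightarrow> \<exists>l\<in>topspace T2. limitin T2 p l sequentially" using assms(2) unfolding souslin_def by blast
  define S where "S = (\<lambda>i::nat. \<lambda>s. if i = 0 then S1 s \<times> topspace T2 else topspace T1 \<times> S2 s)"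
  have S: "sieve (topspace T1 \<times> topspace T2) (S i)" for i
  proof -
    have 1: "S1 s = (\<Union>n. S1 (s @ [n]))" and 2: "S2 s = (\<Union>n. S2 (s @ [n]))" for s
      using S1(1) S2(1) unfolding sieve_def by blast+
    have 3: "S1 s \<times> topspace T2 = (\<Union>n. S1 (s @ [n]) \<times> topspace T2)" for s
      by (subst 1) auto
    have 4: "topspace T1 \<times> S2 s = (\<Union>n. topspace T1 \<times> S2 (s @ [n]))" for s
      by (subst 2) auto
    have "S i s = (\<Union>n. S i (s @ [n]))" for s
    proof (cases "i = 0")
      case True
      then have "S i = (\<lambda>s. S1 s \<times> topspace T2)" unfolding S_def by simp
      then show ?thesis by (simp only: 3[of s])
    next
      case False
      then have "S i = (\<lambda>s. topspace T1 \<times> S2 s)" unfolding S_def by simp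
      then show ?thesis by (simp only: 4[of s])
    qed
    moreover have "S i [] = topspace T1 \<times> topspace T2"
      using sieve_Nil[OF S1(1)] sieve_Nil[OF S2(1)] by (simp add: S_def)
    ultimately show ?thesis unfolding sieve_def by blast
  qed
  have "sieve (topspace (prod_topology T1 T2)) (merge S)"
    using sieve_merge[of "\<lambda>_. topspace T1 \<times> topspace T2" S] S by simp
  moreover have "\<exists>l\<in>topspace (prod_topology T1 T2). limitin (prod_topology T1 T2) p l sequentially"
    if al: "along (merge S) y p" for y p
  proof -
    obtain y0 where "along (S 0) y0 p" using along_merge[OF S al] by blast
    then have ev0: "\<forall>\<^sub>F n in sequentially. p n \<in> S 0 (init y0 j)" for j unfolding along_def by blast
    have "\<forall>\<^sub>F n in sequentially. fst (p n) \<in> S1 (init y0 j)" for j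
      by (rule eventually_mono[OF ev0[of j]]) (simp add: S_def mem_Times_iff)
    then have "along S1 y0 (fst \<circ> p)" unfolding along_def by simp
    then obtain l1 where l1: "limitin T1 (fst \<circ> p) l1 sequentially" using S1(2) by blast
    obtain y1 where "along (S 1) y1 p" using along_merge[OF S al] by blast
    then have ev1: "\<forall>\<^sub>F n in sequentially. p n \<in> S 1 (init y1 j)" for j unfolding along_def by blast
    have "\<forall>\<^sub>F n in sequentially. snd (p n) \<in> S2 (init y1 j)" for j
      by (rule eventually_mono[OF ev1[of j]]) (simp add: S_def mem_Times_iff)
    then have "along S2 y1 (snd \<circ> p)" unfolding along_def by simp
    then obtain l2 where l2: "limitin T2 (snd \<circ> p) l2 sequentially" using S2(2) by blast
    have "limitin (prod_topology T1 T2) p (l1, l2) sequentially" using l1 l2 by (simp add: limitin_pairwise)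
    then show ?thesis using limitin_topspace by metis
  qed
  ultimately show ?thesis unfolding souslin_def by blast
qed

section \<open>The Hilbert space of a positive kernel\<close>

locale pos_kernel =
  fixes A :: "'a set" and k :: "'a \<Rightarrow> 'a \<Rightarrow> real"
  assumes sym: "x \<in> A \<Longrightarrow> y \<in> A \<Longrightarrow> k x y = k y x"
    and pos: "snd ` set c \<subseteq> A \<Longrightarrow> 0 \<le> Re (kernel_form k c c)"
begin

abbreviation form :: "(complex \<times> 'a) list \<Rightarrow> (complex \<times> 'a) list \<Rightarrow> complex" where
  "form \<equiv> kernel_form k"

definition nrm :: "(complex \<times> 'a) list \<Rightarrow> real" where
  "nrm c = sqrt (Re (form c c))"

abbreviation comb :: "(complex \<times> 'a) list \<Rightarrow> bool" where
  "comb c \<equiv> snd ` set c \<subseteq> A"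

lemma form_cnj: "comb c \<Longrightarrow> comb d \<Longrightarrow> form d c = cnj (form c d)"
proof (induction c)
  case (Cons p c)
  have "form d [p] = cnj (form [p] d)" using Cons.prems
  proof (induction d)
    case (Cons r d)
    then have "form [r] [p] = cnj (form [p] [r])" using sym[of "snd p" "snd r"]
      by (cases p; cases r) (simp add: kernel_form_single)
    then show ?case using Cons kernel_form_Cons(1)[of k r d "[p]"] kernel_form_Cons(2)[of k "[p]" r d] by simp
  qed simp
  then show ?case using Cons kernel_form_Cons(2)[of k d p c] kernel_form_Cons(1)[of k p c d] by simp
qed simp

lemma form_self: "comb c \<Longrightarrow> form c c = of_real (Re (form c c))"
  using form_cnj[of c c] by (simp add: complex_eq_iff)

lemma nrm_nonneg [simp]: "comb c \<Longrightarrow> 0 \<le> nrm c"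
  unfolding nrm_def using pos by simp

lemma nrm_square: "comb c \<Longrightarrow> (nrm c)\<^sup>2 = Re (form c c)"
  unfolding nrm_def using pos by simp

lemma nrm_diff_square:
  assumes "comb c" "comb d"
  shows "Re (form (csub c (cscale (of_real s * form c d) d)) (csub c (cscale (of_real s * form c d) d)))
     = Re (form c c) - 2 * s * (cmod (form c d))\<^sup>2 + s\<^sup>2 * (cmod (form c d))\<^sup>2 * Re (form d d)"
  using form_self[OF assms(2)] unfolding kernel_form_csub kernel_form_cscale form_cnj[OF assms] cmod_power2
  by (simp add: power2_eq_square algebra_simps)

lemma cauchy_schwarz:
  assumes "comb c" "comb d" shows "cmod (form c d) \<le> nrm c * nrm d"
proof -
  define p q b where "p = Re (form c c)" and "q = Re (form d d)" and "b = (cmod (form c d))\<^sup>2"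
  have *: "0 \<le> p - 2 * s * b + s\<^sup>2 * b * q" for s
    using nrm_diff_square[OF assms, of s] pos[of "csub c (cscale (of_real s * form c d) d)"] assms
    unfolding p_def q_def b_def by simp
  have pq: "0 \<le> p" "0 \<le> q" "0 \<le> b" using pos assms unfolding p_def q_def b_def by auto
  have "b \<le> p * q"
  proof (cases "q = 0")
    case True
    have "b = 0"
    proof (rule ccontr)
      assume "b \<noteq> 0"
      then show False using *[of "(p + 1) / (2 * b)"] True by (simp add: field_simps)
    qed
    then show ?thesis using True by simp
  next
    case False
    then show ?thesis using *[of "1 / q"] pq by (simp add: field_simps power2_eq_square)
  qed
  then have "(cmod (form c d))\<^sup>2 \<le> (nrm c * nrm d)\<^sup>2"
    unfolding power_mult_distrib nrm_square[OF assms(1)] nrm_square[OF assms(2)] p_def q_def b_def .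
  then show ?thesis by (rule power2_le_imp_le) (use assms in simp)
qed

lemma nrm_append: assumes "comb c" "comb d" shows "nrm (c @ d) \<le> nrm c + nrm d"
proof -
  have "(nrm (c @ d))\<^sup>2 = Re (form c c) + 2 * Re (form c d) + Re (form d d)"
    using assms nrm_square[of "c @ d"] form_cnj[OF assms] by (simp add: image_Un)
  also have "\<dots> \<le> (nrm c)\<^sup>2 + 2 * (nrm c * nrm d) + (nrm d)\<^sup>2"
    using complex_Re_le_cmod[of "form c d"] cauchy_schwarz[OF assms] nrm_square assms by simp
  also have "\<dots> = (nrm c + nrm d)\<^sup>2" by (simp add: power2_eq_square algebra_simps)
  finally show ?thesis by (rule power2_le_imp_le) (use assms in simp)
qed

lemma nrm_cscale: "comb c \<Longrightarrow> nrm (cscale z c) = cmod z * nrm c"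
proof -
  assume c: "comb c"
  have "form (cscale z c) (cscale z c) = of_real ((cmod z)\<^sup>2 * Re (form c c))"
    using form_self[OF c] complex_norm_square[of z] by (simp add: algebra_simps)
  then show ?thesis unfolding nrm_def by (simp add: real_sqrt_mult)
qed

lemma nrm_cong: "form c c = form d d \<Longrightarrow> nrm c = nrm d"
  unfolding nrm_def by simp

lemma nrm_csub_commute: "nrm (csub c d) = nrm (csub d c)"
  by (rule nrm_cong) (simp add: algebra_simps)

lemma nrm_diff_le: assumes "comb a" "comb b" shows "\<bar>nrm a - nrm b\<bar> \<le> nrm (csub a b)"
proof -
  have *: "nrm a \<le> nrm (csub a b) + nrm b" if "comb a" "comb b" for a b
  proof -
    have "nrm a = nrm (csub a b @ b)" by (rule nrm_cong) (simp add: algebra_simps)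
    then show ?thesis using nrm_append[of "csub a b" b] that by simp
  qed
  show ?thesis using *[OF assms] *[OF assms(2,1)] nrm_csub_commute[of a b] by simp
qed

lemma form_diff_bound:
  assumes "comb c" "comb d" "comb c'" "comb d'"
  shows "cmod (form c d - form c' d') \<le> nrm (csub c c') * nrm d + nrm c' * nrm (csub d d')"
proof -
  have "form c d - form c' d' = form (csub c c') d + form c' (csub d d')" by simp
  then have "cmod (form c d - form c' d') \<le> cmod (form (csub c c') d) + cmod (form c' (csub d d'))"
    by (metis norm_triangle_ineq)
  also have "\<dots> \<le> nrm (csub c c') * nrm d + nrm c' * nrm (csub d d')"
    using assms by (intro add_mono cauchy_schwarz) auto
  finally show ?thesis .
qed

text \<open>
  The function on \<open>A\<close> that a combination represents in the reproducing kernel Hilbert space.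
\<close>

definition ev :: "(complex \<times> 'a) list \<Rightarrow> 'a \<Rightarrow> complex" where
  "ev c x = (if x \<in> A then form c [(1, x)] else 0)"

definition cauchy :: "(nat \<Rightarrow> (complex \<times> 'a) list) \<Rightarrow> bool" where
  "cauchy C \<longleftrightarrow> (\<forall>n. comb (C n)) \<and> (\<forall>e>0. \<exists>N. \<forall>m\<ge>N. \<forall>n\<ge>N. nrm (csub (C m) (C n)) < e)"

definition represents :: "(nat \<Rightarrow> (complex \<times> 'a) list) \<Rightarrow> ('a \<Rightarrow> complex) \<Rightarrow> bool" where
  "represents C u \<longleftrightarrow> cauchy C \<and> (\<forall>x. (\<lambda>n. ev (C n) x) \<longlonglongrightarrow> u x)"

text \<open>The completion, realised by pointwise limits of Cauchy sequences of combinations.\<close>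

definition hspace :: "('a \<Rightarrow> complex) set" where
  "hspace = {u. \<exists>C. represents C u}"

definition ip :: "('a \<Rightarrow> complex) \<Rightarrow> ('a \<Rightarrow> complex) \<Rightarrow> complex" where
  "ip u w = lim (\<lambda>n. form ((SOME C. represents C u) n) ((SOME C. represents C w) n))"

text \<open>
  Addition outside the space is defined through this map, so that the distance of any two
  functions, in the space or not, is symmetric and nonnegative.
\<close>

definition retract :: "('a \<Rightarrow> complex) \<Rightarrow> 'a \<Rightarrow> complex" where
  "retract u = (if u \<in> hspace then u else (\<lambda>x. 0))"

definition hilbert :: "(complex, 'a \<Rightarrow> complex) module" where
  "hilbert = \<lparr>carrier = hspace, mult = \<lambda>u w. undefined, one = undefined, zero = \<lambda>x. 0,
     add = \<lambda>u w x. retract u x + retract w x, smult = \<lambda>z u x. z * u x\<rparr>"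

lemma cauchy_nrm: assumes "cauchy C" shows "Bseq (\<lambda>n. nrm (C n))"
proof -
  have C: "comb (C n)" for n using assms unfolding cauchy_def by blast
  have "Cauchy (\<lambda>n. nrm (C n))"
    unfolding Cauchy_def dist_real_def
  proof (intro allI impI)
    fix e :: real assume "e > 0"
    then obtain N where "\<forall>m\<ge>N. \<forall>n\<ge>N. nrm (csub (C m) (C n)) < e" using assms unfolding cauchy_def by blast
    then show "\<exists>N. \<forall>m\<ge>N. \<forall>n\<ge>N. \<bar>nrm (C m) - nrm (C n)\<bar> < e"
      using nrm_diff_le[OF C C] by (meson le_less_trans)
  qed
  then show ?thesis by (simp add: Cauchy_Bseq)
qed

lemma form_convergent:
  assumes "cauchy C" "cauchy D" shows "convergent (\<lambda>n. form (C n) (D n))"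
proof -
  have C: "comb (C n)" "comb (D n)" for n using assms unfolding cauchy_def by blast+
  obtain K where K: "K > 0" "\<And>n. nrm (C n) \<le> K" using cauchy_nrm[OF assms(1)] C unfolding Bseq_def by auto
  obtain L where L: "L > 0" "\<And>n. nrm (D n) \<le> L" using cauchy_nrm[OF assms(2)] C unfolding Bseq_def by auto
  have "Cauchy (\<lambda>n. form (C n) (D n))"
    unfolding Cauchy_def dist_norm
  proof (intro allI impI)
    fix e :: real assume e: "e > 0"
    obtain M where M: "\<forall>m\<ge>M. \<forall>n\<ge>M. nrm (csub (C m) (C n)) < e / (2 * L)"
      using assms(1) e L unfolding cauchy_def by (metis divide_pos_pos mult_pos_pos zero_less_numeral)
    obtain N where N: "\<forall>m\<ge>N. \<forall>n\<ge>N. nrm (csub (D m) (D n)) < e / (2 * K)"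
      using assms(2) e K unfolding cauchy_def by (metis divide_pos_pos mult_pos_pos zero_less_numeral)
    have "norm (form (C m) (D m) - form (C n) (D n)) < e" if mn: "m \<ge> max M N" "n \<ge> max M N" for m n
    proof -
      have "norm (form (C m) (D m) - form (C n) (D n)) \<le> nrm (csub (C m) (C n)) * nrm (D m) + nrm (C n) * nrm (csub (D m) (D n))"
        by (rule form_diff_bound[OF C C])
      also have "\<dots> \<le> nrm (csub (C m) (C n)) * L + K * nrm (csub (D m) (D n))"
        using C K L by (intro add_mono mult_mono) auto
      also have "\<dots> < e / (2 * L) * L + K * (e / (2 * K))"
        using M N mn K L by (intro add_strict_mono mult_strict_right_mono mult_strict_left_mono) auto
      also have "\<dots> = e" using K L by (simp add: field_simps)
      finally show ?thesis .
    qed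
    then show "\<exists>M. \<forall>m\<ge>M. \<forall>n\<ge>M. norm (form (C m) (D m) - form (C n) (D n)) < e" by blast
  qed
  then show ?thesis by (simp add: Cauchy_convergent_iff)
qed

lemma comb_represents: "represents C u \<Longrightarrow> comb (C n)"
  unfolding represents_def cauchy_def by blast

lemma represents_add:
  assumes "represents C u" "represents D w" shows "represents (\<lambda>n. C n @ D n) (\<lambda>x. u x + w x)"
  unfolding represents_def cauchy_def
proof (intro conjI allI impI)
  have C: "comb (C n)" "comb (D n)" for n using assms comb_represents by blast+
  show "comb (C n @ D n)" for n using C by (simp add: image_Un)
  fix e :: real assume e: "e > 0"
  obtain M where M: "\<forall>m\<ge>M. \<forall>n\<ge>M. nrm (csub (C m) (C n)) < e / 2"
    using assms(1) e unfolding represents_def cauchy_def by (meson half_gt_zero)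
  obtain N where N: "\<forall>m\<ge>N. \<forall>n\<ge>N. nrm (csub (D m) (D n)) < e / 2"
    using assms(2) e unfolding represents_def cauchy_def by (meson half_gt_zero)
  have "nrm (csub (C m @ D m) (C n @ D n)) < e" if "m \<ge> max M N" "n \<ge> max M N" for m n
  proof -
    have "nrm (csub (C m @ D m) (C n @ D n)) = nrm (csub (C m) (C n) @ csub (D m) (D n))"
      by (rule nrm_cong) (simp add: algebra_simps)
    also have "\<dots> \<le> nrm (csub (C m) (C n)) + nrm (csub (D m) (D n))" using C by (intro nrm_append) auto
    also have "\<dots> < e" using M N that by (metis add_strict_mono field_sum_of_halves max.bounded_iff)
    finally show ?thesis .
  qed
  then show "\<exists>N. \<forall>m\<ge>N. \<forall>n\<ge>N. nrm (csub (C m @ D m) (C n @ D n)) < e" by blast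
next
  fix x
  have "ev (C n @ D n) x = ev (C n) x + ev (D n) x" for n by (simp add: ev_def)
  then show "(\<lambda>n. ev (C n @ D n) x) \<longlonglongrightarrow> u x + w x"
    using assms unfolding represents_def by (simp add: tendsto_add)
qed

lemma represents_scale:
  assumes "represents C u" shows "represents (\<lambda>n. cscale z (C n)) (\<lambda>x. z * u x)"
  unfolding represents_def cauchy_def
proof (intro conjI allI impI)
  have C: "comb (C n)" for n using assms comb_represents by blast
  show "comb (cscale z (C n))" for n using C by auto
  fix e :: real assume e: "e > 0"
  then have "e / (cmod z + 1) > 0" by (simp add: add_nonneg_pos)
  then obtain M where M: "\<forall>m\<ge>M. \<forall>n\<ge>M. nrm (csub (C m) (C n)) < e / (cmod z + 1)"
    using assms(1) unfolding represents_def cauchy_def by meson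
  have "nrm (csub (cscale z (C m)) (cscale z (C n))) < e" if "m \<ge> M" "n \<ge> M" for m n
  proof -
    have "nrm (csub (cscale z (C m)) (cscale z (C n))) = nrm (cscale z (csub (C m) (C n)))"
      by (rule nrm_cong) (simp add: algebra_simps)
    also have "\<dots> = cmod z * nrm (csub (C m) (C n))" using C by (intro nrm_cscale) auto
    also have "\<dots> \<le> (cmod z + 1) * nrm (csub (C m) (C n))" using C by (intro mult_right_mono) auto
    also have "\<dots> < e"
    proof -
      have "nrm (csub (C m) (C n)) < e / (cmod z + 1)" using M that by blast
      moreover have "cmod z + 1 > 0" by (simp add: add_nonneg_pos)
      ultimately show ?thesis by (simp add: pos_less_divide_eq mult.commute)
    qed
    finally show ?thesis .
  qed
  then show "\<exists>N. \<forall>m\<ge>N. \<forall>n\<ge>N. nrm (csub (cscale z (C m)) (cscale z (C n))) < e" by blast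
next
  fix x
  have "ev (cscale z (C n)) x = z * ev (C n) x" for n by (simp add: ev_def)
  then show "(\<lambda>n. ev (cscale z (C n)) x) \<longlonglongrightarrow> z * u x"
    using assms unfolding represents_def by (simp add: tendsto_mult_left)
qed

lemma represents_diff:
  assumes "represents C u" "represents D w" shows "represents (\<lambda>n. csub (C n) (D n)) (\<lambda>x. u x - w x)"
  using represents_add[OF assms(1) represents_scale[OF assms(2), of "-1"]] unfolding csub_def by simp

lemma represents_const: assumes "comb c" shows "represents (\<lambda>_. c) (ev c)"
proof -
  have "form (csub c c) (csub c c) = 0" by simp
  then have "nrm (csub c c) = 0" unfolding nrm_def by (metis real_sqrt_zero zero_complex.simps(1))
  then show ?thesis using assms unfolding represents_def cauchy_def by auto
qed

lemma form_fixed_tendsto: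
  assumes "represents C (\<lambda>x. 0)" "comb d" shows "(\<lambda>n. form (C n) d) \<longlonglongrightarrow> 0"
  using assms(2)
proof (induction d)
  case (Cons p d)
  have "(\<lambda>n. form (C n) [(1, snd p)]) \<longlonglongrightarrow> 0"
  proof -
    have "(\<lambda>n. ev (C n) (snd p)) \<longlonglongrightarrow> 0" using assms(1) unfolding represents_def by blast
    then show ?thesis using Cons.prems by (simp add: ev_def)
  qed
  then have "(\<lambda>n. cnj (fst p) * form (C n) [(1, snd p)] + form (C n) d) \<longlonglongrightarrow> cnj (fst p) * 0 + 0"
    using Cons by (intro tendsto_add tendsto_mult_left) auto
  moreover have "form (C n) (p # d) = cnj (fst p) * form (C n) [(1, snd p)] + form (C n) d" for n
    using kernel_form_Cons(2)[of k "C n" p d] kernel_form_scale_single(2)[of k "C n" "fst p" 1 "snd p"] by simp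
  ultimately show ?case by simp
qed simp

text \<open>
  A Cauchy sequence of combinations that tends to zero pointwise tends to zero in norm. So a
  function determines its vector, and the inner product is well defined.
\<close>

lemma nrm_null: assumes "represents C (\<lambda>x. 0)" shows "(\<lambda>n. nrm (C n)) \<longlonglongrightarrow> 0"
proof -
  have C: "comb (C n)" for n using assms comb_represents by blast
  obtain K where K: "K > 0" "\<And>n. nrm (C n) \<le> K"
    using cauchy_nrm[of C] assms C unfolding Bseq_def represents_def by auto
  have "(\<lambda>n. (nrm (C n))\<^sup>2) \<longlonglongrightarrow> 0"
  proof (rule LIMSEQ_I)
    fix e :: real assume e: "e > 0"
    obtain N where N: "\<forall>m\<ge>N. \<forall>n\<ge>N. nrm (csub (C m) (C n)) < e / (2 * K)"
      using assms e K unfolding represents_def cauchy_def by (metis divide_pos_pos mult_pos_pos zero_less_numeral)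
    obtain N' where N': "\<forall>n\<ge>N'. norm (form (C n) (C N)) < e / 2"
      using LIMSEQ_D[OF form_fixed_tendsto[OF assms C[of N]], of "e / 2"] e by auto
    have "norm ((nrm (C n))\<^sup>2 - 0) < e" if n: "n \<ge> max N N'" for n
    proof -
      have "(nrm (C n))\<^sup>2 = Re (form (C n) (csub (C n) (C N))) + Re (form (C n) (C N))"
        using nrm_square[OF C] by simp
      also have "\<dots> \<le> norm (form (C n) (csub (C n) (C N))) + norm (form (C n) (C N))"
        by (intro add_mono complex_Re_le_cmod)
      also have "\<dots> \<le> nrm (C n) * nrm (csub (C n) (C N)) + norm (form (C n) (C N))"
        using C by (intro add_mono cauchy_schwarz) auto
      also have "\<dots> \<le> K * nrm (csub (C n) (C N)) + norm (form (C n) (C N))"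
        using C K by (intro add_mono mult_right_mono) auto
      also have "\<dots> < K * (e / (2 * K)) + e / 2"
        using N N' n K by (intro add_strict_mono mult_strict_left_mono) auto
      also have "\<dots> = e" using K by simp
      finally show ?thesis by simp
    qed
    then show "\<exists>no. \<forall>n\<ge>no. norm ((nrm (C n))\<^sup>2 - 0) < e" by blast
  qed
  then have "(\<lambda>n. sqrt ((nrm (C n))\<^sup>2)) \<longlonglongrightarrow> sqrt 0" by (rule tendsto_real_sqrt)
  then show ?thesis using C by simp
qed

lemma ip_tendsto:
  assumes "represents C u" "represents D w" shows "(\<lambda>n. form (C n) (D n)) \<longlonglongrightarrow> ip u w"
proof -
  define C' D' where "C' = (SOME C. represents C u)" and "D' = (SOME C. represents C w)"
  have r: "represents C' u" "represents D' w"
    unfolding C'_def D'_def by (rule someI[of _ C], rule assms) (rule someI[of _ D], rule assms)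
  have cb: "comb (C n)" "comb (D n)" "comb (C' n)" "comb (D' n)" for n using assms r comb_represents by blast+
  have lim: "(\<lambda>n. form (C' n) (D' n)) \<longlonglongrightarrow> ip u w"
  proof -
    have "cauchy C'" "cauchy D'" using r unfolding represents_def by auto
    then have "convergent (\<lambda>n. form (C' n) (D' n))" by (rule form_convergent)
    then show ?thesis unfolding ip_def C'_def[symmetric] D'_def[symmetric] by (simp add: convergent_LIMSEQ_iff)
  qed
  obtain K where K: "\<And>n. nrm (D n) \<le> K"
    using cauchy_nrm[of D] assms(2) cb unfolding Bseq_def represents_def by auto
  obtain L where L: "\<And>n. nrm (C' n) \<le> L"
    using cauchy_nrm[of C'] r(1) cb unfolding Bseq_def represents_def by auto
  have nC: "(\<lambda>n. nrm (csub (C n) (C' n))) \<longlonglongrightarrow> 0"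
    using nrm_null represents_diff[OF assms(1) r(1)] by simp
  have nD: "(\<lambda>n. nrm (csub (D n) (D' n))) \<longlonglongrightarrow> 0"
    using nrm_null represents_diff[OF assms(2) r(2)] by simp
  have "(\<lambda>n. form (C n) (D n) - form (C' n) (D' n)) \<longlonglongrightarrow> 0"
  proof (rule Lim_null_comparison)
    show "\<forall>\<^sub>F n in sequentially. norm (form (C n) (D n) - form (C' n) (D' n))
        \<le> nrm (csub (C n) (C' n)) * K + L * nrm (csub (D n) (D' n))"
    proof (rule always_eventually, rule allI)
      fix n
      have "norm (form (C n) (D n) - form (C' n) (D' n)) \<le> nrm (csub (C n) (C' n)) * nrm (D n) + nrm (C' n) * nrm (csub (D n) (D' n))"
        by (rule form_diff_bound[OF cb])
      also have "\<dots> \<le> nrm (csub (C n) (C' n)) * K + L * nrm (csub (D n) (D' n))"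
        using cb K L order_trans[OF nrm_nonneg[OF cb(3)] L] by (intro add_mono mult_mono) auto
      finally show "norm (form (C n) (D n) - form (C' n) (D' n))
        \<le> nrm (csub (C n) (C' n)) * K + L * nrm (csub (D n) (D' n))" .
    qed
    show "(\<lambda>n. nrm (csub (C n) (C' n)) * K + L * nrm (csub (D n) (D' n))) \<longlonglongrightarrow> 0"
      using tendsto_add[OF tendsto_mult_right[OF nC, of K] tendsto_mult_left[OF nD, of L]] by simp
  qed
  from tendsto_add[OF this lim] show ?thesis by simp
qed

lemma spaceE: assumes "u \<in> hspace" obtains C where "represents C u"
  using assms unfolding hspace_def by blast

lemma spaceI: "represents C u \<Longrightarrow> u \<in> hspace"
  unfolding hspace_def by blast

lemma space_zero: "(\<lambda>x. 0) \<in> hspace"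
proof -
  have "ev [] = (\<lambda>x. 0)" by (simp add: ev_def fun_eq_iff)
  then show ?thesis using spaceI[OF represents_const[of "[]"]] by simp
qed

lemma space_add: "u \<in> hspace \<Longrightarrow> w \<in> hspace \<Longrightarrow> (\<lambda>x. u x + w x) \<in> hspace"
  by (elim spaceE) (rule spaceI[OF represents_add])

lemma space_scale: "u \<in> hspace \<Longrightarrow> (\<lambda>x. z * u x) \<in> hspace"
  by (elim spaceE) (rule spaceI[OF represents_scale])

lemma space_diff: "u \<in> hspace \<Longrightarrow> w \<in> hspace \<Longrightarrow> (\<lambda>x. u x - w x) \<in> hspace"
  by (elim spaceE) (rule spaceI[OF represents_diff])

lemma ip_cnj: assumes "u \<in> hspace" "w \<in> hspace" shows "ip w u = cnj (ip u w)"
proof -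
  obtain C where C: "represents C u" using assms spaceE by blast
  obtain D where D: "represents D w" using assms spaceE by blast
  have "(\<lambda>n. cnj (form (C n) (D n))) \<longlonglongrightarrow> cnj (ip u w)" using ip_tendsto[OF C D] by (rule tendsto_cnj)
  then have "(\<lambda>n. form (D n) (C n)) \<longlonglongrightarrow> cnj (ip u w)"
    using form_cnj[OF comb_represents[OF C] comb_represents[OF D]] by simp
  then show ?thesis by (rule LIMSEQ_unique[OF ip_tendsto[OF D C]])
qed

lemma ip_add: assumes "u \<in> hspace" "v \<in> hspace" "w \<in> hspace"
  shows "ip (\<lambda>x. u x + v x) w = ip u w + ip v w"
proof -
  obtain C where C: "represents C u" using assms spaceE by blast
  obtain E where E: "represents E v" using assms spaceE by blast
  obtain D where D: "represents D w" using assms spaceE by blast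
  have "(\<lambda>n. form (C n @ E n) (D n)) \<longlonglongrightarrow> ip u w + ip v w"
    using tendsto_add[OF ip_tendsto[OF C D] ip_tendsto[OF E D]] by simp
  then show ?thesis by (rule LIMSEQ_unique[OF ip_tendsto[OF represents_add[OF C E] D]])
qed

lemma ip_scale: assumes "u \<in> hspace" "w \<in> hspace"
  shows "ip (\<lambda>x. z * u x) w = z * ip u w"
proof -
  obtain C where C: "represents C u" using assms spaceE by blast
  obtain D where D: "represents D w" using assms spaceE by blast
  have "(\<lambda>n. form (cscale z (C n)) (D n)) \<longlonglongrightarrow> z * ip u w"
    using tendsto_mult_left[OF ip_tendsto[OF C D]] by simp
  then show ?thesis by (rule LIMSEQ_unique[OF ip_tendsto[OF represents_scale[OF C] D]])
qed

lemma norm_tendsto: assumes "represents C u" shows "(\<lambda>n. nrm (C n)) \<longlonglongrightarrow> ip_norm ip u"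
  unfolding nrm_def ip_norm_def by (intro tendsto_real_sqrt tendsto_Re ip_tendsto assms)

lemma ip_norm_nonneg: assumes "u \<in> hspace" shows "0 \<le> Re (ip u u)"
proof -
  obtain C where C: "represents C u" using assms spaceE by blast
  then show ?thesis using pos[OF comb_represents[OF C]]
    by (intro LIMSEQ_le_const[OF tendsto_Re[OF ip_tendsto[OF C C]]]) auto
qed

lemma norm_evaluation: assumes "u \<in> hspace" "x \<in> A" shows "cmod (u x) \<le> ip_norm ip u * nrm [(1, x)]"
proof -
  obtain C where C: "represents C u" using assms spaceE by blast
  have "(\<lambda>n. cmod (ev (C n) x)) \<longlonglongrightarrow> cmod (u x)" using C unfolding represents_def by (intro tendsto_norm) blast
  moreover have "(\<lambda>n. nrm (C n) * nrm [(1, x)]) \<longlonglongrightarrow> ip_norm ip u * nrm [(1, x)]"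
    by (intro tendsto_mult_right norm_tendsto C)
  moreover have "cmod (ev (C n) x) \<le> nrm (C n) * nrm [(1, x)]" for n
    unfolding ev_def using assms(2) comb_represents[OF C] cauchy_schwarz[of "C n" "[(1, x)]"] by simp
  ultimately show ?thesis by (intro LIMSEQ_le) auto
qed

lemma space_outside: assumes "u \<in> hspace" "x \<notin> A" shows "u x = 0"
proof -
  obtain C where C: "represents C u" using assms spaceE by blast
  then have "(\<lambda>n. ev (C n) x) \<longlonglongrightarrow> u x" unfolding represents_def by blast
  moreover have "(\<lambda>n. ev (C n) x) = (\<lambda>n. 0)" using assms(2) by (simp add: ev_def)
  ultimately show ?thesis using LIMSEQ_unique[of "\<lambda>n. 0" "u x" 0] by simp
qed

lemma ip_definite: assumes "u \<in> hspace" "u \<noteq> (\<lambda>x. 0)" shows "0 < Re (ip u u)"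
proof (rule ccontr)
  assume "\<not> ?thesis"
  then have "ip_norm ip u = 0" using ip_norm_nonneg[OF assms(1)] unfolding ip_norm_def by simp
  then have "u x = 0" for x
    using norm_evaluation[OF assms(1), of x] space_outside[OF assms(1), of x] by (cases "x \<in> A") auto
  then show False using assms(2) by blast
qed

abbreviation hdist :: "('a \<Rightarrow> complex) \<Rightarrow> ('a \<Rightarrow> complex) \<Rightarrow> real" where
  "hdist \<equiv> ip_dist hilbert ip"

lemma hilbert_simps [simp]:
  "carrier hilbert = hspace" "zero hilbert = (\<lambda>x. 0)" "add hilbert = (\<lambda>u w x. retract u x + retract w x)"
  "smult hilbert = (\<lambda>z u x. z * u x)"
  unfolding hilbert_def by simp_all

lemma retract_space [simp]: "u \<in> hspace \<Longrightarrow> retract u = u" "retract u \<in> hspace"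
  unfolding retract_def using space_zero by auto

lemma module_hilbert: "Module.module complex_ring hilbert"
proof (rule moduleI)
  have "ring complex_ring"
    unfolding complex_ring_def
    by (unfold_locales) (auto simp: algebra_simps Units_def intro: exI[of _ "- x" for x])
  then show "cring complex_ring"
    unfolding cring_def comm_monoid_def comm_monoid_axioms_def
    by (auto simp: complex_ring_def ring_def)
  show "abelian_group hilbert"
  proof (rule abelian_groupI)
    fix u assume u: "u \<in> carrier hilbert"
    show "\<exists>w\<in>carrier hilbert. w \<oplus>\<^bsub>hilbert\<^esub> u = \<zero>\<^bsub>hilbert\<^esub>"
      using u space_scale[of u "-1"] by (intro bexI[of _ "\<lambda>x. - 1 * u x"]) auto
  qed (auto simp: space_add space_zero add_ac)
qed (auto simp: space_scale complex_ring_def algebra_simps)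

lemma hilbert_minus: "u \<ominus>\<^bsub>hilbert\<^esub> w = (\<lambda>x. retract u x - retract w x)"
proof -
  have m: "(\<lambda>x. - retract w x) \<in> hspace" using space_scale[OF retract_space(2), of "-1" w] by simp
  have "\<ominus>\<^bsub>hilbert\<^esub> w = (\<lambda>x. - retract w x)"
    unfolding a_inv_def m_inv_def
  proof (rule the_equality)
    show "(\<lambda>x. - retract w x) \<in> carrier (add_monoid hilbert) \<and>
      w \<otimes>\<^bsub>add_monoid hilbert\<^esub> (\<lambda>x. - retract w x) = \<one>\<^bsub>add_monoid hilbert\<^esub> \<and>
      (\<lambda>x. - retract w x) \<otimes>\<^bsub>add_monoid hilbert\<^esub> w = \<one>\<^bsub>add_monoid hilbert\<^esub>"
      using m by simp
    fix v assume "v \<in> carrier (add_monoid hilbert) \<and> w \<otimes>\<^bsub>add_monoid hilbert\<^esub> v = \<one>\<^bsub>add_monoid hilbert\<^esub> \<and>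
      v \<otimes>\<^bsub>add_monoid hilbert\<^esub> w = \<one>\<^bsub>add_monoid hilbert\<^esub>"
    then have "v \<in> hspace" "(\<lambda>x. retract w x + v x) = (\<lambda>x. 0)" by auto
    then have "retract w x + v x = 0" for x by meson
    then show "v = (\<lambda>x. - retract w x)" by (simp add: fun_eq_iff eq_neg_iff_add_eq_0 add.commute)
  qed
  then show ?thesis using m unfolding a_minus_def by simp
qed

lemma ip_dist_retract: "hdist u w = ip_norm ip (\<lambda>x. retract u x - retract w x)"
  unfolding ip_dist_def by (simp add: hilbert_minus)

lemma ip_dist_eq: "u \<in> hspace \<Longrightarrow> w \<in> hspace \<Longrightarrow> hdist u w = ip_norm ip (\<lambda>x. u x - w x)"
  by (simp add: ip_dist_retract)

lemma ip_norm_triangle: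
  assumes "u \<in> hspace" "w \<in> hspace" shows "ip_norm ip (\<lambda>x. u x + w x) \<le> ip_norm ip u + ip_norm ip w"
proof -
  obtain C where C: "represents C u" using assms spaceE by blast
  obtain D where D: "represents D w" using assms spaceE by blast
  have "(\<lambda>n. nrm (C n) + nrm (D n)) \<longlonglongrightarrow> ip_norm ip u + ip_norm ip w"
    by (intro tendsto_add norm_tendsto C D)
  then show ?thesis using norm_tendsto[OF represents_add[OF C D]]
    nrm_append[OF comb_represents[OF C] comb_represents[OF D]] by (intro LIMSEQ_le) auto
qed

lemma ip_norm_scale: assumes "u \<in> hspace" shows "ip_norm ip (\<lambda>x. z * u x) = cmod z * ip_norm ip u"
proof -
  obtain C where C: "represents C u" using assms spaceE by blast
  have "(\<lambda>n. nrm (cscale z (C n))) \<longlonglongrightarrow> cmod z * ip_norm ip u"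
    using tendsto_mult_left[OF norm_tendsto[OF C], of "cmod z"] nrm_cscale[OF comb_represents[OF C]] by simp
  then show ?thesis by (rule LIMSEQ_unique[OF norm_tendsto[OF represents_scale[OF C]]])
qed

lemma ip_norm_diff_commute:
  assumes "u \<in> hspace" "w \<in> hspace" shows "ip_norm ip (\<lambda>x. u x - w x) = ip_norm ip (\<lambda>x. w x - u x)"
  using ip_norm_scale[OF space_diff[OF assms], of "-1"] by simp

lemma metric: "Metric_space hspace (hdist)"
proof
  show "0 \<le> hdist u w" for u w
    using ip_norm_nonneg[OF space_diff[OF retract_space(2) retract_space(2)]] unfolding ip_dist_retract ip_norm_def by simp
  show "hdist u w = hdist w u" for u w
    unfolding ip_dist_retract by (rule ip_norm_diff_commute) simp_all
next
  fix u w assume uw: "u \<in> hspace" "w \<in> hspace"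
  show "hdist u w = 0 \<longleftrightarrow> u = w"
  proof
    assume "hdist u w = 0"
    then have "\<not> 0 < Re (ip (\<lambda>x. u x - w x) (\<lambda>x. u x - w x))"
      using ip_dist_eq[OF uw] unfolding ip_norm_def by simp
    then have "(\<lambda>x. u x - w x) = (\<lambda>x. 0)" using ip_definite[OF space_diff[OF uw]] by blast
    then show "u = w" by (metis eq_iff_diff_eq_0 ext)
  next
    assume "u = w"
    then show "hdist u w = 0" using ip_dist_eq[OF uw] ip_norm_scale[OF uw(1), of 0] by simp
  qed
next
  fix u v w assume uvw: "u \<in> hspace" "v \<in> hspace" "w \<in> hspace"
  show "hdist u w \<le> hdist u v + hdist v w"
    using ip_norm_triangle[OF space_diff[OF uvw(1,2)] space_diff[OF uvw(2,3)]] uvw by (simp add: ip_dist_eq)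
qed

lemma dist_approximants:
  assumes "represents C u" "e > 0"
  shows "\<exists>N. \<forall>n\<ge>N. hdist u (ev (C n)) < e"
proof -
  have C: "comb (C n)" for n using assms comb_represents by blast
  obtain N where N: "\<forall>m\<ge>N. \<forall>n\<ge>N. nrm (csub (C m) (C n)) < e / 2"
    using assms unfolding represents_def cauchy_def by (meson half_gt_zero)
  have "hdist u (ev (C n)) < e" if "n \<ge> N" for n
  proof -
    have evn: "represents (\<lambda>_. C n) (ev (C n))" using represents_const C by blast
    have "(\<lambda>m. nrm (csub (C m) (C n))) \<longlonglongrightarrow> ip_norm ip (\<lambda>x. u x - ev (C n) x)"
      by (rule norm_tendsto[OF represents_diff[OF assms(1) evn]])
    then have "ip_norm ip (\<lambda>x. u x - ev (C n) x) \<le> e / 2"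
      by (rule LIMSEQ_le_const2) (use N that less_imp_le in blast)
    then show ?thesis using ip_dist_eq[OF spaceI[OF assms(1)] spaceI[OF evn]] assms(2) by simp
  qed
  then show ?thesis by blast
qed

lemma dist_ev: assumes "comb c" "comb d" shows "hdist (ev c) (ev d) = nrm (csub c d)"
proof -
  have r: "represents (\<lambda>_. c) (ev c)" "represents (\<lambda>_. d) (ev d)" using assms represents_const by auto
  have "ip_norm ip (\<lambda>x. ev c x - ev d x) = nrm (csub c d)"
    by (rule LIMSEQ_unique[OF norm_tendsto[OF represents_diff[OF r]] tendsto_const])
  then show ?thesis using ip_dist_eq[OF spaceI[OF r(1)] spaceI[OF r(2)]] by simp
qed

theorem hilbert_space: "complex_hilbert_space hilbert ip"
proof -
  interpret M: Metric_space hspace "hdist" by (rule metric)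
  have "M.mcomplete"
    unfolding M.mcomplete_def
  proof (intro allI impI)
    fix \<sigma> assume \<sigma>: "M.MCauchy \<sigma>"
    then have \<sigma>s: "\<sigma> n \<in> hspace" for n unfolding M.MCauchy_def by blast
    have "\<exists>c. comb c \<and> hdist (\<sigma> n) (ev c) < inverse (Suc n)" for n
    proof -
      obtain C where C: "represents C (\<sigma> n)" using \<sigma>s spaceE by blast
      then obtain N where "\<forall>m\<ge>N. hdist (\<sigma> n) (ev (C m)) < inverse (Suc n)"
        using dist_approximants[OF C, of "inverse (Suc n)"] by auto
      then show ?thesis using comb_represents[OF C, of N] by blast
    qed
    then obtain c where c: "\<And>n. comb (c n)" "\<And>n. hdist (\<sigma> n) (ev (c n)) < inverse (Suc n)" by metis
    have evs: "ev (c n) \<in> hspace" for n using c(1) represents_const spaceI by blast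
    have small: "\<exists>N. \<forall>n\<ge>N. inverse (real (Suc n)) < e" if "e > 0" for e :: real
      using LIMSEQ_D[OF LIMSEQ_inverse_real_of_nat that] by auto
    have "cauchy c"
      unfolding cauchy_def
    proof (intro conjI allI impI c(1))
      fix e :: real assume e: "e > 0"
      obtain N where N: "\<forall>n\<ge>N. inverse (real (Suc n)) < e / 3" using small[of "e / 3"] e by auto
      obtain N' where N': "\<forall>n n'. N' \<le> n \<longrightarrow> N' \<le> n' \<longrightarrow> hdist (\<sigma> n) (\<sigma> n') < e / 3"
        using \<sigma> e unfolding M.MCauchy_def by (meson divide_pos_pos zero_less_numeral)
      have "nrm (csub (c m) (c n)) < e" if mn: "m \<ge> max N N'" "n \<ge> max N N'" for m n
      proof -
        have "nrm (csub (c m) (c n)) = hdist (ev (c m)) (ev (c n))" using dist_ev c(1) by simp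
        also have "\<dots> \<le> hdist (ev (c m)) (\<sigma> m) + hdist (\<sigma> m) (ev (c n))"
          using evs \<sigma>s by (intro M.triangle)
        also have "\<dots> \<le> hdist (\<sigma> m) (ev (c m)) + (hdist (\<sigma> m) (\<sigma> n) + hdist (\<sigma> n) (ev (c n)))"
          using evs \<sigma>s M.commute by (simp add: M.triangle)
        also have "\<dots> < e / 3 + (e / 3 + e / 3)"
          using c(2)[of m] c(2)[of n] N N' mn by (intro add_strict_mono) (auto intro: less_trans)
        finally show ?thesis by simp
      qed
      then show "\<exists>N. \<forall>m\<ge>N. \<forall>n\<ge>N. nrm (csub (c m) (c n)) < e" by blast
    qed
    moreover have "convergent (\<lambda>n. ev (c n) x)" for x
    proof (cases "x \<in> A")
      case True
      then have "represents (\<lambda>_. [(1, x)]) (ev [(1, x)])" by (intro represents_const) simp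
      then show ?thesis using form_convergent[OF \<open>cauchy c\<close>] True unfolding represents_def ev_def by simp
    qed (simp add: ev_def convergent_const)
    ultimately have rep: "represents c (\<lambda>x. lim (\<lambda>n. ev (c n) x))"
      unfolding represents_def by (simp add: convergent_LIMSEQ_iff)
    let ?u = "\<lambda>x. lim (\<lambda>n. ev (c n) x)"
    have us: "?u \<in> hspace" using rep spaceI by blast
    have "limitin M.mtopology \<sigma> ?u sequentially"
      unfolding M.limit_metric_sequentially
    proof (intro conjI allI impI us)
      fix e :: real assume e: "e > 0"
      obtain N where N: "\<forall>n\<ge>N. inverse (real (Suc n)) < e / 2" using small[of "e / 2"] e by auto
      obtain N' where N': "\<forall>n\<ge>N'. hdist ?u (ev (c n)) < e / 2"
        using dist_approximants[OF rep, of "e / 2"] e by auto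
      have "\<sigma> n \<in> hspace \<and> hdist (\<sigma> n) ?u < e" if n: "n \<ge> max N N'" for n
      proof -
        have "hdist (\<sigma> n) ?u \<le> hdist (\<sigma> n) (ev (c n)) + hdist (ev (c n)) ?u"
          using evs \<sigma>s us by (intro M.triangle)
        also have "\<dots> < e / 2 + e / 2"
          using c(2)[of n] N N' n M.commute[of "ev (c n)" ?u] by (intro add_strict_mono) (auto intro: less_trans)
        finally show ?thesis using \<sigma>s by simp
      qed
      then show "\<exists>N. \<forall>n\<ge>N. \<sigma> n \<in> hspace \<and> hdist (\<sigma> n) ?u < e" by blast
    qed
    then show "\<exists>x. limitin M.mtopology \<sigma> x sequentially" by blast
  qed
  then have complete: "Metric_space.mcomplete (carrier hilbert) (hdist)" by simp
  have "ip (u \<oplus>\<^bsub>hilbert\<^esub> v) w = ip u w + ip v w" if "u \<in> hspace" "v \<in> hspace" "w \<in> hspace" for u v w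
    using ip_add[OF that] that by simp
  moreover have "ip (z \<odot>\<^bsub>hilbert\<^esub> u) w = z * ip u w" if "u \<in> hspace" "w \<in> hspace" for z u w
    using ip_scale[OF that] by simp
  moreover have "0 < Re (ip u u)" if "u \<in> hspace" "u \<noteq> \<zero>\<^bsub>hilbert\<^esub>" for u
    using ip_definite that by simp
  ultimately show ?thesis
    unfolding complex_hilbert_space_def hilbert_simps(1)
    using module_hilbert ip_cnj complete[unfolded hilbert_simps(1)] by blast
qed

end

section \<open>Invariant kernels and unitary representations\<close>

lemma topological_group_mult:
  assumes "topological_group G T" "continuous_map X T f" "continuous_map X T h"
  shows "continuous_map X T (\<lambda>x. f x \<otimes>\<^bsub>G\<^esub> h x)"
proof -
  have "continuous_map X (prod_topology T T) (\<lambda>x. (f x, h x))" using assms by (intro continuous_map_pairedI)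
  moreover have "continuous_map (prod_topology T T) T (\<lambda>(x, y). x \<otimes>\<^bsub>G\<^esub> y)"
    using assms(1) unfolding topological_group_def by blast
  ultimately have "continuous_map X T ((\<lambda>(x, y). x \<otimes>\<^bsub>G\<^esub> y) \<circ> (\<lambda>x. (f x, h x)))" by (rule continuous_map_compose)
  then show ?thesis by (simp add: comp_def)
qed

lemma topological_group_inv:
  assumes "topological_group G T" "continuous_map X T f"
  shows "continuous_map X T (\<lambda>x. inv\<^bsub>G\<^esub> (f x))"
proof -
  have "continuous_map T T (\<lambda>x. inv\<^bsub>G\<^esub> x)" using assms(1) unfolding topological_group_def by blast
  then have "continuous_map X T ((\<lambda>x. inv\<^bsub>G\<^esub> x) \<circ> f)" using assms(2) by (intro continuous_map_compose)
  then show ?thesis by (simp add: comp_def)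
qed

lemma (in Metric_space) continuous_map_into_metric:
  assumes "\<And>x. x \<in> topspace X \<Longrightarrow> f x \<in> M"
    and "\<And>x e. x \<in> topspace X \<Longrightarrow> e > 0 \<Longrightarrow> \<exists>U. openin X U \<and> x \<in> U \<and> (\<forall>y\<in>U. d (f x) (f y) < e)"
  shows "continuous_map X mtopology f"
  unfolding continuous_map_to_metric
proof (intro ballI allI impI)
  fix x and e :: real assume x: "x \<in> topspace X" "e > 0"
  obtain U where U: "openin X U" "x \<in> U" "\<forall>y\<in>U. d (f x) (f y) < e" using assms(2) x by blast
  have "f y \<in> mball (f x) e" if "y \<in> U" for y using U that assms(1) x openin_subset[OF U(1)] by auto
  then show "\<exists>U. openin X U \<and> x \<in> U \<and> (\<forall>y\<in>U. f y \<in> mball (f x) e)" using U by blast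
qed

locale invariant_kernel = pos_kernel "carrier G" k + group G
  for G :: "'a monoid" (structure) and k :: "'a \<Rightarrow> 'a \<Rightarrow> real" +
  assumes kernel_invariant: "g \<in> carrier G \<Longrightarrow> x \<in> carrier G \<Longrightarrow> y \<in> carrier G \<Longrightarrow> k (g \<otimes> x) (g \<otimes> y) = k x y"
begin

definition shift :: "'a \<Rightarrow> (complex \<times> 'a) list \<Rightarrow> (complex \<times> 'a) list" where
  "shift g c = map (apsnd (\<lambda>x. g \<otimes> x)) c"

definition translate :: "'a \<Rightarrow> ('a \<Rightarrow> complex) \<Rightarrow> 'a \<Rightarrow> complex" where
  "translate g u x = (if x \<in> carrier G then u (inv g \<otimes> x) else 0)"

definition rep :: "'a \<Rightarrow> ('a \<Rightarrow> complex) \<Rightarrow> 'a \<Rightarrow> complex" where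
  "rep g = restrict (translate g) hspace"

lemma comb_shift: "g \<in> carrier G \<Longrightarrow> comb c \<Longrightarrow> comb (shift g c)"
  unfolding shift_def by auto

lemma form_shift:
  assumes "g \<in> carrier G" "comb c" "comb d" shows "form (shift g c) (shift g d) = form c d"
  unfolding shift_def kernel_form_pullback using assms kernel_invariant by (intro kernel_form_cong) blast

lemma ev_shift:
  assumes "g \<in> carrier G" "comb c" shows "ev (shift g c) x = translate g (ev c) x"
proof (cases "x \<in> carrier G")
  case True
  have "form (shift g c) [(1, x)] = form (shift g c) (shift g [(1, inv g \<otimes> x)])"
    using True assms by (simp add: shift_def m_assoc[symmetric])
  also have "\<dots> = form c [(1, inv g \<otimes> x)]" using True assms by (intro form_shift) auto
  finally show ?thesis using True assms by (simp add: ev_def translate_def)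
qed (simp add: ev_def translate_def)

lemma nrm_shift:
  assumes "g \<in> carrier G" "comb c" "comb d" shows "nrm (csub (shift g c) (shift g d)) = nrm (csub c d)"
  by (rule nrm_cong) (simp add: form_shift assms)

lemma represents_translate:
  assumes "g \<in> carrier G" "represents C u" shows "represents (\<lambda>n. shift g (C n)) (translate g u)"
  unfolding represents_def
proof (intro conjI allI)
  have C: "comb (C n)" for n using assms comb_represents by blast
  show "cauchy (\<lambda>n. shift g (C n))"
    using assms(2) nrm_shift[OF assms(1) C C] comb_shift[OF assms(1) C] unfolding cauchy_def represents_def by simp
  fix x
  show "(\<lambda>n. ev (shift g (C n)) x) \<longlonglongrightarrow> translate g u x"
    using assms(2) unfolding ev_shift[OF assms(1) C] translate_def represents_def by auto
qed

lemma translate_space: "g \<in> carrier G \<Longrightarrow> u \<in> hspace \<Longrightarrow> translate g u \<in> hspace"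
  by (elim spaceE) (rule spaceI[OF represents_translate])

lemma translate_mult:
  assumes "g \<in> carrier G" "h \<in> carrier G" shows "translate (g \<otimes> h) u = translate g (translate h u)"
  using assms unfolding translate_def by (intro ext) (simp add: inv_mult_group m_assoc)

lemma translate_one: "u \<in> hspace \<Longrightarrow> translate \<one> u = u"
  unfolding translate_def using space_outside by (intro ext) auto

lemma translate_inv: "g \<in> carrier G \<Longrightarrow> u \<in> hspace \<Longrightarrow> translate (inv g) (translate g u) = u"
  using translate_mult[of "inv g" g u] translate_one by simp

lemma translate_inv': "g \<in> carrier G \<Longrightarrow> u \<in> hspace \<Longrightarrow> translate g (translate (inv g) u) = u"
  using translate_mult[of g "inv g" u] translate_one by simp

lemma rep_Bij: assumes g: "g \<in> carrier G" shows "rep g \<in> Bij hspace"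
proof -
  have "bij_betw (translate g) hspace hspace"
    by (rule bij_betw_byWitness[of _ "translate (inv g)"])
      (use g translate_inv translate_inv' translate_space in auto)
  then show ?thesis unfolding Bij_def rep_def by (simp add: bij_betw_restrict_eq)
qed

lemma rep_action: "group_action G hspace rep"
  unfolding group_action_def
proof -
  have "rep (g \<otimes> h) = rep g \<otimes>\<^bsub>BijGroup hspace\<^esub> rep h" if gh: "g \<in> carrier G" "h \<in> carrier G" for g h
  proof -
    have "rep (g \<otimes> h) = compose hspace (rep g) (rep h)"
      unfolding rep_def compose_def using gh translate_space translate_mult by (intro ext) (simp add: restrict_def)
    then show ?thesis using rep_Bij gh unfolding BijGroup_def by simp
  qed
  then have "rep \<in> hom G (BijGroup hspace)" unfolding hom_def using rep_Bij by (simp add: BijGroup_def)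
  then show "group_hom G (BijGroup hspace) rep"
    unfolding group_hom_def group_hom_axioms_def using group_BijGroup is_group by blast
qed

lemma ip_translate:
  assumes "g \<in> carrier G" "u \<in> hspace" "w \<in> hspace" shows "ip (translate g u) (translate g w) = ip u w"
proof -
  obtain C where C: "represents C u" using assms spaceE by blast
  obtain D where D: "represents D w" using assms spaceE by blast
  have "(\<lambda>n. form (shift g (C n)) (shift g (D n))) \<longlonglongrightarrow> ip u w"
    using ip_tendsto[OF C D] form_shift[OF assms(1) comb_represents[OF C] comb_represents[OF D]] by simp
  then show ?thesis
    by (rule LIMSEQ_unique[OF ip_tendsto[OF represents_translate[OF assms(1) C] represents_translate[OF assms(1) D]]])
qed

lemma dist_translate:
  assumes "g \<in> carrier G" "u \<in> hspace" "w \<in> hspace"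
  shows "hdist (translate g u) (translate g w) = hdist u w"
proof -
  have "(\<lambda>x. translate g u x - translate g w x) = translate g (\<lambda>x. u x - w x)"
    unfolding translate_def by auto
  then have "ip_norm ip (\<lambda>x. translate g u x - translate g w x) = ip_norm ip (\<lambda>x. u x - w x)"
    unfolding ip_norm_def using ip_translate[OF assms(1) space_diff[OF assms(2,3)] space_diff[OF assms(2,3)]] by simp
  then show ?thesis using ip_dist_eq[OF assms(2,3)] ip_dist_eq[OF translate_space[OF assms(1,2)] translate_space[OF assms(1,3)]] by simp
qed

lemma kernel_diagonal: "x \<in> carrier G \<Longrightarrow> k x x = k \<one> \<one>"
  using kernel_invariant[of x \<one> \<one>] by simp

lemma nrm_two_points:
  assumes "x \<in> carrier G" "y \<in> carrier G"
  shows "nrm (csub [(a, x)] [(a, y)]) = cmod a * sqrt (2 * k \<one> \<one> - 2 * k (inv y \<otimes> x) \<one>)"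
proof -
  have "k x y = k (inv y \<otimes> x) \<one>" using kernel_invariant[of "inv y" x y] assms by simp
  then have "form (csub [(a, x)] [(a, y)]) (csub [(a, x)] [(a, y)]) = a * cnj a * of_real (2 * k \<one> \<one> - 2 * k (inv y \<otimes> x) \<one>)"
    using sym[OF assms(2,1)] kernel_diagonal[OF assms(1)] kernel_diagonal[OF assms(2)]
    by (simp add: kernel_form_single algebra_simps)
  also have "a * cnj a = of_real ((cmod a)\<^sup>2)" using complex_norm_square[of a] by simp
  finally have "Re (form (csub [(a, x)] [(a, y)]) (csub [(a, x)] [(a, y)])) = (cmod a)\<^sup>2 * (2 * k \<one> \<one> - 2 * k (inv y \<otimes> x) \<one>)"
    by (metis Re_complex_of_real of_real_mult)
  then show ?thesis unfolding nrm_def by (simp add: real_sqrt_mult)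
qed

text \<open>
  By induction over the combination, the norm is bounded by a continuous function of \<open>h\<close> that
  vanishes at \<open>g\<close>; for single points it is a function of the kernel at one group element.
\<close>

lemma shift_continuous:
  assumes T: "topological_group G T" and cont: "continuous_map T euclideanreal (\<lambda>g. k g \<one>)"
    and g: "g \<in> carrier G" and c: "comb c" and e: "e > 0"
  shows "\<exists>U. openin T U \<and> g \<in> U \<and> (\<forall>h\<in>U. nrm (csub (shift h c) (shift g c)) < e)"
proof -
  have TG: "topspace T = carrier G" using T unfolding topological_group_def by blast
  have "\<exists>N. continuous_map T euclideanreal N \<and> N g = 0 \<and> (\<forall>h\<in>carrier G. nrm (csub (shift h c) (shift g c)) \<le> N h)"
    using c
  proof (induction c)
    case Nil
    have "nrm [] = 0" unfolding nrm_def by simp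
    then show ?case by (intro exI[of _ "\<lambda>_. 0"]) (auto simp: shift_def csub_def)
  next
    case (Cons p c)
    obtain a x where p: "p = (a, x)" by (cases p)
    then have x: "x \<in> carrier G" and c: "comb c" using Cons.prems by auto
    obtain N where N: "continuous_map T euclideanreal N" "N g = 0"
      "\<forall>h\<in>carrier G. nrm (csub (shift h c) (shift g c)) \<le> N h" using Cons.IH c by blast
    let ?N = "\<lambda>h. cmod a * sqrt (2 * k \<one> \<one> - 2 * k (inv (g \<otimes> x) \<otimes> (h \<otimes> x)) \<one>)"
    have m: "continuous_map T T (\<lambda>h. inv (g \<otimes> x) \<otimes> (h \<otimes> x))"
      using g x TG by (intro topological_group_mult[OF T]) (auto simp: continuous_map_const)
    have s: "continuous_map euclideanreal euclideanreal sqrt" by (simp add: continuous_on_real_sqrt)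
    have "continuous_map T euclideanreal (\<lambda>h. 2 * k \<one> \<one> - 2 * k (inv (g \<otimes> x) \<otimes> (h \<otimes> x)) \<one>)"
      using continuous_map_compose[OF m cont]
      by (intro continuous_map_diff continuous_map_real_mult) (auto simp: comp_def)
    from continuous_map_compose[OF this s]
    have "continuous_map T euclideanreal (\<lambda>h. ?N h + N h)"
      by (intro continuous_map_add continuous_map_real_mult N) (auto simp: comp_def)
    moreover have "?N g + N g = 0" using N x g by simp
    moreover have "nrm (csub (shift h (p # c)) (shift g (p # c))) \<le> ?N h + N h" if h: "h \<in> carrier G" for h
    proof -
      have "nrm (csub (shift h (p # c)) (shift g (p # c))) =
          nrm (csub [(a, h \<otimes> x)] [(a, g \<otimes> x)] @ csub (shift h c) (shift g c))"
        by (rule nrm_cong) (simp add: p shift_def kernel_form_Cons(1)[of _ _ "map _ _"] kernel_form_Cons(2)[of _ _ _ "map _ _"] algebra_simps)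
      also have "\<dots> \<le> nrm (csub [(a, h \<otimes> x)] [(a, g \<otimes> x)]) + nrm (csub (shift h c) (shift g c))"
        using c x g h comb_shift by (intro nrm_append) auto
      also have "\<dots> \<le> ?N h + N h"
        using N(3) h nrm_two_points[of "h \<otimes> x" "g \<otimes> x" a] x g by simp
      finally show ?thesis .
    qed
    ultimately show ?case by (intro exI[of _ "\<lambda>h. ?N h + N h"]) blast
  qed
  then obtain N where N: "continuous_map T euclideanreal N" "N g = 0"
      "\<forall>h\<in>carrier G. nrm (csub (shift h c) (shift g c)) \<le> N h" by blast
  have "openin T {h \<in> topspace T. N h \<in> {..<e}}"
    by (rule openin_continuous_map_preimage[OF N(1)]) simp
  moreover have "g \<in> {h \<in> topspace T. N h \<in> {..<e}}" using g TG N(2) e by simp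
  moreover have "\<forall>h\<in>{h \<in> topspace T. N h \<in> {..<e}}. nrm (csub (shift h c) (shift g c)) < e"
    using N(3) TG by (auto intro: le_less_trans)
  ultimately show ?thesis by blast
qed

theorem unitary_rep:
  assumes T: "topological_group G T" and cont: "continuous_map T euclideanreal (\<lambda>g. k g \<one>)"
  shows "unitary_rep G T hilbert ip rep"
proof -
  interpret M: Metric_space hspace "hdist" by (rule metric)
  have TG: "topspace T = carrier G" using T unfolding topological_group_def by blast
  have rep: "rep g u = translate g u" if "u \<in> hspace" for g u using that by (simp add: rep_def)
  have "continuous_map T M.mtopology (\<lambda>g. rep g u)" if u: "u \<in> hspace" for u
  proof (rule M.continuous_map_into_metric)
    show "rep g u \<in> hspace" if "g \<in> topspace T" for g using that TG u rep translate_space by simp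
    fix g e assume g: "g \<in> topspace T" and e: "(e::real) > 0"
    then have gG: "g \<in> carrier G" using TG by simp
    obtain C where C: "represents C u" using u spaceE by blast
    obtain n where n: "hdist u (ev (C n)) < e / 3" using dist_approximants[OF C, of "e / 3"] e by auto
    have c: "comb (C n)" using C comb_represents by blast
    then have es: "ev (C n) \<in> hspace" using represents_const spaceI by blast
    obtain U where U: "openin T U" "g \<in> U" "\<forall>h\<in>U. nrm (csub (shift h (C n)) (shift g (C n))) < e / 3"
      using shift_continuous[OF T cont gG c, of "e / 3"] e by auto
    have "hdist (rep g u) (rep h u) < e" if h: "h \<in> U" for h
    proof -
      have hG: "h \<in> carrier G" using h U(1) openin_subset TG by blast
      note ts = translate_space[OF gG u] translate_space[OF hG u] translate_space[OF gG es] translate_space[OF hG es]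
      have "hdist (translate g u) (translate h u) \<le>
          hdist (translate g u) (translate g (ev (C n))) + hdist (translate g (ev (C n))) (translate h u)"
        using ts by (intro M.triangle)
      also have "\<dots> \<le> hdist (translate g u) (translate g (ev (C n))) +
          (hdist (translate g (ev (C n))) (translate h (ev (C n))) + hdist (translate h (ev (C n))) (translate h u))"
        using ts by (intro add_left_mono M.triangle)
      also have "hdist (translate g u) (translate g (ev (C n))) < e / 3"
        using dist_translate[OF gG u es] n by simp
      also have "hdist (translate h (ev (C n))) (translate h u) < e / 3"
        using dist_translate[OF hG es u] n M.commute[of u "ev (C n)"] by simp
      also have "hdist (translate g (ev (C n))) (translate h (ev (C n))) < e / 3"
      proof -
        have "translate g (ev (C n)) = ev (shift g (C n))" "translate h (ev (C n)) = ev (shift h (C n))"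
          using ev_shift[OF gG c] ev_shift[OF hG c] by auto
        then show ?thesis using dist_ev[OF comb_shift[OF gG c] comb_shift[OF hG c]] U(3) h nrm_csub_commute by metis
      qed
      finally show ?thesis using rep u by simp
    qed
    then show "\<exists>U. openin T U \<and> g \<in> U \<and> (\<forall>y\<in>U. hdist (rep g u) (rep y u) < e)" using U by blast
  qed
  moreover have "rep g (u \<oplus>\<^bsub>hilbert\<^esub> w) = rep g u \<oplus>\<^bsub>hilbert\<^esub> rep g w"
    if "g \<in> carrier G" "u \<in> hspace" "w \<in> hspace" for g u w
    using that translate_space space_add[OF that(2,3)] by (simp add: rep) (auto simp: translate_def)
  moreover have "rep g (z \<odot>\<^bsub>hilbert\<^esub> u) = z \<odot>\<^bsub>hilbert\<^esub> rep g u"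
    if "g \<in> carrier G" "u \<in> hspace" for g u z
    using that translate_space space_scale[OF that(2)] by (simp add: rep) (auto simp: translate_def)
  moreover have "ip (rep g u) (rep g w) = ip u w" if "g \<in> carrier G" "u \<in> hspace" "w \<in> hspace" for g u w
    using ip_translate[OF that] that by (simp add: rep)
  ultimately show ?thesis unfolding unitary_rep_def hilbert_simps(1) using rep_action by blast
qed

end

section \<open>Haar measure\<close>

locale lcsc = group G for G :: "'g monoid" (structure) +
  fixes T :: "'g topology"
  assumes lcsc: "lcsc_group G T"
begin

lemma top_group: "topological_group G T" and hausdorff: "Hausdorff_space T"
  and loc_compact: "locally_compact_space T" and sec_countable: "second_countable T"
  using lcsc unfolding lcsc_group_def by auto

lemma topspace_T [simp]: "topspace T = carrier G"
  using top_group unfolding topological_group_def by blast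

abbreviation lt :: "'g \<Rightarrow> 'g set \<Rightarrow> 'g set" where
  "lt g A \<equiv> (\<lambda>x. g \<otimes> x) ` A"

lemma continuous_lt: "g \<in> carrier G \<Longrightarrow> continuous_map T T (\<lambda>x. g \<otimes> x)"
  by (intro topological_group_mult[OF top_group]) auto

lemma lt_lt: "g \<in> carrier G \<Longrightarrow> h \<in> carrier G \<Longrightarrow> A \<subseteq> carrier G \<Longrightarrow> lt g (lt h A) = lt (g \<otimes> h) A"
  by (auto simp: image_image m_assoc subset_iff intro!: image_cong)

lemma lt_one: "A \<subseteq> carrier G \<Longrightarrow> lt \<one> A = A"
  by (auto simp: subset_iff image_iff)

lemma lt_subset: "g \<in> carrier G \<Longrightarrow> A \<subseteq> carrier G \<Longrightarrow> lt g A \<subseteq> carrier G"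
  by auto

lemma lt_inv: "g \<in> carrier G \<Longrightarrow> A \<subseteq> carrier G \<Longrightarrow> lt (inv g) (lt g A) = A"
  by (simp add: lt_lt lt_one)

lemma lt_eq_vimage:
  assumes "g \<in> carrier G" "A \<subseteq> carrier G" shows "lt g A = {x \<in> carrier G. inv g \<otimes> x \<in> A}"
proof (intro equalityI subsetI)
  fix x assume "x \<in> {x \<in> carrier G. inv g \<otimes> x \<in> A}"
  then have "x = g \<otimes> (inv g \<otimes> x)" "inv g \<otimes> x \<in> A" using assms(1) by (auto simp: m_assoc[symmetric])
  then show "x \<in> lt g A" by blast
next
  fix x assume "x \<in> lt g A"
  then obtain a where "a \<in> A" "x = g \<otimes> a" by blast
  then show "x \<in> {x \<in> carrier G. inv g \<otimes> x \<in> A}" using assms by (auto simp: m_assoc[symmetric])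
qed

lemma openin_carrier: "openin T U \<Longrightarrow> U \<subseteq> carrier G"
  using openin_subset by fastforce

lemma compactin_carrier: "compactin T K \<Longrightarrow> K \<subseteq> carrier G"
  using compactin_subset_topspace by fastforce

lemma openin_lt: assumes "g \<in> carrier G" "openin T U" shows "openin T (lt g U)"
  using openin_continuous_map_preimage[OF continuous_lt[of "inv g"] assms(2)] assms lt_eq_vimage[OF assms(1) openin_carrier]
  by simp

lemma compactin_lt: "g \<in> carrier G \<Longrightarrow> compactin T K \<Longrightarrow> compactin T (lt g K)"
  using image_compactin continuous_lt by blast

text \<open>
  Haar's index of \<open>K\<close> by \<open>V\<close>: the least number of left translates of \<open>V\<close> that cover \<open>K\<close>.
\<close>

definition covering :: "'g set \<Rightarrow> 'g set \<Rightarrow> nat" where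
  "covering V K = (LEAST n. \<exists>F. finite F \<and> F \<subseteq> carrier G \<and> card F = n \<and> K \<subseteq> (\<Union>g\<in>F. lt g V))"

lemma covering_attained:
  assumes "compactin T K" "openin T V" "\<one> \<in> V"
  obtains F where "finite F" "F \<subseteq> carrier G" "card F = covering V K" "K \<subseteq> (\<Union>g\<in>F. lt g V)"
proof -
  have KG: "K \<subseteq> carrier G" using assms(1) compactin_carrier by blast
  have "K \<subseteq> \<Union>((\<lambda>g. lt g V) ` K)"
  proof
    fix x assume "x \<in> K"
    moreover then have "x \<in> lt x V" using assms(3) KG by (auto intro!: image_eqI[of _ _ \<one>])
    ultimately show "x \<in> \<Union>((\<lambda>g. lt g V) ` K)" by blast
  qed
  moreover have "openin T U" if "U \<in> (\<lambda>g. lt g V) ` K" for U using that KG openin_lt assms(2) by blast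
  ultimately obtain \<F> where F: "finite \<F>" "\<F> \<subseteq> (\<lambda>g. lt g V) ` K" "K \<subseteq> \<Union>\<F>"
    using compactinD[OF assms(1)] by meson
  then obtain F where "finite F" "F \<subseteq> K" "\<F> = (\<lambda>g. lt g V) ` F" using finite_subset_image by metis
  then have "\<exists>F. finite F \<and> F \<subseteq> carrier G \<and> card F = card F \<and> K \<subseteq> (\<Union>g\<in>F. lt g V)" using F(3) KG by blast
  then have "\<exists>n. \<exists>F. finite F \<and> F \<subseteq> carrier G \<and> card F = n \<and> K \<subseteq> (\<Union>g\<in>F. lt g V)" by blast
  then have "\<exists>F. finite F \<and> F \<subseteq> carrier G \<and> card F = covering V K \<and> K \<subseteq> (\<Union>g\<in>F. lt g V)"
    unfolding covering_def by (rule LeastI_ex)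
  then show thesis using that by blast
qed

lemma covering_le: "finite F \<Longrightarrow> F \<subseteq> carrier G \<Longrightarrow> K \<subseteq> (\<Union>g\<in>F. lt g V) \<Longrightarrow> covering V K \<le> card F"
  unfolding covering_def by (rule Least_le) blast

lemma covering_empty: "covering V {} = 0"
  using covering_le[of "{}" "{}"] by simp

lemma covering_pos:
  assumes "compactin T K" "openin T V" "\<one> \<in> V" "K \<noteq> {}" shows "0 < covering V K"
proof -
  obtain F where F: "finite F" "card F = covering V K" "K \<subseteq> (\<Union>g\<in>F. lt g V)"
    using covering_attained[OF assms(1-3)] by metis
  then have "F \<noteq> {}" using assms(4) by auto
  then show ?thesis using F by (metis card_gt_0_iff)
qed

lemma covering_mono:
  assumes "compactin T L" "openin T V" "\<one> \<in> V" "K \<subseteq> L" shows "covering V K \<le> covering V L"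
proof -
  obtain F where F: "finite F" "F \<subseteq> carrier G" "card F = covering V L" "L \<subseteq> (\<Union>g\<in>F. lt g V)"
    using covering_attained[OF assms(1-3)] by metis
  then show ?thesis using covering_le[OF F(1,2), of K V] assms(4) by auto
qed

lemma covering_Un:
  assumes "compactin T K" "compactin T L" "openin T V" "\<one> \<in> V"
  shows "covering V (K \<union> L) \<le> covering V K + covering V L"
proof -
  obtain F where F: "finite F" "F \<subseteq> carrier G" "card F = covering V K" "K \<subseteq> (\<Union>g\<in>F. lt g V)"
    using covering_attained[OF assms(1,3,4)] by metis
  obtain F' where F': "finite F'" "F' \<subseteq> carrier G" "card F' = covering V L" "L \<subseteq> (\<Union>g\<in>F'. lt g V)"
    using covering_attained[OF assms(2-4)] by metis
  have "covering V (K \<union> L) \<le> card (F \<union> F')" using F F' by (intro covering_le) auto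
  also have "\<dots> \<le> card F + card F'" by (rule card_Un_le)
  finally show ?thesis using F F' by simp
qed

lemma covering_disjoint:
  assumes "compactin T K" "compactin T L" "openin T V" "\<one> \<in> V"
    and "\<And>g. g \<in> carrier G \<Longrightarrow> lt g V \<inter> K = {} \<or> lt g V \<inter> L = {}"
  shows "covering V (K \<union> L) = covering V K + covering V L"
proof (rule antisym[OF covering_Un[OF assms(1-4)]])
  obtain F where F: "finite F" "F \<subseteq> carrier G" "card F = covering V (K \<union> L)" "K \<union> L \<subseteq> (\<Union>g\<in>F. lt g V)"
    using covering_attained[OF compactin_Un[OF assms(1,2)] assms(3,4)] by metis
  let ?A = "{g \<in> F. lt g V \<inter> K \<noteq> {}}" and ?B = "{g \<in> F. lt g V \<inter> L \<noteq> {}}"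
  have meet: "M \<subseteq> (\<Union>g\<in>{g \<in> F. lt g V \<inter> M \<noteq> {}}. lt g V)" if M: "M \<subseteq> K \<union> L" for M
  proof
    fix x assume x: "x \<in> M"
    then obtain g where g: "g \<in> F" "x \<in> lt g V" using F(4) M by blast
    then have "lt g V \<inter> M \<noteq> {}" using x by blast
    then show "x \<in> (\<Union>g\<in>{g \<in> F. lt g V \<inter> M \<noteq> {}}. lt g V)" using g by (intro UN_I[of g]) simp_all
  qed
  have sub: "{g \<in> F. lt g V \<inter> M \<noteq> {}} \<subseteq> carrier G" "finite {g \<in> F. lt g V \<inter> M \<noteq> {}}" for M
    using F(1,2) by auto
  have "covering V K + covering V L \<le> card ?A + card ?B"
    by (intro add_mono covering_le[OF sub(2,1) meet]) simp_all
  also have "\<dots> = card (?A \<union> ?B)" using F(1,2) assms(5) by (intro card_Un_disjoint[symmetric]) auto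
  also have "\<dots> \<le> card F" using F(1) by (intro card_mono) auto
  finally show "covering V K + covering V L \<le> covering V (K \<union> L)" using F(3) by simp
qed

lemma covering_lt_le:
  assumes "compactin T K" "openin T V" "\<one> \<in> V" "g \<in> carrier G" shows "covering V (lt g K) \<le> covering V K"
proof -
  obtain F where F: "finite F" "F \<subseteq> carrier G" "card F = covering V K" "K \<subseteq> (\<Union>g\<in>F. lt g V)"
    using covering_attained[OF assms(1-3)] by metis
  have "lt g K \<subseteq> (\<Union>h\<in>(\<lambda>h. g \<otimes> h) ` F. lt h V)"
  proof
    fix x assume "x \<in> lt g K"
    then obtain k where k: "k \<in> K" "x = g \<otimes> k" by blast
    then obtain h v where h: "h \<in> F" "v \<in> V" "k = h \<otimes> v" using F(4) by blast
    have "h \<in> carrier G" "v \<in> carrier G" using h F(2) openin_carrier[OF assms(2)] by auto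
    then have "x = g \<otimes> h \<otimes> v" using k h assms(4) by (simp add: m_assoc)
    then show "x \<in> (\<Union>h\<in>(\<lambda>h. g \<otimes> h) ` F. lt h V)" using h by blast
  qed
  then have "covering V (lt g K) \<le> card ((\<lambda>h. g \<otimes> h) ` F)" using F(1,2) assms(4) by (intro covering_le) auto
  also have "\<dots> \<le> card F" by (rule card_image_le[OF F(1)])
  finally show ?thesis using F(3) by simp
qed

lemma covering_lt:
  assumes "compactin T K" "openin T V" "\<one> \<in> V" "g \<in> carrier G" shows "covering V (lt g K) = covering V K"
  using covering_lt_le[OF assms] covering_lt_le[OF compactin_lt[OF assms(4,1)] assms(2,3), of "inv g"]
    lt_inv[OF assms(4) compactin_carrier[OF assms(1)]] assms(4) by simp

lemma covering_compare:
  assumes "compactin T K" "openin T V" "\<one> \<in> V" "openin T U" "\<one> \<in> U" "compactin T A" "U \<subseteq> A"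
  shows "covering V K \<le> covering U K * covering V A"
proof -
  obtain F where F: "finite F" "F \<subseteq> carrier G" "card F = covering U K" "K \<subseteq> (\<Union>g\<in>F. lt g U)"
    using covering_attained[OF assms(1,4,5)] by metis
  obtain E where E: "finite E" "E \<subseteq> carrier G" "card E = covering V A" "A \<subseteq> (\<Union>g\<in>E. lt g V)"
    using covering_attained[OF assms(6,2,3)] by metis
  have "K \<subseteq> (\<Union>h\<in>(\<lambda>(g, h). g \<otimes> h) ` (F \<times> E). lt h V)"
  proof
    fix x assume "x \<in> K"
    then obtain g u where g: "g \<in> F" "u \<in> U" "x = g \<otimes> u" using F(4) by blast
    then obtain h v where h: "h \<in> E" "v \<in> V" "u = h \<otimes> v" using E(4) assms(7) by blast
    have "g \<in> carrier G" "h \<in> carrier G" "v \<in> carrier G" using g h F(2) E(2) openin_carrier[OF assms(2)] by auto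
    then have "x = g \<otimes> h \<otimes> v" using g h by (simp add: m_assoc)
    then show "x \<in> (\<Union>h\<in>(\<lambda>(g, h). g \<otimes> h) ` (F \<times> E). lt h V)" using g h by force
  qed
  then have "covering V K \<le> card ((\<lambda>(g, h). g \<otimes> h) ` (F \<times> E))" using F(1,2) E(1,2) by (intro covering_le) auto
  also have "\<dots> \<le> card (F \<times> E)" using F(1) E(1) by (intro card_image_le) auto
  finally show ?thesis using F(3) E(3) by (simp add: card_cartesian_product)
qed

lemma neighbourhood_base_one:
  obtains V :: "nat \<Rightarrow> 'g set" where "\<And>n. openin T (V n)" "\<And>n. \<one> \<in> V n"
    "\<And>m n. m \<le> n \<Longrightarrow> V n \<subseteq> V m" "\<And>U. openin T U \<Longrightarrow> \<one> \<in> U \<Longrightarrow> \<exists>n. V n \<subseteq> U"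
proof -
  obtain O' :: "nat \<Rightarrow> 'g set" where O': "\<And>n. openin T (O' n)"
    "\<And>U x. openin T U \<Longrightarrow> x \<in> U \<Longrightarrow> \<exists>n. x \<in> O' n \<and> O' n \<subseteq> U"
    using second_countable_base sec_countable by blast
  define V where "V = (\<lambda>n. topspace T \<inter> (\<Inter>m\<in>{m. m \<le> n \<and> \<one> \<in> O' m}. O' m))"
  show thesis
  proof
    show "openin T (V n)" for n unfolding V_def using O'(1) by (auto intro!: openin_Int_Inter simp del: topspace_T)
    show "\<one> \<in> V n" for n unfolding V_def by simp
    show "V n \<subseteq> V m" if "m \<le> n" for m n unfolding V_def using that by auto
    show "\<exists>n. V n \<subseteq> U" if U: "openin T U" "\<one> \<in> U" for U
    proof -
      obtain m where "\<one> \<in> O' m" "O' m \<subseteq> U" using O'(2) U by blast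
      then have "V m \<subseteq> U" unfolding V_def by blast
      then show ?thesis by blast
    qed
  qed
qed

text \<open>
  The compact set of all \<open>inv x \<otimes> y\<close> with \<open>x\<close> in \<open>K\<close> and \<open>y\<close> in \<open>L\<close> does not contain the
  unit.
\<close>

lemma separating_neighbourhood:
  assumes "compactin T K" "compactin T L" "K \<inter> L = {}"
  obtains U where "openin T U" "\<one> \<in> U" "\<And>g V. g \<in> carrier G \<Longrightarrow> V \<subseteq> U \<Longrightarrow> lt g V \<inter> K = {} \<or> lt g V \<inter> L = {}"
proof -
  have KG: "K \<subseteq> carrier G" "L \<subseteq> carrier G" using assms compactin_carrier by auto
  have 1: "continuous_map (prod_topology T T) T (\<lambda>p. inv (fst p) \<otimes> snd p)"
    by (intro topological_group_mult[OF top_group] topological_group_inv[OF top_group] continuous_map_fst continuous_map_snd)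
  then have "compactin T ((\<lambda>p. inv (fst p) \<otimes> snd p) ` (K \<times> L))"
    using assms by (intro image_compactin[OF _ 1]) (simp add: compactin_Times)
  then have "closedin T ((\<lambda>p. inv (fst p) \<otimes> snd p) ` (K \<times> L))" using hausdorff compactin_imp_closedin by blast
  then have W: "openin T (carrier G - (\<lambda>p. inv (fst p) \<otimes> snd p) ` (K \<times> L))" (is "openin T ?W")
    using openin_diff[OF openin_topspace] by fastforce
  have W1: "\<one> \<in> ?W"
  proof -
    have "inv x \<otimes> y \<noteq> \<one>" if "x \<in> K" "y \<in> L" for x y
      using that assms(3) KG by (metis IntI empty_iff inv_closed inv_equality inv_inv subsetD)
    then have "\<one> \<notin> (\<lambda>p. inv (fst p) \<otimes> snd p) ` (K \<times> L)" by (metis (no_types, lifting) SigmaE fst_conv imageE snd_conv)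
    then show ?thesis by simp
  qed
  define P where "P = {p \<in> topspace (prod_topology T T). inv (fst p) \<otimes> snd p \<in> ?W}"
  have P: "openin (prod_topology T T) P" unfolding P_def by (rule openin_continuous_map_preimage[OF 1 W])
  have 11: "(\<one>, \<one>) \<in> P" using W1 unfolding P_def by simp
  obtain A B where AB: "openin T A" "openin T B" "\<one> \<in> A" "\<one> \<in> B" "A \<times> B \<subseteq> P"
    using openin_prod_topology_alt[THEN iffD1, rule_format, OF P 11] by (elim exE conjE)
  show thesis
  proof
    show "openin T (A \<inter> B)" "\<one> \<in> A \<inter> B" using AB by auto
    fix g V assume gV: "g \<in> carrier G" "V \<subseteq> A \<inter> B"
    show "lt g V \<inter> K = {} \<or> lt g V \<inter> L = {}"
    proof (rule ccontr)
      assume "\<not> ?thesis"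
      then obtain v w where vw: "v \<in> V" "w \<in> V" "g \<otimes> v \<in> K" "g \<otimes> w \<in> L" by blast
      then have G: "v \<in> carrier G" "w \<in> carrier G" using gV AB openin_carrier by blast+
      have "inv (g \<otimes> v) \<otimes> (g \<otimes> w) = inv v \<otimes> w"
        using gV G by (simp add: inv_mult_group m_assoc) (simp add: m_assoc[symmetric])
      moreover have "(v, w) \<in> P" using vw gV AB(5) by blast
      then have "inv v \<otimes> w \<notin> (\<lambda>p. inv (fst p) \<otimes> snd p) ` (K \<times> L)" unfolding P_def by simp
      moreover have "inv (g \<otimes> v) \<otimes> (g \<otimes> w) \<in> (\<lambda>p. inv (fst p) \<otimes> snd p) ` (K \<times> L)"
        using vw(3,4) by (intro image_eqI[of _ _ "(g \<otimes> v, g \<otimes> w)"]) auto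
      ultimately show False by simp
    qed
  qed
qed

end

locale haar_content = lcsc +
  fixes c :: "'a set \<Rightarrow> real"
  assumes content_nonneg: "compactin T K \<Longrightarrow> 0 \<le> c K"
    and content_empty: "c {} = 0"
    and content_nontrivial: "\<exists>A. compactin T A \<and> c A = 1"
    and content_mono: "compactin T K \<Longrightarrow> compactin T L \<Longrightarrow> K \<subseteq> L \<Longrightarrow> c K \<le> c L"
    and content_Un: "compactin T K \<Longrightarrow> compactin T L \<Longrightarrow> c (K \<union> L) \<le> c K + c L"
    and content_disjoint: "compactin T K \<Longrightarrow> compactin T L \<Longrightarrow> K \<inter> L = {} \<Longrightarrow> c (K \<union> L) = c K + c L"
    and content_lt: "g \<in> carrier G \<Longrightarrow> compactin T K \<Longrightarrow> c (lt g K) = c K"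

lemma cluster_point_closed:
  assumes "inf (nhds l) (filtermap f sequentially) \<noteq> bot" "closed C" "\<forall>\<^sub>F n in sequentially. f n \<in> C"
  shows "l \<in> C"
proof (rule ccontr)
  assume "l \<notin> C"
  then have "\<forall>\<^sub>F x in nhds l. x \<in> - C" using assms(2) by (intro eventually_nhds_in_open) auto
  moreover have "\<forall>\<^sub>F x in filtermap f sequentially. x \<in> C" using assms(3) by (simp add: eventually_filtermap)
  ultimately have "\<forall>\<^sub>F x in inf (nhds l) (filtermap f sequentially). False"
    unfolding eventually_inf by (intro exI[of _ "\<lambda>x. x \<in> - C"] exI[of _ "\<lambda>x. x \<in> C"]) auto
  then show False using assms(1) trivial_limit_def by blast
qed

text \<open>
  The quotients of \<open>covering (V n) K\<close> by \<open>covering (V n) A\<close>, for a fixed compact neighbourhood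
  \<open>A\<close> of the unit and shrinking \<open>V n\<close>, lie in a product of compact intervals and have a cluster
  point. It inherits each closed condition on finitely many coordinates that the quotients
  eventually satisfy.
\<close>

lemma (in lcsc) exists_haar_content: "\<exists>c. haar_content G T c"
proof -
  obtain V :: "nat \<Rightarrow> 'g set" where V: "\<And>n. openin T (V n)" "\<And>n. \<one> \<in> V n"
    "\<And>m n. m \<le> n \<Longrightarrow> V n \<subseteq> V m" "\<And>U. openin T U \<Longrightarrow> \<one> \<in> U \<Longrightarrow> \<exists>n. V n \<subseteq> U"
    using neighbourhood_base_one by blast
  obtain U A where A: "openin T U" "compactin T A" "\<one> \<in> U" "U \<subseteq> A"
    using loc_compact one_closed unfolding locally_compact_space_def topspace_T by blast
  define r where "r = (\<lambda>n K. if compactin T K then real (covering (V n) K) / real (covering (V n) A) else 0)"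
  define b where "b = (\<lambda>K. if compactin T K then real (covering U K) else 0)"
  have Apos: "0 < covering (V n) A" for n using covering_pos[OF A(2) V(1,2)] A by blast
  have "r n K \<in> {0..b K}" for n K
  proof (cases "compactin T K")
    case True
    have "real (covering (V n) K) \<le> real (covering U K) * real (covering (V n) A)"
      using covering_compare[OF True V(1,2) A(1,3,2,4), of n] by (simp flip: of_nat_mult)
    then show ?thesis using True Apos[of n] unfolding r_def b_def by (simp add: field_simps)
  qed (simp add: r_def b_def)
  then have rS: "r n \<in> (\<Pi>\<^sub>E K\<in>UNIV. {0..b K})" for n by auto
  have "compactin (product_topology (\<lambda>_. euclidean) UNIV) (\<Pi>\<^sub>E K\<in>UNIV. {0..b K})"
    unfolding compactin_PiE by simp
  then have "compact (\<Pi>\<^sub>E K\<in>UNIV. {0..b K})" by (simp add: euclidean_product_topology)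
  then obtain c where c: "inf (nhds c) (filtermap r sequentially) \<noteq> bot"
    unfolding compact_filter using rS
    by (metis (no_types, lifting) always_eventually eventually_filtermap filtermap_bot_iff sequentially_bot)
  note lim = cluster_point_closed[OF c]
  have coord: "continuous_on UNIV (\<lambda>f :: 'g set \<Rightarrow> real. f K)" for K by simp
  have "0 \<le> c K" if "compactin T K" for K
  proof -
    have "c \<in> {f. 0 \<le> f K}" by (intro lim closed_Collect_le coord continuous_on_const) (simp add: r_def)
    then show ?thesis by simp
  qed
  moreover have "c {} = 0"
  proof -
    have "c \<in> {f. f {} = 0}" by (intro lim closed_Collect_eq coord continuous_on_const) (simp add: r_def covering_empty)
    then show ?thesis by simp
  qed
  moreover have "c A = 1"
  proof -
    have "c \<in> {f. f A = 1}" using A(2) Apos by (intro lim closed_Collect_eq coord continuous_on_const) (simp add: r_def)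
    then show ?thesis by simp
  qed
  moreover have "c K \<le> c L" if KL: "compactin T K" "compactin T L" "K \<subseteq> L" for K L
  proof -
    have "r n K \<le> r n L" for n using covering_mono[OF KL(2) V(1,2) KL(3), of n] KL unfolding r_def by (simp add: divide_right_mono)
    then have "c \<in> {f. f K \<le> f L}" by (intro lim closed_Collect_le coord) simp
    then show ?thesis by simp
  qed
  moreover have "c (K \<union> L) \<le> c K + c L" if KL: "compactin T K" "compactin T L" for K L
  proof -
    have "r n (K \<union> L) \<le> r n K + r n L" for n
      using covering_Un[OF KL V(1,2), of n] KL compactin_Un[OF KL] unfolding r_def
      by (simp add: add_divide_distrib[symmetric] divide_right_mono)
    then have "c \<in> {f. f (K \<union> L) \<le> f K + f L}" by (intro lim closed_Collect_le coord continuous_on_add) simp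
    then show ?thesis by simp
  qed
  moreover have "c (K \<union> L) = c K + c L" if KL: "compactin T K" "compactin T L" "K \<inter> L = {}" for K L
  proof -
    obtain W where W: "openin T W" "\<one> \<in> W" "\<And>g V. g \<in> carrier G \<Longrightarrow> V \<subseteq> W \<Longrightarrow> lt g V \<inter> K = {} \<or> lt g V \<inter> L = {}"
      using separating_neighbourhood[OF KL] by blast
    obtain N where N: "V N \<subseteq> W" using V(4)[OF W(1,2)] by blast
    have "r n (K \<union> L) = r n K + r n L" if "n \<ge> N" for n
    proof -
      have "V n \<subseteq> W" using V(3)[OF that] N by blast
      then have "covering (V n) (K \<union> L) = covering (V n) K + covering (V n) L"
        using W(3) by (intro covering_disjoint[OF KL(1,2) V(1,2)]) blast
      then show ?thesis using KL compactin_Un[OF KL(1,2)] unfolding r_def by (simp add: add_divide_distrib)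
    qed
    then have "\<forall>\<^sub>F n in sequentially. r n \<in> {f. f (K \<union> L) = f K + f L}" unfolding eventually_sequentially by auto
    then have "c \<in> {f. f (K \<union> L) = f K + f L}" by (intro lim closed_Collect_eq coord continuous_on_add)
    then show ?thesis by simp
  qed
  moreover have "c (lt g K) = c K" if gK: "g \<in> carrier G" "compactin T K" for g K
  proof -
    have "r n (lt g K) = r n K" for n
      using covering_lt[OF gK(2) V(1,2) gK(1), of n] gK compactin_lt unfolding r_def by simp
    then have "c \<in> {f. f (lt g K) = f K}" by (intro lim closed_Collect_eq coord) simp
    then show ?thesis by simp
  qed
  ultimately have "haar_content G T c" using A(2) by unfold_locales blast+
  then show ?thesis by blast
qed

lemma measurable_borel_of_continuous:
  assumes "continuous_map T S f" shows "f \<in> borel_of T \<rightarrow>\<^sub>M borel_of S"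
proof -
  have "f \<in> borel_of T \<rightarrow>\<^sub>M sigma (topspace S) {U. openin S U}"
  proof (rule measurable_measure_of)
    show "{U. openin S U} \<subseteq> Pow (topspace S)" using openin_subset by auto
    show "f \<in> space (borel_of T) \<rightarrow> topspace S" using assms by (auto simp: space_borel_of continuous_map_def)
    fix U assume "U \<in> {U. openin S U}"
    then have "openin T {x \<in> topspace T. f x \<in> U}" using assms by (intro openin_continuous_map_preimage) auto
    moreover have "f -` U \<inter> space (borel_of T) = {x \<in> topspace T. f x \<in> U}" by (auto simp: space_borel_of)
    ultimately show "f -` U \<inter> space (borel_of T) \<in> sets (borel_of T)" unfolding sets_borel_of by (auto intro: sigma_sets.Basic)
  qed
  then show ?thesis unfolding borel_of_def .
qed

context lcsc
begin

lemma compactin_closedin: "compactin T K \<Longrightarrow> closedin T K"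
  using hausdorff compactin_imp_closedin by blast

lemma openin_minus_compact: "openin T U \<Longrightarrow> compactin T K \<Longrightarrow> openin T (U - K)"
  using openin_diff compactin_closedin by blast

lemma compact_neighbourhood:
  assumes "openin T U" "x \<in> U"
  obtains W K where "openin T W" "compactin T K" "x \<in> W" "W \<subseteq> K" "K \<subseteq> U"
proof -
  have "neighbourhood_base_of (compactin T) T"
    using loc_compact hausdorff locally_compact_space_neighbourhood_base by blast
  then show thesis using that assms unfolding neighbourhood_base_of by (metis (no_types, lifting))
qed

lemma compactin_finite_UN: "finite I \<Longrightarrow> (\<And>i. i \<in> I \<Longrightarrow> compactin T (K i)) \<Longrightarrow> compactin T (\<Union>i\<in>I. K i)"
  by (induction I rule: finite_induct) (auto intro: compactin_Un)

lemma compact_decomposition: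
  fixes U :: "nat \<Rightarrow> 'g set"
  assumes K: "compactin T K" "K \<subseteq> (\<Union>i. U i)" and U: "\<And>i. openin T (U i)"
  obtains I L where "finite I" "\<And>i. compactin T (L i)" "\<And>i. L i \<subseteq> U i" "K = (\<Union>i\<in>I. L i)"
proof -
  have "\<exists>i W C. x \<in> W \<and> openin T W \<and> compactin T C \<and> W \<subseteq> C \<and> C \<subseteq> U i" if x: "x \<in> K" for x
  proof -
    obtain i where "x \<in> U i" using x K(2) by blast
    then show ?thesis using compact_neighbourhood[OF U] by metis
  qed
  then obtain i W C where *: "\<And>x. x \<in> K \<Longrightarrow> x \<in> W x \<and> openin T (W x) \<and> compactin T (C x) \<and> W x \<subseteq> C x \<and> C x \<subseteq> U (i x)"
    by metis
  then have "K \<subseteq> \<Union>(W ` K)" "\<And>V. V \<in> W ` K \<Longrightarrow> openin T V" by blast+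
  then obtain \<F> where "finite \<F>" "\<F> \<subseteq> W ` K" "K \<subseteq> \<Union>\<F>" using compactinD[OF K(1)] by meson
  then obtain F where F: "finite F" "F \<subseteq> K" "K \<subseteq> (\<Union>x\<in>F. W x)" using finite_subset_image by metis
  define L where "L = (\<lambda>j. K \<inter> (\<Union>x\<in>{x \<in> F. i x = j}. C x))"
  show thesis
  proof
    show "finite (i ` F)" using F(1) by simp
    show "compactin T (L j)" for j
      unfolding L_def using F * by (intro compact_Int_closedin K(1) compactin_closedin compactin_finite_UN) auto
    show "L j \<subseteq> U j" for j unfolding L_def using F * by blast
    show "K = (\<Union>j\<in>i ` F. L j)"
    proof
      show "K \<subseteq> (\<Union>j\<in>i ` F. L j)"
      proof
        fix x assume x: "x \<in> K"
        then obtain y where "y \<in> F" "x \<in> W y" using F(3) by blast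
        then have "x \<in> L (i y)" unfolding L_def using x F * by blast
        then show "x \<in> (\<Union>j\<in>i ` F. L j)" using \<open>y \<in> F\<close> by blast
      qed
    qed (auto simp: L_def)
  qed
qed

lemma open_borel: "openin T U \<Longrightarrow> U \<in> sets (borel_of T)"
  unfolding sets_borel_of by (intro sigma_sets.Basic) simp

lemma compact_borel: assumes "compactin T K" shows "K \<in> sets (borel_of T)"
proof -
  have "openin T (carrier G - K)" using openin_minus_compact[OF openin_topspace assms] by simp
  then have "space (borel_of T) - (carrier G - K) \<in> sets (borel_of T)" by (intro sets.compl_sets open_borel)
  moreover have "space (borel_of T) - (carrier G - K) = K" using compactin_carrier[OF assms] by (auto simp: space_borel_of)
  ultimately show ?thesis by simp
qed

lemma lt_borel: assumes "g \<in> carrier G" "E \<in> sets (borel_of T)" shows "lt g E \<in> sets (borel_of T)"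
proof -
  have EG: "E \<subseteq> carrier G" using sets.sets_into_space[OF assms(2)] by (simp add: space_borel_of)
  have "(\<lambda>x. inv g \<otimes> x) \<in> borel_of T \<rightarrow>\<^sub>M borel_of T"
    by (rule measurable_borel_of_continuous[OF continuous_lt]) (use assms in simp)
  from measurable_sets[OF this assms(2)]
  show ?thesis unfolding lt_eq_vimage[OF assms(1) EG] by (simp add: space_borel_of vimage_def Int_def conj_commute)
qed

end

context haar_content
begin

definition inner :: "'a set \<Rightarrow> ennreal" where
  "inner U = (SUP K\<in>{K. compactin T K \<and> K \<subseteq> U}. ennreal (c K))"

definition outer :: "'a set \<Rightarrow> ennreal" where
  "outer E = (INF U\<in>{U. openin T U \<and> E \<subseteq> U}. inner U)"

lemma content_le_inner: "compactin T K \<Longrightarrow> K \<subseteq> U \<Longrightarrow> ennreal (c K) \<le> inner U"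
  unfolding inner_def by (rule SUP_upper) simp

lemma inner_mono: "U \<subseteq> W \<Longrightarrow> inner U \<le> inner W"
  unfolding inner_def by (rule SUP_subset_mono) auto

lemma outer_le_inner: "openin T U \<Longrightarrow> E \<subseteq> U \<Longrightarrow> outer E \<le> inner U"
  unfolding outer_def by (rule INF_lower) simp

lemma outer_open: "openin T U \<Longrightarrow> outer U = inner U"
  by (rule antisym[OF outer_le_inner]) (auto simp: outer_def intro!: INF_greatest inner_mono)

lemma outer_mono: "E \<subseteq> F \<Longrightarrow> outer E \<le> outer F"
  unfolding outer_def by (rule INF_superset_mono) auto

lemma content_finite_UN:
  assumes "finite I" "\<And>i. compactin T (L i)"
  shows "ennreal (c (\<Union>i\<in>I. L i)) \<le> (\<Sum>i\<in>I. ennreal (c (L i)))"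
  using assms(1)
proof (induction I rule: finite_induct)
  case (insert i I)
  have cp: "compactin T (\<Union>i\<in>I. L i)" using insert(1) assms(2) by (intro compactin_finite_UN)
  have "ennreal (c (\<Union>i\<in>insert i I. L i)) \<le> ennreal (c (L i) + c (\<Union>i\<in>I. L i))"
    using content_Un[OF assms(2) cp, of i] by (simp add: ennreal_leI)
  also have "\<dots> = ennreal (c (L i)) + ennreal (c (\<Union>i\<in>I. L i))"
    using content_nonneg assms(2) cp by (intro ennreal_plus) auto
  also have "\<dots> \<le> ennreal (c (L i)) + (\<Sum>i\<in>I. ennreal (c (L i)))" using insert.IH by (intro add_left_mono)
  finally show ?case using insert by simp
qed (simp add: content_empty)

lemma inner_UN:
  assumes "\<And>i::nat. openin T (U i)" shows "inner (\<Union>i. U i) \<le> (\<Sum>i. inner (U i))"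
  unfolding inner_def[of "\<Union>i. U i"]
proof (rule SUP_least)
  fix K assume "K \<in> {K. compactin T K \<and> K \<subseteq> (\<Union>i. U i)}"
  then have K: "compactin T K" "K \<subseteq> (\<Union>i. U i)" by auto
  obtain I L where L: "finite I" "\<And>i. compactin T (L i)" "\<And>i. L i \<subseteq> U i" "K = (\<Union>i\<in>I. L i)"
    using compact_decomposition[OF K assms] by metis
  have "ennreal (c K) \<le> (\<Sum>i\<in>I. ennreal (c (L i)))" unfolding L(4) by (rule content_finite_UN[OF L(1,2)])
  also have "\<dots> \<le> (\<Sum>i\<in>I. inner (U i))" using L by (intro sum_mono content_le_inner)
  also have "\<dots> \<le> (\<Sum>i. inner (U i))" using L(1) by (intro sum_le_suminf) auto
  finally show "ennreal (c K) \<le> (\<Sum>i. inner (U i))" .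
qed

lemma outer_measure: "outer_measure_space (Pow (carrier G)) outer"
  unfolding outer_measure_space_def
proof (intro conjI)
  have "inner {} = 0"
  proof -
    have "inner {} \<le> 0" unfolding inner_def by (rule SUP_least) (simp add: content_empty)
    then show ?thesis by simp
  qed
  then have "outer {} = 0" using outer_open[of "{}"] by simp
  then show "positive (Pow (carrier G)) outer" unfolding positive_def by simp
  show "increasing (Pow (carrier G)) outer" unfolding increasing_def using outer_mono by blast
  show "countably_subadditive (Pow (carrier G)) outer"
    unfolding countably_subadditive_def
  proof (intro allI impI)
    fix A :: "nat \<Rightarrow> 'a set" assume A: "range A \<subseteq> Pow (carrier G)"
    show "outer (\<Union>i. A i) \<le> (\<Sum>i. outer (A i))"
    proof (rule ennreal_le_epsilon)
      fix e :: real assume fin: "(\<Sum>i. outer (A i)) < top_class.top" and e: "0 < e"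
      have "\<exists>U. openin T U \<and> A i \<subseteq> U \<and> inner U \<le> outer (A i) + ennreal (e * (1 / 2) ^ Suc i)" for i
      proof -
        have "outer (A i) < top_class.top" using fin by (rule ennreal_suminf_lessD)
        then have "outer (A i) < outer (A i) + ennreal (e * (1 / 2) ^ Suc i)" using e by simp
        then obtain U where "openin T U" "A i \<subseteq> U" "inner U < outer (A i) + ennreal (e * (1 / 2) ^ Suc i)"
          unfolding outer_def[of "A i"] INF_less_iff by auto
        then show ?thesis by (auto intro: less_imp_le)
      qed
      then obtain U where U: "\<And>i. openin T (U i)" "\<And>i. A i \<subseteq> U i"
        "\<And>i. inner (U i) \<le> outer (A i) + ennreal (e * (1 / 2) ^ Suc i)" by metis
      have "outer (\<Union>i. A i) \<le> inner (\<Union>i. U i)" using U by (intro outer_le_inner openin_Union) auto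
      also have "\<dots> \<le> (\<Sum>i. inner (U i))" by (rule inner_UN[OF U(1)])
      also have "\<dots> \<le> (\<Sum>i. outer (A i) + ennreal (e * (1 / 2) ^ Suc i))" using U(3) by (intro suminf_le) auto
      also have "\<dots> = (\<Sum>i. outer (A i)) + (\<Sum>i. ennreal (e * (1 / 2) ^ Suc i))" by (intro suminf_add[symmetric]) auto
      also have "(\<Sum>i. ennreal (e * (1 / 2) ^ Suc i)) = ennreal e"
        using e sums_mult[OF power_half_series, of e] by (intro suminf_ennreal_eq) auto
      finally show "outer (\<Union>i. A i) \<le> (\<Sum>i. outer (A i)) + ennreal e" .
    qed
  qed
qed

lemma outer_Un: assumes "A \<subseteq> carrier G" "B \<subseteq> carrier G" "A \<inter> B = {}" shows "outer (A \<union> B) \<le> outer A + outer B"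
proof -
  interpret P: sigma_algebra "carrier G" "Pow (carrier G)" by (rule sigma_algebra_Pow)
  have "subadditive (Pow (carrier G)) outer"
    using outer_measure P.countably_subadditive_subadditive unfolding outer_measure_space_def by blast
  then show ?thesis using assms unfolding subadditive_def by blast
qed

lemma inner_split:
  assumes U: "openin T U" and W: "openin T W" shows "inner (U \<inter> W) + outer (W - U) \<le> inner W"
proof -
  have "ennreal (c K) + outer (W - U) \<le> inner W" if K: "compactin T K" "K \<subseteq> U \<inter> W" for K
  proof -
    have "outer (W - U) \<le> inner (W - K)" using K by (intro outer_le_inner openin_minus_compact W) auto
    moreover have "ennreal (c K) + inner (W - K) \<le> inner W"
    proof -
      have "ennreal (c K) + inner (W - K) = (SUP L\<in>{L. compactin T L \<and> L \<subseteq> W - K}. ennreal (c K) + ennreal (c L))"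
        unfolding inner_def[of "W - K"] by (rule ennreal_SUP_add_right) (auto intro: exI[of _ "{}"])
      also have "\<dots> \<le> inner W"
      proof (rule SUP_least)
        fix L assume L: "L \<in> {L. compactin T L \<and> L \<subseteq> W - K}"
        then have "c (K \<union> L) = c K + c L" using content_disjoint[OF K(1), of L] by auto
        then have "ennreal (c K) + ennreal (c L) = ennreal (c (K \<union> L))"
          using content_nonneg K(1) L by simp
        also have "\<dots> \<le> inner W" using L K by (intro content_le_inner compactin_Un) auto
        finally show "ennreal (c K) + ennreal (c L) \<le> inner W" .
      qed
      finally show ?thesis .
    qed
    ultimately show ?thesis by (meson add_left_mono order_trans)
  qed
  then have "(SUP K\<in>{K. compactin T K \<and> K \<subseteq> U \<inter> W}. ennreal (c K) + outer (W - U)) \<le> inner W"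
    by (intro SUP_least) auto
  moreover have "inner (U \<inter> W) + outer (W - U) = (SUP K\<in>{K. compactin T K \<and> K \<subseteq> U \<inter> W}. ennreal (c K) + outer (W - U))"
    unfolding inner_def[of "U \<inter> W"] by (rule ennreal_SUP_add_left[symmetric]) (auto intro: exI[of _ "{}"])
  ultimately show ?thesis by simp
qed

text \<open>
  Caratheodory's condition for open sets, by which the outer measure is a measure on the Borel
  sets.
\<close>

lemma open_lambda_system: assumes U: "openin T U" shows "U \<in> lambda_system (carrier G) (Pow (carrier G)) outer"
  unfolding lambda_system_def
proof (intro CollectI conjI ballI)
  show "U \<in> Pow (carrier G)" using openin_carrier U by blast
  fix E assume E: "E \<in> Pow (carrier G)"
  have "outer (U \<inter> E) + outer ((carrier G - U) \<inter> E) \<le> outer E"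
    unfolding outer_def[of E]
  proof (rule INF_greatest)
    fix W assume "W \<in> {W. openin T W \<and> E \<subseteq> W}"
    then have W: "openin T W" "E \<subseteq> W" by auto
    have "outer (U \<inter> E) + outer ((carrier G - U) \<inter> E) \<le> inner (U \<inter> W) + outer (W - U)"
      using W U by (intro add_mono outer_le_inner outer_mono openin_Int) auto
    also have "\<dots> \<le> inner W" by (rule inner_split[OF U W(1)])
    finally show "outer (U \<inter> E) + outer ((carrier G - U) \<inter> E) \<le> inner W" .
  qed
  moreover have "outer E \<le> outer (U \<inter> E) + outer ((carrier G - U) \<inter> E)"
  proof -
    have "E = (U \<inter> E) \<union> ((carrier G - U) \<inter> E)" using E by blast
    then have "outer E = outer ((U \<inter> E) \<union> ((carrier G - U) \<inter> E))" by simp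
    also have "\<dots> \<le> outer (U \<inter> E) + outer ((carrier G - U) \<inter> E)" using E by (intro outer_Un) auto
    finally show ?thesis .
  qed
  ultimately show "outer (U \<inter> E) + outer ((carrier G - U) \<inter> E) = outer E" by (rule antisym)
qed

definition haar :: "'a measure" where
  "haar = measure_of (carrier G) {U. openin T U} outer"

lemma space_haar: "space haar = carrier G"
  unfolding haar_def by (rule space_measure_of) (use openin_carrier in blast)

lemma sets_haar: "sets haar = sets (borel_of T)"
  unfolding haar_def sets_borel_of topspace_T by (rule sets_measure_of) (use openin_carrier in blast)

lemma emeasure_haar: assumes "E \<in> sets (borel_of T)" shows "emeasure haar E = outer E"
proof -
  let ?L = "lambda_system (carrier G) (Pow (carrier G)) outer"
  have "measure_space (carrier G) ?L outer"
    using sigma_algebra.caratheodory_lemma[OF sigma_algebra_Pow outer_measure] .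
  then have L: "sigma_algebra (carrier G) ?L" "positive ?L outer" "countably_additive ?L outer"
    unfolding measure_space_def by auto
  have sub: "sigma_sets (carrier G) {U. openin T U} \<subseteq> ?L"
    by (rule sigma_algebra.sigma_sets_subset[OF L(1)]) (use open_lambda_system in blast)
  have S: "sets haar = sigma_sets (carrier G) {U. openin T U}" using sets_haar unfolding sets_borel_of by simp
  show ?thesis
  proof (rule emeasure_measure_of[OF haar_def])
    show "{U. openin T U} \<subseteq> Pow (carrier G)" using openin_carrier by blast
    show "positive (sets haar) outer" using L(2) S sub unfolding positive_def by simp
    show "countably_additive (sets haar) outer" using L(3) S sub unfolding countably_additive_def by blast
    show "E \<in> sets haar" using assms sets_haar by simp
  qed
qed

lemma outer_lt_le: assumes "g \<in> carrier G" "E \<subseteq> carrier G" shows "outer (lt g E) \<le> outer E"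
  unfolding outer_def[of E]
proof (rule INF_greatest)
  fix U assume "U \<in> {U. openin T U \<and> E \<subseteq> U}"
  then have U: "openin T U" "E \<subseteq> U" by auto
  have "outer (lt g E) \<le> inner (lt g U)" using U assms by (intro outer_le_inner openin_lt) auto
  also have "\<dots> \<le> inner U" unfolding inner_def[of "lt g U"]
  proof (rule SUP_least)
    fix K assume K: "K \<in> {K. compactin T K \<and> K \<subseteq> lt g U}"
    then have "compactin T (lt (inv g) K)" using assms compactin_lt by simp
    moreover have "lt (inv g) K \<subseteq> U"
      using K lt_inv[OF assms(1) openin_carrier[OF U(1)]] by blast
    ultimately have "ennreal (c (lt (inv g) K)) \<le> inner U" by (rule content_le_inner)
    then show "ennreal (c K) \<le> inner U" using content_lt[of "inv g" K] K assms by simp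
  qed
  finally show "outer (lt g E) \<le> inner U" .
qed

lemma outer_lt: assumes "g \<in> carrier G" "E \<subseteq> carrier G" shows "outer (lt g E) = outer E"
  using outer_lt_le[OF assms] outer_lt_le[of "inv g" "lt g E"] lt_inv[OF assms] lt_subset[OF assms] assms(1)
  by simp

lemma haar_lt: assumes "g \<in> carrier G" "E \<in> sets (borel_of T)" shows "emeasure haar (lt g E) = emeasure haar E"
proof -
  have EG: "E \<subseteq> carrier G" using sets.sets_into_space[OF assms(2)] by (simp add: space_borel_of)
  show ?thesis using emeasure_haar lt_borel[OF assms] assms(2) outer_lt[OF assms(1) EG] by simp
qed

lemma haar_open: "openin T U \<Longrightarrow> emeasure haar U = inner U"
  using emeasure_haar open_borel outer_open by simp

lemma haar_compact_ge: assumes "compactin T K" shows "ennreal (c K) \<le> emeasure haar K"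
  unfolding emeasure_haar[OF compact_borel[OF assms]] outer_def
  by (rule INF_greatest) (use assms content_le_inner in auto)

lemma haar_nonzero: "emeasure haar (carrier G) \<noteq> 0"
proof -
  obtain A where A: "compactin T A" "c A = 1" using content_nontrivial by blast
  have "1 \<le> emeasure haar A" using haar_compact_ge[OF A(1)] A(2) by simp
  also have "\<dots> \<le> emeasure haar (carrier G)"
    using compactin_carrier[OF A(1)] sets_haar open_borel[OF openin_topspace] by (intro emeasure_mono) auto
  finally show ?thesis by auto
qed

lemma haar_sigma_finite: "sigma_finite_measure haar"
proof -
  obtain O' :: "nat \<Rightarrow> 'a set" where O': "\<And>n. openin T (O' n)"
    "\<And>U x. openin T U \<Longrightarrow> x \<in> U \<Longrightarrow> \<exists>n. x \<in> O' n \<and> O' n \<subseteq> U"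
    using second_countable_base sec_countable by blast
  let ?A = "{O' n |n. \<exists>K. compactin T K \<and> O' n \<subseteq> K}"
  show ?thesis
  proof
    have "?A \<subseteq> range O'" by blast
    then have "countable ?A" by (rule countable_subset) simp
    moreover have "?A \<subseteq> sets haar" using O'(1) open_borel sets_haar by auto
    moreover have "\<Union>?A = space haar"
    proof
      show "\<Union>?A \<subseteq> space haar" using O'(1) openin_carrier space_haar by blast
      show "space haar \<subseteq> \<Union>?A"
      proof
        fix x assume "x \<in> space haar"
        then have "x \<in> topspace T" using space_haar by simp
        then obtain W K where W: "openin T W" "compactin T K" "x \<in> W" "W \<subseteq> K"
          using compact_neighbourhood[OF openin_topspace] by metis
        then obtain n where "x \<in> O' n" "O' n \<subseteq> W" using O'(2) by blast
        then have "O' n \<in> ?A" using W by blast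
        then show "x \<in> \<Union>?A" using \<open>x \<in> O' n\<close> by blast
      qed
    qed
    moreover have "emeasure haar a \<noteq> \<infinity>" if aA: "a \<in> ?A" for a
    proof -
      obtain n K where a: "a = O' n" "compactin T K" "O' n \<subseteq> K" using aA by blast
      have "emeasure haar a = inner (O' n)" using a O'(1) emeasure_haar open_borel outer_open by simp
      also have "\<dots> \<le> ennreal (c K)"
        unfolding inner_def by (rule SUP_least) (use a content_mono in \<open>auto intro: ennreal_leI\<close>)
      finally show ?thesis by (auto simp: top_unique)
    qed
    ultimately show "\<exists>A. countable A \<and> A \<subseteq> sets haar \<and> \<Union>A = space haar \<and> (\<forall>a\<in>A. emeasure haar a \<noteq> \<infinity>)"
      by (intro exI[of _ ?A] conjI ballI)
  qed
qed

lemma compact_translate_nbhd: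
  assumes K: "compactin T K" and U: "openin T U" "K \<subseteq> U"
  obtains W where "openin T W" "\<one> \<in> W" "\<And>w x. w \<in> W \<Longrightarrow> x \<in> K \<Longrightarrow> w \<otimes> x \<in> U"
proof -
  have m: "continuous_map (prod_topology T T) T (\<lambda>p. fst p \<otimes> snd p)"
    by (intro topological_group_mult[OF top_group] continuous_map_fst continuous_map_snd)
  define P where "P = {p \<in> topspace (prod_topology T T). fst p \<otimes> snd p \<in> U}"
  have P: "openin (prod_topology T T) P" unfolding P_def by (rule openin_continuous_map_preimage[OF m U(1)])
  have "\<exists>A B. openin T A \<and> openin T B \<and> \<one> \<in> A \<and> x \<in> B \<and> A \<times> B \<subseteq> P" if "x \<in> K" for x
  proof -
    have "x \<in> U" "x \<in> carrier G" using that U(2) compactin_carrier[OF K] by auto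
    then have "(\<one>, x) \<in> P" unfolding P_def by simp
    then show ?thesis using openin_prod_topology_alt[THEN iffD1, rule_format, OF P] by blast
  qed
  then obtain A B where AB: "\<And>x. x \<in> K \<Longrightarrow> openin T (A x) \<and> openin T (B x) \<and> \<one> \<in> A x \<and> x \<in> B x \<and> A x \<times> B x \<subseteq> P" by metis
  then have "K \<subseteq> \<Union>(B ` K)" "\<And>V. V \<in> B ` K \<Longrightarrow> openin T V" by blast+
  then obtain \<F> where "finite \<F>" "\<F> \<subseteq> B ` K" "K \<subseteq> \<Union>\<F>" using compactinD[OF K] by meson
  then obtain F where F: "finite F" "F \<subseteq> K" "K \<subseteq> (\<Union>x\<in>F. B x)" using finite_subset_image by metis
  show thesis
  proof
    show "openin T (topspace T \<inter> (\<Inter>x\<in>F. A x))"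
      using F AB openin_topspace[of T] by (intro openin_Int_Inter) auto
    show "\<one> \<in> topspace T \<inter> (\<Inter>x\<in>F. A x)" using F AB by auto
    fix w x assume w: "w \<in> topspace T \<inter> (\<Inter>x\<in>F. A x)" and x: "x \<in> K"
    obtain y where y: "y \<in> F" "x \<in> B y" using F x by blast
    then have "(w, x) \<in> P" using w AB[of y] F(2) by blast
    then show "w \<otimes> x \<in> U" unfolding P_def by simp
  qed
qed

text \<open>
  Choose \<open>K\<close> and \<open>U\<close> with \<open>K\<close> compact, \<open>U\<close> open containing both \<open>E\<close> and \<open>K\<close>, and both \<open>U - E\<close>
  and \<open>U - K\<close> small. If \<open>inv w\<close> maps \<open>K\<close> into \<open>U\<close>, a point of \<open>E\<close> outside the translate lies in
  \<open>U - K\<close> or in the translate of \<open>U - E\<close>.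
\<close>

theorem translation_continuous:
  assumes E: "E \<in> sets (borel_of T)" "emeasure haar E \<noteq> \<infinity>" and w: "\<And>n. w n \<in> carrier G"
    and lim: "\<And>U. openin T U \<Longrightarrow> \<one> \<in> U \<Longrightarrow> \<forall>\<^sub>F n in sequentially. w n \<in> U"
  shows "(\<lambda>n. emeasure haar (E - lt (w n) E)) \<longlonglongrightarrow> 0"
proof (rule order_tendstoI)
  fix a :: ennreal assume "0 < a"
  then obtain b where "0 < b" "b < a" using dense by blast
  then obtain e where e: "0 < e" "ennreal e < a" by (cases b) auto
  then have e2: "0 < e / 2" by simp
  define d where "d = ennreal (e / 2)"
  have d: "d + d < a" using e unfolding d_def by (simp flip: ennreal_plus)
  have EG: "E \<subseteq> carrier G" using sets.sets_into_space[OF E(1)] by (simp add: space_borel_of)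
  obtain U where U: "openin T U" "E \<subseteq> U" "inner U < outer E + d"
    using INF_approx_ennreal[OF e2 outer_def[of E]] E emeasure_haar unfolding d_def by auto
  have fin: "emeasure haar U \<noteq> \<infinity>" using U(3) haar_open[OF U(1)] by (auto simp: top_unique)
  have ne: "{K. compactin T K \<and> K \<subseteq> U} \<noteq> {}" by (auto intro: exI[of _ "{}"])
  obtain K where K: "compactin T K" "K \<subseteq> U" "inner U < ennreal (c K) + d"
    using SUP_approx_ennreal[OF e2 ne inner_def[of U]] fin haar_open[OF U(1)] unfolding d_def by auto
  have sets: "U \<in> sets haar" "E \<in> sets haar" "K \<in> sets haar"
    using sets_haar E U(1) K(1) open_borel compact_borel by auto
  have UE: "emeasure haar (U - E) \<le> d"
    using U E sets emeasure_haar haar_open by (simp add: emeasure_Diff ennreal_minus_le_iff less_imp_le)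
  have Kfin: "emeasure haar K \<noteq> \<infinity>" using emeasure_mono[OF K(2) sets(1)] fin by (auto simp: top_unique)
  have "inner U \<le> emeasure haar K + d" using K(3) haar_compact_ge[OF K(1)] by (meson add_right_mono less_imp_le order_trans)
  then have UK: "emeasure haar (U - K) \<le> d"
    using U K Kfin sets haar_open by (simp add: emeasure_Diff ennreal_minus_le_iff)
  obtain W where W: "openin T W" "\<one> \<in> W" "\<And>w x. w \<in> W \<Longrightarrow> x \<in> K \<Longrightarrow> w \<otimes> x \<in> U"
    using compact_translate_nbhd[OF K(1) U(1) K(2)] by blast
  have "openin T {x \<in> topspace T. inv x \<in> W}"
    by (rule openin_continuous_map_preimage[OF topological_group_inv[OF top_group] W(1)]) simp
  then have "\<forall>\<^sub>F n in sequentially. w n \<in> {x \<in> topspace T. inv x \<in> W}" by (rule lim) (use W(2) in simp)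
  then show "\<forall>\<^sub>F n in sequentially. emeasure haar (E - lt (w n) E) < a"
  proof eventually_elim
    case (elim n)
    have "E - lt (w n) E \<subseteq> (U - K) \<union> lt (w n) (U - E)"
    proof
      fix x assume x: "x \<in> E - lt (w n) E"
      then have eq: "x = w n \<otimes> (inv (w n) \<otimes> x)" using w EG by (auto simp: m_assoc[symmetric])
      then have "inv (w n) \<otimes> x \<notin> E" using x by blast
      then show "x \<in> (U - K) \<union> lt (w n) (U - E)" using eq x U(2) elim W(3)[of "inv (w n)" x] by blast
    qed
    note sub = this
    have UEb: "U - E \<in> sets (borel_of T)" using sets sets_haar by auto
    have s: "U - K \<in> sets haar" "lt (w n) (U - E) \<in> sets haar" using sets lt_borel[OF w UEb] sets_haar by auto
    have "emeasure haar (E - lt (w n) E) \<le> emeasure haar ((U - K) \<union> lt (w n) (U - E))"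
      by (rule emeasure_mono[OF sub]) (use s in simp)
    also have "\<dots> \<le> emeasure haar (U - K) + emeasure haar (lt (w n) (U - E))" by (rule emeasure_subadditive[OF s])
    also have "emeasure haar (lt (w n) (U - E)) = emeasure haar (U - E)" by (rule haar_lt[OF w UEb])
    also have "emeasure haar (U - K) + \<dots> \<le> d + d" using UK UE by (rule add_mono)
    finally show ?case using d by (rule le_less_trans)
  qed
qed simp

end

section \<open>Cocycles acting on a countable set\<close>

text \<open>
  An action of \<open>G\<close> on the product of \<open>\<Omega>\<close> and the countable set \<open>D\<close> over the given action
  on \<open>\<Omega>\<close>.
\<close>

locale discrete_cocycle = lcsc G T for G :: "'g monoid" (structure) and T :: "'g topology" +
  fixes \<Omega> :: "'w measure" and act :: "'g \<Rightarrow> 'w \<Rightarrow> 'w" and D :: "'v set" and a :: "'g \<Rightarrow> 'w \<Rightarrow> 'v \<Rightarrow> 'v"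
  assumes prob: "prob_space \<Omega>" and standard: "standard_borel \<Omega>"
    and act_action: "group_action G (space \<Omega>) act"
    and act_measurable: "(\<lambda>(g, w). act g w) \<in> borel_of T \<Otimes>\<^sub>M \<Omega> \<rightarrow>\<^sub>M \<Omega>"
    and act_preserving: "g \<in> carrier G \<Longrightarrow> distr \<Omega> \<Omega> (act g) = \<Omega>"
    and D_countable: "countable D"
    and a_closed: "g \<in> carrier G \<Longrightarrow> w \<in> space \<Omega> \<Longrightarrow> x \<in> D \<Longrightarrow> a g w x \<in> D"
    and a_mult: "g \<in> carrier G \<Longrightarrow> h \<in> carrier G \<Longrightarrow> w \<in> space \<Omega> \<Longrightarrow> x \<in> D \<Longrightarrow>
                   a (g \<otimes> h) w x = a g (act h w) (a h w x)"
    and a_one: "w \<in> space \<Omega> \<Longrightarrow> x \<in> D \<Longrightarrow> a \<one> w x = x"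
    and a_measurable: "x \<in> D \<Longrightarrow> y \<in> D \<Longrightarrow>
                   {p \<in> space (borel_of T \<Otimes>\<^sub>M \<Omega>). a (fst p) (snd p) x = y} \<in> sets (borel_of T \<Otimes>\<^sub>M \<Omega>)"

sublocale discrete_cocycle \<subseteq> prob_space \<Omega> by (rule prob)
sublocale discrete_cocycle \<subseteq> action: group_action G "space \<Omega>" act by (rule act_action)

context discrete_cocycle
begin

lemma space_borel_T [simp]: "space (borel_of T) = carrier G"
  by (simp add: space_borel_of)

lemma act_space [simp]: "g \<in> carrier G \<Longrightarrow> w \<in> space \<Omega> \<Longrightarrow> act g w \<in> space \<Omega>"
  by (rule action.element_image) auto

lemma act_mult: "g \<in> carrier G \<Longrightarrow> h \<in> carrier G \<Longrightarrow> w \<in> space \<Omega> \<Longrightarrow> act (g \<otimes> h) w = act g (act h w)"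
  using action.composition_rule by simp

lemma act_one: "w \<in> space \<Omega> \<Longrightarrow> act \<one> w = w"
  using action.id_eq_one by (metis restrict_apply')

lemma act_inv [simp]: "g \<in> carrier G \<Longrightarrow> w \<in> space \<Omega> \<Longrightarrow> act (inv g) (act g w) = w"
  using act_mult[of "inv g" g w] act_one by simp

lemma act_inv' [simp]: "g \<in> carrier G \<Longrightarrow> w \<in> space \<Omega> \<Longrightarrow> act g (act (inv g) w) = w"
  using act_mult[of g "inv g" w] act_one by simp

lemma a_inv: "g \<in> carrier G \<Longrightarrow> w \<in> space \<Omega> \<Longrightarrow> x \<in> D \<Longrightarrow> a (inv g) (act g w) (a g w x) = x"
  using a_mult[of "inv g" g w x] a_one by simp

lemma a_inv': "g \<in> carrier G \<Longrightarrow> w \<in> space \<Omega> \<Longrightarrow> x \<in> D \<Longrightarrow> a g w (a (inv g) (act g w) x) = x"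
  using a_mult[of g "inv g" "act g w" x] a_one by simp

lemma a_bij: "g \<in> carrier G \<Longrightarrow> w \<in> space \<Omega> \<Longrightarrow> bij_betw (a g w) D D"
  by (rule bij_betw_byWitness[of _ "a (inv g) (act g w)"]) (auto simp: a_inv a_inv' a_closed)

lemma act_measurable1: "g \<in> carrier G \<Longrightarrow> act g \<in> \<Omega> \<rightarrow>\<^sub>M \<Omega>"
  using measurable_compose[OF measurable_Pair1'[of g "borel_of T" \<Omega>] act_measurable] by simp

lemma AE_act: assumes "g \<in> carrier G" "AE w in \<Omega>. P w" shows "AE w in \<Omega>. P (act g w)"
proof -
  have "AE w in distr \<Omega> \<Omega> (act g). P w" by (subst act_preserving[OF assms(1)]) (rule assms(2))
  then show ?thesis by (rule AE_distrD[OF act_measurable1[OF assms(1)]])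
qed

lemma measure_act:
  assumes "g \<in> carrier G" "{w \<in> space \<Omega>. P w} \<in> sets \<Omega>"
  shows "measure \<Omega> {w \<in> space \<Omega>. P (act g w)} = measure \<Omega> {w \<in> space \<Omega>. P w}"
proof -
  have "measure (distr \<Omega> \<Omega> (act g)) {w \<in> space \<Omega>. P w} = measure \<Omega> (act g -` {w \<in> space \<Omega>. P w} \<inter> space \<Omega>)"
    by (rule measure_distr[OF act_measurable1[OF assms(1)] assms(2)])
  moreover have "act g -` {w \<in> space \<Omega>. P w} \<inter> space \<Omega> = {w \<in> space \<Omega>. P (act g w)}" using assms(1) by auto
  ultimately show ?thesis using act_preserving[OF assms(1)] by simp
qed

lemma integral_act:
  fixes f :: "'w \<Rightarrow> real"
  assumes "g \<in> carrier G" "f \<in> borel_measurable \<Omega>" shows "(\<integral>w. f (act g w) \<partial>\<Omega>) = (\<integral>w. f w \<partial>\<Omega>)"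
  using integral_distr[OF act_measurable1[OF assms(1)] assms(2)] act_preserving[OF assms(1)] by simp

lemma a_measurable1: assumes "g \<in> carrier G" "x \<in> D" shows "(\<lambda>w. a g w x) \<in> \<Omega> \<rightarrow>\<^sub>M count_space D"
proof (subst measurable_count_space_eq_countable[OF D_countable], intro conjI ballI)
  show "(\<lambda>w. a g w x) \<in> space \<Omega> \<rightarrow> D" using a_closed assms by auto
  fix y assume y: "y \<in> D"
  have "(\<lambda>w. a g w x) -` {y} \<inter> space \<Omega> = Pair g -` {p \<in> space (borel_of T \<Otimes>\<^sub>M \<Omega>). a (fst p) (snd p) x = y}"
    using assms(1) by (auto simp: space_pair_measure)
  then show "(\<lambda>w. a g w x) -` {y} \<inter> space \<Omega> \<in> sets \<Omega>" using sets_Pair1[OF a_measurable[OF assms(2) y]] by simp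
qed

text \<open>The function takes the value of \<open>C\<close> at \<open>inv g . w\<close> and transports it back to \<open>w\<close>.\<close>

lemma pulled_measurable:
  assumes C: "C \<in> \<Omega> \<rightarrow>\<^sub>M count_space D"
  shows "(\<lambda>p. a (snd p) (act (inv (snd p)) (fst p)) (C (act (inv (snd p)) (fst p)))) \<in> \<Omega> \<Otimes>\<^sub>M borel_of T \<rightarrow>\<^sub>M count_space D"
proof -
  have CD: "C w \<in> D" if "w \<in> space \<Omega>" for w using measurable_space[OF C that] by simp
  have inv_m: "(\<lambda>g. inv g) \<in> borel_of T \<rightarrow>\<^sub>M borel_of T"
    by (rule measurable_borel_of_continuous[OF topological_group_inv[OF top_group]]) simp
  have i: "(\<lambda>p. (inv (snd p), fst p)) \<in> \<Omega> \<Otimes>\<^sub>M borel_of T \<rightarrow>\<^sub>M borel_of T \<Otimes>\<^sub>M \<Omega>"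
    using measurable_compose[OF measurable_snd inv_m] by (intro measurable_Pair measurable_fst)
  have act': "(\<lambda>p. act (inv (snd p)) (fst p)) \<in> \<Omega> \<Otimes>\<^sub>M borel_of T \<rightarrow>\<^sub>M \<Omega>"
    using measurable_compose[OF i act_measurable] by simp
  have pr: "(\<lambda>p. (snd p, act (inv (snd p)) (fst p))) \<in> \<Omega> \<Otimes>\<^sub>M borel_of T \<rightarrow>\<^sub>M borel_of T \<Otimes>\<^sub>M \<Omega>"
    by (intro measurable_Pair measurable_snd act')
  have "(\<lambda>p. a (snd p) (act (inv (snd p)) (fst p)) z) \<in> \<Omega> \<Otimes>\<^sub>M borel_of T \<rightarrow>\<^sub>M count_space D" if z: "z \<in> D" for z
  proof (subst measurable_count_space_eq_countable[OF D_countable], intro conjI ballI)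
    show "(\<lambda>p. a (snd p) (act (inv (snd p)) (fst p)) z) \<in> space (\<Omega> \<Otimes>\<^sub>M borel_of T) \<rightarrow> D"
      using a_closed z by (auto simp: space_pair_measure)
    fix y assume "y \<in> D"
    from measurable_sets[OF pr a_measurable[OF z this]]
    show "(\<lambda>p. a (snd p) (act (inv (snd p)) (fst p)) z) -` {y} \<inter> space (\<Omega> \<Otimes>\<^sub>M borel_of T) \<in> sets (\<Omega> \<Otimes>\<^sub>M borel_of T)"
      by (rule back_subst[of "\<lambda>S. S \<in> _"]) (auto simp: space_pair_measure)
  qed
  from measurable_compose_countable'[OF this measurable_compose[OF act' C] D_countable] show ?thesis .
qed

end

locale metric_cocycle = discrete_cocycle G T \<Omega> act D a
  for G :: "'g monoid" (structure) and T :: "'g topology" and \<Omega> :: "'w measure" and act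
    and D :: "'v set" and a :: "'g \<Rightarrow> 'w \<Rightarrow> 'v \<Rightarrow> 'v" +
  fixes d :: "'v \<Rightarrow> 'v \<Rightarrow> nat" and base :: 'v
  assumes base: "base \<in> D"
    and d_refl: "x \<in> D \<Longrightarrow> d x x = 0"
    and d_commute: "x \<in> D \<Longrightarrow> y \<in> D \<Longrightarrow> d x y = d y x"
    and d_triangle: "x \<in> D \<Longrightarrow> y \<in> D \<Longrightarrow> z \<in> D \<Longrightarrow> d x z \<le> d x y + d y z"
    and d_invariant: "g \<in> carrier G \<Longrightarrow> w \<in> space \<Omega> \<Longrightarrow> x \<in> D \<Longrightarrow> y \<in> D \<Longrightarrow> d (a g w x) (a g w y) = d x y"
    and d_negative_type: "snd ` set c \<subseteq> D \<Longrightarrow> 0 < t \<Longrightarrow> 0 \<le> Re (kernel_form (\<lambda>x y. exp (- (t * real (d x y)))) c c)"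
begin

text \<open>
  The base point at \<open>inv g . w\<close>, transported to \<open>w\<close>; it satisfies the equivariance \<open>orb_mult\<close>.
\<close>

definition orb :: "'g \<Rightarrow> 'w \<Rightarrow> 'v" where
  "orb g w = a g (act (inv g) w) base"

definition K :: "real \<Rightarrow> 'v \<Rightarrow> 'v \<Rightarrow> real" where
  "K t x y = exp (- (t * real (d x y)))"

definition Psi :: "real \<Rightarrow> 'g \<Rightarrow> 'g \<Rightarrow> real" where
  "Psi t g h = (\<integral>w. K t (orb g w) (orb h w) \<partial>\<Omega>)"

lemma K_bounds: "0 \<le> t \<Longrightarrow> 0 \<le> K t x y \<and> K t x y \<le> 1"
  unfolding K_def by simp

lemma K_refl: "x \<in> D \<Longrightarrow> K t x x = 1"
  unfolding K_def by (simp add: d_refl)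

lemma K_commute: "x \<in> D \<Longrightarrow> y \<in> D \<Longrightarrow> K t x y = K t y x"
  unfolding K_def by (simp add: d_commute)

lemma K_invariant:
  "g \<in> carrier G \<Longrightarrow> w \<in> space \<Omega> \<Longrightarrow> x \<in> D \<Longrightarrow> y \<in> D \<Longrightarrow> K t (a g w x) (a g w y) = K t x y"
  unfolding K_def by (simp add: d_invariant)

lemma orb_closed: "g \<in> carrier G \<Longrightarrow> w \<in> space \<Omega> \<Longrightarrow> orb g w \<in> D"
  unfolding orb_def using a_closed base by simp

lemma orb_one: "w \<in> space \<Omega> \<Longrightarrow> orb \<one> w = base"
  unfolding orb_def using a_one act_one base by simp

lemma orb_mult:
  assumes "g \<in> carrier G" "h \<in> carrier G" "w \<in> space \<Omega>" shows "orb (g \<otimes> h) (act g w) = a g w (orb h w)"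
proof -
  have "act (inv (g \<otimes> h)) (act g w) = act (inv h) w"
    using assms by (simp add: inv_mult_group act_mult)
  then show ?thesis unfolding orb_def using assms base a_mult[of g h "act (inv h) w" base] by simp
qed

lemma orb_act: "g \<in> carrier G \<Longrightarrow> w \<in> space \<Omega> \<Longrightarrow> orb g (act g w) = a g w base"
  unfolding orb_def by simp

lemma orb_measurable: "g \<in> carrier G \<Longrightarrow> orb g \<in> \<Omega> \<rightarrow>\<^sub>M count_space D"
  unfolding orb_def
  using measurable_compose[OF act_measurable1[of "inv g"] a_measurable1[of g base]] base by simp

lemma pair_function_measurable:
  fixes F :: "'v \<Rightarrow> 'v \<Rightarrow> real"
  assumes "u \<in> M \<rightarrow>\<^sub>M count_space D" "v \<in> M \<rightarrow>\<^sub>M count_space D"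
  shows "(\<lambda>w. F (u w) (v w)) \<in> borel_measurable M"
proof (rule measurable_compose_countable'[OF _ assms(1) D_countable])
  show "(\<lambda>w. F i (v w)) \<in> borel_measurable M" for i
    by (rule measurable_compose[OF assms(2)]) simp
qed

lemma K_orb_measurable: "g \<in> carrier G \<Longrightarrow> h \<in> carrier G \<Longrightarrow> (\<lambda>w. K t (orb g w) (orb h w)) \<in> borel_measurable \<Omega>"
  by (intro pair_function_measurable orb_measurable)

lemma K_orb_integrable:
  assumes "0 \<le> t" "g \<in> carrier G" "h \<in> carrier G" shows "integrable \<Omega> (\<lambda>w. K t (orb g w) (orb h w))"
  by (rule integrable_const_bound[of _ 1]) (use assms K_orb_measurable K_bounds in auto)

lemma Psi_invariant:
  assumes "g \<in> carrier G" "x \<in> carrier G" "y \<in> carrier G" shows "Psi t (g \<otimes> x) (g \<otimes> y) = Psi t x y"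
proof -
  have "Psi t (g \<otimes> x) (g \<otimes> y) = (\<integral>w. K t (orb (g \<otimes> x) (act g w)) (orb (g \<otimes> y) (act g w)) \<partial>\<Omega>)"
    unfolding Psi_def using assms by (intro integral_act[symmetric] K_orb_measurable) auto
  also have "\<dots> = Psi t x y"
    unfolding Psi_def using assms by (intro Bochner_Integration.integral_cong refl) (simp add: orb_mult K_invariant orb_closed)
  finally show ?thesis .
qed

lemma Psi_one:
  assumes "g \<in> carrier G" shows "Psi t g \<one> = (\<integral>w. K t (a g w base) base \<partial>\<Omega>)"
proof -
  have "Psi t g \<one> = (\<integral>w. K t (orb g (act g w)) (orb \<one> (act g w)) \<partial>\<Omega>)"
    unfolding Psi_def using assms by (intro integral_act[symmetric] K_orb_measurable) auto
  also have "\<dots> = (\<integral>w. K t (a g w base) base \<partial>\<Omega>)"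
    using assms by (intro Bochner_Integration.integral_cong refl) (simp add: orb_act orb_one)
  finally show ?thesis .
qed

lemma Psi_one_one: "Psi t \<one> \<one> = 1"
  unfolding Psi_one[OF one_closed] by (simp add: a_one base K_refl prob_space cong: Bochner_Integration.integral_cong)

lemma kernel_form_integral:
  assumes "\<And>g h. g \<in> snd ` set c \<Longrightarrow> h \<in> snd ` set e \<Longrightarrow> integrable \<Omega> (\<lambda>w. f g h w)"
  shows "integrable \<Omega> (\<lambda>w. kernel_form (\<lambda>g h. f g h w) c e) \<and>
    (\<integral>w. kernel_form (\<lambda>g h. f g h w) c e \<partial>\<Omega>) = kernel_form (\<lambda>g h. (\<integral>w. f g h w \<partial>\<Omega>)) c e"
  using assms
proof (induction c)
  case (Cons p c)
  have "integrable \<Omega> (\<lambda>w. kernel_form (\<lambda>g h. f g h w) [p] e) \<and>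
    (\<integral>w. kernel_form (\<lambda>g h. f g h w) [p] e \<partial>\<Omega>) = kernel_form (\<lambda>g h. (\<integral>w. f g h w \<partial>\<Omega>)) [p] e"
    using Cons.prems
  proof (induction e)
    case (Cons q e)
    have *: "integrable \<Omega> (\<lambda>w. of_real (f (snd p) (snd q) w) :: complex)" using Cons.prems by simp
    have s: "kernel_form k [p] [q] = fst p * cnj (fst q) * of_real (k (snd p) (snd q))" for k
      by (cases p; cases q) (simp add: kernel_form_single)
    have i: "integrable \<Omega> (\<lambda>w. kernel_form (\<lambda>g h. f g h w) [p] [q])" unfolding s using * by simp
    have v: "(\<integral>w. kernel_form (\<lambda>g h. f g h w) [p] [q] \<partial>\<Omega>) = kernel_form (\<lambda>g h. (\<integral>w. f g h w \<partial>\<Omega>)) [p] [q]"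
      unfolding s using * by simp
    have "integrable \<Omega> (\<lambda>w. kernel_form (\<lambda>g h. f g h w) [p] e) \<and>
      (\<integral>w. kernel_form (\<lambda>g h. f g h w) [p] e \<partial>\<Omega>) = kernel_form (\<lambda>g h. (\<integral>w. f g h w \<partial>\<Omega>)) [p] e"
      using Cons by simp
    then show ?case unfolding kernel_form_Cons(2)[of _ "[p]" q e] using i v by simp
  qed simp
  moreover have "integrable \<Omega> (\<lambda>w. kernel_form (\<lambda>g h. f g h w) c e) \<and>
    (\<integral>w. kernel_form (\<lambda>g h. f g h w) c e \<partial>\<Omega>) = kernel_form (\<lambda>g h. (\<integral>w. f g h w \<partial>\<Omega>)) c e"
    using Cons by simp
  ultimately show ?case unfolding kernel_form_Cons(1)[of _ p c e] by simp
qed simp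

text \<open>The restriction to the fibre over \<open>w\<close> of a combination of group elements.\<close>

definition combo :: "(complex \<times> 'g) list \<Rightarrow> 'w \<Rightarrow> (complex \<times> 'v) list" where
  "combo c w = map (apsnd (\<lambda>g. orb g w)) c"

lemma Psi_form:
  assumes "0 \<le> t" "snd ` set c \<subseteq> carrier G" "snd ` set e \<subseteq> carrier G"
  shows "integrable \<Omega> (\<lambda>w. kernel_form (K t) (combo c w) (combo e w))"
    "(\<integral>w. kernel_form (K t) (combo c w) (combo e w) \<partial>\<Omega>) = kernel_form (Psi t) c e"
  using kernel_form_integral[of c e "\<lambda>g h w. K t (orb g w) (orb h w)"] K_orb_integrable[OF assms(1)] assms(2,3)
  unfolding combo_def kernel_form_pullback Psi_def by blast+

lemma combo_D: "snd ` set c \<subseteq> carrier G \<Longrightarrow> w \<in> space \<Omega> \<Longrightarrow> snd ` set (combo c w) \<subseteq> D"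
  unfolding combo_def using orb_closed by auto

lemma pos_kernel_K: assumes "0 < t" shows "pos_kernel D (K t)"
proof
  show "K t x y = K t y x" if "x \<in> D" "y \<in> D" for x y using K_commute that by blast
  have "K t = (\<lambda>x y. exp (- (t * real (d x y))))" by (intro ext) (simp add: K_def)
  then show "0 \<le> Re (kernel_form (K t) c c)" if "snd ` set c \<subseteq> D" for c using d_negative_type[OF that assms] by simp
qed

lemma invariant_kernel_Psi: assumes t: "0 < t" shows "invariant_kernel G (Psi t)"
proof
  fix x y assume xy: "x \<in> carrier G" "y \<in> carrier G"
  then show "Psi t x y = Psi t y x"
    unfolding Psi_def by (intro Bochner_Integration.integral_cong refl K_commute orb_closed)
next
  interpret KD: pos_kernel D "K t" by (rule pos_kernel_K[OF t])
  fix c :: "(complex \<times> 'g) list" assume c: "snd ` set c \<subseteq> carrier G"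
  note P = Psi_form[OF less_imp_le[OF t] c c]
  have "Re (kernel_form (Psi t) c c) = (\<integral>w. Re (kernel_form (K t) (combo c w) (combo c w)) \<partial>\<Omega>)"
    unfolding P(2)[symmetric] using P(1) by simp
  also have "\<dots> \<ge> 0" using KD.pos combo_D[OF c] by (intro integral_nonneg_AE) auto
  finally show "0 \<le> Re (kernel_form (Psi t) c c)" .
qed (use Psi_invariant in blast)

definition disp :: "'g \<Rightarrow> real" where
  "disp g = measure \<Omega> {w \<in> space \<Omega>. a g w base \<noteq> base}"

lemma moved_sets: "g \<in> carrier G \<Longrightarrow> {w \<in> space \<Omega>. a g w base \<noteq> base} \<in> sets \<Omega>"
proof -
  assume g: "g \<in> carrier G"
  have "(\<lambda>w. a g w base) -` (D - {base}) \<inter> space \<Omega> \<in> sets \<Omega>"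
    by (rule measurable_sets[OF a_measurable1[OF g base]]) simp
  moreover have "(\<lambda>w. a g w base) -` (D - {base}) \<inter> space \<Omega> = {w \<in> space \<Omega>. a g w base \<noteq> base}"
    using a_closed[OF g _ base] by auto
  ultimately show ?thesis by simp
qed

lemma disagree_sets:
  assumes "u \<in> M \<rightarrow>\<^sub>M count_space D" "v \<in> M \<rightarrow>\<^sub>M count_space D"
  shows "{w \<in> space M. u w \<noteq> v w} \<in> sets M"
proof -
  have "(\<lambda>w. if u w = v w then 0 else 1 :: real) -` {1} \<inter> space M \<in> sets M"
    by (rule measurable_sets[OF pair_function_measurable[OF assms]]) simp
  moreover have "(\<lambda>w. if u w = v w then 0 else 1 :: real) -` {1} \<inter> space M = {w \<in> space M. u w \<noteq> v w}"
    by auto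
  ultimately show ?thesis by simp
qed

lemma orb_differ:
  assumes "g \<in> carrier G" "h \<in> carrier G"
  shows "measure \<Omega> {w \<in> space \<Omega>. orb h w \<noteq> orb g w} = disp (inv g \<otimes> h)"
proof -
  let ?k = "inv g \<otimes> h"
  have k: "?k \<in> carrier G" using assms by simp
  have h: "h = g \<otimes> ?k" using assms by (simp add: m_assoc[symmetric])
  have s: "{w \<in> space \<Omega>. orb h w \<noteq> orb g w} \<in> sets \<Omega>"
    using orb_measurable assms by (intro disagree_sets) auto
  have "measure \<Omega> {w \<in> space \<Omega>. orb h w \<noteq> orb g w} = measure \<Omega> {w \<in> space \<Omega>. orb h (act h w) \<noteq> orb g (act h w)}"
    by (rule measure_act[OF assms(2) s, symmetric])
  also have "{w \<in> space \<Omega>. orb h (act h w) \<noteq> orb g (act h w)} = {w \<in> space \<Omega>. a ?k w base \<noteq> base}"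
  proof -
    have "orb h (act h w) \<noteq> orb g (act h w) \<longleftrightarrow> a ?k w base \<noteq> base" if w: "w \<in> space \<Omega>" for w
    proof -
      have ah: "act h w = act g (act ?k w)" using act_mult[OF assms(1) k w] h by simp
      have "orb h (act h w) = a g (act ?k w) (a ?k w base)"
        using orb_mult[OF assms(1) k, of "act ?k w"] orb_act[OF k w] h ah k w by simp
      moreover have "orb g (act h w) = a g (act ?k w) base"
        using orb_mult[OF assms(1) one_closed, of "act ?k w"] orb_one[of "act ?k w"] ah k w assms(1) by simp
      moreover have "inj_on (a g (act ?k w)) D" using a_bij[OF assms(1), of "act ?k w"] k w unfolding bij_betw_def by simp
      ultimately show ?thesis using a_closed[OF k w base] base by (simp add: inj_on_eq_iff)
    qed
    then show ?thesis by blast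
  qed
  finally show ?thesis unfolding disp_def .
qed

text \<open>
  For fixed \<open>w\<close> the sets of those \<open>g\<close>, in a set \<open>A\<close> of finite positive Haar measure, with a
  given value of \<open>orb (inv g) w\<close> form a countable partition of \<open>A\<close>. By \<open>translation_continuous\<close>
  and dominated convergence, the part of \<open>A\<close> where a small translation changes the value has
  small measure. Integrated over \<open>w\<close>, this measure is \<open>disp\<close> of the translation times the
  measure of \<open>A\<close>.
\<close>

lemma disp_small:
  assumes e: "e > 0" obtains W where "openin T W" "\<one> \<in> W" "\<And>w. w \<in> W \<Longrightarrow> disp w < e"
proof (rule ccontr)
  assume no: "\<not> thesis"
  obtain k where "haar_content G T k" using exists_haar_content by blast
  then interpret H: haar_content G T k .
  define m where "m = H.haar"
  note m = H.sets_haar[folded m_def] H.haar_sigma_finite[folded m_def] H.haar_nonzero[folded m_def] H.translation_continuous[folded m_def]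
  have spm: "space m = carrier G" using sets_eq_imp_space_eq[OF m(1)] by simp
  interpret m: sigma_finite_measure m by (rule m(2))
  interpret P: pair_sigma_finite \<Omega> m ..
  obtain A where A: "A \<in> sets m" "emeasure m A \<noteq> \<infinity>" "emeasure m A \<noteq> 0"
  proof -
    obtain A :: "nat \<Rightarrow> 'g set" where A: "range A \<subseteq> sets m" "(\<Union>i. A i) = space m" "\<And>i. emeasure m (A i) \<noteq> \<infinity>"
      using m.sigma_finite by metis
    have "\<exists>i. emeasure m (A i) \<noteq> 0"
    proof (rule ccontr)
      assume "\<not> ?thesis"
      then have "(\<Union>i. A i) \<in> null_sets m" using A(1) by (intro null_sets_UN) (auto simp: null_sets_def)
      then show False using A(2) m(3) spm by auto
    qed
    then show thesis using that A by blast
  qed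
  have AG: "A \<subseteq> carrier G" using sets.sets_into_space[OF A(1)] spm by simp
  obtain V :: "nat \<Rightarrow> 'g set" where V: "\<And>n. openin T (V n)" "\<And>n. \<one> \<in> V n"
    "\<And>m n. m \<le> n \<Longrightarrow> V n \<subseteq> V m" "\<And>U. openin T U \<Longrightarrow> \<one> \<in> U \<Longrightarrow> \<exists>n. V n \<subseteq> U"
    using neighbourhood_base_one by blast
  have "\<exists>w. w \<in> V n \<and> e \<le> disp w" for n
    using no that[OF V(1,2)] by (meson not_le)
  then obtain h where h: "\<And>n. h n \<in> V n" "\<And>n. e \<le> disp (h n)" by metis
  have wG: "h n \<in> carrier G" for n using h(1) openin_carrier[OF V(1)] by blast
  have wlim: "\<forall>\<^sub>F n in sequentially. h n \<in> U" if "openin T U" "\<one> \<in> U" for U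
    using V(4)[OF that] V(3) h(1) unfolding eventually_sequentially by (meson subsetD)
  define u where "u = (\<lambda>g w. orb (inv g) w)"
  have u_meas: "(\<lambda>p. u (k \<otimes> snd p) (fst p)) \<in> \<Omega> \<Otimes>\<^sub>M m \<rightarrow>\<^sub>M count_space D" if k: "k \<in> carrier G" for k
  proof -
    have c: "continuous_map T T (\<lambda>g. inv (k \<otimes> g))"
      by (intro topological_group_inv[OF top_group] continuous_lt k)
    have "(\<lambda>p. (fst p, inv (k \<otimes> snd p))) \<in> \<Omega> \<Otimes>\<^sub>M borel_of T \<rightarrow>\<^sub>M \<Omega> \<Otimes>\<^sub>M borel_of T"
      by (intro measurable_Pair measurable_fst measurable_compose[OF measurable_snd measurable_borel_of_continuous[OF c]])
    from measurable_compose[OF this pulled_measurable[of "\<lambda>_. base"]]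
    have "(\<lambda>p. u (k \<otimes> snd p) (fst p)) \<in> \<Omega> \<Otimes>\<^sub>M borel_of T \<rightarrow>\<^sub>M count_space D"
      using base unfolding u_def orb_def by simp
    then show ?thesis unfolding measurable_cong_sets[OF sets_pair_measure_cong[OF refl m(1)] refl] .
  qed
  define S where "S = (\<lambda>n. {p \<in> space (\<Omega> \<Otimes>\<^sub>M m). snd p \<in> A \<and> u (inv (h n) \<otimes> snd p) (fst p) \<noteq> u (\<one> \<otimes> snd p) (fst p)})"
  have S: "S n \<in> sets (\<Omega> \<Otimes>\<^sub>M m)" for n
  proof -
    have "{p \<in> space (\<Omega> \<Otimes>\<^sub>M m). u (inv (h n) \<otimes> snd p) (fst p) \<noteq> u (\<one> \<otimes> snd p) (fst p)} \<in> sets (\<Omega> \<Otimes>\<^sub>M m)"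
      by (intro disagree_sets u_meas inv_closed wG one_closed)
    moreover have "{p \<in> space (\<Omega> \<Otimes>\<^sub>M m). snd p \<in> A} \<in> sets (\<Omega> \<Otimes>\<^sub>M m)"
      using measurable_sets[OF measurable_snd A(1), of \<Omega>] by (simp add: vimage_def Int_def conj_commute)
    ultimately show ?thesis unfolding S_def by (rule sets.sets_Collect_conj)
  qed
  have "(\<lambda>n. \<integral>\<^sup>+w. emeasure m (Pair w -` S n) \<partial>\<Omega>) \<longlonglongrightarrow> (\<integral>\<^sup>+w. 0 \<partial>\<Omega>)"
  proof (rule nn_integral_dominated_convergence[where w = "\<lambda>_. emeasure m A"])
    show "(\<lambda>w. emeasure m (Pair w -` S n)) \<in> borel_measurable \<Omega>" for n by (rule m.measurable_emeasure_Pair[OF S])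
    show "AE w in \<Omega>. emeasure m (Pair w -` S n) \<le> emeasure m A" for n
      by (intro AE_I2 emeasure_mono A) (auto simp: S_def)
    show "(\<integral>\<^sup>+w. emeasure m A \<partial>\<Omega>) < \<infinity>" using A(2) by (simp add: emeasure_space_1 top.not_eq_extremum)
    show "AE w in \<Omega>. (\<lambda>n. emeasure m (Pair w -` S n)) \<longlonglongrightarrow> 0"
    proof (rule AE_I2)
      fix w assume w: "w \<in> space \<Omega>"
      define E where "E = (\<lambda>y. {g \<in> A. u g w = y})"
      have E: "E y \<in> sets m" if y: "y \<in> D" for y
      proof -
        have "Pair w -` ((\<lambda>p. u (\<one> \<otimes> snd p) (fst p)) -` {y} \<inter> space (\<Omega> \<Otimes>\<^sub>M m)) \<inter> A \<in> sets m"
          by (rule sets.Int[OF sets_Pair1[OF measurable_sets[OF u_meas[OF one_closed]]] A(1)]) (use y in simp)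
        moreover have "Pair w -` ((\<lambda>p. u (\<one> \<otimes> snd p) (fst p)) -` {y} \<inter> space (\<Omega> \<Otimes>\<^sub>M m)) \<inter> A = E y"
          using AG w spm by (auto simp: E_def space_pair_measure)
        ultimately show ?thesis by simp
      qed
      have uD: "u g w \<in> D" if "g \<in> carrier G" for g unfolding u_def using orb_closed w that by simp
      let ?d = "\<lambda>n y. emeasure m (E y - lt (h n) (E y))"
      have le: "emeasure m (Pair w -` S n) \<le> (\<integral>\<^sup>+y. ?d n y \<partial>count_space D)" for n
      proof -
        have "Pair w -` S n \<subseteq> (\<Union>y\<in>D. E y - lt (h n) (E y))"
        proof
          fix g assume "g \<in> Pair w -` S n"
          then have g: "g \<in> A" "u (inv (h n) \<otimes> g) w \<noteq> u g w" "g \<in> carrier G" using AG by (auto simp: S_def)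
          have "g \<notin> lt (h n) (E (u g w))"
          proof
            assume "g \<in> lt (h n) (E (u g w))"
            then obtain x where x: "x \<in> A" "u x w = u g w" "g = h n \<otimes> x" unfolding E_def by blast
            then have "inv (h n) \<otimes> g = x" using wG AG by (auto simp: m_assoc[symmetric])
            then show False using g(2) x(2) by simp
          qed
          then show "g \<in> (\<Union>y\<in>D. E y - lt (h n) (E y))" using uD[OF g(3)] g(1) unfolding E_def by blast
        qed
        moreover have d_sets: "E y - lt (h n) (E y) \<in> sets m" if "y \<in> D" for y
          using lt_borel[OF wG] E[OF that] m(1) by auto
        ultimately have "emeasure m (Pair w -` S n) \<le> emeasure m (\<Union>y\<in>D. E y - lt (h n) (E y))"
          by (intro emeasure_mono sets.countable_UN'' D_countable)
        also have "\<dots> = (\<integral>\<^sup>+y. ?d n y \<partial>count_space D)"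
          by (intro emeasure_UN_countable d_sets D_countable) (auto simp: disjoint_family_on_def E_def)
        finally show ?thesis .
      qed
      have "(\<lambda>n. \<integral>\<^sup>+y. ?d n y \<partial>count_space D) \<longlonglongrightarrow> (\<integral>\<^sup>+y. 0 \<partial>count_space D)"
      proof (rule nn_integral_dominated_convergence[where w = "\<lambda>y. emeasure m (E y)"])
        show "AE y in count_space D. ?d n y \<le> emeasure m (E y)" for n
          using E by (auto simp: AE_count_space intro!: emeasure_mono)
        have "(\<integral>\<^sup>+y. emeasure m (E y) \<partial>count_space D) = emeasure m (\<Union>y\<in>D. E y)"
          by (intro emeasure_UN_countable[symmetric] E D_countable) (auto simp: disjoint_family_on_def E_def)
        also have "\<dots> \<le> emeasure m A" by (intro emeasure_mono A(1)) (auto simp: E_def)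
        finally show "(\<integral>\<^sup>+y. emeasure m (E y) \<partial>count_space D) < \<infinity>" using A(2) by (auto simp: top_unique less_top)
        show "AE y in count_space D. (\<lambda>n. ?d n y) \<longlonglongrightarrow> 0"
        proof (simp add: AE_count_space, intro ballI m(4) wG wlim)
          fix y assume y: "y \<in> D"
          show "E y \<in> sets (borel_of T)" using E[OF y] m(1) by simp
          have "emeasure m (E y) \<le> emeasure m A" by (intro emeasure_mono A(1)) (auto simp: E_def)
          then show "emeasure m (E y) \<noteq> \<infinity>" using A(2) by (auto simp: top_unique)
        qed
      qed auto
      then have "(\<lambda>n. \<integral>\<^sup>+y. ?d n y \<partial>count_space D) \<longlonglongrightarrow> 0" by simp
      then show "(\<lambda>n. emeasure m (Pair w -` S n)) \<longlonglongrightarrow> 0"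
        by (rule tendsto_sandwich[rotated 3]) (use le in auto)
    qed
  qed auto
  moreover have "(\<integral>\<^sup>+w. emeasure m (Pair w -` S n) \<partial>\<Omega>) \<ge> ennreal e * emeasure m A" for n
  proof -
    have "emeasure \<Omega> ((\<lambda>w. (w, g)) -` S n) = ennreal (disp (h n))" if g: "g \<in> A" for g
    proof -
      have gG: "g \<in> carrier G" using g AG by blast
      have "(\<lambda>w. (w, g)) -` S n = {w \<in> space \<Omega>. orb (inv g \<otimes> h n) w \<noteq> orb (inv g) w}"
        using g gG wG spm by (auto simp: S_def u_def space_pair_measure inv_mult_group)
      then show ?thesis
        using orb_differ[of "inv g" "inv g \<otimes> h n"] gG wG by (simp add: emeasure_eq_measure m_assoc[symmetric])
    qed
    moreover have "ennreal e \<le> ennreal (disp (h n))" using h(2) by (rule ennreal_leI)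
    ultimately have "(\<integral>\<^sup>+g. ennreal e * indicator A g \<partial>m) \<le> (\<integral>\<^sup>+g. emeasure \<Omega> ((\<lambda>w. (w, g)) -` S n) \<partial>m)"
      by (intro nn_integral_mono) (auto simp: indicator_def)
    then show ?thesis
      using A(1) P.emeasure_pair_measure_alt2[OF S] m.emeasure_pair_measure_alt[OF S] by (simp add: nn_integral_cmult_indicator)
  qed
  ultimately have "ennreal e * emeasure m A \<le> 0"
    by (intro LIMSEQ_le_const) auto
  then show False using e A(3) by simp
qed

text \<open>The integrands agree unless \<open>k\<close> moves the base point.\<close>

lemma Psi_disp:
  assumes t: "0 \<le> t" and g: "g \<in> carrier G" and k: "k \<in> carrier G"
  shows "\<bar>Psi t (g \<otimes> k) \<one> - Psi t g \<one>\<bar> \<le> disp k"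
proof -
  have m1: "(\<lambda>w. K t (a g w base) base) \<in> borel_measurable \<Omega>" if "g \<in> carrier G" for g
    using measurable_compose[OF a_measurable1[OF that base], of "\<lambda>x. K t x base"] by simp
  have m2: "(\<lambda>w. K t (a g (act k w) base) base) \<in> borel_measurable \<Omega>"
    using measurable_compose[OF act_measurable1[OF k] m1[OF g]] .
  have P: "Psi t g \<one> = (\<integral>w. K t (a g (act k w) base) base \<partial>\<Omega>)"
    unfolding Psi_one[OF g] by (rule integral_act[OF k m1[OF g], symmetric])
  have i1: "integrable \<Omega> (\<lambda>w. K t (a (g \<otimes> k) w base) base)"
    by (rule integrable_const_bound[of _ 1]) (use t K_bounds m1 g k in auto)
  have i2: "integrable \<Omega> (\<lambda>w. K t (a g (act k w) base) base)"
    by (rule integrable_const_bound[of _ 1]) (use t K_bounds m2 in auto)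
  let ?S = "{w \<in> space \<Omega>. a k w base \<noteq> base}"
  have "\<bar>Psi t (g \<otimes> k) \<one> - Psi t g \<one>\<bar> = \<bar>\<integral>w. K t (a (g \<otimes> k) w base) base - K t (a g (act k w) base) base \<partial>\<Omega>\<bar>"
    unfolding P Psi_one[OF m_closed[OF g k]] using i1 i2 by simp
  also have "\<dots> \<le> (\<integral>w. \<bar>K t (a (g \<otimes> k) w base) base - K t (a g (act k w) base) base\<bar> \<partial>\<Omega>)"
    by (rule integral_abs_bound)
  also have "\<dots> \<le> (\<integral>w. indicator ?S w \<partial>\<Omega>)"
  proof (rule integral_mono)
    show "integrable \<Omega> (\<lambda>w. \<bar>K t (a (g \<otimes> k) w base) base - K t (a g (act k w) base) base\<bar>)" using i1 i2 by auto
    show "integrable \<Omega> (\<lambda>w. indicator ?S w :: real)" using moved_sets[OF k] by (simp add: emeasure_eq_measure)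
    fix w assume w: "w \<in> space \<Omega>"
    have "a (g \<otimes> k) w base = a g (act k w) (a k w base)" using a_mult g k w base by blast
    moreover have "\<bar>K t x base - K t y base\<bar> \<le> 1" for x y using K_bounds[OF t, of x base] K_bounds[OF t, of y base] by auto
    ultimately show "\<bar>K t (a (g \<otimes> k) w base) base - K t (a g (act k w) base) base\<bar> \<le> indicator ?S w"
      using w by (auto simp: indicator_def)
  qed
  also have "\<dots> = disp k" unfolding disp_def using moved_sets[OF k] by simp
  finally show ?thesis .
qed

lemma Psi_continuous: assumes t: "0 \<le> t" shows "continuous_map T euclideanreal (\<lambda>g. Psi t g \<one>)"
proof -
  have "continuous_map T Met_TC.mtopology (\<lambda>g. Psi t g \<one>)"
  proof (rule Met_TC.continuous_map_into_metric)
    fix g e assume g: "g \<in> topspace T" and e: "(e::real) > 0"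
    then have gG: "g \<in> carrier G" by simp
    obtain W where W: "openin T W" "\<one> \<in> W" "\<And>w. w \<in> W \<Longrightarrow> disp w < e" using disp_small e by blast
    have "dist (Psi t g \<one>) (Psi t h \<one>) < e" if h: "h \<in> lt g W" for h
    proof -
      obtain w where w: "w \<in> W" "h = g \<otimes> w" using h by blast
      then have "w \<in> carrier G" using W(1) openin_carrier by blast
      then show ?thesis using Psi_disp[OF t gG, of w] W(3)[OF w(1)] w(2) by (simp add: dist_real_def abs_minus_commute)
    qed
    moreover have "openin T (lt g W)" using openin_lt gG W(1) by blast
    moreover have "g \<in> lt g W" using W(2) gG by (intro image_eqI[of _ _ \<one>]) auto
    ultimately show "\<exists>U. openin T U \<and> g \<in> U \<and> (\<forall>y\<in>U. dist (Psi t g \<one>) (Psi t y \<one>) < e)" by blast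
  qed simp
  then show ?thesis by simp
qed

lemma Psi_tendsto_one: assumes g: "g \<in> carrier G" shows "(\<lambda>n. Psi (inverse (Suc n)) g \<one>) \<longlonglongrightarrow> 1"
proof -
  have "(\<lambda>n. \<integral>w. K (inverse (Suc n)) (a g w base) base \<partial>\<Omega>) \<longlonglongrightarrow> (\<integral>w. 1 \<partial>\<Omega>)"
  proof (rule integral_dominated_convergence[where w = "\<lambda>_. 1"])
    show "(\<lambda>w. K (inverse (Suc n)) (a g w base) base) \<in> borel_measurable \<Omega>" for n
      using measurable_compose[OF a_measurable1[OF g base], of "\<lambda>x. K (inverse (Suc n)) x base"] by simp
    show "AE w in \<Omega>. (\<lambda>n. K (inverse (Suc n)) (a g w base) base) \<longlonglongrightarrow> 1"
    proof (rule AE_I2)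
      fix w
      have "(\<lambda>n. exp (- (inverse (real (Suc n)) * real (d (a g w base) base)))) \<longlonglongrightarrow> exp (- (0 * real (d (a g w base) base)))"
        by (intro tendsto_intros LIMSEQ_inverse_real_of_nat)
      then show "(\<lambda>n. K (inverse (Suc n)) (a g w base) base) \<longlonglongrightarrow> 1" unfolding K_def by simp
    qed
    show "AE w in \<Omega>. norm (K (inverse (Suc n)) (a g w base) base) \<le> 1" for n
      using K_bounds[of "inverse (Suc n)"] by (intro AE_I2) simp
  qed auto
  then show ?thesis unfolding Psi_one[OF g] by (simp add: prob_space)
qed

text \<open>
  The bound in \<open>Psi_disp\<close> does not depend on \<open>t\<close>, which makes the pointwise convergence as \<open>t\<close>
  tends to zero uniform on compact sets.
\<close>

lemma Psi_uniform:
  assumes Q: "compactin T Q" and e: "e > 0"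
  obtains t where "0 < t" "\<And>g. g \<in> Q \<Longrightarrow> 1 - Psi t g \<one> < e"
proof -
  have QG: "Q \<subseteq> carrier G" using Q compactin_carrier by blast
  obtain W where W: "openin T W" "\<one> \<in> W" "\<And>w. w \<in> W \<Longrightarrow> disp w < e / 2" using disp_small[of "e / 2"] e by auto
  obtain F where F: "finite F" "F \<subseteq> carrier G" "Q \<subseteq> (\<Union>g\<in>F. lt g W)" using covering_attained[OF Q W(1,2)] by metis
  have "\<forall>g\<in>F. \<forall>\<^sub>F n in sequentially. 1 - Psi (inverse (Suc n)) g \<one> < e / 2"
  proof
    fix g assume "g \<in> F"
    then have "(\<lambda>n. 1 - Psi (inverse (Suc n)) g \<one>) \<longlonglongrightarrow> 1 - 1" using F(2) by (intro tendsto_diff tendsto_const Psi_tendsto_one) auto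
    then show "\<forall>\<^sub>F n in sequentially. 1 - Psi (inverse (Suc n)) g \<one> < e / 2" using e by (intro order_tendstoD(2)) auto
  qed
  then have "\<forall>\<^sub>F n in sequentially. \<forall>g\<in>F. 1 - Psi (inverse (Suc n)) g \<one> < e / 2" using F(1) by (intro eventually_ball_finite)
  then obtain n where n: "\<forall>g\<in>F. 1 - Psi (inverse (Suc n)) g \<one> < e / 2" using eventually_happens trivial_limit_sequentially by blast
  show thesis
  proof (rule that[of "inverse (Suc n)"])
    fix q assume "q \<in> Q"
    then obtain g w where gw: "g \<in> F" "w \<in> W" "q = g \<otimes> w" using F(3) by blast
    then have G: "g \<in> carrier G" "w \<in> carrier G" using F(2) W(1) openin_carrier by blast+
    have "\<bar>Psi (inverse (Suc n)) q \<one> - Psi (inverse (Suc n)) g \<one>\<bar> \<le> disp w" using Psi_disp[OF _ G] gw(3) by simp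
    then show "1 - Psi (inverse (Suc n)) q \<one> < e" using n gw(1) W(3)[OF gw(2)] by (auto simp: abs_le_iff)
  qed simp
qed


section \<open>Property (T) and bounded equivariant sets\<close>

text \<open>
  The generator at the unit is almost invariant when \<open>t\<close> is small, so Property (T) gives a
  nonzero invariant vector. The combination \<open>c n\<close> approximates it up to \<open>(1 / 4) ^ n\<close>, fast
  enough for almost sure convergence later. The vector does not vanish at the unit, since it is
  a constant function on \<open>G\<close>.
\<close>

lemma almost_invariant_combinations:
  assumes T: "property_T G T"
  obtains t c M z where "0 < t" "\<And>n. snd ` set (c n) \<subseteq> carrier G"
    "\<And>n. pos_kernel.nrm (Psi t) (c n) \<le> M"
    "\<And>n. pos_kernel.nrm (Psi t) (csub (c n) (c (Suc n))) \<le> 2 * (1 / 4) ^ n"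
    "\<And>g n. g \<in> carrier G \<Longrightarrow> pos_kernel.nrm (Psi t) (csub (map (apsnd (\<lambda>x. g \<otimes> x)) (c n)) (c n)) \<le> 2 * (1 / 4) ^ n"
    "(\<lambda>n. kernel_form (Psi t) (c n) [(1, \<one>)]) \<longlonglongrightarrow> z" "z \<noteq> 0"
proof -
  obtain Q e where Q: "compactin T Q" and e: "e > 0" and
    inv: "\<And>(V :: (complex, 'g \<Rightarrow> complex) module) ip \<pi>. complex_hilbert_space V ip \<Longrightarrow> unitary_rep G T V ip \<pi> \<Longrightarrow>
      \<exists>\<xi>\<in>carrier V. \<xi> \<noteq> \<zero>\<^bsub>V\<^esub> \<and> (\<forall>g\<in>Q. ip_dist V ip (\<pi> g \<xi>) \<xi> < e * ip_norm ip \<xi>) \<Longrightarrow>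
      \<exists>\<eta>\<in>carrier V. \<eta> \<noteq> \<zero>\<^bsub>V\<^esub> \<and> (\<forall>g\<in>carrier G. \<pi> g \<eta> = \<eta>)"
    using T unfolding property_T_def by blast
  have e2: "0 < e\<^sup>2 / 2" using e by simp
  obtain t where t: "0 < t" and tQ: "\<And>g. g \<in> Q \<Longrightarrow> 1 - Psi t g \<one> < e\<^sup>2 / 2" using Psi_uniform[OF Q e2] by blast
  interpret I: invariant_kernel G "Psi t" by (rule invariant_kernel_Psi[OF t])
  interpret M: Metric_space I.hspace "I.hdist" by (rule I.metric)
  have evs: "I.ev c \<in> I.hspace" if "snd ` set c \<subseteq> carrier G" for c
    using I.spaceI[OF I.represents_const[OF that]] .
  have c1: "snd ` set [(1, \<one>)] \<subseteq> carrier G" by simp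
  define \<xi> where "\<xi> = I.ev [(1, \<one>)]"
  have \<xi>s: "\<xi> \<in> I.hspace" unfolding \<xi>_def by (rule evs[OF c1])
  have "(\<lambda>n. I.nrm [(1, \<one>)]) \<longlonglongrightarrow> ip_norm I.ip \<xi>"
    unfolding \<xi>_def by (rule I.norm_tendsto[OF I.represents_const[OF c1]])
  then have "ip_norm I.ip \<xi> = I.nrm [(1, \<one>)]" using LIMSEQ_unique tendsto_const by blast
  also have "\<dots> = 1" unfolding I.nrm_def by (simp add: kernel_form_single Psi_one_one)
  finally have \<xi>1: "ip_norm I.ip \<xi> = 1" .
  have "\<xi> \<one> = 1" unfolding \<xi>_def I.ev_def by (simp add: kernel_form_single Psi_one_one)
  then have \<xi>0: "\<xi> \<noteq> \<zero>\<^bsub>I.hilbert\<^esub>" by auto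
  have \<xi>Q: "I.hdist (I.rep g \<xi>) \<xi> < e * ip_norm I.ip \<xi>" if g: "g \<in> Q" for g
  proof -
    have gG: "g \<in> carrier G" using g Q compactin_carrier by blast
    have "I.rep g \<xi> = I.translate g \<xi>" using \<xi>s by (simp add: I.rep_def)
    also have "\<dots> = I.ev (I.shift g [(1, \<one>)])" unfolding \<xi>_def using I.ev_shift[OF gG c1] by (intro ext) simp
    also have "I.shift g [(1, \<one>)] = [(1, g)]" using gG by (simp add: I.shift_def)
    finally have "I.hdist (I.rep g \<xi>) \<xi> = I.nrm (csub [(1, g)] [(1, \<one>)])"
      unfolding \<xi>_def using I.dist_ev[of "[(1, g)]" "[(1, \<one>)]"] gG by simp
    also have "\<dots> = sqrt (2 * (1 - Psi t g \<one>))" using I.nrm_two_points[OF gG one_closed, of 1] gG by (simp add: Psi_one_one)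
    also have "\<dots> < sqrt (e\<^sup>2)" using tQ[OF g] by (intro real_sqrt_less_mono) simp
    also have "\<dots> = e" using e by simp
    finally show ?thesis using \<xi>1 by simp
  qed
  have "\<exists>\<eta>\<in>carrier I.hilbert. \<eta> \<noteq> \<zero>\<^bsub>I.hilbert\<^esub> \<and> (\<forall>g\<in>carrier G. I.rep g \<eta> = \<eta>)"
    by (rule inv[OF I.hilbert_space I.unitary_rep[OF top_group Psi_continuous[OF less_imp_le[OF t]]]])
      (use \<xi>s \<xi>0 \<xi>Q in auto)
  then obtain \<eta> where \<eta>: "\<eta> \<in> I.hspace" "\<eta> \<noteq> (\<lambda>x. 0)" "\<And>g. g \<in> carrier G \<Longrightarrow> I.rep g \<eta> = \<eta>" by auto
  have \<eta>t: "I.translate g \<eta> = \<eta>" if "g \<in> carrier G" for g using \<eta>(3)[OF that] \<eta>(1) by (simp add: I.rep_def)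
  have \<eta>1: "\<eta> \<one> \<noteq> 0"
  proof
    assume z: "\<eta> \<one> = 0"
    have "\<eta> x = 0" for x
    proof (cases "x \<in> carrier G")
      case True
      have "I.translate x \<eta> x = \<eta> \<one>" using True by (simp add: I.translate_def)
      then show ?thesis using \<eta>t[OF True] z by simp
    next
      case False
      then show ?thesis using I.space_outside \<eta>(1) by blast
    qed
    then show False using \<eta>(2) by blast
  qed
  obtain C where C: "I.represents C \<eta>" using \<eta>(1) I.spaceE by blast
  have "\<exists>N. I.hdist \<eta> (I.ev (C N)) < (1 / 4) ^ n" for n
    using I.dist_approximants[OF C, of "(1/4)^n"] by auto
  then obtain N where N: "\<And>n. I.hdist \<eta> (I.ev (C (N n))) < (1 / 4) ^ n" by metis
  define c where "c = (\<lambda>n. C (N n))"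
  have c: "snd ` set (c n) \<subseteq> carrier G" for n unfolding c_def using I.comb_represents[OF C] .
  have near: "I.hdist \<eta> (I.ev (c n)) < (1 / 4) ^ n" for n using N unfolding c_def .
  show thesis
  proof (rule that[OF t, of c "1 + I.hdist \<eta> (I.ev [])" "\<eta> \<one>"])
    show "snd ` set (c n) \<subseteq> carrier G" for n by (rule c)
    show "I.nrm (c n) \<le> 1 + I.hdist \<eta> (I.ev [])" for n
    proof -
      have "I.nrm (c n) = I.nrm (csub (c n) [])" by (rule I.nrm_cong) simp
      also have "\<dots> = I.hdist (I.ev (c n)) (I.ev [])" by (rule I.dist_ev[symmetric]) (use c in auto)
      also have "\<dots> \<le> I.hdist (I.ev (c n)) \<eta> + I.hdist \<eta> (I.ev [])"
        by (rule M.triangle) (use \<eta>(1) c in \<open>auto intro: evs\<close>)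
      also have "I.hdist (I.ev (c n)) \<eta> \<le> 1"
        using near[of n] M.commute[of \<eta> "I.ev (c n)"] power_le_one[of "1/4::real" n] by simp
      finally show ?thesis by simp
    qed
    show "I.nrm (csub (c n) (c (Suc n))) \<le> 2 * (1 / 4) ^ n" for n
    proof -
      have "I.nrm (csub (c n) (c (Suc n))) = I.hdist (I.ev (c n)) (I.ev (c (Suc n)))"
        by (rule I.dist_ev[symmetric, OF c c])
      also have "\<dots> \<le> I.hdist (I.ev (c n)) \<eta> + I.hdist \<eta> (I.ev (c (Suc n)))"
        by (rule M.triangle) (use \<eta>(1) c in \<open>auto intro: evs\<close>)
      also have "\<dots> \<le> (1 / 4) ^ n + (1 / 4) ^ Suc n"
        using near[of n] near[of "Suc n"] M.commute[of \<eta> "I.ev (c n)"] by simp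
      also have "\<dots> \<le> 2 * (1 / 4) ^ n" by simp
      finally show ?thesis .
    qed
    show "I.nrm (csub (map (apsnd (\<lambda>x. g \<otimes> x)) (c n)) (c n)) \<le> 2 * (1 / 4) ^ n" if g: "g \<in> carrier G" for g n
    proof -
      have s: "map (apsnd (\<lambda>x. g \<otimes> x)) (c n) = I.shift g (c n)" by (simp add: I.shift_def)
      have sc: "snd ` set (I.shift g (c n)) \<subseteq> carrier G" using I.comb_shift[OF g c] .
      have "I.nrm (csub (I.shift g (c n)) (c n)) = I.hdist (I.ev (I.shift g (c n))) (I.ev (c n))"
        by (rule I.dist_ev[symmetric, OF sc c])
      also have "I.ev (I.shift g (c n)) = I.translate g (I.ev (c n))" using I.ev_shift[OF g c] by (intro ext)
      also have "I.hdist (I.translate g (I.ev (c n))) (I.ev (c n)) \<le>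
          I.hdist (I.translate g (I.ev (c n))) \<eta> + I.hdist \<eta> (I.ev (c n))"
        by (rule M.triangle) (use \<eta>(1) evs[OF c] I.translate_space[OF g evs[OF c]] in auto)
      also have "I.hdist (I.translate g (I.ev (c n))) \<eta> = I.hdist (I.ev (c n)) \<eta>"
        using I.dist_translate[OF g evs[OF c] \<eta>(1)] \<eta>t[OF g] by simp
      also have "\<dots> + I.hdist \<eta> (I.ev (c n)) \<le> 2 * (1 / 4) ^ n"
        using near[of n] M.commute[of \<eta> "I.ev (c n)"] by simp
      finally show ?thesis unfolding s .
    qed
    have "(\<lambda>n. I.form (c n) [(1, \<one>)]) = (\<lambda>n. I.ev (c n) \<one>)" unfolding I.ev_def by simp
    moreover have "(\<lambda>n. I.ev (c n) \<one>) \<longlonglongrightarrow> \<eta> \<one>"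
    proof -
      have b: "cmod (I.ev (c n) \<one> - \<eta> \<one>) \<le> (1 / 4) ^ n" for n
      proof -
        have "cmod ((\<lambda>x. \<eta> x - I.ev (c n) x) \<one>) \<le> ip_norm I.ip (\<lambda>x. \<eta> x - I.ev (c n) x) * I.nrm [(1, \<one>)]"
          by (rule I.norm_evaluation[OF I.space_diff[OF \<eta>(1) evs[OF c]] one_closed])
        also have "I.nrm [(1, \<one>)] = 1" unfolding I.nrm_def by (simp add: kernel_form_single Psi_one_one)
        also have "ip_norm I.ip (\<lambda>x. \<eta> x - I.ev (c n) x) = I.hdist \<eta> (I.ev (c n))"
          using I.ip_dist_eq[OF \<eta>(1) evs[OF c]] by simp
        finally show ?thesis using near[of n] by (simp add: norm_minus_commute)
      qed
      have "(\<lambda>n. I.ev (c n) \<one> - \<eta> \<one>) \<longlonglongrightarrow> 0"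
        by (rule Lim_null_comparison[where g = "\<lambda>n. (1 / 4) ^ n"]) (use b in \<open>auto intro: LIMSEQ_power_zero\<close>)
      then show ?thesis using LIM_zero_iff by blast
    qed
    ultimately show "(\<lambda>n. I.form (c n) [(1, \<one>)]) \<longlonglongrightarrow> \<eta> \<one>" by simp
  qed (rule \<eta>1)
qed

end

text \<open>Markov's inequality and the Borel-Cantelli lemma.\<close>

lemma (in prob_space) AE_eventually_small:
  assumes "\<And>n. integrable M (f n)" "\<And>n x. x \<in> space M \<Longrightarrow> 0 \<le> f n x" "\<And>n. (\<integral>x. f n x \<partial>M) \<le> C * (1 / 16) ^ n"
  shows "AE x in M. \<forall>\<^sub>F n in sequentially. f n x \<le> (1 / 4 :: real) ^ n"
proof -
  have m [measurable]: "f n \<in> borel_measurable M" for n using assms(1) by blast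
  let ?A = "\<lambda>n. {x \<in> space M. f n x \<ge> (1 / 4) ^ n}"
  have A: "?A n \<in> sets M" for n by measurable
  have *: "measure M (?A n) \<le> C * (1 / 4) ^ n" for n
  proof -
    have "measure M (?A n) \<le> (\<integral>x. f n x \<partial>M) / (1 / 4) ^ n"
      by (rule integral_Markov_inequality_measure[OF assms(1) A]) (use assms(2) in auto)
    also have "\<dots> \<le> (C * (1 / 16) ^ n) / (1 / 4) ^ n" by (intro divide_right_mono assms) simp
    also have "\<dots> = C * (1 / 4) ^ n" using power_mult_distrib[of "1/4::real" "1/4" n] by (simp add: power_divide)
    finally show ?thesis .
  qed
  have "summable (\<lambda>n. measure M (?A n))"
    by (rule summable_comparison_test[where g = "\<lambda>n. C * (1 / 4) ^ n"])
      (use * in \<open>auto intro: summable_mult summable_geometric\<close>)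
  then have "AE x in M. \<forall>\<^sub>F n in sequentially. x \<in> space M - ?A n"
    by (intro borel_cantelli_AE1 A) (auto simp: emeasure_eq_measure)
  then show ?thesis by (rule AE_mp) (intro AE_I2 impI, auto elim!: eventually_mono)
qed

lemma geometric_limit:
  fixes z :: "nat \<Rightarrow> complex"
  assumes "\<And>n. N \<le> n \<Longrightarrow> cmod (z n - z (Suc n)) \<le> (1 / 2) ^ n"
  shows "z \<longlonglongrightarrow> lim z" "N \<le> n \<Longrightarrow> cmod (z n - lim z) \<le> 2 * (1 / 2) ^ n"
proof -
  have b: "cmod (z n - z (n + k)) \<le> (2 - 2 * (1 / 2) ^ k) * (1 / 2) ^ n" if n: "N \<le> n" for n k
  proof (induction k)
    case (Suc k)
    have "z n - z (n + Suc k) = (z n - z (n + k)) + (z (n + k) - z (Suc (n + k)))" by simp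
    then have "cmod (z n - z (n + Suc k)) \<le> cmod (z n - z (n + k)) + cmod (z (n + k) - z (Suc (n + k)))"
      by (metis norm_triangle_ineq)
    also have "\<dots> \<le> (2 - 2 * (1 / 2) ^ k) * (1 / 2) ^ n + (1 / 2) ^ (n + k)"
      using Suc assms[of "n + k"] n by simp
    also have "\<dots> = (2 - 2 * (1 / 2) ^ Suc k) * (1 / 2) ^ n" by (simp add: power_add algebra_simps)
    finally show ?case .
  qed simp
  have b': "cmod (z n - z (n + k)) \<le> 2 * (1 / 2) ^ n" if n: "N \<le> n" for n k
    using b[OF n, of k] by (rule order_trans) (simp add: algebra_simps)
  have "Cauchy z"
  proof (rule metric_CauchyI)
    fix e :: real assume e: "e > 0"
    have "(\<lambda>n. 4 * (1 / 2) ^ n) \<longlonglongrightarrow> 4 * (0 :: real)" by (intro tendsto_intros LIMSEQ_power_zero) simp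
    then have "\<forall>\<^sub>F n in sequentially. 4 * (1 / 2) ^ n < e" using e by (intro order_tendstoD(2)) auto
    then have "\<forall>\<^sub>F n in sequentially. 4 * (1 / 2) ^ n < e \<and> N \<le> n" using eventually_ge_at_top eventually_conj by blast
    then obtain n where n: "4 * (1 / 2) ^ n < e" "N \<le> n" using eventually_happens trivial_limit_sequentially by blast
    have "dist (z i) (z j) < e" if ij: "i \<ge> n" "j \<ge> n" for i j
    proof -
      have "cmod (z n - z i) \<le> 2 * (1 / 2) ^ n" using b'[OF n(2), of "i - n"] ij by simp
      moreover have "cmod (z n - z j) \<le> 2 * (1 / 2) ^ n" using b'[OF n(2), of "j - n"] ij by simp
      moreover have "dist (z i) (z j) \<le> dist (z n) (z i) + dist (z n) (z j)" by (rule dist_triangle3)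
      ultimately show ?thesis using n(1) unfolding dist_norm by linarith
    qed
    then show "\<exists>M. \<forall>m\<ge>M. \<forall>n\<ge>M. dist (z m) (z n) < e" by blast
  qed
  then have "convergent z" by (rule Cauchy_convergent)
  then show l: "z \<longlonglongrightarrow> lim z" by (simp add: convergent_LIMSEQ_iff)
  show "cmod (z n - lim z) \<le> 2 * (1 / 2) ^ n" if n: "N \<le> n" for n
  proof (rule LIMSEQ_le_const2)
    show "(\<lambda>m. cmod (z n - z m)) \<longlonglongrightarrow> cmod (z n - lim z)" by (intro tendsto_intros l)
    have "cmod (z n - z m) \<le> 2 * (1 / 2) ^ n" if "n \<le> m" for m using b'[OF n, of "m - n"] that by simp
    then show "\<exists>M. \<forall>m\<ge>M. cmod (z n - z m) \<le> 2 * (1 / 2) ^ n" by blast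
  qed
qed

text \<open>
  A uniform bound on the second moments prevents the means from escaping to infinity.
  Quantitatively, \<open>cmod f \<le> min (cmod f) s + (cmod f)\<^sup>2 / s\<close>, and the second term
  contributes at most \<open>C / s\<close>.
\<close>

lemma (in prob_space) integral_limit_nonzero:
  fixes f :: "nat \<Rightarrow> 'a \<Rightarrow> complex"
  assumes meas: "\<And>n. f n \<in> borel_measurable M"
    and int2: "\<And>n. integrable M (h n)" and fh: "\<And>n x. x \<in> space M \<Longrightarrow> (cmod (f n x))\<^sup>2 \<le> h n x"
    and bound: "\<And>n. (\<integral>x. h n x \<partial>M) \<le> C"
    and lim: "(\<lambda>n. \<integral>x. f n x \<partial>M) \<longlonglongrightarrow> z" "z \<noteq> 0"
  shows "\<not> (AE x in M. (\<lambda>n. f n x) \<longlonglongrightarrow> 0)"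
proof
  assume ae: "AE x in M. (\<lambda>n. f n x) \<longlonglongrightarrow> 0"
  have C: "0 \<le> C"
  proof -
    have "0 \<le> (\<integral>x. h 0 x \<partial>M)" using fh[of _ 0] by (intro integral_nonneg_AE AE_I2) (meson order_trans zero_le_power2)
    then show ?thesis using bound[of 0] by linarith
  qed
  \<comment> \<open>Then \<open>C / s < cmod z\<close>.\<close>
  define s where "s = (C + 1) / cmod z"
  have s: "s > 0" using C lim(2) unfolding s_def by simp
  have m: "(\<lambda>x. min (cmod (f n x)) s) \<in> borel_measurable M" for n using meas[of n] by measurable
  have t: "(\<lambda>n. \<integral>x. min (cmod (f n x)) s \<partial>M) \<longlonglongrightarrow> (\<integral>x. 0 \<partial>M)"
  proof (rule integral_dominated_convergence[where w = "\<lambda>_. s"])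
    show "AE x in M. (\<lambda>n. min (cmod (f n x)) s) \<longlonglongrightarrow> 0"
      using ae
    proof (rule AE_mp, intro AE_I2 impI)
      fix x assume "(\<lambda>n. f n x) \<longlonglongrightarrow> 0"
      then have "(\<lambda>n. min (cmod (f n x)) s) \<longlonglongrightarrow> min (cmod 0) s" by (intro tendsto_min tendsto_norm tendsto_const)
      then show "(\<lambda>n. min (cmod (f n x)) s) \<longlonglongrightarrow> 0" using s by simp
    qed
  qed (use m s in auto)
  have b: "cmod (\<integral>x. f n x \<partial>M) \<le> (\<integral>x. min (cmod (f n x)) s \<partial>M) + C / s" for n
  proof -
    have i: "integrable M (\<lambda>x. min (cmod (f n x)) s)"
      by (rule integrable_const_bound[of _ s]) (use m s in auto)
    have p: "cmod (f n x) \<le> min (cmod (f n x)) s + h n x / s" if x: "x \<in> space M" for x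
    proof (cases "cmod (f n x) \<le> s")
      case False
      have "cmod (f n x) * s \<le> (cmod (f n x))\<^sup>2" using False s by (simp add: power2_eq_square mult_left_mono)
      then have "cmod (f n x) \<le> h n x / s" using fh[OF x, of n] s by (simp add: field_simps)
      moreover have "0 \<le> min (cmod (f n x)) s" using s by simp
      ultimately show ?thesis by linarith
    next
      case True
      have "0 \<le> h n x" using fh[OF x, of n] by (meson order_trans zero_le_power2)
      then show ?thesis using True s by simp
    qed
    have i2: "integrable M (\<lambda>x. min (cmod (f n x)) s + h n x / s)" using i int2[of n] by auto
    have "cmod (f n x) \<le> norm (min (cmod (f n x)) s + h n x / s)" if "x \<in> space M" for x
      using p[OF that] abs_ge_self[of "min (cmod (f n x)) s + h n x / s"] by (simp only: real_norm_def)
    then have fi: "integrable M (f n)"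
      by (intro Bochner_Integration.integrable_bound[OF i2 meas] AE_I2)
    have "cmod (\<integral>x. f n x \<partial>M) \<le> (\<integral>x. cmod (f n x) \<partial>M)" by (rule integral_norm_bound)
    also have "\<dots> \<le> (\<integral>x. min (cmod (f n x)) s + h n x / s \<partial>M)" using fi i2 p by (intro integral_mono) auto
    also have "\<dots> = (\<integral>x. min (cmod (f n x)) s \<partial>M) + (\<integral>x. h n x \<partial>M) / s" using i int2[of n] by simp
    also have "\<dots> \<le> (\<integral>x. min (cmod (f n x)) s \<partial>M) + C / s" using bound[of n] s by (simp add: divide_right_mono)
    finally show ?thesis .
  qed
  have "cmod z \<le> 0 + C / s"
  proof (rule LIMSEQ_le)
    show "(\<lambda>n. cmod (\<integral>x. f n x \<partial>M)) \<longlonglongrightarrow> cmod z" by (intro tendsto_norm lim)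
    show "(\<lambda>n. (\<integral>x. min (cmod (f n x)) s \<partial>M) + C / s) \<longlonglongrightarrow> 0 + C / s" using t by (intro tendsto_intros) simp
  qed (use b in blast)
  then have "cmod z * (C + 1) \<le> C * cmod z" using C lim(2) unfolding s_def by (simp add: field_simps)
  then show False using lim(2) by (simp add: algebra_simps)
qed

context metric_cocycle
begin

text \<open>Each summand \<open>z * exp (- t * d y x)\<close> becomes small far from the base point.\<close>

lemma far_points_small:
  assumes t: "0 < t" and "snd ` set c \<subseteq> D" "e > 0"
  shows "\<exists>n. \<forall>x\<in>D. e \<le> cmod (kernel_form (K t) c [(1, x)]) \<longrightarrow> d base x \<le> n"
  using assms(2,3)
proof (induction c arbitrary: e)
  case (Cons p c)
  obtain z y where p: "p = (z, y)" by (cases p)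
  have y: "y \<in> D" using Cons.prems p by simp
  obtain n where n: "\<forall>x\<in>D. e / 2 \<le> cmod (kernel_form (K t) c [(1, x)]) \<longrightarrow> d base x \<le> n"
    using Cons.IH[of "e / 2"] Cons.prems by auto
  have "(\<lambda>n. cmod z * exp (- t) ^ n) \<longlonglongrightarrow> cmod z * 0" using t by (intro tendsto_intros LIMSEQ_power_zero) simp
  then have "\<forall>\<^sub>F n in sequentially. cmod z * exp (- t) ^ n < e / 2" using Cons.prems by (intro order_tendstoD(2)) auto
  then obtain k where k: "\<And>i. k \<le> i \<Longrightarrow> cmod z * exp (- t) ^ i < e / 2" unfolding eventually_sequentially by blast
  have Kp: "K t y x = exp (- t) ^ d y x" for x unfolding K_def by (simp add: exp_of_nat_mult[symmetric] mult_ac)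
  have "d base x \<le> max n (d base y + k)"
    if x: "x \<in> D" and e: "e \<le> cmod (kernel_form (K t) (p # c) [(1, x)])" for x
  proof (cases "e / 2 \<le> cmod (kernel_form (K t) c [(1, x)])")
    case True
    then show ?thesis using n x by auto
  next
    case False
    have "kernel_form (K t) (p # c) [(1, x)] = z * of_real (K t y x) + kernel_form (K t) c [(1, x)]"
      using kernel_form_Cons(1)[of "K t" p c "[(1, x)]"] p by (simp add: kernel_form_single)
    then have "e \<le> cmod z * K t y x + cmod (kernel_form (K t) c [(1, x)])"
      using e norm_triangle_ineq[of "z * of_real (K t y x)" "kernel_form (K t) c [(1, x)]"] by (simp add: norm_mult K_def)
    then have "e / 2 \<le> cmod z * exp (- t) ^ d y x" using False unfolding Kp by linarith
    then have "d y x < k" using k[of "d y x"] by linarith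
    then show ?thesis using d_triangle[OF base y x] by linarith
  qed
  then show ?case by blast
qed (auto intro: exI[of _ 0])


lemma combo_csub: "combo (csub c e) w = csub (combo c w) (combo e w)"
  unfolding combo_def csub_def cscale_def by (simp add: comp_def apsnd_def map_prod_def split_def)

lemma combo_shift:
  assumes "g \<in> carrier G" "w \<in> space \<Omega>" "snd ` set c \<subseteq> carrier G"
  shows "combo (map (apsnd (\<lambda>x. g \<otimes> x)) c) (act g w) = map (apsnd (a g w)) (combo c w)"
  unfolding combo_def using assms by (auto simp: orb_mult)

text \<open>
  The squared norm of a combination is the integral of the squared norms of its restrictions to
  the fibres.
\<close>

lemma AE_combo_small:
  assumes t: "0 < t" and c: "\<And>n. snd ` set (c n) \<subseteq> carrier G" "\<And>n. pos_kernel.nrm (Psi t) (c n) \<le> 2 * (1 / 4) ^ n"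
  shows "AE w in \<Omega>. \<forall>\<^sub>F n in sequentially. pos_kernel.nrm (K t) (combo (c n) w) \<le> (1 / 2) ^ n"
proof -
  interpret I: invariant_kernel G "Psi t" by (rule invariant_kernel_Psi[OF t])
  interpret KD: pos_kernel D "K t" by (rule pos_kernel_K[OF t])
  note P = Psi_form[OF less_imp_le[OF t] c(1) c(1)]
  have "AE w in \<Omega>. \<forall>\<^sub>F n in sequentially. Re (KD.form (combo (c n) w) (combo (c n) w)) \<le> (1 / 4) ^ n"
  proof (rule AE_eventually_small[where C = 4])
    show "integrable \<Omega> (\<lambda>w. Re (KD.form (combo (c n) w) (combo (c n) w)))" for n using P(1)[of n n] by simp
    show "0 \<le> Re (KD.form (combo (c n) w) (combo (c n) w))" if "w \<in> space \<Omega>" for n w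
      by (rule KD.pos[OF combo_D[OF c(1) that]])
    show "(\<integral>w. Re (KD.form (combo (c n) w) (combo (c n) w)) \<partial>\<Omega>) \<le> 4 * (1 / 16) ^ n" for n
    proof -
      have "(\<integral>w. Re (KD.form (combo (c n) w) (combo (c n) w)) \<partial>\<Omega>) = Re (I.form (c n) (c n))"
        unfolding P(2)[symmetric] using P(1)[of n n] by simp
      also have "\<dots> = (I.nrm (c n))\<^sup>2" by (rule I.nrm_square[OF c(1), symmetric])
      also have "\<dots> \<le> (2 * (1 / 4) ^ n)\<^sup>2" by (rule power_mono[OF c(2)]) (rule I.nrm_nonneg[OF c(1)])
      also have "\<dots> = 4 * (1 / 16) ^ n" by (simp add: power_mult_distrib power_mult[symmetric] mult.commute[of n]) (simp add: power_mult power_divide)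
      finally show ?thesis .
    qed
  qed
  then show ?thesis
  proof (rule AE_mp, intro AE_I2 impI)
    fix w assume "\<forall>\<^sub>F n in sequentially. Re (KD.form (combo (c n) w) (combo (c n) w)) \<le> (1 / 4) ^ n"
    then show "\<forall>\<^sub>F n in sequentially. KD.nrm (combo (c n) w) \<le> (1 / 2) ^ n"
    proof (rule eventually_mono)
      fix n assume "Re (KD.form (combo (c n) w) (combo (c n) w)) \<le> (1 / 4) ^ n"
      then have "KD.nrm (combo (c n) w) \<le> sqrt ((1 / 4) ^ n)" unfolding KD.nrm_def by (rule real_sqrt_le_mono)
      also have "sqrt ((1 / 4 :: real) ^ n) = (1 / 2) ^ n"
        using real_sqrt_power[of "1 / 4" n] real_sqrt_divide[of 1 4] real_sqrt_four by simp
      finally show "KD.nrm (combo (c n) w) \<le> (1 / 2) ^ n" .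
    qed
  qed
qed

text \<open>
  The invariant vector restricts to functions \<open>F w\<close> on almost every fibre, limits of the
  restrictions \<open>f n w\<close> of its approximants, uniform in \<open>x\<close> because evaluation at a point has
  norm one. The sets are level sets of \<open>F\<close>.
\<close>

theorem bounded_equivariant_sets:
  assumes T: "property_T G T"
  obtains B :: "'w \<Rightarrow> 'v set" where "\<And>w. B w \<subseteq> D" "\<And>x. x \<in> D \<Longrightarrow> {w \<in> space \<Omega>. x \<in> B w} \<in> sets \<Omega>"
    "AE w in \<Omega>. \<exists>n. \<forall>x\<in>B w. d base x \<le> n"
    "\<And>g. g \<in> carrier G \<Longrightarrow> AE w in \<Omega>. B (act g w) = a g w ` B w"
    "measure \<Omega> {w \<in> space \<Omega>. base \<in> B w} > 0"
proof -
  obtain t c M z where t: "0 < t" and c: "\<And>n. snd ` set (c n) \<subseteq> carrier G"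
    and cM: "\<And>n. pos_kernel.nrm (Psi t) (c n) \<le> M"
    and c1: "\<And>n. pos_kernel.nrm (Psi t) (csub (c n) (c (Suc n))) \<le> 2 * (1 / 4) ^ n"
    and c2: "\<And>g n. g \<in> carrier G \<Longrightarrow> pos_kernel.nrm (Psi t) (csub (map (apsnd (\<lambda>x. g \<otimes> x)) (c n)) (c n)) \<le> 2 * (1 / 4) ^ n"
    and z: "(\<lambda>n. kernel_form (Psi t) (c n) [(1, \<one>)]) \<longlonglongrightarrow> z" "z \<noteq> 0"
    by (rule almost_invariant_combinations[OF T]) (rule that; assumption)
  interpret I: invariant_kernel G "Psi t" by (rule invariant_kernel_Psi[OF t])
  interpret KD: pos_kernel D "K t" by (rule pos_kernel_K[OF t])
  define f where "f = (\<lambda>n w x. KD.form (combo (c n) w) [(1, x)])"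
  define F where "F = (\<lambda>w x. lim (\<lambda>n. f n w x))"
  have cD: "snd ` set (combo (c n) w) \<subseteq> D" if "w \<in> space \<Omega>" for n w by (rule combo_D[OF c that])
  have eval: "cmod (KD.form e [(1, x)]) \<le> KD.nrm e" if "snd ` set e \<subseteq> D" "x \<in> D" for e x
  proof -
    have "KD.nrm [(1, x)] = 1" unfolding KD.nrm_def using that by (simp add: kernel_form_single K_refl)
    then show ?thesis using KD.cauchy_schwarz[of e "[(1, x)]"] that by simp
  qed
  have f_meas: "(\<lambda>w. f n w x) \<in> borel_measurable \<Omega>" for n x
  proof -
    have s: "kernel_form k [p] [(1, x)] = fst p * of_real (k (snd p) x)" for k and p :: "complex \<times> 'v"
      by (cases p) (simp add: kernel_form_single)
    have "(\<lambda>w. KD.form (combo e w) [(1, x)]) \<in> borel_measurable \<Omega>" if "snd ` set e \<subseteq> carrier G" for e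
      using that
    proof (induction e)
      case (Cons p e)
      have "(\<lambda>w. K t (orb (snd p) w) x) \<in> borel_measurable \<Omega>"
        using measurable_compose[OF orb_measurable[of "snd p"], of "\<lambda>y. K t y x"] Cons.prems by simp
      then have "(\<lambda>w. fst p * of_real (K t (orb (snd p) w) x)) \<in> borel_measurable \<Omega>" by measurable
      moreover have "(\<lambda>w. KD.form (combo (p # e) w) [(1, x)]) =
          (\<lambda>w. fst p * of_real (K t (orb (snd p) w) x) + KD.form (combo e w) [(1, x)])"
        using kernel_form_Cons(1) s by (intro ext) (simp add: combo_def kernel_form_Cons(1)[of _ _ "map _ _"])
      ultimately show ?case using Cons by simp
    qed (simp add: combo_def)
    then show ?thesis unfolding f_def using c by blast
  qed
  have F_meas: "(\<lambda>w. F w x) \<in> borel_measurable \<Omega>" for x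
    unfolding F_def by (rule borel_measurable_lim_metric[OF f_meas])
  define good where "good = (\<lambda>w. \<exists>N. \<forall>n\<ge>N. \<forall>x\<in>D. cmod (f n w x - f (Suc n) w x) \<le> (1 / 2) ^ n)"
  have AE_good: "AE w in \<Omega>. good w"
  proof -
    have "AE w in \<Omega>. \<forall>\<^sub>F n in sequentially. KD.nrm (combo (csub (c n) (c (Suc n))) w) \<le> (1 / 2) ^ n"
      by (rule AE_combo_small[OF t _ c1]) (use c in simp)
    then show ?thesis
    proof (rule AE_mp, intro AE_I2 impI)
      fix w assume w: "w \<in> space \<Omega>" and "\<forall>\<^sub>F n in sequentially. KD.nrm (combo (csub (c n) (c (Suc n))) w) \<le> (1 / 2) ^ n"
      then obtain N where N: "\<And>n. n \<ge> N \<Longrightarrow> KD.nrm (combo (csub (c n) (c (Suc n))) w) \<le> (1 / 2) ^ n"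
        unfolding eventually_sequentially by blast
      have "cmod (f n w x - f (Suc n) w x) \<le> (1 / 2) ^ n" if "n \<ge> N" "x \<in> D" for n x
      proof -
        have "f n w x - f (Suc n) w x = KD.form (combo (csub (c n) (c (Suc n))) w) [(1, x)]"
          unfolding f_def combo_csub by simp
        also have "cmod \<dots> \<le> KD.nrm (combo (csub (c n) (c (Suc n))) w)"
          by (rule eval[OF combo_D[OF _ w] that(2)]) (use c in simp)
        finally show ?thesis using N[OF that(1)] by linarith
      qed
      then show "good w" unfolding good_def by blast
    qed
  qed
  have lim_F: "(\<lambda>n. f n w x) \<longlonglongrightarrow> F w x" if "good w" "x \<in> D" for w x
    using that unfolding good_def F_def by (metis (no_types, lifting) geometric_limit(1))
  have unif: "\<exists>N. \<forall>n\<ge>N. \<forall>x\<in>D. cmod (f n w x - F w x) \<le> 2 * (1 / 2) ^ n" if g: "good w" for w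
  proof -
    obtain N where N: "\<And>n x. n \<ge> N \<Longrightarrow> x \<in> D \<Longrightarrow> cmod (f n w x - f (Suc n) w x) \<le> (1 / 2) ^ n"
      using g unfolding good_def by blast
    have "cmod (f n w x - F w x) \<le> 2 * (1 / 2) ^ n" if n: "n \<ge> N" and x: "x \<in> D" for n x
      unfolding F_def by (rule geometric_limit(2)[of N "\<lambda>n. f n w x", OF N n]) (use x in auto)
    then show ?thesis by blast
  qed
  have equiv: "AE w in \<Omega>. \<forall>x\<in>D. F (act g w) (a g w x) = F w x" if g: "g \<in> carrier G" for g
  proof -
    let ?s = "\<lambda>n. map (apsnd (\<lambda>x. g \<otimes> x)) (c n)"
    have sG: "snd ` set (?s n) \<subseteq> carrier G" for n using c g by (force)
    have "AE w in \<Omega>. \<forall>\<^sub>F n in sequentially. KD.nrm (combo (csub (?s n) (c n)) w) \<le> (1 / 2) ^ n"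
      by (rule AE_combo_small[OF t _ c2[OF g]]) (use c sG in simp)
    from AE_act[OF g this] AE_good AE_act[OF g AE_good] AE_space show ?thesis
    proof eventually_elim
      case (elim w)
      note w = elim(4)
        show ?case
        proof
          fix x assume x: "x \<in> D"
          have y: "a g w x \<in> D" using a_closed g w x by blast
          have e: "f n (act g w) (a g w x) - f n w x = - KD.form (combo (csub (?s n) (c n)) (act g w)) [(1, a g w x)]" for n
          proof -
            have "KD.form (combo (?s n) (act g w)) [(1, a g w x)] = f n w x"
            proof -
              have "KD.form (combo (?s n) (act g w)) [(1, a g w x)] =
                  KD.form (map (apsnd (a g w)) (combo (c n) w)) (map (apsnd (a g w)) [(1, x)])"
                using combo_shift[OF g w c] by simp
              also have "\<dots> = kernel_form (\<lambda>x y. K t (a g w x) (a g w y)) (combo (c n) w) [(1, x)]"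
                by (rule kernel_form_pullback)
              also have "\<dots> = f n w x" unfolding f_def
                by (rule kernel_form_cong, rule K_invariant[OF g w], erule subsetD[OF cD[OF w]]) (use x in simp)
              finally show ?thesis .
            qed
            then show ?thesis unfolding combo_csub f_def by simp
          qed
          have "\<forall>\<^sub>F n in sequentially. cmod (f n (act g w) (a g w x) - f n w x) \<le> (1 / 2) ^ n"
            using elim(1)
          proof (rule eventually_mono)
            fix n assume n: "KD.nrm (combo (csub (?s n) (c n)) (act g w)) \<le> (1 / 2) ^ n"
            have "cmod (KD.form (combo (csub (?s n) (c n)) (act g w)) [(1, a g w x)]) \<le> KD.nrm (combo (csub (?s n) (c n)) (act g w))"
              by (rule eval[OF combo_D y]) (use c sG act_space[OF g w] in simp_all)
            then show "cmod (f n (act g w) (a g w x) - f n w x) \<le> (1 / 2) ^ n" unfolding e norm_minus_cancel using n by linarith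
          qed
          then have "(\<lambda>n. f n (act g w) (a g w x) - f n w x) \<longlonglongrightarrow> 0"
            by (rule Lim_null_comparison) (simp add: LIMSEQ_power_zero)
          moreover have "(\<lambda>n. f n (act g w) (a g w x) - f n w x) \<longlonglongrightarrow> F (act g w) (a g w x) - F w x"
            by (intro tendsto_diff lim_F elim x y)
          ultimately have "F (act g w) (a g w x) - F w x = 0" by (rule LIMSEQ_unique[rotated])
          then show "F (act g w) (a g w x) = F w x" by simp
        qed
    qed
  qed
  have not0: "\<not> (AE w in \<Omega>. F w base = 0)"
  proof
    assume 0: "AE w in \<Omega>. F w base = 0"
    have l0: "AE w in \<Omega>. (\<lambda>n. f n w base) \<longlonglongrightarrow> 0"
      using 0 AE_good by eventually_elim (metis lim_F base)
    have "\<not> (AE w in \<Omega>. (\<lambda>n. f n w base) \<longlonglongrightarrow> 0)"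
    proof (rule integral_limit_nonzero[where h = "\<lambda>n w. Re (KD.form (combo (c n) w) (combo (c n) w))" and C = "M\<^sup>2", OF f_meas])
      note P = Psi_form[OF less_imp_le[OF t] c c]
      show "integrable \<Omega> (\<lambda>w. Re (KD.form (combo (c n) w) (combo (c n) w)))" for n using P(1)[of n n] by simp
      show "(cmod (f n w base))\<^sup>2 \<le> Re (KD.form (combo (c n) w) (combo (c n) w))" if w: "w \<in> space \<Omega>" for n w
        unfolding f_def KD.nrm_square[OF cD[OF w], symmetric] by (rule power_mono[OF eval[OF cD[OF w] base]]) simp
      show "(\<integral>w. Re (KD.form (combo (c n) w) (combo (c n) w)) \<partial>\<Omega>) \<le> M\<^sup>2" for n
      proof -
        have "(\<integral>w. Re (KD.form (combo (c n) w) (combo (c n) w)) \<partial>\<Omega>) = Re (I.form (c n) (c n))"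
          unfolding P(2)[symmetric] using P(1)[of n n] by simp
        also have "\<dots> = (I.nrm (c n))\<^sup>2" by (rule I.nrm_square[OF c, symmetric])
        also have "\<dots> \<le> M\<^sup>2" by (rule power_mono[OF cM]) (rule I.nrm_nonneg[OF c])
        finally show ?thesis .
      qed
      have "(\<integral>w. f n w base \<partial>\<Omega>) = I.form (c n) [(1, \<one>)]" for n
      proof -
        have "(\<integral>w. f n w base \<partial>\<Omega>) = (\<integral>w. KD.form (combo (c n) w) (combo [(1, \<one>)] w) \<partial>\<Omega>)"
          by (rule Bochner_Integration.integral_cong) (auto simp: f_def combo_def orb_one)
        also have "\<dots> = I.form (c n) [(1, \<one>)]" by (rule Psi_form(2)) (use t c in auto)
        finally show ?thesis .
      qed
      then show "(\<lambda>n. \<integral>w. f n w base \<partial>\<Omega>) \<longlonglongrightarrow> z" using z(1) by simp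
      show "z \<noteq> 0" by (rule z(2))
    qed
    then show False using l0 by blast
  qed
  define B where "B = (\<lambda>k w. {x \<in> D. inverse (real (Suc k)) \<le> cmod (F w x)})"
  have B_meas: "{w \<in> space \<Omega>. x \<in> B k w} \<in> sets \<Omega>" if "x \<in> D" for x k
  proof -
    have "{w \<in> space \<Omega>. x \<in> B k w} = {w \<in> space \<Omega>. inverse (real (Suc k)) \<le> cmod (F w x)}"
      using that by (auto simp: B_def)
    moreover have "{w \<in> space \<Omega>. inverse (real (Suc k)) \<le> cmod (F w x)} \<in> sets \<Omega>" using F_meas by measurable
    ultimately show ?thesis by simp
  qed
  have "\<exists>k. measure \<Omega> {w \<in> space \<Omega>. base \<in> B k w} > 0"
  proof (rule ccontr)
    assume "\<not> ?thesis"
    then have "measure \<Omega> {w \<in> space \<Omega>. base \<in> B k w} = 0" for k by (simp add: zero_less_measure_iff)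
    then have n: "{w \<in> space \<Omega>. base \<in> B k w} \<in> null_sets \<Omega>" for k
      using B_meas[OF base, of k] by (simp add: null_sets_def emeasure_eq_measure)
    have "(\<Union>k. {w \<in> space \<Omega>. base \<in> B k w}) \<in> null_sets \<Omega>" using n by (intro null_sets_UN)
    moreover have "{w \<in> space \<Omega>. \<not> F w base = 0} \<subseteq> (\<Union>k. {w \<in> space \<Omega>. base \<in> B k w})"
    proof
      fix w assume w: "w \<in> {w \<in> space \<Omega>. \<not> F w base = 0}"
      then obtain k where "inverse (real (Suc k)) < cmod (F w base)" using reals_Archimedean[of "cmod (F w base)"] by auto
      then have "base \<in> B k w" unfolding B_def mem_Collect_eq using base less_imp_le by blast
      then show "w \<in> (\<Union>k. {w \<in> space \<Omega>. base \<in> B k w})" using w by blast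
    qed
    ultimately have "AE w in \<Omega>. F w base = 0" by (rule AE_I')
    then show False using not0 by blast
  qed
  then obtain k where k: "measure \<Omega> {w \<in> space \<Omega>. base \<in> B k w} > 0" by blast
  show thesis
  proof (rule that[of "B k"])
    show "B k w \<subseteq> D" for w unfolding B_def by blast
    show "{w \<in> space \<Omega>. x \<in> B k w} \<in> sets \<Omega>" if "x \<in> D" for x by (rule B_meas[OF that])
    show "measure \<Omega> {w \<in> space \<Omega>. base \<in> B k w} > 0" by (rule k)
    show "AE w in \<Omega>. \<exists>n. \<forall>x\<in>B k w. d base x \<le> n"
      using AE_good
    proof (rule AE_mp, intro AE_I2 impI)
      fix w assume w: "w \<in> space \<Omega>" and g: "good w"
      define r where "r = inverse (real (Suc k))"
      have r: "r > 0" unfolding r_def by simp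
      obtain N where N: "\<And>n x. n \<ge> N \<Longrightarrow> x \<in> D \<Longrightarrow> cmod (f n w x - F w x) \<le> 2 * (1 / 2) ^ n" using unif[OF g] by blast
      have "(\<lambda>n. 2 * (1 / 2) ^ n) \<longlonglongrightarrow> 2 * (0 :: real)" by (intro tendsto_intros LIMSEQ_power_zero) simp
      from order_tendstoD(2)[OF this, of "r / 2"] have "\<forall>\<^sub>F n in sequentially. 2 * (1 / 2) ^ n < r / 2" using r by simp
      then have "\<forall>\<^sub>F n in sequentially. 2 * (1 / 2) ^ n < r / 2 \<and> N \<le> n" using eventually_ge_at_top eventually_conj by blast
      then obtain n where n: "2 * (1 / 2) ^ n < r / 2" "N \<le> n" using eventually_happens trivial_limit_sequentially by blast
      obtain b where b: "\<forall>x\<in>D. r / 2 \<le> cmod (f n w x) \<longrightarrow> d base x \<le> b"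
        using far_points_small[OF t cD[OF w], of "r / 2" n] r unfolding f_def by auto
      have "d base x \<le> b" if x: "x \<in> B k w" for x
      proof -
        have xD: "x \<in> D" "r \<le> cmod (F w x)" using x unfolding B_def r_def by auto
        have "cmod (F w x) \<le> cmod (f n w x) + cmod (f n w x - F w x)"
          using norm_triangle_sub[of "F w x" "f n w x"] by (simp add: norm_minus_commute)
        then have "r / 2 \<le> cmod (f n w x)" using N[OF n(2) xD(1)] n(1) xD(2) by linarith
        then show ?thesis using b xD(1) by blast
      qed
      then show "\<exists>n. \<forall>x\<in>B k w. d base x \<le> n" by blast
    qed
    show "AE w in \<Omega>. B k (act g w) = a g w ` B k w" if g: "g \<in> carrier G" for g
      using equiv[OF g]
    proof (rule AE_mp, intro AE_I2 impI)
      fix w assume w: "w \<in> space \<Omega>" and e: "\<forall>x\<in>D. F (act g w) (a g w x) = F w x"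
      show "B k (act g w) = a g w ` B k w"
      proof
        show "a g w ` B k w \<subseteq> B k (act g w)" unfolding B_def using e a_closed[OF g w] by auto
        show "B k (act g w) \<subseteq> a g w ` B k w"
        proof
          fix y assume y: "y \<in> B k (act g w)"
          then have yD: "y \<in> D" unfolding B_def by blast
          then obtain x where x: "x \<in> D" "y = a g w x" using a_bij[OF g w] unfolding bij_betw_def by blast
          then show "y \<in> a g w ` B k w" using y e unfolding B_def by auto
        qed
      qed
    qed
  qed
qed

end

context discrete_cocycle
begin

section \<open>Strict equivariance and ergodicity\<close>

text \<open>
  The value of \<open>C\<close> at \<open>inv g . w\<close>, transported to \<open>w\<close>, almost surely equals \<open>C w\<close> for each \<open>g\<close>.
  By Fubini's theorem, for almost every \<open>w\<close> it has a single value \<open>y\<close> for almost every \<open>g\<close>; let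
  \<open>N y\<close> be the set of \<open>w\<close> for which this holds with the value \<open>y\<close>. Left invariance of Haar
  measure makes these sets strictly equivariant.
\<close>

theorem strict_equivariant_version:
  assumes C: "C \<in> \<Omega> \<rightarrow>\<^sub>M count_space D"
    and ae: "\<And>g. g \<in> carrier G \<Longrightarrow> AE w in \<Omega>. C (act g w) = a g w (C w)"
  obtains N where "\<And>y. y \<in> D \<Longrightarrow> N y \<in> sets \<Omega>" "disjoint_family_on N D"
    "\<And>y g w. y \<in> D \<Longrightarrow> g \<in> carrier G \<Longrightarrow> w \<in> N y \<Longrightarrow> act g w \<in> N (a g w y)"
    "AE w in \<Omega>. w \<in> N (C w)"
proof -
  obtain k where "haar_content G T k" using exists_haar_content by blast
  then interpret H: haar_content G T k .
  define m where "m = H.haar"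
  note m = H.sets_haar[folded m_def] H.haar_sigma_finite[folded m_def] H.haar_nonzero[folded m_def] H.haar_lt[folded m_def]
  have spm: "space m = carrier G" using sets_eq_imp_space_eq[OF m(1)] by simp
  interpret m: sigma_finite_measure m by (rule m(2))
  interpret P: pair_sigma_finite \<Omega> m ..
  have pm: "sets (\<Omega> \<Otimes>\<^sub>M m) = sets (\<Omega> \<Otimes>\<^sub>M borel_of T)" by (intro sets_pair_measure_cong refl m(1))
  have CD: "C w \<in> D" if "w \<in> space \<Omega>" for w using measurable_space[OF C that] by simp
  define c where "c = (\<lambda>w g. a g (act (inv g) w) (C (act (inv g) w)))"
  have cD: "c w g \<in> D" if "w \<in> space \<Omega>" "g \<in> carrier G" for w g unfolding c_def using a_closed CD that by simp
  have c_shift: "c (act h w) (h \<otimes> g) = a h w (c w g)"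
    if "w \<in> space \<Omega>" "h \<in> carrier G" "g \<in> carrier G" for w h g
  proof -
    have "act (inv (h \<otimes> g)) (act h w) = act (inv g) w" using that by (simp add: inv_mult_group act_mult)
    then show ?thesis unfolding c_def using that CD a_mult[of h g "act (inv g) w" "C (act (inv g) w)"] by simp
  qed
  have c_meas: "{p \<in> space (\<Omega> \<Otimes>\<^sub>M m). c (fst p) (snd p) = y} \<in> sets (\<Omega> \<Otimes>\<^sub>M m)" if y: "y \<in> D" for y
  proof -
    have "(\<lambda>p. c (fst p) (snd p)) -` {y} \<inter> space (\<Omega> \<Otimes>\<^sub>M borel_of T) \<in> sets (\<Omega> \<Otimes>\<^sub>M borel_of T)"
      unfolding c_def by (rule measurable_sets[OF pulled_measurable[OF C]]) (use y in simp)
    then show ?thesis using pm sets_eq_imp_space_eq[OF pm] by (simp add: vimage_def Int_def conj_commute)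
  qed
  define N where "N = (\<lambda>y. {w \<in> space \<Omega>. AE g in m. c w g = y})"
  have N_emeasure: "(AE g in m. c w g = y) \<longleftrightarrow> emeasure m {g \<in> carrier G. c w g \<noteq> y} = 0"
    and N_sets: "{g \<in> carrier G. c w g \<noteq> y} \<in> sets m" if "w \<in> space \<Omega>" "y \<in> D" for w y
  proof -
    have "Pair w -` (space (\<Omega> \<Otimes>\<^sub>M m) - {p \<in> space (\<Omega> \<Otimes>\<^sub>M m). c (fst p) (snd p) = y}) \<in> sets m"
      by (rule sets_Pair1[OF sets.compl_sets[OF c_meas[OF that(2)]]])
    moreover have "Pair w -` (space (\<Omega> \<Otimes>\<^sub>M m) - {p \<in> space (\<Omega> \<Otimes>\<^sub>M m). c (fst p) (snd p) = y}) = {g \<in> carrier G. c w g \<noteq> y}"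
      using that(1) spm by (auto simp: space_pair_measure)
    ultimately show s: "{g \<in> carrier G. c w g \<noteq> y} \<in> sets m" by simp
    show "(AE g in m. c w g = y) \<longleftrightarrow> emeasure m {g \<in> carrier G. c w g \<noteq> y} = 0"
      using AE_iff_measurable[OF s, of "\<lambda>g. c w g = y"] spm by simp
  qed
  show thesis
  proof (rule that[of N])
    show "N y \<in> sets \<Omega>" if y: "y \<in> D" for y
    proof -
      let ?S = "space (\<Omega> \<Otimes>\<^sub>M m) - {p \<in> space (\<Omega> \<Otimes>\<^sub>M m). c (fst p) (snd p) = y}"
      have "(\<lambda>w. emeasure m (Pair w -` ?S)) \<in> borel_measurable \<Omega>"
        by (rule m.measurable_emeasure_Pair[OF sets.compl_sets[OF c_meas[OF y]]])
      then have "{w \<in> space \<Omega>. emeasure m (Pair w -` ?S) = 0} \<in> sets \<Omega>" by measurable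
      moreover have "Pair w -` ?S = {g \<in> carrier G. c w g \<noteq> y}" if "w \<in> space \<Omega>" for w
        using that spm by (auto simp: space_pair_measure)
      ultimately show ?thesis unfolding N_def using N_emeasure[OF _ y] by (simp cong: conj_cong)
    qed
    show "disjoint_family_on N D"
    proof -
      have False if w: "w \<in> N y" "w \<in> N z" and "y \<noteq> z" for w y z
      proof -
        have "AE g in m. c w g = y" "AE g in m. c w g = z" using w unfolding N_def by auto
        then have "AE g in m. False" by eventually_elim (use \<open>y \<noteq> z\<close> in simp)
        then show False using m(3) AE_iff_measurable[OF sets.top[of m], of "\<lambda>_. False"] spm by simp
      qed
      then show ?thesis unfolding disjoint_family_on_def by blast
    qed
    show "act h w \<in> N (a h w y)" if y: "y \<in> D" and h: "h \<in> carrier G" and w: "w \<in> N y" for y h w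
    proof -
      have ws: "w \<in> space \<Omega>" using w unfolding N_def by blast
      have z: "a h w y \<in> D" using a_closed h ws y by blast
      let ?E = "{g \<in> carrier G. c w g \<noteq> y}"
      have "{g \<in> carrier G. c (act h w) g \<noteq> a h w y} = lt h ?E"
      proof (intro Set.set_eqI iffI)
        fix g assume g: "g \<in> {g \<in> carrier G. c (act h w) g \<noteq> a h w y}"
        let ?k = "inv h \<otimes> g"
        have k: "?k \<in> carrier G" "g = h \<otimes> ?k" using g h by (auto simp: m_assoc[symmetric])
        then have "c w ?k \<noteq> y" using c_shift[OF ws h k(1)] g by auto
        then show "g \<in> lt h ?E" using k by blast
      next
        fix g assume "g \<in> lt h ?E"
        then obtain k where k: "k \<in> carrier G" "c w k \<noteq> y" "g = h \<otimes> k" by blast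
        have "inj_on (a h w) D" using a_bij[OF h ws] unfolding bij_betw_def by blast
        then have "a h w (c w k) \<noteq> a h w y" using cD[OF ws k(1)] y k(2) by (simp add: inj_on_eq_iff)
        then show "g \<in> {g \<in> carrier G. c (act h w) g \<noteq> a h w y}" using c_shift[OF ws h k(1)] k h by simp
      qed
      then have "emeasure m {g \<in> carrier G. c (act h w) g \<noteq> a h w y} = emeasure m ?E"
        using m(4)[OF h] N_sets[OF ws y] m(1) by simp
      then show ?thesis using w N_emeasure[OF ws y] N_emeasure[OF act_space[OF h ws] z] act_space[OF h ws] unfolding N_def by simp
    qed
    have "AE g in m. AE w in \<Omega>. c w g = C w"
    proof (rule AE_I2)
      fix g assume "g \<in> space m"
      then have g: "g \<in> carrier G" using spm by simp
      have "AE w in \<Omega>. C (act g (act (inv g) w)) = a g (act (inv g) w) (C (act (inv g) w))"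
        using AE_act[OF inv_closed[OF g] ae[OF g]] .
      then show "AE w in \<Omega>. c w g = C w" using AE_space by eventually_elim (simp add: c_def g)
    qed
    moreover have "{p \<in> space (\<Omega> \<Otimes>\<^sub>M m). c (fst p) (snd p) = C (fst p)} \<in> sets (\<Omega> \<Otimes>\<^sub>M m)"
    proof -
      have "{p \<in> space (\<Omega> \<Otimes>\<^sub>M m). c (fst p) (snd p) = C (fst p)} =
          (\<Union>y\<in>D. {p \<in> space (\<Omega> \<Otimes>\<^sub>M m). c (fst p) (snd p) = y} \<inter> ((\<lambda>p. C (fst p)) -` {y} \<inter> space (\<Omega> \<Otimes>\<^sub>M m)))"
        using CD by (auto simp: space_pair_measure)
      also have "\<dots> \<in> sets (\<Omega> \<Otimes>\<^sub>M m)"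
        by (intro sets.countable_UN'' D_countable sets.Int c_meas measurable_sets[OF measurable_compose[OF measurable_fst C]]) auto
      finally show ?thesis .
    qed
    ultimately have "AE w in \<Omega>. AE g in m. c w g = C w" using P.AE_commute[of "\<lambda>w g. c w g = C w"] by simp
    then show "AE w in \<Omega>. w \<in> N (C w)" using AE_space by eventually_elim (simp add: N_def)
  qed
qed

text \<open>
  The function \<open>q\<close> is to be thought of as the map to an orbit space. The points whose strictly
  equivariant value lies in a given orbit form an invariant set, null or conull by ergodicity.
  As there are countably many values, one of these sets is conull.
\<close>

theorem equivariant_map_into_orbit:
  assumes C: "C \<in> \<Omega> \<rightarrow>\<^sub>M count_space D"
    and ae: "\<And>g. g \<in> carrier G \<Longrightarrow> AE w in \<Omega>. C (act g w) = a g w (C w)"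
    and erg: "\<And>A. A \<in> sets \<Omega> \<Longrightarrow> (\<And>g. g \<in> carrier G \<Longrightarrow> act g ` A = A) \<Longrightarrow> measure \<Omega> A = 0 \<or> measure \<Omega> A = 1"
    and q: "\<And>g w y. g \<in> carrier G \<Longrightarrow> w \<in> space \<Omega> \<Longrightarrow> y \<in> D \<Longrightarrow> q (a g w y) = q y"
    and P: "measure \<Omega> {w \<in> space \<Omega>. P (C w)} > 0"
  obtains y0 C' \<Omega>' where "y0 \<in> D" "P y0" "C' \<in> \<Omega> \<rightarrow>\<^sub>M count_space D" "\<Omega>' \<in> sets \<Omega>" "AE w in \<Omega>. w \<in> \<Omega>'"
    "\<And>w. w \<in> space \<Omega> \<Longrightarrow> q (C' w) = q y0"
    "\<And>g w. g \<in> carrier G \<Longrightarrow> w \<in> \<Omega>' \<Longrightarrow> act g w \<in> \<Omega>' \<and> C' (act g w) = a g w (C' w)"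
proof -
  obtain N where N: "\<And>y. y \<in> D \<Longrightarrow> N y \<in> sets \<Omega>" "disjoint_family_on N D"
    "\<And>y g w. y \<in> D \<Longrightarrow> g \<in> carrier G \<Longrightarrow> w \<in> N y \<Longrightarrow> act g w \<in> N (a g w y)"
    "AE w in \<Omega>. w \<in> N (C w)"
    by (rule strict_equivariant_version[OF C ae], assumption) (rule that; assumption)
  have CD: "C w \<in> D" if "w \<in> space \<Omega>" for w using measurable_space[OF C that] by simp
  have Nsp: "w \<in> space \<Omega>" if "y \<in> D" "w \<in> N y" for y w using N(1)[OF that(1)] that(2) sets.sets_into_space by blast
  define U where "U = (\<lambda>z. \<Union>y\<in>{y \<in> D. q y = z}. N y)"
  have U_sets: "U z \<in> sets \<Omega>" for z
    unfolding U_def using N(1) by (intro sets.countable_UN'') (auto intro: countable_subset[OF _ D_countable])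
  have U_act: "act g w \<in> U z" if g: "g \<in> carrier G" and w: "w \<in> U z" for g w z
  proof -
    obtain y where y: "y \<in> D" "q y = z" "w \<in> N y" using w unfolding U_def by blast
    then have ws: "w \<in> space \<Omega>" using Nsp by blast
    have "act g w \<in> N (a g w y)" "q (a g w y) = z" "a g w y \<in> D"
      using N(3)[OF y(1) g y(3)] q[OF g ws y(1)] a_closed[OF g ws y(1)] y(2) by auto
    then show ?thesis unfolding U_def by blast
  qed
  have U01: "measure \<Omega> (U z) = 0 \<or> measure \<Omega> (U z) = 1" for z
  proof (rule erg[OF U_sets])
    fix g assume g: "g \<in> carrier G"
    show "act g ` U z = U z"
    proof
      show "act g ` U z \<subseteq> U z" using U_act[OF g] by blast
      show "U z \<subseteq> act g ` U z"
      proof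
        fix w assume w: "w \<in> U z"
        then have "w \<in> space \<Omega>" using U_sets sets.sets_into_space by blast
        then have "w = act g (act (inv g) w)" using g by simp
        then show "w \<in> act g ` U z" using U_act[OF inv_closed[OF g] w] by blast
      qed
    qed
  qed
  have "\<exists>y\<in>D. P y \<and> measure \<Omega> (U (q y)) \<noteq> 0"
  proof (rule ccontr)
    assume no: "\<not> ?thesis"
    have "U (q y) \<in> null_sets \<Omega>" if "y \<in> {y \<in> D. P y}" for y
      using no that U_sets by (auto simp: null_sets_def emeasure_eq_measure)
    then have n: "(\<Union>y\<in>{y \<in> D. P y}. U (q y)) \<in> null_sets \<Omega>"
      by (intro null_sets_UN') (auto intro: countable_subset[OF _ D_countable])
    have "AE w in \<Omega>. \<not> P (C w)"
      using N(4) AE_not_in[OF n] AE_space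
    proof eventually_elim
      case (elim w)
      then have "w \<in> U (q (C w))" unfolding U_def using CD by blast
      then show ?case using elim CD by blast
    qed
    moreover have s: "{w \<in> space \<Omega>. P (C w)} \<in> sets \<Omega>"
    proof -
      have "C -` {y \<in> D. P y} \<inter> space \<Omega> \<in> sets \<Omega>" by (rule measurable_sets[OF C]) simp
      moreover have "C -` {y \<in> D. P y} \<inter> space \<Omega> = {w \<in> space \<Omega>. P (C w)}" using CD by auto
      ultimately show ?thesis by simp
    qed
    ultimately have "measure \<Omega> {w \<in> space \<Omega>. P (C w)} = 0"
      using AE_iff_measurable[OF s, of "\<lambda>w. \<not> P (C w)"] by (simp add: measure_def)
    then show False using P by simp
  qed
  then obtain y0 where y0: "y0 \<in> D" "P y0" "measure \<Omega> (U (q y0)) = 1" using U01 by blast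
  define C' where "C' = (\<lambda>w. if w \<in> U (q y0) then THE y. y \<in> D \<and> w \<in> N y else y0)"
  have C'_eq: "C' w = y" if "y \<in> D" "q y = q y0" "w \<in> N y" for w y
  proof -
    have "w \<in> U (q y0)" using that unfolding U_def by blast
    moreover have "(THE y. y \<in> D \<and> w \<in> N y) = y"
      using that N(2) unfolding disjoint_family_on_def by (intro the_equality) blast+
    ultimately show ?thesis unfolding C'_def by simp
  qed
  have C'_U: "\<exists>y\<in>D. q y = q y0 \<and> w \<in> N y \<and> C' w = y" if "w \<in> U (q y0)" for w
    using that C'_eq unfolding U_def by blast
  have C'D: "C' w \<in> D \<and> q (C' w) = q y0" for w
    using C'_U[of w] y0(1) by (cases "w \<in> U (q y0)") (auto simp: C'_def)
  show thesis
  proof (rule that[of y0 C' "U (q y0)"])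
    show "C' \<in> \<Omega> \<rightarrow>\<^sub>M count_space D"
    proof (subst measurable_count_space_eq_countable[OF D_countable], intro conjI ballI)
      show "C' \<in> space \<Omega> \<rightarrow> D" using C'D by blast
      fix y assume y: "y \<in> D"
      have "C' -` {y} \<inter> space \<Omega> = (if q y = q y0 then N y else {}) \<union> (if y = y0 then space \<Omega> - U (q y0) else {})"
      proof (rule Set.set_eqI)
        fix w
        have "C' w = y \<longleftrightarrow> (q y = q y0 \<and> w \<in> N y) \<or> (y = y0 \<and> w \<notin> U (q y0))"
        proof (cases "w \<in> U (q y0)")
          case True
          then obtain y' where "y' \<in> D" "q y' = q y0" "w \<in> N y'" "C' w = y'" using C'_U by blast
          then show ?thesis using True C'_eq[OF y, of w] by blast
        next
          case False
          then have "\<not> (q y = q y0 \<and> w \<in> N y)" using y unfolding U_def by blast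
          moreover have "C' w = y0" using False unfolding C'_def by (rule if_not_P)
          ultimately show ?thesis using False by blast
        qed
        then show "w \<in> C' -` {y} \<inter> space \<Omega> \<longleftrightarrow>
            w \<in> (if q y = q y0 then N y else {}) \<union> (if y = y0 then space \<Omega> - U (q y0) else {})"
          using Nsp[OF y, of w] by (cases "q y = q y0"; cases "y = y0"; simp; blast)
      qed
      then show "C' -` {y} \<inter> space \<Omega> \<in> sets \<Omega>" using N(1)[OF y] U_sets by auto
    qed
    show "AE w in \<Omega>. w \<in> U (q y0)" by (rule AE_prob_1[OF y0(3)])
    show "act g w \<in> U (q y0) \<and> C' (act g w) = a g w (C' w)" if g: "g \<in> carrier G" and w: "w \<in> U (q y0)" for g w
    proof -
      obtain y where y: "y \<in> D" "q y = q y0" "w \<in> N y" "C' w = y" using C'_U[OF w] by blast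
      then have ws: "w \<in> space \<Omega>" using Nsp by blast
      have "C' (act g w) = a g w y"
        using C'_eq[OF a_closed[OF g ws y(1)] _ N(3)[OF y(1) g y(3)]] q[OF g ws y(1)] y(2) by simp
      then show ?thesis using U_act[OF g w] y(4) by simp
    qed
  qed (use y0(1,2) U_sets C'D in blast)+
qed

end

section \<open>Finite equivariant sets\<close>

lemma image_eq_iff: "(f ` F = F') \<longleftrightarrow> (\<forall>x\<in>F. \<exists>y\<in>F'. f x = y) \<and> (\<forall>y\<in>F'. \<exists>x\<in>F. f x = y)"
  (is "_ \<longleftrightarrow> ?P \<and> ?Q")
proof (intro iffI conjI)
  assume e: "f ` F = F'"
  show ?P using e by auto
  show ?Q using e by auto
next
  assume pq: "?P \<and> ?Q"
  show "f ` F = F'"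
  proof
    show "f ` F \<subseteq> F'" using pq by auto
    show "F' \<subseteq> f ` F"
    proof
      fix y assume "y \<in> F'"
      then obtain x where "x \<in> F" "f x = y" using pq by blast
      then show "y \<in> f ` F" by blast
    qed
  qed
qed

lemma (in discrete_cocycle) finite_subsets_cocycle:
  "discrete_cocycle G T \<Omega> act {F. finite F \<and> F \<subseteq> D} (\<lambda>g w F. a g w ` F)"
proof unfold_locales
  show "countable {F. finite F \<and> F \<subseteq> D}" using countable_Collect_finite_subset[OF D_countable] .
  show "a g w ` F \<in> {F. finite F \<and> F \<subseteq> D}" if "g \<in> carrier G" "w \<in> space \<Omega>" "F \<in> {F. finite F \<and> F \<subseteq> D}" for g w F
    using that a_closed by blast
  show "a (g \<otimes> h) w ` F = a g (act h w) ` a h w ` F"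
    if "g \<in> carrier G" "h \<in> carrier G" "w \<in> space \<Omega>" "F \<in> {F. finite F \<and> F \<subseteq> D}" for g h w F
    unfolding image_image using that a_mult by (intro image_cong) auto
  show "a \<one> w ` F = F" if "w \<in> space \<Omega>" "F \<in> {F. finite F \<and> F \<subseteq> D}" for w F
    using that a_one by force
  show "{p \<in> space (borel_of T \<Otimes>\<^sub>M \<Omega>). a (fst p) (snd p) ` F = F'} \<in> sets (borel_of T \<Otimes>\<^sub>M \<Omega>)"
    if F: "F \<in> {F. finite F \<and> F \<subseteq> D}" and F': "F' \<in> {F. finite F \<and> F \<subseteq> D}" for F F'
  proof -
    have "{p \<in> space (borel_of T \<Otimes>\<^sub>M \<Omega>). (\<forall>x\<in>F. \<exists>y\<in>F'. a (fst p) (snd p) x = y) \<and> (\<forall>y\<in>F'. \<exists>x\<in>F. a (fst p) (snd p) x = y)}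
        \<in> sets (borel_of T \<Otimes>\<^sub>M \<Omega>)"
      using F F' by (intro sets.sets_Collect_conj sets.sets_Collect_countable_All' sets.sets_Collect_countable_Ex'
        a_measurable countable_finite) auto
    moreover have "(a (fst p) (snd p) ` F = F') \<longleftrightarrow>
        (\<forall>x\<in>F. \<exists>y\<in>F'. a (fst p) (snd p) x = y) \<and> (\<forall>y\<in>F'. \<exists>x\<in>F. a (fst p) (snd p) x = y)" for p
      by (rule image_eq_iff)
    ultimately show ?thesis by simp
  qed
qed (fact standard act_measurable act_preserving)+

text \<open>The centres of the bounded equivariant sets.\<close>

lemma finite_equivariant_sets:
  fixes G :: "'g monoid" and \<Omega> :: "'w measure" and a :: "'g \<Rightarrow> 'w \<Rightarrow> 'v \<Rightarrow> 'v"
  assumes graph: "simply_connected_square_graph E sq V"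
    and mc: "metric_cocycle G T \<Omega> act D a (square_graph.dst E) base"
    and DV: "D \<subseteq> V"
    and conv: "\<And>x y. x \<in> D \<Longrightarrow> y \<in> D \<Longrightarrow> simply_connected_square_graph.interval E V x y \<subseteq> D"
    and T: "property_T G T"
  obtains C :: "'w \<Rightarrow> 'v set" where "C \<in> \<Omega> \<rightarrow>\<^sub>M count_space {F. finite F \<and> F \<subseteq> D}"
    "\<And>g. g \<in> carrier G \<Longrightarrow> AE w in \<Omega>. C (act g w) = a g w ` C w"
    "measure \<Omega> {w \<in> space \<Omega>. C w \<noteq> {}} > 0"
proof -
  interpret simply_connected_square_graph E sq V by (rule graph)
  interpret metric_cocycle G T \<Omega> act D a dst base by (rule mc)
  interpret F: discrete_cocycle G T \<Omega> act "{F. finite F \<and> F \<subseteq> D}" "\<lambda>g w F. a g w ` F" by (rule finite_subsets_cocycle)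
  obtain B where BD: "\<And>w. B w \<subseteq> D" and B_meas: "\<And>x. x \<in> D \<Longrightarrow> {w \<in> space \<Omega>. x \<in> B w} \<in> sets \<Omega>"
    and B_bdd: "AE w in \<Omega>. \<exists>n. \<forall>x\<in>B w. dst base x \<le> n"
    and B_equiv: "\<And>g. g \<in> carrier G \<Longrightarrow> AE w in \<Omega>. B (act g w) = a g w ` B w"
    and B_pos: "measure \<Omega> {w \<in> space \<Omega>. base \<in> B w} > 0"
    by (rule bounded_equivariant_sets[OF T]) (rule that; assumption)
  \<comment> \<open>The case distinction matters because the centre of the empty set is all of \<open>D\<close>.\<close>
  define C where "C = (\<lambda>w. if B w = {} then {} else centre D (B w))"
  have CF: "C w \<in> {F. finite F \<and> F \<subseteq> D}" for w
    unfolding C_def using finite_centre[OF DV conv BD] by (auto simp: centre_def)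
  have all_meas: "{w \<in> space \<Omega>. \<forall>b\<in>B w. dst x b \<le> r} \<in> sets \<Omega>" for x r
  proof -
    have "{w \<in> space \<Omega>. \<forall>b\<in>D. b \<in> B w \<longrightarrow> dst x b \<le> r} \<in> sets \<Omega>"
      by (intro sets.sets_Collect_countable_All'[OF _ D_countable] sets.sets_Collect_imp sets.sets_Collect_const B_meas)
    moreover have "(\<forall>b\<in>D. b \<in> B w \<longrightarrow> dst x b \<le> r) \<longleftrightarrow> (\<forall>b\<in>B w. dst x b \<le> r)" for w using BD by blast
    ultimately show ?thesis by simp
  qed
  have ne_meas: "{w \<in> space \<Omega>. B w \<noteq> {}} \<in> sets \<Omega>"
  proof -
    have "{w \<in> space \<Omega>. \<exists>b\<in>D. b \<in> B w} \<in> sets \<Omega>"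
      by (intro sets.sets_Collect_countable_Ex'[OF _ D_countable] B_meas)
    moreover have "(\<exists>b\<in>D. b \<in> B w) \<longleftrightarrow> B w \<noteq> {}" for w using BD by blast
    ultimately show ?thesis by simp
  qed
  have C_meas1: "{w \<in> space \<Omega>. x \<in> C w} \<in> sets \<Omega>" if x: "x \<in> D" for x
  proof -
    have "{w \<in> space \<Omega>. (\<exists>r. (\<forall>b\<in>B w. dst x b \<le> r) \<and>
        (\<forall>y\<in>D. \<forall>s. (\<forall>b\<in>B w. dst y b \<le> s) \<longrightarrow> r \<le> s)) \<and> B w \<noteq> {}} \<in> sets \<Omega>"
      by (intro sets.sets_Collect_conj sets.sets_Collect_countable_Ex sets.sets_Collect_countable_All
        sets.sets_Collect_countable_All'[OF _ D_countable] sets.sets_Collect_imp sets.sets_Collect_const all_meas ne_meas)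
    moreover have "x \<in> C w \<longleftrightarrow> (\<exists>r. (\<forall>b\<in>B w. dst x b \<le> r) \<and>
        (\<forall>y\<in>D. \<forall>s. (\<forall>b\<in>B w. dst y b \<le> s) \<longrightarrow> r \<le> s)) \<and> B w \<noteq> {}" for w
      using x unfolding C_def centre_def by simp
    ultimately show ?thesis by simp
  qed
  show thesis
  proof (rule that[of C])
    show "C \<in> \<Omega> \<rightarrow>\<^sub>M count_space {F. finite F \<and> F \<subseteq> D}"
    proof (subst measurable_count_space_eq_countable[OF F.D_countable], intro conjI ballI)
      show "C \<in> space \<Omega> \<rightarrow> {F. finite F \<and> F \<subseteq> D}" using CF by blast
      fix F assume F: "F \<in> {F. finite F \<and> F \<subseteq> D}"
      have "{w \<in> space \<Omega>. \<forall>x\<in>D. x \<in> C w \<longleftrightarrow> x \<in> F} \<in> sets \<Omega>"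
      proof (rule sets.sets_Collect_countable_All'[OF _ D_countable])
        fix x assume x: "x \<in> D"
        show "{w \<in> space \<Omega>. x \<in> C w \<longleftrightarrow> x \<in> F} \<in> sets \<Omega>"
          using C_meas1[OF x] sets.sets_Collect_neg[OF C_meas1[OF x]] by (cases "x \<in> F") simp_all
      qed
      moreover have "{w \<in> space \<Omega>. \<forall>x\<in>D. x \<in> C w \<longleftrightarrow> x \<in> F} = C -` {F} \<inter> space \<Omega>"
      proof (rule Set.set_eqI)
        fix w
        have "(\<forall>x\<in>D. x \<in> C w \<longleftrightarrow> x \<in> F) \<longleftrightarrow> C w = F" using CF[of w] F by blast
        then show "w \<in> {w \<in> space \<Omega>. \<forall>x\<in>D. x \<in> C w \<longleftrightarrow> x \<in> F} \<longleftrightarrow> w \<in> C -` {F} \<inter> space \<Omega>" by simp blast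
      qed
      ultimately show "C -` {F} \<inter> space \<Omega> \<in> sets \<Omega>" by simp
    qed
    show "AE w in \<Omega>. C (act g w) = a g w ` C w" if g: "g \<in> carrier G" for g
      using B_equiv[OF g] AE_space
    proof eventually_elim
      case (elim w)
      let ?a = "a g w"
      have bij: "?a ` D = D" "\<And>x. x \<in> D \<Longrightarrow> ?a x \<in> D" using a_bij[OF g elim(2)] unfolding bij_betw_def by auto
      have iso: "dst (?a x) (?a y) = dst x y" if "x \<in> D" "y \<in> D" for x y using d_invariant[OF g elim(2) that] .
      have bound: "(\<forall>b\<in>?a ` B w. dst (?a x) b \<le> r) \<longleftrightarrow> (\<forall>b\<in>B w. dst x b \<le> r)" if x: "x \<in> D" for x r
        using iso[OF x] BD by (auto simp: subset_iff)
      have all: "(\<forall>y\<in>D. \<forall>s. (\<forall>b\<in>?a ` B w. dst y b \<le> s) \<longrightarrow> r \<le> s) \<longleftrightarrow>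
          (\<forall>y\<in>D. \<forall>s. (\<forall>b\<in>B w. dst y b \<le> s) \<longrightarrow> r \<le> s)" for r
      proof -
        have im: "(\<forall>y\<in>?a ` D. P y) \<longleftrightarrow> (\<forall>y\<in>D. P (?a y))" for P by blast
        have "(\<forall>y\<in>?a ` D. \<forall>s. (\<forall>b\<in>?a ` B w. dst y b \<le> s) \<longrightarrow> r \<le> s) \<longleftrightarrow>
          (\<forall>y\<in>D. \<forall>s. (\<forall>b\<in>B w. dst y b \<le> s) \<longrightarrow> r \<le> s)"
          unfolding im using bound by (intro ball_cong refl) simp
        then show ?thesis unfolding bij(1) .
      qed
      have ca: "?a x \<in> centre D (?a ` B w) \<longleftrightarrow> x \<in> centre D (B w)" if x: "x \<in> D" for x
        using x bij(2)[OF x] unfolding centre_def mem_Collect_eq all bound[OF x] by simp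
      have cD: "centre D B' \<subseteq> D" for B' unfolding centre_def by blast
      have "centre D (?a ` B w) = ?a ` centre D (B w)"
      proof
        show "?a ` centre D (B w) \<subseteq> centre D (?a ` B w)" using ca subsetD[OF cD] by auto
        show "centre D (?a ` B w) \<subseteq> ?a ` centre D (B w)"
        proof
          fix y assume y: "y \<in> centre D (?a ` B w)"
          then have "y \<in> ?a ` D" using subsetD[OF cD y] bij(1) by simp
          then obtain x where x: "x \<in> D" "y = ?a x" by blast
          then show "y \<in> ?a ` centre D (B w)" using y ca[OF x(1)] by simp
        qed
      qed
      then show ?case unfolding C_def elim(1) by simp
    qed
    have "measure \<Omega> {w \<in> space \<Omega>. base \<in> B w} \<le> measure \<Omega> {w \<in> space \<Omega>. C w \<noteq> {}}"
    proof (rule finite_measure_mono_AE)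
      show "AE w in \<Omega>. w \<in> {w \<in> space \<Omega>. base \<in> B w} \<longrightarrow> w \<in> {w \<in> space \<Omega>. C w \<noteq> {}}"
        using B_bdd
      proof eventually_elim
        case (elim w)
        then obtain n where "\<forall>x\<in>B w. dst base x \<le> n" by blast
        then have "centre D (B w) \<noteq> {}" using base by (rule centre_nonempty[rotated])
        then show ?case unfolding C_def by auto
      qed
      have "{w \<in> space \<Omega>. \<exists>x\<in>D. x \<in> C w} \<in> sets \<Omega>"
        by (intro sets.sets_Collect_countable_Ex'[OF _ D_countable] C_meas1)
      moreover have "(\<exists>x\<in>D. x \<in> C w) \<longleftrightarrow> C w \<noteq> {}" for w using CF[of w] by blast
      ultimately show "{w \<in> space \<Omega>. C w \<noteq> {}} \<in> sets \<Omega>" by simp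
    qed
    then show "measure \<Omega> {w \<in> space \<Omega>. C w \<noteq> {}} > 0" using B_pos by linarith
  qed
qed

section \<open>Cocycles of isometries of a cube complex\<close>

lemma subgroup_isometries:
  "subgroup {f \<in> Bij V. \<forall>u\<in>V. \<forall>v\<in>V. d (f u) (f v) = d u v} (BijGroup V)" (is "subgroup ?S _")
proof (rule group.subgroupI[OF group_BijGroup])
  show "?S \<subseteq> carrier (BijGroup V)" by (auto simp: BijGroup_def)
  have "(\<lambda>x\<in>V. x) \<in> ?S" by (auto simp: id_Bij)
  then show "?S \<noteq> {}" by blast
  show "inv\<^bsub>BijGroup V\<^esub> f \<in> ?S" if f: "f \<in> ?S" for f
  proof -
    have B: "f \<in> Bij V" using f by blast
    then have im: "f ` V = V" unfolding Bij_def bij_betw_def by blast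
    have i: "inv\<^bsub>BijGroup V\<^esub> f = (\<lambda>x\<in>V. inv_into V f x)" by (rule inv_BijGroup[OF B])
    have "d (inv_into V f u) (inv_into V f v) = d u v"
      if uv: "u \<in> V" "v \<in> V" for u v
    proof -
      have "inv_into V f u \<in> V" "inv_into V f v \<in> V"
        using uv im inv_into_into[of _ f "V"] by auto
      then have "d (f (inv_into V f u)) (f (inv_into V f v)) =
          d (inv_into V f u) (inv_into V f v)" using f by blast
      then show ?thesis using f_inv_into_f[of _ f "V"] uv im by simp
    qed
    then show ?thesis using i restrict_inv_into_Bij[OF B] by simp
  qed
  show "f \<otimes>\<^bsub>BijGroup V\<^esub> h \<in> ?S" if fh: "f \<in> ?S" "h \<in> ?S" for f h
  proof -
    have B: "f \<in> Bij V" "h \<in> Bij V" using fh by auto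
    have "h x \<in> V" if "x \<in> V" for x using Bij_imp_funcset[OF B(2)] that by blast
    then show ?thesis using fh compose_Bij[OF B] B by (simp add: BijGroup_def compose_def)
  qed
qed

lemma group_isom_group: "group (isom_group X)"
  unfolding isom_group_def by (rule subgroup.subgroup_is_group[OF subgroup_isometries group_BijGroup])

locale isometries =
  fixes X :: "'v set set" and H :: "('v \<Rightarrow> 'v) set"
  assumes subgroup_H: "subgroup H (isom_group X)"
begin

abbreviation "V \<equiv> vertices X"
abbreviation "HG \<equiv> isom_group X\<lparr>carrier := H\<rparr>"
abbreviation "TH \<equiv> pointwise_topology X H"

lemma group_HG: "group HG"
  using subgroup.subgroup_is_group[OF subgroup_H group_isom_group] .

sublocale HG: group HG
  rewrites "carrier HG = H"
  by (rule group_HG) simp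

lemma H_Bij: "h \<in> H \<Longrightarrow> h \<in> Bij V"
  using subgroup.subset[OF subgroup_H] unfolding isom_group_def by auto

lemma H_isometry: "h \<in> H \<Longrightarrow> u \<in> V \<Longrightarrow> v \<in> V \<Longrightarrow> gdist X (h u) (h v) = gdist X u v"
  using subgroup.subset[OF subgroup_H] unfolding isom_group_def by auto

lemma H_vertex: "h \<in> H \<Longrightarrow> x \<in> V \<Longrightarrow> h x \<in> V"
  using Bij_imp_funcset[OF H_Bij] by blast

lemma H_mult_apply: "h \<in> H \<Longrightarrow> k \<in> H \<Longrightarrow> x \<in> V \<Longrightarrow> (h \<otimes>\<^bsub>HG\<^esub> k) x = h (k x)"
  using H_Bij by (simp add: isom_group_def BijGroup_def compose_def)

lemma H_one_apply: "x \<in> V \<Longrightarrow> \<one>\<^bsub>HG\<^esub> x = x"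
  by (simp add: isom_group_def BijGroup_def)

lemma H_inv_apply: assumes "h \<in> H" "x \<in> V"
  shows "(inv\<^bsub>HG\<^esub> h) (h x) = x" "h ((inv\<^bsub>HG\<^esub> h) x) = x"
proof -
  have i: "inv\<^bsub>HG\<^esub> h \<in> H" using HG.inv_closed assms(1) by simp
  show "(inv\<^bsub>HG\<^esub> h) (h x) = x" using H_mult_apply[OF i assms] HG.l_inv assms H_one_apply by simp
  show "h ((inv\<^bsub>HG\<^esub> h) x) = x" using H_mult_apply[OF assms(1) i assms(2)] HG.r_inv assms H_one_apply by simp
qed

lemma H_inv_image: "h \<in> H \<Longrightarrow> F \<subseteq> V \<Longrightarrow> (inv\<^bsub>HG\<^esub> h) ` h ` F = F"
  unfolding image_image using H_inv_apply(1) subsetD[of F V] by (simp del: Union_iff)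

lemma H_mult_image: "h \<in> H \<Longrightarrow> k \<in> H \<Longrightarrow> F \<subseteq> V \<Longrightarrow> (h \<otimes>\<^bsub>HG\<^esub> k) ` F = h ` k ` F"
  unfolding image_image by (intro image_cong refl H_mult_apply subsetD[of F V])

lemma topspace_TH [simp]: "topspace TH = H"
proof -
  have "H \<subseteq> (\<Pi>\<^sub>E x\<in>V. V)"
  proof
    fix h assume "h \<in> H"
    then show "h \<in> (\<Pi>\<^sub>E x\<in>V. V)" using Bij_imp_extensional[OF H_Bij] H_vertex by (auto simp: PiE_iff)
  qed
  then show ?thesis unfolding pointwise_topology_def by (auto simp: topspace_subtopology)
qed

lemma continuous_apply: "x \<in> V \<Longrightarrow> continuous_map TH (discrete_topology V) (\<lambda>h. h x)"
  unfolding pointwise_topology_def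
  by (rule continuous_map_from_subtopology[OF continuous_map_product_projection])

lemma openin_apply: "x \<in> V \<Longrightarrow> openin TH {h \<in> H. h x \<in> A}"
proof -
  assume x: "x \<in> V"
  have "openin TH {h \<in> topspace TH. h x \<in> A \<inter> V}"
    by (rule openin_continuous_map_preimage[OF continuous_apply[OF x]]) simp
  moreover have "{h \<in> topspace TH. h x \<in> A \<inter> V} = {h \<in> H. h x \<in> A}" using H_vertex x by auto
  ultimately show ?thesis by simp
qed

lemma continuous_two_sided: assumes h: "h \<in> H" "k \<in> H" shows "continuous_map TH TH (\<lambda>f. h \<otimes>\<^bsub>HG\<^esub> f \<otimes>\<^bsub>HG\<^esub> k)"
proof -
  have "continuous_map TH (product_topology (\<lambda>_. discrete_topology V) V) (\<lambda>f. h \<otimes>\<^bsub>HG\<^esub> f \<otimes>\<^bsub>HG\<^esub> k)"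
    unfolding continuous_map_componentwise
  proof (intro conjI ballI)
    show "(\<lambda>f. h \<otimes>\<^bsub>HG\<^esub> f \<otimes>\<^bsub>HG\<^esub> k) ` topspace TH \<subseteq> extensional V"
      using Bij_imp_extensional[OF H_Bij] HG.m_closed h by auto
    fix x assume x: "x \<in> V"
    have kx: "k x \<in> V" using H_vertex[OF h(2) x] .
    have "continuous_map (discrete_topology V) (discrete_topology V) h"
      using H_vertex[OF h(1)] by (simp del: Union_iff)
    from continuous_map_compose[OF continuous_apply[OF kx] this]
    have "continuous_map TH (discrete_topology V) (\<lambda>f. h (f (k x)))" by (simp add: comp_def)
    then show "continuous_map TH (discrete_topology V) (\<lambda>f. (h \<otimes>\<^bsub>HG\<^esub> f \<otimes>\<^bsub>HG\<^esub> k) x)"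
      by (rule continuous_map_eq) (use x h kx H_mult_apply HG.m_closed in simp)
  qed
  then show ?thesis unfolding pointwise_topology_def
    by (rule continuous_map_into_subtopology) (use h HG.m_closed in \<open>auto simp: pointwise_topology_def[symmetric]\<close>)
qed

end

lemma sets_pair_borel_of: "sets (borel_of S \<Otimes>\<^sub>M borel_of T) \<subseteq> sets (borel_of (prod_topology S T))"
proof -
  have f: "fst \<in> borel_of (prod_topology S T) \<rightarrow>\<^sub>M borel_of S" "snd \<in> borel_of (prod_topology S T) \<rightarrow>\<^sub>M borel_of T"
    by (intro measurable_borel_of_continuous continuous_map_fst continuous_map_snd)+
  have "(\<lambda>p. (fst p, snd p)) \<in> borel_of (prod_topology S T) \<rightarrow>\<^sub>M borel_of S \<Otimes>\<^sub>M borel_of T"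
    by (intro measurable_Pair f)
  note m = measurable_sets[OF this]
  show ?thesis
  proof
    fix A assume A: "A \<in> sets (borel_of S \<Otimes>\<^sub>M borel_of T)"
    have "A \<subseteq> topspace S \<times> topspace T" using sets.sets_into_space[OF A] by (simp add: space_pair_measure space_borel_of)
    then have "(\<lambda>p. (fst p, snd p)) -` A \<inter> space (borel_of (prod_topology S T)) = A" by (auto simp: space_borel_of)
    then show "A \<in> sets (borel_of (prod_topology S T))" using m[OF A] by simp
  qed
qed

lemma second_countable_prod_topology:
  assumes "second_countable S" "second_countable T" shows "second_countable (prod_topology S T)"
proof -
  obtain A where A: "countable A" "\<forall>V\<in>A. openin S V" "\<forall>U x. openin S U \<and> x \<in> U \<longrightarrow> (\<exists>V\<in>A. x \<in> V \<and> V \<subseteq> U)"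
    using assms(1) unfolding second_countable_def by blast
  obtain B where B: "countable B" "\<forall>V\<in>B. openin T V" "\<forall>U x. openin T U \<and> x \<in> U \<longrightarrow> (\<exists>V\<in>B. x \<in> V \<and> V \<subseteq> U)"
    using assms(2) unfolding second_countable_def by blast
  show ?thesis unfolding second_countable_def
  proof (intro exI conjI ballI allI impI)
    show "countable ((\<lambda>(U, V). U \<times> V) ` (A \<times> B))" using A(1) B(1) by simp
    show "openin (prod_topology S T) W" if "W \<in> (\<lambda>(U, V). U \<times> V) ` (A \<times> B)" for W
      using that A(2) B(2) by (auto simp: openin_prod_Times_iff)
    fix W p assume W: "openin (prod_topology S T) W \<and> p \<in> W"
    then have p: "(fst p, snd p) \<in> W" by simp
    obtain U V where UV: "openin S U" "openin T V" "fst p \<in> U" "snd p \<in> V" "U \<times> V \<subseteq> W"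
      using openin_prod_topology_alt[THEN iffD1, OF conjunct1[OF W], rule_format, OF p] by blast
    obtain U' where U': "U' \<in> A" "fst p \<in> U'" "U' \<subseteq> U" using A(3) UV(1,3) by blast
    obtain V' where V': "V' \<in> B" "snd p \<in> V'" "V' \<subseteq> V" using B(3) UV(2,4) by blast
    have "U' \<times> V' \<subseteq> W" using U'(3) V'(3) UV(5) by blast
    moreover have "p \<in> U' \<times> V'" using U'(2) V'(2) by (simp add: mem_Times_iff)
    moreover have "U' \<times> V' \<in> (\<lambda>(U, V). U \<times> V) ` (A \<times> B)" using U'(1) V'(1) by auto
    ultimately show "\<exists>W'\<in>(\<lambda>(U, V). U \<times> V) ` (A \<times> B). p \<in> W' \<and> W' \<subseteq> W"
      by (intro bexI[of _ "U' \<times> V'"] conjI)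
  qed
qed

locale isometry_cocycle = lcsc G T + isometries X H
  for G :: "'g monoid" (structure) and T :: "'g topology" and X :: "'v set set" and H +
  fixes \<Omega> :: "'w measure" and act :: "'g \<Rightarrow> 'w \<Rightarrow> 'w" and \<alpha> :: "'g \<Rightarrow> 'w \<Rightarrow> 'v \<Rightarrow> 'v"
  assumes ergodic: "ergodic_gspace G T \<Omega> act"
    and cat0: "cat0_cube_complex X"
    and cocycle: "measurable_cocycle G T \<Omega> act HG TH \<alpha>"
begin

lemma cocycle_measurable: "(\<lambda>(g, w). \<alpha> g w) \<in> borel_of T \<Otimes>\<^sub>M \<Omega> \<rightarrow>\<^sub>M borel_of TH"
  using cocycle unfolding measurable_cocycle_def by blast

lemma cocycle_mult:
  "g \<in> carrier G \<Longrightarrow> h \<in> carrier G \<Longrightarrow> w \<in> space \<Omega> \<Longrightarrow> \<alpha> (g \<otimes> h) w = \<alpha> g (act h w) \<otimes>\<^bsub>HG\<^esub> \<alpha> h w"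
  using cocycle unfolding measurable_cocycle_def by blast

lemma cocycle_H: "g \<in> carrier G \<Longrightarrow> w \<in> space \<Omega> \<Longrightarrow> \<alpha> g w \<in> H"
  using measurable_space[OF cocycle_measurable, of "(g, w)"] by (simp add: space_pair_measure space_borel_of)

lemma cocycle_vertex: "g \<in> carrier G \<Longrightarrow> w \<in> space \<Omega> \<Longrightarrow> x \<in> V \<Longrightarrow> \<alpha> g w x \<in> V"
  by (rule H_vertex[OF cocycle_H])

lemma action_one: "w \<in> space \<Omega> \<Longrightarrow> act \<one> w = w"
  using ergodic group_action.id_eq_one[of G "space \<Omega>" act] unfolding ergodic_gspace_def by (metis restrict_apply')

lemma cocycle_one: assumes "w \<in> space \<Omega>" shows "\<alpha> \<one> w = \<one>\<^bsub>HG\<^esub>"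
proof -
  have "\<alpha> \<one> w = \<alpha> \<one> w \<otimes>\<^bsub>HG\<^esub> \<alpha> \<one> w"
    using cocycle_mult[of \<one> \<one> w] action_one assms by simp
  then show ?thesis using HG.l_cancel_one'[OF cocycle_H cocycle_H] assms by (metis one_closed)
qed

lemma cocycle_at_vertex_measurable:
  assumes "x \<in> V"
  shows "{p \<in> space (borel_of T \<Otimes>\<^sub>M \<Omega>). \<alpha> (fst p) (snd p) x \<in> A} \<in> sets (borel_of T \<Otimes>\<^sub>M \<Omega>)"
proof -
  have "{h \<in> H. h x \<in> A} \<in> sets (borel_of TH)"
    using openin_apply[OF assms] unfolding sets_borel_of by (intro sigma_sets.Basic) simp
  from measurable_sets[OF cocycle_measurable this]
  have "(\<lambda>(g, w). \<alpha> g w) -` {h \<in> H. h x \<in> A} \<inter> space (borel_of T \<Otimes>\<^sub>M \<Omega>) \<in> sets (borel_of T \<Otimes>\<^sub>M \<Omega>)" .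
  moreover have "(\<lambda>(g, w). \<alpha> g w) -` {h \<in> H. h x \<in> A} \<inter> space (borel_of T \<Otimes>\<^sub>M \<Omega>) =
      {p \<in> space (borel_of T \<Otimes>\<^sub>M \<Omega>). \<alpha> (fst p) (snd p) x \<in> A}"
    using cocycle_H by (auto simp: space_pair_measure space_borel_of)
  ultimately show ?thesis by simp
qed

text \<open>
  For each \<open>x\<close> the map to \<open>\<alpha>(g, w) x\<close> on the product of \<open>G\<close> and \<open>\<Omega>\<close> is Borel into
  a discrete space.
\<close>

lemma countable_orbit: assumes x: "x \<in> V" shows "countable ((\<lambda>p. \<alpha> (fst p) (snd p) x) ` (carrier G \<times> space \<Omega>))"
proof -
  obtain S where S: "completely_metrizable_space S" "second_countable S" "topspace S = space \<Omega>" "sets \<Omega> = sets (borel_of S)"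
    using ergodic unfolding ergodic_gspace_def standard_borel_def by blast
  let ?P = "prod_topology T S"
  have mS: "metrizable_space S" using S(1) by (rule completely_metrizable_imp_metrizable_space)
  have "countable ((\<lambda>p. \<alpha> (fst p) (snd p) x) ` topspace ?P)"
  proof (rule countable_range_of_discrete_borel_map)
    show "souslin ?P (topspace ?P)"
      by (intro souslin_prod_topology souslin_locally_compact[OF loc_compact hausdorff sec_countable]
        souslin_completely_metrizable[OF S(1,2)])
    show "Hausdorff_space ?P" using hausdorff metrizable_imp_Hausdorff_space[OF mS] by (simp add: Hausdorff_space_prod_topology)
    show "regular_space ?P"
      using locally_compact_Hausdorff_imp_regular_space[OF loc_compact hausdorff] metrizable_imp_regular_space[OF mS]
      by (simp add: regular_space_prod_topology)
    show "second_countable ?P" using sec_countable S(2) by (simp add: second_countable_prod_topology)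
    fix A
    have "sets (borel_of T \<Otimes>\<^sub>M \<Omega>) = sets (borel_of T \<Otimes>\<^sub>M borel_of S)" by (intro sets_pair_measure_cong refl S(4))
    then have "{p \<in> space (borel_of T \<Otimes>\<^sub>M \<Omega>). \<alpha> (fst p) (snd p) x \<in> A} \<in> sets (borel_of ?P)"
      using cocycle_at_vertex_measurable[OF x, of A] sets_pair_borel_of[of T S] by blast
    moreover have "space (borel_of T \<Otimes>\<^sub>M \<Omega>) = topspace ?P" using S(3) by (simp add: space_pair_measure space_borel_of)
    ultimately show "{p \<in> topspace ?P. \<alpha> (fst p) (snd p) x \<in> A} \<in> sigma_sets (topspace ?P) {U. openin ?P U}"
      unfolding sets_borel_of by simp
  qed
  then show ?thesis using S(3) by simp
qed

interpretation graph: simply_connected_square_graph "adj X" "square X" V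
  by (rule cat0_square_graph[OF cat0])

text \<open>
  Orbits are countable and intervals are finite, so the closure of a point under both is
  countable.
\<close>

lemma countable_convex_invariant_set:
  obtains D base where "countable D" "D \<subseteq> V" "base \<in> D"
    "\<And>x y. x \<in> D \<Longrightarrow> y \<in> D \<Longrightarrow> graph.interval x y \<subseteq> D"
    "\<And>g w x. g \<in> carrier G \<Longrightarrow> w \<in> space \<Omega> \<Longrightarrow> x \<in> D \<Longrightarrow> \<alpha> g w x \<in> D"
proof -
  have "V \<noteq> {}"
  proof -
    obtain c where c: "c \<in> X" using cat0 unfolding cat0_cube_complex_def by blast
    have "cube_complex X" using cat0 unfolding cat0_cube_complex_def by blast
    from cube_card[OF this c] have "c \<noteq> {}" by auto
    then show ?thesis using c by blast
  qed
  then obtain base where base: "base \<in> V" by blast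
  define orbit where "orbit = (\<lambda>x. (\<lambda>p. \<alpha> (fst p) (snd p) x) ` (carrier G \<times> space \<Omega>))"
  have orbit: "\<alpha> g w x \<in> orbit x" if "g \<in> carrier G" "w \<in> space \<Omega>" for g w x
    unfolding orbit_def by (rule image_eqI[of _ _ "(g, w)"]) (use that in simp_all)
  have orbit_V: "orbit x \<subseteq> V" if "x \<in> V" for x
    unfolding orbit_def by (rule image_subsetI, rule cocycle_vertex) (use that in auto)
  define step where "step = (\<lambda>S. S \<union> (\<Union>x\<in>S. orbit x) \<union> (\<Union>x\<in>S. \<Union>y\<in>S. graph.interval x y))"
  define L where "L = (\<lambda>n. (step ^^ n) {base})"
  have L: "countable (L n) \<and> L n \<subseteq> V" for n
  proof (induction n)
    case 0
    then show ?case using base by (simp add: L_def)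
  next
    case (Suc n)
    have "countable (graph.interval x y)" if "x \<in> L n" "y \<in> L n" for x y
      using graph.finite_interval[of x y] that Suc countable_finite by blast
    moreover have "countable (orbit x)" if "x \<in> L n" for x
      unfolding orbit_def using countable_orbit[of x] that Suc by blast
    ultimately have "countable (step (L n))" unfolding step_def using Suc by (intro countable_Un countable_UN) auto
    moreover have "step (L n) \<subseteq> V"
      unfolding step_def graph.interval_def using Suc orbit_V by blast
    moreover have "L (Suc n) = step (L n)" unfolding L_def by simp
    ultimately show ?case by simp
  qed
  have mono: "L n \<subseteq> L (n + k)" for n k
  proof (induction k)
    case (Suc k)
    have "L (n + k) \<subseteq> L (n + Suc k)" unfolding L_def step_def by auto
    then show ?case using Suc by blast
  qed simp
  show thesis
  proof (rule that[of "\<Union>n. L n" base])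
    show "countable (\<Union>n. L n)" using L by (intro countable_UN) auto
    show "(\<Union>n. L n) \<subseteq> V" using L by blast
    have "base \<in> L 0" unfolding L_def by simp
    then show "base \<in> (\<Union>n. L n)" by blast
    have sL: "step (L n) \<subseteq> (\<Union>n. L n)" for n
    proof -
      have "L (Suc n) = step (L n)" unfolding L_def by simp
      then show ?thesis by blast
    qed
    show "graph.interval x y \<subseteq> (\<Union>n. L n)" if xy: "x \<in> (\<Union>n. L n)" "y \<in> (\<Union>n. L n)" for x y
    proof -
      obtain i j where ij: "x \<in> L i" "y \<in> L j" using xy by blast
      then have "x \<in> L (i + j)" "y \<in> L (i + j)" using mono[of i j] mono[of j i] by (auto simp: add.commute)
      then have "graph.interval x y \<subseteq> step (L (i + j))" unfolding step_def by blast
      then show ?thesis using sL[of "i + j"] by blast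
    qed
    show "\<alpha> g w x \<in> (\<Union>n. L n)" if g: "g \<in> carrier G" "w \<in> space \<Omega>" and x: "x \<in> (\<Union>n. L n)" for g w x
    proof -
      obtain i where "x \<in> L i" using x by blast
      then have "\<alpha> g w x \<in> step (L i)" unfolding step_def using orbit[OF g] by blast
      then show ?thesis using sL by blast
    qed
  qed
qed

lemma metric_cocycle_on_invariant_set:
  assumes "countable D" "D \<subseteq> V" "base \<in> D"
    "\<And>g w x. g \<in> carrier G \<Longrightarrow> w \<in> space \<Omega> \<Longrightarrow> x \<in> D \<Longrightarrow> \<alpha> g w x \<in> D"
  shows "metric_cocycle G T \<Omega> act D \<alpha> graph.dst base"
proof -
  have DV: "x \<in> V" if "x \<in> D" for x using assms(2) that by blast
  have erg: "prob_space \<Omega>" "standard_borel \<Omega>" "group_action G (space \<Omega>) act"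
    "(\<lambda>(g, w). act g w) \<in> borel_of T \<Otimes>\<^sub>M \<Omega> \<rightarrow>\<^sub>M \<Omega>" "\<And>g. g \<in> carrier G \<Longrightarrow> distr \<Omega> \<Omega> (act g) = \<Omega>"
    using ergodic unfolding ergodic_gspace_def by auto
  show ?thesis
  proof (intro metric_cocycle.intro discrete_cocycle.intro metric_cocycle_axioms.intro discrete_cocycle_axioms.intro)
    show "\<alpha> (g \<otimes> h) w x = \<alpha> g (act h w) (\<alpha> h w x)"
      if "g \<in> carrier G" "h \<in> carrier G" "w \<in> space \<Omega>" "x \<in> D" for g h w x
    proof -
      have "act h w \<in> space \<Omega>" using group_action.element_image[OF erg(3)] that by blast
      then show ?thesis using cocycle_mult H_mult_apply cocycle_H DV that by simp
    qed
    show "\<alpha> \<one> w x = x" if "w \<in> space \<Omega>" "x \<in> D" for w x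
      using cocycle_one H_one_apply DV that by simp
    show "{p \<in> space (borel_of T \<Otimes>\<^sub>M \<Omega>). \<alpha> (fst p) (snd p) x = y} \<in> sets (borel_of T \<Otimes>\<^sub>M \<Omega>)"
      if "x \<in> D" "y \<in> D" for x y using cocycle_at_vertex_measurable[OF DV[OF that(1)], of "{y}"] by simp
    show "graph.dst (\<alpha> g w x) (\<alpha> g w y) = graph.dst x y"
      if "g \<in> carrier G" "w \<in> space \<Omega>" "x \<in> D" "y \<in> D" for g w x y
      unfolding gdist_eq_dst[OF cat0] by (rule H_isometry[OF cocycle_H[OF that(1,2)] DV[OF that(3)] DV[OF that(4)]])
    show "0 \<le> Re (kernel_form (\<lambda>x y. exp (- (t * real (graph.dst x y)))) c c)"
      if "snd ` set c \<subseteq> D" "0 < t" for c t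
      by (rule graph.exp_dist_pos) (use that assms(2) in auto)
    show "graph.dst x x = 0" if "x \<in> D" for x using graph.dst_refl .
    show "graph.dst x y = graph.dst y x" if "x \<in> D" "y \<in> D" for x y by (rule graph.dst_commute[OF DV DV]) fact+
    show "graph.dst x z \<le> graph.dst x y + graph.dst y z" if "x \<in> D" "y \<in> D" "z \<in> D" for x y z
      by (rule graph.dst_triangle[OF DV DV DV]) fact+
  qed (fact assms erg lcsc_axioms)+
qed

end

lemma (in group) conjugate_mult:
  assumes "u \<in> carrier G" "x \<in> carrier G" "y \<in> carrier G" "v \<in> carrier G" "p \<in> carrier G"
  shows "u \<otimes> (x \<otimes> y) \<otimes> v = (u \<otimes> x \<otimes> inv p) \<otimes> (p \<otimes> y \<otimes> v)"
  using assms m_assoc[of "inv p" p "y \<otimes> v", symmetric] by (simp add: m_assoc)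

lemma (in group) conjugate_back:
  assumes "x \<in> carrier G" "p \<in> carrier G" "r \<in> carrier G"
  shows "x = inv p \<otimes> (p \<otimes> x \<otimes> inv r) \<otimes> r"
  using assms m_assoc[of "inv p" p x, symmetric] by (simp add: m_assoc)

text \<open>
  A finite set of vertices is a subcomplex of dimension zero. A permutation of the vertices
  preserves it exactly if it preserves the set.
\<close>

lemma singleton_subcomplex:
  assumes X: "cube_complex X" and F: "finite F" "F \<noteq> {}" "F \<subseteq> vertices X"
  shows "bounded_subcomplex X ((\<lambda>v. {v}) ` F)"
proof -
  have "{v} \<in> X" if v: "v \<in> F" for v
  proof -
    obtain c where c: "c \<in> X" "v \<in> c" using v F(3) by blast
    obtain n f where f: "bij_betw f (Pow {..<n::nat}) c" "{d \<in> X. d \<subseteq> c} = {f ` {A..B} |A B. A \<subseteq> B \<and> B \<subseteq> {..<n}}"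
      using X c(1) unfolding cube_complex_def by meson
    obtain A where A: "A \<subseteq> {..<n}" "v = f A" using f(1) c(2) unfolding bij_betw_def by blast
    have "f ` {A..A} \<in> {f ` {A..B} |A B. A \<subseteq> B \<and> B \<subseteq> {..<n}}" using A(1) by blast
    then have "f ` {A..A} \<in> X" unfolding f(2)[symmetric] by blast
    then show ?thesis using A(2) by simp
  qed
  moreover have "d \<noteq> {}" if "d \<in> X" for d using cube_card[OF X that] by auto
  moreover have "\<forall>u\<in>F. \<forall>v\<in>F. gdist X u v \<le> Max ((\<lambda>(u, v). gdist X u v) ` (F \<times> F))"
    using F(1) by (intro ballI Max_ge) auto
  ultimately show ?thesis unfolding bounded_subcomplex_def using F(2) by (auto simp: subset_singleton_iff)
qed

context isometry_cocycle
begin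

lemma H_orbit_image:
  assumes k: "k \<in> H" and F: "F \<subseteq> V" shows "{h ` k ` F | h. h \<in> H} = {h ` F | h. h \<in> H}"
proof (intro equalityI subsetI)
  fix S assume "S \<in> {h ` k ` F | h. h \<in> H}"
  then obtain h where h: "h \<in> H" "S = h ` k ` F" by blast
  then have "S = (h \<otimes>\<^bsub>HG\<^esub> k) ` F" using H_mult_image[OF h(1) k F] by simp
  then show "S \<in> {h ` F | h. h \<in> H}" using HG.m_closed[OF h(1) k] by blast
next
  fix S assume "S \<in> {h ` F | h. h \<in> H}"
  then obtain h where h: "h \<in> H" "S = h ` F" by blast
  have kF: "k ` F \<subseteq> V" using H_vertex[OF k] F by blast
  have i: "(inv\<^bsub>HG\<^esub> k) \<in> H" using HG.inv_closed[OF k] .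
  have "(h \<otimes>\<^bsub>HG\<^esub> inv\<^bsub>HG\<^esub> k) ` k ` F = h ` (inv\<^bsub>HG\<^esub> k) ` k ` F" by (rule H_mult_image[OF h(1) i kF])
  also have "\<dots> = S" unfolding H_inv_image[OF k F] h(2) ..
  finally show "S \<in> {h ` k ` F | h. h \<in> H}" using HG.m_closed[OF h(1) i] by blast
qed

theorem cohomologous_to_bounded_isotropy:
  assumes T: "property_T G T"
  shows "\<exists>Z \<beta>. bounded_subcomplex X Z \<and> measurable_cocycle G T \<Omega> act HG TH \<beta> \<and>
    (\<forall>g\<in>carrier G. \<forall>w\<in>space \<Omega>. \<beta> g w \<in> isotropy_group H Z) \<and> cohomologous G \<Omega> act HG TH \<alpha> \<beta>"
proof -
  obtain D base where D: "countable D" "D \<subseteq> V" "base \<in> D"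
    "\<And>x y. x \<in> D \<Longrightarrow> y \<in> D \<Longrightarrow> simply_connected_square_graph.interval (adj X) V x y \<subseteq> D"
    "\<And>g w x. g \<in> carrier G \<Longrightarrow> w \<in> space \<Omega> \<Longrightarrow> x \<in> D \<Longrightarrow> \<alpha> g w x \<in> D"
    by (rule countable_convex_invariant_set) (rule that; assumption)
  have mc: "metric_cocycle G T \<Omega> act D \<alpha> (square_graph.dst (adj X)) base"
    by (rule metric_cocycle_on_invariant_set[OF D(1,2,3,5)])
  interpret M: metric_cocycle G T \<Omega> act D \<alpha> "square_graph.dst (adj X)" base by (rule mc)
  let ?E = "{F. finite F \<and> F \<subseteq> D}"
  interpret F: discrete_cocycle G T \<Omega> act ?E "\<lambda>g w F. \<alpha> g w ` F" by (rule M.finite_subsets_cocycle)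
  obtain C where C: "C \<in> \<Omega> \<rightarrow>\<^sub>M count_space ?E"
    "\<And>g. g \<in> carrier G \<Longrightarrow> AE w in \<Omega>. C (act g w) = \<alpha> g w ` C w"
    "measure \<Omega> {w \<in> space \<Omega>. C w \<noteq> {}} > 0"
    by (rule finite_equivariant_sets[OF cat0_square_graph[OF cat0] mc D(2) D(4) T]) (assumption | rule that)+
  define q where "q = (\<lambda>F. {h ` F | h. h \<in> H})"
  have EV: "F \<subseteq> V" if "F \<in> ?E" for F using that D(2) by blast
  obtain F0 C' \<Omega>' where F0: "F0 \<in> ?E" "F0 \<noteq> {}" and C': "C' \<in> \<Omega> \<rightarrow>\<^sub>M count_space ?E"
    and \<Omega>': "\<Omega>' \<in> sets \<Omega>" "AE w in \<Omega>. w \<in> \<Omega>'"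
    and qC': "\<And>w. w \<in> space \<Omega> \<Longrightarrow> q (C' w) = q F0"
    and act': "\<And>g w. g \<in> carrier G \<Longrightarrow> w \<in> \<Omega>' \<Longrightarrow> act g w \<in> \<Omega>' \<and> C' (act g w) = \<alpha> g w ` C' w"
  proof (rule F.equivariant_map_into_orbit[OF C(1), where q = q and P = "\<lambda>F. F \<noteq> {}"])
    show "AE w in \<Omega>. C (act g w) = \<alpha> g w ` C w" if "g \<in> carrier G" for g by (rule C(2)[OF that])
    show "measure \<Omega> A = 0 \<or> measure \<Omega> A = 1" if "A \<in> sets \<Omega>" "\<And>g. g \<in> carrier G \<Longrightarrow> act g ` A = A" for A
      using ergodic that unfolding ergodic_gspace_def by blast
    show "q (\<alpha> g w ` F) = q F" if "g \<in> carrier G" "w \<in> space \<Omega>" "F \<in> ?E" for g w F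
      unfolding q_def by (rule H_orbit_image[OF cocycle_H[OF that(1,2)] EV[OF that(3)]])
    show "measure \<Omega> {w \<in> space \<Omega>. C w \<noteq> {}} > 0" by (rule C(3))
  qed (rule that; assumption)
  have C'E: "C' w \<in> ?E" if "w \<in> space \<Omega>" for w using measurable_space[OF C' that] by simp
  have \<Omega>'_space: "w \<in> space \<Omega>" if "w \<in> \<Omega>'" for w using that \<Omega>'(1) sets.sets_into_space by blast
  define s where "s = (\<lambda>F. if \<exists>h\<in>H. h ` F = F0 then SOME h. h \<in> H \<and> h ` F = F0 else \<one>\<^bsub>HG\<^esub>)"
  have s_some: "s F \<in> H \<and> s F ` F = F0" if "\<exists>h\<in>H. h ` F = F0" for F
  proof -
    have "\<exists>h. h \<in> H \<and> h ` F = F0" using that by blast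
    from someI_ex[OF this] show ?thesis unfolding s_def using that by simp
  qed
  have sH: "s F \<in> H" for F
    using s_some[of F] HG.one_closed by (cases "\<exists>h\<in>H. h ` F = F0") (auto simp: s_def)
  define \<phi> where "\<phi> = (\<lambda>w. s (C' w))"
  have \<phi>H: "\<phi> w \<in> H" for w unfolding \<phi>_def by (rule sH)
  have \<phi>_image: "\<phi> w ` C' w = F0" if w: "w \<in> space \<Omega>" for w
  proof -
    have "\<one>\<^bsub>HG\<^esub> ` F0 = (\<lambda>x. x) ` F0" using H_one_apply EV[OF F0(1)] by (intro image_cong refl) blast
    then have "F0 = \<one>\<^bsub>HG\<^esub> ` F0" by simp
    then have "F0 \<in> q F0" unfolding q_def using HG.one_closed by blast
    then have "F0 \<in> q (C' w)" using qC'[OF w] by simp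
    then show ?thesis using s_some[of "C' w"] unfolding q_def \<phi>_def by blast
  qed
  have \<phi>_measurable: "\<phi> \<in> \<Omega> \<rightarrow>\<^sub>M borel_of TH"
    unfolding \<phi>_def by (rule measurable_compose[OF C']) (use sH in \<open>simp add: space_borel_of\<close>)
  \<comment> \<open>Off the conull invariant set \<open>\<Omega>'\<close> the identity serves to make \<open>\<beta>\<close> a strict
    cocycle with values in the isotropy group everywhere.\<close>
  define \<beta> where "\<beta> = (\<lambda>g w. if w \<in> \<Omega>' then \<phi> (act g w) \<otimes>\<^bsub>HG\<^esub> \<alpha> g w \<otimes>\<^bsub>HG\<^esub> inv\<^bsub>HG\<^esub> \<phi> w else \<one>\<^bsub>HG\<^esub>)"
  note HGs = HG.m_closed HG.inv_closed HG.one_closed \<phi>H cocycle_H \<Omega>'_space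
  have act_iff: "act g w \<in> \<Omega>' \<longleftrightarrow> w \<in> \<Omega>'" if g: "g \<in> carrier G" and w: "w \<in> space \<Omega>" for g w
    using act'[OF g, of w] act'[OF inv_closed[OF g], of "act g w"] M.act_inv[OF g w] by auto
  have "measurable_cocycle G T \<Omega> act HG TH \<beta>"
    unfolding measurable_cocycle_def
  proof (intro conjI ballI)
    have on: "(\<lambda>p. s (C' (act (fst p) (snd p))) \<otimes>\<^bsub>HG\<^esub> \<alpha> (fst p) (snd p) \<otimes>\<^bsub>HG\<^esub> inv\<^bsub>HG\<^esub> s (C' (snd p)))
        \<in> borel_of T \<Otimes>\<^sub>M \<Omega> \<rightarrow>\<^sub>M borel_of TH"
    proof (rule measurable_compose_countable'[where g = "\<lambda>p. C' (act (fst p) (snd p))" and I = ?E and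
          f = "\<lambda>i p. s i \<otimes>\<^bsub>HG\<^esub> \<alpha> (fst p) (snd p) \<otimes>\<^bsub>HG\<^esub> inv\<^bsub>HG\<^esub> s (C' (snd p))"])
      show "(\<lambda>p. C' (act (fst p) (snd p))) \<in> borel_of T \<Otimes>\<^sub>M \<Omega> \<rightarrow>\<^sub>M count_space ?E"
        using measurable_compose[OF M.act_measurable C'] by (simp add: case_prod_unfold)
      show "(\<lambda>p. s i \<otimes>\<^bsub>HG\<^esub> \<alpha> (fst p) (snd p) \<otimes>\<^bsub>HG\<^esub> inv\<^bsub>HG\<^esub> s (C' (snd p))) \<in> borel_of T \<Otimes>\<^sub>M \<Omega> \<rightarrow>\<^sub>M borel_of TH" for i
      proof (rule measurable_compose_countable'[where g = "\<lambda>p. C' (snd p)" and I = ?E and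
            f = "\<lambda>j p. s i \<otimes>\<^bsub>HG\<^esub> \<alpha> (fst p) (snd p) \<otimes>\<^bsub>HG\<^esub> inv\<^bsub>HG\<^esub> s j"])
        show "(\<lambda>p. C' (snd p)) \<in> borel_of T \<Otimes>\<^sub>M \<Omega> \<rightarrow>\<^sub>M count_space ?E"
          by (rule measurable_compose[OF measurable_snd C'])
        show "(\<lambda>p. s i \<otimes>\<^bsub>HG\<^esub> \<alpha> (fst p) (snd p) \<otimes>\<^bsub>HG\<^esub> inv\<^bsub>HG\<^esub> s j) \<in> borel_of T \<Otimes>\<^sub>M \<Omega> \<rightarrow>\<^sub>M borel_of TH" for j
          using measurable_compose[OF cocycle_measurable
              measurable_borel_of_continuous[OF continuous_two_sided[OF sH HG.inv_closed[OF sH]]], of i j]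
          by (simp add: case_prod_unfold)
      qed (rule F.D_countable)
    qed (rule F.D_countable)
    have "(\<lambda>p. if snd p \<in> \<Omega>' then s (C' (act (fst p) (snd p))) \<otimes>\<^bsub>HG\<^esub> \<alpha> (fst p) (snd p) \<otimes>\<^bsub>HG\<^esub> inv\<^bsub>HG\<^esub> s (C' (snd p))
        else \<one>\<^bsub>HG\<^esub>) \<in> borel_of T \<Otimes>\<^sub>M \<Omega> \<rightarrow>\<^sub>M borel_of TH"
    proof (rule measurable_If[OF on])
      show "(\<lambda>p. \<one>\<^bsub>HG\<^esub>) \<in> borel_of T \<Otimes>\<^sub>M \<Omega> \<rightarrow>\<^sub>M borel_of TH"
        by (rule measurable_const) (simp only: space_borel_of topspace_TH HG.one_closed)
      show "{p \<in> space (borel_of T \<Otimes>\<^sub>M \<Omega>). snd p \<in> \<Omega>'} \<in> sets (borel_of T \<Otimes>\<^sub>M \<Omega>)"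
        using measurable_sets[OF measurable_snd \<Omega>'(1), of "borel_of T"] by (simp add: vimage_def Int_def conj_commute)
    qed
    then show "(\<lambda>(g, w). \<beta> g w) \<in> borel_of T \<Otimes>\<^sub>M \<Omega> \<rightarrow>\<^sub>M borel_of TH"
      unfolding \<beta>_def \<phi>_def case_prod_unfold .
    fix g h w assume g: "g \<in> carrier G" and h: "h \<in> carrier G" and w: "w \<in> space \<Omega>"
    show "\<beta> (g \<otimes> h) w = \<beta> g (act h w) \<otimes>\<^bsub>HG\<^esub> \<beta> h w"
    proof (cases "w \<in> \<Omega>'")
      case True
      have aw: "act h w \<in> \<Omega>'" using act_iff[OF h w] True by simp
      show ?thesis
        unfolding \<beta>_def cocycle_mult[OF g h w] M.act_mult[OF g h w] if_P[OF True] if_P[OF aw]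
        by (rule HG.conjugate_mult) (use HGs g h w M.act_space in auto)
    next
      case False
      then have "act h w \<notin> \<Omega>'" using act_iff[OF h w] by simp
      then show ?thesis unfolding \<beta>_def using False HG.one_closed HG.l_one by simp
    qed
  qed
  moreover have "\<beta> g w \<in> isotropy_group H ((\<lambda>v. {v}) ` F0)" if g: "g \<in> carrier G" and w: "w \<in> space \<Omega>" for g w
  proof -
    have "\<beta> g w \<in> H \<and> \<beta> g w ` F0 = F0"
    proof (cases "w \<in> \<Omega>'")
      case True
      have F: "C' w \<subseteq> V" "\<alpha> g w ` C' w \<subseteq> V" "F0 \<subseteq> V"
        using EV[OF C'E[OF w]] cocycle_vertex[OF g w] EV[OF F0(1)] by blast+
      have \<alpha>H: "\<alpha> g w \<in> H" by (rule cocycle_H[OF g w])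
      have iH: "(inv\<^bsub>HG\<^esub> \<phi> w) \<in> H" by (rule HG.inv_closed[OF \<phi>H])
      have iF: "(inv\<^bsub>HG\<^esub> \<phi> w) ` F0 = C' w" using H_inv_image[OF \<phi>H F(1), of w] unfolding \<phi>_image[OF w] .
      have "\<beta> g w ` F0 = (\<phi> (act g w) \<otimes>\<^bsub>HG\<^esub> \<alpha> g w) ` (inv\<^bsub>HG\<^esub> \<phi> w) ` F0"
        unfolding \<beta>_def if_P[OF True] by (rule H_mult_image[OF HG.m_closed[OF \<phi>H \<alpha>H] iH F(3)])
      also have "\<dots> = \<phi> (act g w) ` \<alpha> g w ` C' w" unfolding iF by (rule H_mult_image[OF \<phi>H \<alpha>H F(1)])
      also have "\<dots> = F0" using \<phi>_image[OF M.act_space[OF g w]] act'[OF g True] by simp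
      finally show ?thesis unfolding \<beta>_def if_P[OF True] using HG.m_closed[OF HG.m_closed[OF \<phi>H \<alpha>H] iH] by blast
    next
      case False
      have "\<one>\<^bsub>HG\<^esub> ` F0 = (\<lambda>x. x) ` F0" using H_one_apply EV[OF F0(1)] by (intro image_cong refl) blast
      then show ?thesis unfolding \<beta>_def if_not_P[OF False] using HG.one_closed by simp
    qed
    moreover have "(\<lambda>c. h ` c) ` (\<lambda>v. {v}) ` F0 = (\<lambda>v. {v}) ` h ` F0" for h :: "'v \<Rightarrow> 'v" by (simp add: image_image)
    ultimately show ?thesis unfolding isotropy_group_def by simp
  qed
  moreover have "cohomologous G \<Omega> act HG TH \<alpha> \<beta>"
    unfolding cohomologous_def
  proof (intro bexI[of _ \<phi>] ballI \<phi>_measurable)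
    fix g assume g: "g \<in> carrier G"
    show "AE w in \<Omega>. \<alpha> g w = inv\<^bsub>HG\<^esub> \<phi> (act g w) \<otimes>\<^bsub>HG\<^esub> \<beta> g w \<otimes>\<^bsub>HG\<^esub> \<phi> w"
      using \<Omega>'(2) AE_space
    proof eventually_elim
      case (elim w)
      show ?case unfolding \<beta>_def if_P[OF elim(1)] by (rule HG.conjugate_back[OF cocycle_H[OF g elim(2)] \<phi>H \<phi>H])
    qed
  qed
  moreover have "bounded_subcomplex X ((\<lambda>v. {v}) ` F0)"
  proof (rule singleton_subcomplex)
    show "cube_complex X" using cat0 unfolding cat0_cube_complex_def by blast
  qed (use F0 EV in blast)+
  ultimately show ?thesis by blast
qed

end

theorem corollary8:
  fixes G :: "'g monoid" and T :: "'g topology"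
    and \<Omega> :: "'w measure" and act :: "'g \<Rightarrow> 'w \<Rightarrow> 'w"
    and X :: "'v set set" and H :: "('v \<Rightarrow> 'v) set"
    and \<alpha> :: "'g \<Rightarrow> 'w \<Rightarrow> 'v \<Rightarrow> 'v"
  assumes "lcsc_group G T" and "property_T G T"
    and "ergodic_gspace G T \<Omega> act"
    and "cat0_cube_complex X"
    and "subgroup H (isom_group X)"
    and "measurable_cocycle G T \<Omega> act (isom_group X\<lparr>carrier := H\<rparr>) (pointwise_topology X H) \<alpha>"
  shows "\<exists>Z \<beta>. bounded_subcomplex X Z \<and>
    measurable_cocycle G T \<Omega> act (isom_group X\<lparr>carrier := H\<rparr>) (pointwise_topology X H) \<beta> \<and>
    (\<forall>g\<in>carrier G. \<forall>\<omega>\<in>space \<Omega>. \<beta> g \<omega> \<in> isotropy_group H Z) \<and>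
    cohomologous G \<Omega> act (isom_group X\<lparr>carrier := H\<rparr>) (pointwise_topology X H) \<alpha> \<beta>"
proof -
  have "group G" using assms(1) unfolding lcsc_group_def topological_group_def by blast
  then interpret isometry_cocycle G T X H \<Omega> act \<alpha>
    using assms by (intro isometry_cocycle.intro lcsc.intro lcsc_axioms.intro isometries.intro isometry_cocycle_axioms.intro)
  show ?thesis by (rule cohomologous_to_bounded_isotropy[OF assms(2)])
qed

end
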